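(* In the setting described in the context, let $\{u_p(t,z,\epsilon)\}_{0\le p\le\varsigma-1}$ be the family of holomorphic solutions of (E) described there, and set $$\kappa=\frac{kk'}{k+k'} .$$ Let $\mathbb{F}$ be the Banach space of complex valued bounded holomorphic functions on $(\mathcal{T}\cap D(0,\sigma'))\times H_{\beta'}$ endowed with the supremum norm. Then, for all $0\le p\le\varsigma-1$, the holomorphic and bounded functions $\epsilon\mapsto u_p(t,z,\epsilon)$ from $\mathcal{E}_p$ into $\mathbb{F}$ possess a common formal power series $$\hat u(t,z,\epsilon)=\sum_{m\ge0}h_m(t,z)\epsilon^m\in\mathbb{F}[[\epsilon]]$$ as Gevrey asymptotic expansion of order $1/\kappa$. More precisely, for all $0\le p\le\varsigma-1$ there are constants $C_p,M_p>0$ with $$\sup_{t\in\mathcal{T}\cap D(0,\sigma'),\,z\in H_{\beta'}}\Big|u_p(t,z,\epsilon)-\sum_{m=0}^{n-1}h_m(t,z)\epsilon^m\Big|\le C_pM_p^n\,\Gamma\Big(1+\frac n\kappa\Big)|\epsilon|^n$$ for all $n\ge1$ and all $\epsilon\in\mathcal{E}_p$. Furthermore, if the aperture of one sector $\mathcal{E}_{p_0}$ can be taken slightly larger than $\pi/\kappa$, then $\epsilon\mapsto u_{p_0}(t,z,\epsilon)$ is the $\kappa$-sum of $\hat u(t,z,\epsilon)$ on $\mathcal{E}_{p_0}$.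
   Context: Notation. $D(0,\rho)$ is the open disc of radius $\rho$ centered at $0$ in $\mathbb{C}$; $H_{\beta'}=\{z\in\mathbb{C}:|\mathrm{Im}(z)|<\beta'\}$; "aperture"/"opening" of a sector means its full opening angle. For $\beta,\mu\in\mathbb{R}$, $E_{(\beta,\mu)}$ is the Banach space of continuous $h:\mathbb{R}\to\mathbb{C}$ with $\|h\|_{(\beta,\mu)}=\sup_{m\in\mathbb{R}}(1+|m|)^\mu e^{\beta|m|}|h(m)|<\infty$. Parameters. $k,k',m_D,\delta_D\ge1$ are integers with $k\delta_D=m_Dk'$. $I\subset\mathbb{N}^2$ ($0\in\mathbb N$) is finite with $kl_1\ge1+l_2k'$ for all $(l_1,l_2)\in I$; for $\mathbf l=(l_1,l_2)\in I$, $\Delta_{\mathbf l}\ge0$ is an integer with $\Delta_{\mathbf l}-kl_1\ge0$. $Q,R_D,R_{\mathbf l}\in\mathbb{C}[X]$ ($\mathbf l\in I$) are polynomials with $\deg Q=\deg R_D\ge\deg R_{\mathbf l}$, $Q(im)\ne0$ and $R_D(im)\ne0$ for all $m\in\mathbb{R}$. $\beta,\mu,\epsilon_0,K_0,T_0>0$ are real. $k_1$ is an integer with $0<k_1<k'$, and $\kappa_1$ is defined by $\frac1{\kappa_1}=\frac1{k_1}-\frac1{k'}$; it is assumed that $\frac12<\kappa_1\le k$. Moreover, for all $\mathbf l=(l_1,l_2)\in I$, $$k_1\ge1,\qquad \mu>\deg(R_{\mathbf l})+1,\qquad k\delta_D\ge kl_1\Big(1-\frac{k_1}{k'}\Big)+k_1l_2+1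 .$$ Coefficients. For $\mathbf l\in I$, $m\mapsto C_{\mathbf l}(m,\epsilon)$ belongs to $E_{(\beta,\mu)}$, depends holomorphically on $\epsilon\in D(0,\epsilon_0)$, and $C_{\mathbf l}>0$ is a constant with $\sup_{\epsilon\in D(0,\epsilon_0)}\|C_{\mathbf l}(m,\epsilon)\|_{(\beta,\mu)}\le C_{\mathbf l}$. Put $c_{\mathbf l}(z,\epsilon)=(2\pi)^{-1/2}\int_{-\infty}^{+\infty}C_{\mathbf l}(m,\epsilon)e^{izm}dm$. Forcing term. For $n\ge1$, $m\mapsto\psi_n(m,\epsilon)$ belongs to $E_{(\beta,\mu)}$, depends holomorphically on $\epsilon\in D(0,\epsilon_0)$, with $\sup_{\epsilon\in D(0,\epsilon_0)}\|\psi_n(m,\epsilon)\|_{(\beta,\mu)}\le K_0T_0^{-n}$. Put $F_n(z,\epsilon)=(2\pi)^{-1/2}\int_{-\infty}^{+\infty}\psi_n(m,\epsilon)e^{izm}dm$ and $$f(t,z,\epsilon)=\sum_{n\ge1}F_n(z,\epsilon)\frac{\Gamma(\frac nk)\Gamma(\frac n{k'})}{\Gamma(\frac n{k_1}+1)}(\epsilon t)^n .$$ Equation (E), for vanishing initial data $u(0,z,\epsilon)\equiv0$: $$Q(\partial_z)u=R_D(\partial_z)\epsilon^{k\delta_D}(t^{k+1}\partial_t)^{\delta_D}(t\partial_t)^{m_D}u+\sum_{\mathbf l=(l_1,l_2)\in I}\epsilon^{\Delta_{\mathbf l}}c_{\mathbf l}(z,\epsilon)R_{\mathbf l}(\partial_z)(t^{k+1}\partial_t)^{l_1}(t\partial_t)^{l_2}u+f(t,z,\epsilon).$$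 Sectorial annulus. It is assumed that $\{Q(im)/R_D(im):m\in\mathbb{R}\}\subset S_{Q,R_D}$, where $S_{Q,R_D}=\{z\in\mathbb{C}^*: r_{Q,R_D,1}<|z|<r_{Q,R_D,2},\ |\arg(z)-d_{Q,R_D}|\le\eta_{Q,R_D}\}$ for some $d_{Q,R_D}\in\mathbb{R}$, $\eta_{Q,R_D}>0$ and $0<r_{Q,R_D,1}<r_{Q,R_D,2}$. For $m\in\mathbb{R}$ let $q_l(m)$, $0\le l\le k\delta_D-1$, be the roots of $P_m(u)=Q(im)-R_D(im)k^{\delta_D}(k')^{m_D}u^{k\delta_D}$, labelled by $$q_l(m)=\Big(\frac{|Q(im)|}{|R_D(im)|k^{\delta_D}(k')^{m_D}}\Big)^{\frac1{k\delta_D}}\exp\Big(\sqrt{-1}\Big(\arg\Big(\frac{Q(im)}{R_D(im)k^{\delta_D}(k')^{m_D}}\Big)\frac1{k\delta_D}+\frac{2\pi l}{k\delta_D}\Big)\Big).$$ Good covering. For an integer $\varsigma\ge2$, a set $\underline{\mathcal{E}}=\{\mathcal{E}_p\}_{0\le p\le\varsigma-1}$ of open sectors centered at $0$ with radius $\epsilon_0$ is a good covering of $\mathbb{C}^*$ if $\mathcal{E}_p\cap\mathcal{E}_{p+1}\ne\emptyset$ for all $p$ (with $\mathcal{E}_\varsigma=\mathcal{E}_0$), the intersection of any three of them is empty, and their union is $\mathcal{U}\setminus\{0\}$ for some neighborhood $\mathcal{U}$ of $0$. Admissible data. $\{\underline{\mathcal{E}},\underline U,\underline S,\mathcal{T},D(0,r)\}$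 is admissible if: $\underline{\mathcal{E}}$ is a good covering; $\underline U=\{U_{\mathfrak{d}_p}\}$ are unbounded sectors centered at $0$ with bisecting directions $\mathfrak{d}_p\in\mathbb{R}$ and small openings $\theta_{U_{\mathfrak{d}_p}}>0$; $\underline S=\{S_{\mathfrak{d}_p}\}$ are unbounded sectors centered at $0$ with bisecting directions $\mathfrak{d}_p$ and apertures $0<\theta_{S_{\mathfrak{d}_p}}<\frac{\pi}{k'}+\theta_{U_{\mathfrak{d}_p}}$; $\mathcal{T}$ is a fixed bounded sector centered at $0$ with radius $r_{\mathcal{T}}>0$; $D(0,r)$ is a disc; and: 1) for each $p$ there are $M_1,M_2>0$ such that for all $u\in U_{\mathfrak{d}_p}\cup D(0,r)$ and $m\in\mathbb{R}$: $|u-q_l(m)|\ge M_1(1+|u|)$ for all $0\le l\le k\delta_D-1$, and $|u-q_{l_0}(m)|\ge M_2|q_{l_0}(m)|$ for some $0\le l_0\le k\delta_D-1$ (independent of $u,m$); 2) $S_{\mathfrak{d}_p}\cap S_{\mathfrak{d}_{p+1}}\ne\emptyset$ for all $p$ (with $S_{\mathfrak{d}_\varsigma}=S_{\mathfrak{d}_0}$) and $\bigcup_pS_{\mathfrak{d}_p}=\mathbb{C}\setminus\{0\}$; 3) for all $p$, all $\epsilon\in\mathcal{E}_p$, $t\in\mathcal{T}$, one has $\epsilon t\in S_{\mathfrak{d}_p,\theta_{k,k'},\epsilon_0r_{\mathcal{T}}}$, a bounded sector with bisecting direction $\mathfrak{d}_p$, radius $\epsilon_0r_{\mathcal{T}}$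 and opening $0<\theta_{k,k'}<\frac\pi k+\theta_{S_{\mathfrak{d}_p}}$. Banach spaces. For $\nu_1>0$, $E^{\mathfrak{d}_p}_{(\nu_1,\beta,\mu,\kappa_1)}$ is the space of continuous $h(\tau,m)$ on $S_{\mathfrak{d}_p}\times\mathbb{R}$, holomorphic in $\tau\in S_{\mathfrak{d}_p}$, with finite norm $\sup_{\tau\in S_{\mathfrak{d}_p},m\in\mathbb{R}}(1+|m|)^\mu\frac1{|\tau|}e^{\beta|m|-\nu_1|\tau|^{\kappa_1}}|h(\tau,m)|$. For $\nu_2>0$, $F^{\mathfrak{d}_p}_{(\nu_2,\beta,\mu,k_1)}$ is the space of continuous $h(u,m)$ on $(U_{\mathfrak{d}_p}\cup D(0,r))\times\mathbb{R}$, holomorphic in $u\in U_{\mathfrak{d}_p}\cup D(0,r)$, with finite norm $\sup_{u\in U_{\mathfrak{d}_p}\cup D(0,r),m\in\mathbb{R}}(1+|m|)^\mu\frac1{|u|}e^{\beta|m|-\nu_2|u|^{k_1}}|h(u,m)|$. The family $u_p$. Fix an admissible set of data, with $r_{Q,R_D,1}$ large enough and the constants $C_{\mathbf l}$ close enough to $0$. Then (this is a result of the paper, which may be taken as given here) for any $0<\beta'<\beta$ there are radii $0<\sigma'<\sigma$ and a family $\{u_p\}_{0\le p\le\varsigma-1}$ of solutions of (E), each bounded holomorphic on $(\mathcal{T}\cap D(0,\sigma))\times H_{\beta'}\times\mathcal{E}_p$, of the form $$u_p(t,z,\epsilon)=\frac{k}{(2\pi)^{1/2}}\int_{-\infty}^{+\infty}\int_{L_{\gamma_p}}W^{\mathfrak{d}_p}(\tau,m,\epsilon)e^{-(\tau/(\epsilon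 t))^k}e^{izm}\frac{d\tau}{\tau}dm,\qquad W^{\mathfrak{d}_p}(\tau,m,\epsilon)=k'\int_{L_{\gamma_p'}}w^{\mathfrak{d}_p}(u,m,\epsilon)e^{-(u/\tau)^{k'}}\frac{du}{u},$$ along halflines $L_{\gamma_p}=\mathbb{R}_+e^{\sqrt{-1}\gamma_p}\subset S_{\mathfrak{d}_p}\cup\{0\}$ and $L_{\gamma_p'}\subset U_{\mathfrak{d}_p}\cup\{0\}$ (directions possibly depending on $\epsilon t$, resp. $\tau$), with $W^{\mathfrak{d}_p}(\cdot,\cdot,\epsilon)\in E^{\mathfrak{d}_p}_{(\nu_1,\beta,\mu,\kappa_1)}$ for some $\nu_1>(1/T_0)^{\kappa_1}$ and $w^{\mathfrak{d}_p}(\cdot,\cdot,\epsilon)\in F^{\mathfrak{d}_p}_{(\nu_2,\beta,\mu,k_1)}$ for $\nu_2=(1/T_0)^{k_1}$, for all $\epsilon\in D(0,\epsilon_0)$, and such that for some constants $K_p,M_p>0$ $$\sup_{t\in\mathcal{T}\cap D(0,\sigma'),z\in H_{\beta'}}|u_{p+1}(t,z,\epsilon)-u_p(t,z,\epsilon)|\le K_p\exp\big(-M_p|\epsilon|^{-\frac{kk'}{k+k'}}\big),\quad \epsilon\in\mathcal{E}_{p+1}\cap\mathcal{E}_p,\ 0\le p\le\varsigma-1\quad(u_\varsigma=u_0).$$ The $u_p$, $\sigma'$, $\beta'$ in the claim are these. $\kappa$-summability. For a complex Banach space $\mathbb{F}$ and $\kappa>1/2$, $\hat a(\epsilon)=\sum_{j\ge0}a_j\epsilon^j\in\mathbb{F}[[\epsilon]]$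 is $\kappa$-summable in direction $d\in\mathbb{R}$ if $B_\kappa(\hat a)(\tau)=\sum_{j\ge0}a_j\tau^j/\Gamma(1+\frac j\kappa)$ converges absolutely on some disc $|\tau|<\rho$ and extends analytically to an unbounded sector $S_{d,\delta}=\{\tau\in\mathbb{C}^*:|d-\arg\tau|<\delta\}$ with $\|B_\kappa(\hat a)(\tau)\|_{\mathbb{F}}\le Ce^{K|\tau|^\kappa}$ there for some $C,K>0$. Its $\kappa$-sum in direction $d$ is $\epsilon^{-\kappa}\int_{L_\gamma}B_\kappa(\hat a)(u)e^{-(u/\epsilon)^\kappa}\kappa u^{\kappa-1}du$, with $L_\gamma\subset S_{d,\delta}\cup\{0\}$ and $\gamma$ depending on $\epsilon$ with $\cos(\kappa(\gamma-\arg\epsilon))\ge\delta_1>0$; it is bounded holomorphic on sectors $\{|\epsilon|<R^{1/\kappa},|d-\arg\epsilon|<\theta/2\}$ with $0<\theta<\frac\pi\kappa+2\delta$, $0<R<\delta_1/K$, and for $\theta>\pi/\kappa$ is the unique such function having $\hat a$ as Gevrey asymptotic expansion of order $1/\kappa$. *)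

theory Defs
  imports "HOL-Complex_Analysis.Complex_Analysis"
begin

text \<open>The third argument is the full opening angle; the argument of a point is only defined
  modulo \<open>2\<pi>\<close>, hence the existentially quantified angle \<open>\<phi>\<close>.\<close>

definition sector :: "real \<Rightarrow> real \<Rightarrow> real \<Rightarrow> complex set" where
  "sector d \<theta> \<rho> = {of_real r * cis \<phi> | r \<phi>. 0 < r \<and> r < \<rho> \<and> \<bar>\<phi> - d\<bar> < \<theta> / 2}"

definition unbounded_sector :: "real \<Rightarrow> real \<Rightarrow> complex set" where
  "unbounded_sector d \<theta> = {of_real r * cis \<phi> | r \<phi>. 0 < r \<and> \<bar>\<phi> - d\<bar> < \<theta> / 2}"

definition sectorial_annulus :: "real \<Rightarrow> real \<Rightarrow> real \<Rightarrow> real \<Rightarrow> complex set" where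
  "sectorial_annulus d \<eta> r1 r2 =
     {of_real r * cis \<phi> | r \<phi>. 0 < r \<and> r1 < r \<and> r < r2 \<and> \<bar>\<phi> - d\<bar> \<le> \<eta>}"

definition strip :: "real \<Rightarrow> complex set" where
  "strip b = {z. \<bar>Im z\<bar> < b}"

definition halfline :: "real \<Rightarrow> complex set" where
  "halfline \<gamma> = {of_real s * cis \<gamma> | s. 0 \<le> s}"

text \<open>Absolutely convergent integrals \<open>\<integral>\<^bsub>L\<^esub> g(u) du\<close> along the half-line \<open>L = halfline \<gamma>\<close>,
  oriented from 0 to infinity.\<close>

definition ray_integrable :: "real \<Rightarrow> (complex \<Rightarrow> complex) \<Rightarrow> bool" where
  "ray_integrable \<gamma> g \<longleftrightarrow>
     set_integrable lborel {0<..} (\<lambda>s::real. g (of_real s * cis \<gamma>) * cis \<gamma>)"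

definition ray_integral :: "real \<Rightarrow> (complex \<Rightarrow> complex) \<Rightarrow> complex" where
  "ray_integral \<gamma> g = (LINT s:{0<..}|lborel. g (of_real s * cis \<gamma>) * cis \<gamma>)"

text \<open>Complex Frechet differentiability at every point of an open set.\<close>

definition holomorphic2_on :: "(complex \<times> complex \<Rightarrow> complex) \<Rightarrow> (complex \<times> complex) set \<Rightarrow> bool" where
  "holomorphic2_on f A \<longleftrightarrow>
     (\<forall>x\<in>A. \<exists>a b. (f has_derivative (\<lambda>(v, w). a * v + b * w)) (at x))"

definition holomorphic3_on ::
    "(complex \<times> complex \<times> complex \<Rightarrow> complex) \<Rightarrow> (complex \<times> complex \<times> complex) set \<Rightarrow> bool" where
  "holomorphic3_on f A \<longleftrightarrow>
     (\<forall>x\<in>A. \<exists>a b c. (f has_derivative (\<lambda>(v, w, y). a * v + b * w + c * y)) (at x))"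

text \<open>The complex Banach spaces that occur are spaces of functions with pointwise operations. Such a
  space is given by its set of elements \<open>V\<close> and its norm \<open>N\<close>. A \<open>V\<close>-valued function is holomorphic
  when its difference quotients converge in norm to an element of \<open>V\<close>.\<close>

definition vholomorphic_on ::
    "('x \<Rightarrow> complex) set \<Rightarrow> (('x \<Rightarrow> complex) \<Rightarrow> real) \<Rightarrow> (complex \<Rightarrow> 'x \<Rightarrow> complex) \<Rightarrow> complex set \<Rightarrow> bool" where
  "vholomorphic_on V N g A \<longleftrightarrow>
     (\<forall>e\<in>A. g e \<in> V \<and>
        (\<exists>g'\<in>V. ((\<lambda>w. N (\<lambda>x. (g w x - g e x) / (w - e) - g' x)) \<longlongrightarrow> 0) (at e within A)))"

text \<open>Bounded holomorphic functions on \<open>D\<close> with the supremum norm. Since HOL functions are total,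
  the values off \<open>D\<close> are normalised to 0, which makes \<open>sup_norm D\<close> a norm and not just a
  seminorm. The function \<open>zero_off D f\<close> represents the restriction of \<open>f\<close> to \<open>D\<close>.\<close>

definition bounded_holomorphic :: "(complex \<times> complex) set \<Rightarrow> (complex \<times> complex \<Rightarrow> complex) set" where
  "bounded_holomorphic D = {h. holomorphic2_on h D \<and> bounded (h ` D) \<and> (\<forall>x. x \<notin> D \<longrightarrow> h x = 0)}"

definition sup_norm :: "'x set \<Rightarrow> ('x \<Rightarrow> complex) \<Rightarrow> real" where
  "sup_norm D h = (SUP x\<in>D. cmod (h x))"

definition zero_off :: "'x set \<Rightarrow> ('x \<Rightarrow> complex) \<Rightarrow> 'x \<Rightarrow> complex" where
  "zero_off D f = (\<lambda>x. if x \<in> D then f x else 0)"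

definition E_weight :: "real \<Rightarrow> real \<Rightarrow> (real \<Rightarrow> complex) \<Rightarrow> real \<Rightarrow> real" where
  "E_weight \<beta> \<mu> h m = (1 + \<bar>m\<bar>) powr \<mu> * exp (\<beta> * \<bar>m\<bar>) * cmod (h m)"

definition E_space :: "real \<Rightarrow> real \<Rightarrow> (real \<Rightarrow> complex) set" where
  "E_space \<beta> \<mu> = {h. continuous_on UNIV h \<and> bdd_above (range (E_weight \<beta> \<mu> h))}"

definition E_norm :: "real \<Rightarrow> real \<Rightarrow> (real \<Rightarrow> complex) \<Rightarrow> real" where
  "E_norm \<beta> \<mu> h = (SUP m. E_weight \<beta> \<mu> h m)"

text \<open>Functions \<open>h(\<tau>, m)\<close> on \<open>A \<times> \<real>\<close>, holomorphic in \<open>\<tau>\<close>, of finite weighted norm. For \<open>\<tau> = 0 \<in> A\<close>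
  the weight \<open>1 / \<bar>\<tau>\<bar>\<close> is 0 in HOL; the bound at the other points and continuity
  force \<open>h(0, m) = 0\<close>.\<close>

definition weighted_space ::
    "complex set \<Rightarrow> real \<Rightarrow> real \<Rightarrow> real \<Rightarrow> real \<Rightarrow> (complex \<Rightarrow> real \<Rightarrow> complex) set" where
  "weighted_space A \<nu> \<beta> \<mu> \<kappa> =
     {h. continuous_on (A \<times> UNIV) (\<lambda>(\<tau>, m). h \<tau> m) \<and>
         (\<forall>m. (\<lambda>\<tau>. h \<tau> m) holomorphic_on A) \<and>
         bdd_above ((\<lambda>(\<tau>, m). (1 + \<bar>m\<bar>) powr \<mu> * (1 / cmod \<tau>) *
            exp (\<beta> * \<bar>m\<bar> - \<nu> * cmod \<tau> powr \<kappa>) * cmod (h \<tau> m)) ` (A \<times> UNIV))}"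

definition inverse_fourier :: "(real \<Rightarrow> complex) \<Rightarrow> complex \<Rightarrow> complex" where
  "inverse_fourier h z =
     of_real ((2 * pi) powr (-1/2)) * (LINT m|lborel. h m * exp (\<i> * z * of_real m))"

definition forcing_term ::
    "nat \<Rightarrow> nat \<Rightarrow> nat \<Rightarrow> (nat \<Rightarrow> real \<Rightarrow> complex \<Rightarrow> complex) \<Rightarrow> complex \<Rightarrow> complex \<Rightarrow> complex \<Rightarrow> complex" where
  "forcing_term k k' k\<^sub>1 \<psi> t z \<epsilon> =
     (\<Sum>j. let n = Suc j in
        inverse_fourier (\<lambda>m. \<psi> n m \<epsilon>) z *
        of_real (Gamma (real n / real k) * Gamma (real n / real k') / Gamma (real n / real k\<^sub>1 + 1)) *
        (\<epsilon> * t) ^ n)"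

text \<open>The operators \<open>P(\<partial>\<^sub>z)\<close> and \<open>t\<^sup>n \<partial>\<^sub>t\<close> acting on functions \<open>v t z\<close>.\<close>

definition poly_dz :: "complex poly \<Rightarrow> (complex \<Rightarrow> complex \<Rightarrow> complex) \<Rightarrow> complex \<Rightarrow> complex \<Rightarrow> complex" where
  "poly_dz P v t z = (\<Sum>j\<le>degree P. coeff P j * (deriv ^^ j) (v t) z)"

definition tpow_dt :: "nat \<Rightarrow> (complex \<Rightarrow> complex \<Rightarrow> complex) \<Rightarrow> complex \<Rightarrow> complex \<Rightarrow> complex" where
  "tpow_dt n v t z = t ^ n * deriv (\<lambda>s. v s z) t"

definition satisfies_pde ::
    "nat \<Rightarrow> nat \<Rightarrow> nat \<Rightarrow> nat \<Rightarrow> nat \<Rightarrow> (nat \<times> nat) set \<Rightarrow> (nat \<times> nat \<Rightarrow> nat) \<Rightarrow>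
     complex poly \<Rightarrow> complex poly \<Rightarrow> (nat \<times> nat \<Rightarrow> complex poly) \<Rightarrow>
     (nat \<times> nat \<Rightarrow> real \<Rightarrow> complex \<Rightarrow> complex) \<Rightarrow> (nat \<Rightarrow> real \<Rightarrow> complex \<Rightarrow> complex) \<Rightarrow>
     (complex \<Rightarrow> complex \<Rightarrow> complex \<Rightarrow> complex) \<Rightarrow> complex \<Rightarrow> complex \<Rightarrow> complex \<Rightarrow> bool" where
  "satisfies_pde k k' k\<^sub>1 m\<^sub>D \<delta>\<^sub>D I \<Delta> Q R\<^sub>D R C \<psi> u t z \<epsilon> \<longleftrightarrow>
     (let v = (\<lambda>t z. u t z \<epsilon>) in
       poly_dz Q v t z =
         poly_dz R\<^sub>D (\<lambda>t z. \<epsilon> ^ (k * \<delta>\<^sub>D) * (tpow_dt (k + 1) ^^ \<delta>\<^sub>D) ((tpow_dt 1 ^^ m\<^sub>D) v) t z) t z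
         + (\<Sum>(l1, l2)\<in>I. \<epsilon> ^ \<Delta> (l1, l2) * inverse_fourier (\<lambda>m. C (l1, l2) m \<epsilon>) z *
              poly_dz (R (l1, l2)) ((tpow_dt (k + 1) ^^ l1) ((tpow_dt 1 ^^ l2) v)) t z)
         + forcing_term k k' k\<^sub>1 \<psi> t z \<epsilon>)"

text \<open>The roots of \<open>Q(im) - R\<^sub>D(im) k\<^bsup>\<delta>\<^esup> k'\<^bsup>m'\<^esup> u\<^bsup>k\<delta>\<^esup>\<close> in the variable \<open>u\<close>, where \<open>\<delta>\<close>, \<open>m'\<close> stand for
  \<open>\<delta>\<^sub>D\<close>, \<open>m\<^sub>D\<close>.\<close>

definition q_root ::
    "nat \<Rightarrow> nat \<Rightarrow> nat \<Rightarrow> nat \<Rightarrow> complex poly \<Rightarrow> complex poly \<Rightarrow> nat \<Rightarrow> real \<Rightarrow> complex" where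
  "q_root k k' m\<^sub>D \<delta>\<^sub>D Q R\<^sub>D l m =
     (let a = poly Q (\<i> * of_real m); b = poly R\<^sub>D (\<i> * of_real m);
          c = real k ^ \<delta>\<^sub>D * real k' ^ m\<^sub>D; n = real (k * \<delta>\<^sub>D)
      in of_real ((cmod a / (cmod b * c)) powr (1 / n)) *
         exp (\<i> * of_real (Arg (a / (b * of_real c)) * (1 / n) + 2 * pi * real l / n)))"

text \<open>Families are indexed by \<open>p < n\<close>, cyclically: the successor of \<open>p\<close> is \<open>(p + 1) mod n\<close>. The
  opening of a sector is at most \<open>2\<pi>\<close>, so that it is determined by the sector.\<close>

definition good_covering :: "nat \<Rightarrow> (nat \<Rightarrow> real) \<Rightarrow> (nat \<Rightarrow> real) \<Rightarrow> real \<Rightarrow> bool" where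
  "good_covering n d \<theta> \<rho> \<longleftrightarrow>
     2 \<le> n \<and> (\<forall>p<n. 0 < \<theta> p \<and> \<theta> p \<le> 2 * pi) \<and>
     (\<forall>p<n. sector (d p) (\<theta> p) \<rho> \<inter> sector (d ((p + 1) mod n)) (\<theta> ((p + 1) mod n)) \<rho> \<noteq> {}) \<and>
     (\<forall>i<n. \<forall>j<n. \<forall>l<n. i \<noteq> j \<and> j \<noteq> l \<and> i \<noteq> l \<longrightarrow>
        sector (d i) (\<theta> i) \<rho> \<inter> sector (d j) (\<theta> j) \<rho> \<inter> sector (d l) (\<theta> l) \<rho> = {}) \<and>
     (\<exists>U. 0 \<in> interior U \<and> (\<Union>p<n. sector (d p) (\<theta> p) \<rho>) = U - {0})"

text \<open>The data are: the covering (\<open>d\<^sub>E\<close>, \<open>\<theta>\<^sub>E\<close>, radius \<open>\<epsilon>\<^sub>0\<close>), the sectors with common bisecting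
  directions \<open>d\<close> and openings \<open>\<theta>\<^sub>U\<close>, \<open>\<theta>\<^sub>S\<close>, the sector \<open>sector d\<^sub>T \<theta>\<^sub>T r\<^sub>T\<close>, the disc
  \<open>ball 0 r\<close>; \<open>q l m\<close> are the \<open>L\<close> roots.\<close>

definition admissible ::
    "nat \<Rightarrow> nat \<Rightarrow> nat \<Rightarrow> (nat \<Rightarrow> real \<Rightarrow> complex) \<Rightarrow> nat \<Rightarrow> real \<Rightarrow> (nat \<Rightarrow> real) \<Rightarrow> (nat \<Rightarrow> real) \<Rightarrow>
     (nat \<Rightarrow> real) \<Rightarrow> (nat \<Rightarrow> real) \<Rightarrow> (nat \<Rightarrow> real) \<Rightarrow> real \<Rightarrow> real \<Rightarrow> real \<Rightarrow> real \<Rightarrow> bool" where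
  "admissible k k' L q n \<epsilon>\<^sub>0 d\<^sub>E \<theta>\<^sub>E d \<theta>\<^sub>U \<theta>\<^sub>S d\<^sub>T \<theta>\<^sub>T r\<^sub>T r \<longleftrightarrow>
     good_covering n d\<^sub>E \<theta>\<^sub>E \<epsilon>\<^sub>0 \<and>
     (\<forall>p<n. 0 < \<theta>\<^sub>U p \<and> 0 < \<theta>\<^sub>S p \<and> \<theta>\<^sub>S p < pi / real k' + \<theta>\<^sub>U p) \<and>
     0 < \<theta>\<^sub>T \<and> 0 < r\<^sub>T \<and> 0 < r \<and>
     (\<forall>p<n. \<exists>M1>0. \<exists>M2>0.
        (\<forall>u \<in> unbounded_sector (d p) (\<theta>\<^sub>U p) \<union> ball 0 r. \<forall>m. \<forall>l<L.
           M1 * (1 + cmod u) \<le> cmod (u - q l m)) \<and>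
        (\<exists>l0<L. \<forall>u \<in> unbounded_sector (d p) (\<theta>\<^sub>U p) \<union> ball 0 r. \<forall>m.
           M2 * cmod (q l0 m) \<le> cmod (u - q l0 m))) \<and>
     (\<forall>p<n. unbounded_sector (d p) (\<theta>\<^sub>S p) \<inter>
            unbounded_sector (d ((p + 1) mod n)) (\<theta>\<^sub>S ((p + 1) mod n)) \<noteq> {}) \<and>
     (\<Union>p<n. unbounded_sector (d p) (\<theta>\<^sub>S p)) = UNIV - {0} \<and>
     (\<forall>p<n. \<exists>\<theta>. 0 < \<theta> \<and> \<theta> < pi / real k + \<theta>\<^sub>S p \<and>
        (\<forall>\<epsilon> \<in> sector (d\<^sub>E p) (\<theta>\<^sub>E p) \<epsilon>\<^sub>0. \<forall>t \<in> sector d\<^sub>T \<theta>\<^sub>T r\<^sub>T.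
           \<epsilon> * t \<in> sector (d p) \<theta> (\<epsilon>\<^sub>0 * r\<^sub>T)))"

text \<open>\<open>v t z \<epsilon>\<close> (for \<open>t\<close>, \<open>z\<close>, \<open>\<epsilon>\<close> in the sets \<open>T\<close>, \<open>H\<close>, \<open>E\<close>) is a Fourier transform in \<open>m\<close> of a Laplace
  transform of order \<open>k\<close> of a function \<open>W\<close> on \<open>S\<close>, which is itself a Laplace transform of order \<open>k'\<close> of
  a function \<open>w\<close> on \<open>U \<union> ball 0 r\<close>. The directions of integration \<open>\<gamma>\<close> and \<open>\<gamma>'\<close> may depend on \<open>\<epsilon>t\<close>
  and \<open>\<tau>\<close>, respectively.\<close>

definition double_laplace_form ::
    "nat \<Rightarrow> nat \<Rightarrow> nat \<Rightarrow> real \<Rightarrow> real \<Rightarrow> real \<Rightarrow> real \<Rightarrow> real \<Rightarrow> complex set \<Rightarrow> complex set \<Rightarrow> real \<Rightarrow>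
     complex set \<Rightarrow> complex set \<Rightarrow> complex set \<Rightarrow>
     (complex \<Rightarrow> complex \<Rightarrow> complex \<Rightarrow> complex) \<Rightarrow> bool" where
  "double_laplace_form k k' k\<^sub>1 \<kappa>\<^sub>1 \<beta> \<mu> T\<^sub>0 \<epsilon>\<^sub>0 S U r T H E v \<longleftrightarrow>
     (\<exists>W w \<nu>\<^sub>1 \<gamma> \<gamma>'.
        (1 / T\<^sub>0) powr \<kappa>\<^sub>1 < \<nu>\<^sub>1 \<and>
        (\<forall>\<epsilon>\<in>ball 0 \<epsilon>\<^sub>0.
           (\<lambda>\<tau> m. W \<tau> m \<epsilon>) \<in> weighted_space S \<nu>\<^sub>1 \<beta> \<mu> \<kappa>\<^sub>1 \<and>
           (\<lambda>u m. w u m \<epsilon>) \<in> weighted_space (U \<union> ball 0 r) ((1 / T\<^sub>0) ^ k\<^sub>1) \<beta> \<mu> (real k\<^sub>1)) \<and>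
        (\<forall>\<tau>\<in>S. halfline (\<gamma>' \<tau>) \<subseteq> U \<union> {0} \<and>
           (\<forall>\<epsilon>\<in>ball 0 \<epsilon>\<^sub>0. \<forall>m.
              ray_integrable (\<gamma>' \<tau>) (\<lambda>u. w u m \<epsilon> * exp (- ((u / \<tau>) ^ k')) / u) \<and>
              W \<tau> m \<epsilon> = of_nat k' *
                ray_integral (\<gamma>' \<tau>) (\<lambda>u. w u m \<epsilon> * exp (- ((u / \<tau>) ^ k')) / u))) \<and>
        (\<forall>t\<in>T. \<forall>\<epsilon>\<in>E. halfline (\<gamma> (\<epsilon> * t)) \<subseteq> S \<union> {0} \<and>
           (\<forall>m. ray_integrable (\<gamma> (\<epsilon> * t))
                  (\<lambda>\<tau>. W \<tau> m \<epsilon> * exp (- ((\<tau> / (\<epsilon> * t)) ^ k)) / \<tau>)) \<and>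
           (\<forall>z\<in>H.
              integrable lborel (\<lambda>m. ray_integral (\<gamma> (\<epsilon> * t))
                  (\<lambda>\<tau>. W \<tau> m \<epsilon> * exp (- ((\<tau> / (\<epsilon> * t)) ^ k)) / \<tau>) * exp (\<i> * z * of_real m)) \<and>
              v t z \<epsilon> = of_nat k * inverse_fourier (\<lambda>m. ray_integral (\<gamma> (\<epsilon> * t))
                  (\<lambda>\<tau>. W \<tau> m \<epsilon> * exp (- ((\<tau> / (\<epsilon> * t)) ^ k)) / \<tau>)) z)))"

text \<open>\<open>B\<close> is the sum near 0 of the formal Borel transform of order \<open>\<kappa>\<close> of \<open>\<Sum>j. a\<^sub>j \<epsilon>\<^sup>j\<close>, continued
  analytically to the unbounded sector \<open>\<bar>d - arg \<tau>\<bar> < \<delta>\<close> with growth of order \<open>\<kappa>\<close>.\<close>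

definition borel_continuation ::
    "('x \<Rightarrow> complex) set \<Rightarrow> (('x \<Rightarrow> complex) \<Rightarrow> real) \<Rightarrow> real \<Rightarrow> (nat \<Rightarrow> 'x \<Rightarrow> complex) \<Rightarrow>
     real \<Rightarrow> real \<Rightarrow> real \<Rightarrow> real \<Rightarrow> (complex \<Rightarrow> 'x \<Rightarrow> complex) \<Rightarrow> bool" where
  "borel_continuation V N \<kappa> a d \<delta> C K B \<longleftrightarrow>
     (\<exists>\<rho>>0.
        (\<forall>\<tau>\<in>ball 0 \<rho>.
           summable (\<lambda>j. N (a j) * cmod \<tau> ^ j / Gamma (1 + real j / \<kappa>)) \<and>
           (\<lambda>n. N (\<lambda>x. (\<Sum>j<n. a j x * \<tau> ^ j / of_real (Gamma (1 + real j / \<kappa>))) - B \<tau> x))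
             \<longlonglongrightarrow> 0) \<and>
        vholomorphic_on V N B (ball 0 \<rho> \<union> unbounded_sector d (2 * \<delta>))) \<and>
     (\<forall>\<tau>\<in>unbounded_sector d (2 * \<delta>). N (B \<tau>) \<le> C * exp (K * cmod \<tau> powr \<kappa>))"

definition kappa_summable ::
    "('x \<Rightarrow> complex) set \<Rightarrow> (('x \<Rightarrow> complex) \<Rightarrow> real) \<Rightarrow> real \<Rightarrow> (nat \<Rightarrow> 'x \<Rightarrow> complex) \<Rightarrow> real \<Rightarrow> bool" where
  "kappa_summable V N \<kappa> a d \<longleftrightarrow>
     1 / 2 < \<kappa> \<and> (\<forall>j. a j \<in> V) \<and>
     (\<exists>\<delta>>0. \<exists>C>0. \<exists>K>0. \<exists>B. borel_continuation V N \<kappa> a d \<delta> C K B)"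

text \<open>The integrand \<open>\<epsilon>\<^bsup>-\<kappa>\<^esup> B(u) exp(-(u/\<epsilon>)\<^bsup>\<kappa>\<^esup>) \<kappa> u\<^bsup>\<kappa>-1\<^esup>\<close> is written with \<open>(u/\<epsilon>)\<^bsup>\<kappa>\<^esup> / u\<close> in place of
  \<open>\<epsilon>\<^bsup>-\<kappa>\<^esup> u\<^bsup>\<kappa>-1\<^esup>\<close>. For an admissible direction the angle of \<open>u/\<epsilon>\<close> is less than \<open>\<pi>/(2\<kappa>) < \<pi>\<close> in
  absolute value, so the principal branch of the power is the right one. The integral of a
  function-space valued function is evaluated pointwise; it converges absolutely in norm
  by the growth of \<open>B\<close>, and point evaluations are continuous.\<close>

definition laplace_integrand :: "real \<Rightarrow> (complex \<Rightarrow> 'x \<Rightarrow> complex) \<Rightarrow> complex \<Rightarrow> 'x \<Rightarrow> complex \<Rightarrow> complex" where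
  "laplace_integrand \<kappa> B \<epsilon> x u =
     B u x * exp (- ((u / \<epsilon>) powr of_real \<kappa>)) * of_real \<kappa> * (u / \<epsilon>) powr of_real \<kappa> / u"

text \<open>The condition \<open>cos(\<kappa>(\<gamma> - arg \<epsilon>)) \<ge> \<delta>\<^sub>1\<close> is meant with \<open>\<kappa>(\<gamma> - arg \<epsilon>)\<close> in the interval around 0
  where the cosine is positive; the other such intervals belong to other determinations
  of \<open>\<epsilon>\<^bsup>\<kappa>\<^esup>\<close>.\<close>

definition laplace_direction :: "real \<Rightarrow> real \<Rightarrow> real \<Rightarrow> real \<Rightarrow> complex \<Rightarrow> real \<Rightarrow> bool" where
  "laplace_direction \<kappa> d \<delta> \<delta>\<^sub>1 \<epsilon> \<gamma> \<longleftrightarrow>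
     \<bar>\<gamma> - d\<bar> < \<delta> \<and> \<bar>\<kappa> * Arg (cis \<gamma> / \<epsilon>)\<bar> < pi / 2 \<and> \<delta>\<^sub>1 \<le> cos (\<kappa> * Arg (cis \<gamma> / \<epsilon>))"

text \<open>\<open>f\<close> is the \<open>\<kappa>\<close>-sum of \<open>\<Sum>j. a\<^sub>j \<epsilon>\<^sup>j\<close> in direction \<open>d\<close> on the sector of bisecting direction \<open>d\<close>,
  opening \<open>\<theta>\<close> and radius \<open>\<rho>\<close>.\<close>

definition is_kappa_sum ::
    "('x \<Rightarrow> complex) set \<Rightarrow> (('x \<Rightarrow> complex) \<Rightarrow> real) \<Rightarrow> real \<Rightarrow> (nat \<Rightarrow> 'x \<Rightarrow> complex) \<Rightarrow>
     real \<Rightarrow> real \<Rightarrow> real \<Rightarrow> (complex \<Rightarrow> 'x \<Rightarrow> complex) \<Rightarrow> bool" where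
  "is_kappa_sum V N \<kappa> a d \<theta> \<rho> f \<longleftrightarrow>
     1 / 2 < \<kappa> \<and> (\<forall>j. a j \<in> V) \<and>
     (\<exists>\<delta>>0. \<exists>C>0. \<exists>K>0. \<exists>\<delta>\<^sub>1>0. \<exists>B.
        borel_continuation V N \<kappa> a d \<delta> C K B \<and>
        0 < \<theta> \<and> \<theta> < pi / \<kappa> + 2 * \<delta> \<and> 0 < \<rho> \<and> \<rho> powr \<kappa> < \<delta>\<^sub>1 / K \<and>
        (\<forall>\<epsilon>\<in>sector d \<theta> \<rho>.
           (\<exists>\<gamma>. laplace_direction \<kappa> d \<delta> \<delta>\<^sub>1 \<epsilon> \<gamma>) \<and>
           (\<forall>\<gamma>. laplace_direction \<kappa> d \<delta> \<delta>\<^sub>1 \<epsilon> \<gamma> \<longrightarrow>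
              (\<forall>x. ray_integrable \<gamma> (laplace_integrand \<kappa> B \<epsilon> x) \<and>
                   f \<epsilon> x = ray_integral \<gamma> (laplace_integrand \<kappa> B \<epsilon> x)))))"

text \<open>Being the \<open>\<kappa>\<close>-sum on a sector of opening \<open>\<Theta> > \<pi>/\<kappa>\<close> with bisecting direction \<open>d\<close>: agreement, on
  each subsector of smaller opening and suitable radius, with the \<open>\<kappa>\<close>-sum in direction \<open>d\<close>.\<close>

definition is_kappa_sum_on_sector ::
    "('x \<Rightarrow> complex) set \<Rightarrow> (('x \<Rightarrow> complex) \<Rightarrow> real) \<Rightarrow> real \<Rightarrow> (nat \<Rightarrow> 'x \<Rightarrow> complex) \<Rightarrow>
     real \<Rightarrow> real \<Rightarrow> real \<Rightarrow> (complex \<Rightarrow> 'x \<Rightarrow> complex) \<Rightarrow> bool" where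
  "is_kappa_sum_on_sector V N \<kappa> a d \<Theta> R f \<longleftrightarrow>
     pi / \<kappa> < \<Theta> \<and> kappa_summable V N \<kappa> a d \<and>
     (\<forall>\<theta>. pi / \<kappa> < \<theta> \<and> \<theta> < \<Theta> \<longrightarrow> (\<exists>\<rho>>0. \<rho> \<le> R \<and> is_kappa_sum V N \<kappa> a d \<theta> \<rho> f))"

end

theory Submission
  imports Defs
begin

text \<open>
  The differential equation and the integral representation of the solutions are the source of the
  exponential flatness of the differences of neighbouring solutions. Given this flatness, the
  theorem is a statement about bounded holomorphic functions of \<open>\<epsilon>\<close> on the sectors of a good covering,
  with values in a space of bounded holomorphic functions: the theorem of Ramis and Sibuya provides the common
  Gevrey expansion, and the theorem of Watson and Nevanlinna its summability on a wide sector. Both are proved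
  for functions of \<open>\<epsilon>\<close> at each point \<open>x = (t, z)\<close>, with constants that do not depend on \<open>x\<close>. This suffices,
  because holomorphy in the sup norm follows from pointwise holomorphy and uniform bounds
  (\<open>vholomorphic_on_bounded_holomorphic\<close>), and uniformly bounded pointwise limits of holomorphic functions are
  holomorphic (\<open>bounded_holomorphic_pointwise_limit\<close>).

  \<^emph>\<open>Covering.\<close> The flatness is given for neighbouring sectors. In a good covering other sectors do not meet,
  because every sector that meets a given one contains one of its two edges and triple intersections are empty
  (\<open>good_covering_meet_adjacent\<close>). So the differences are flat for all pairs.

  \<^emph>\<open>Expansion.\<close> Divide the circle into equal arcs so small that each lies, with a margin, in a single sector of the
  covering, and choose for each arc the function of this sector. The result is holomorphic off finitely many rays,
  and Cauchy's formula represents it by an integral along a circle and the integrals of its jumps along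
  the rays (\<open>cauchy_formula_jumps\<close>). The jumps are flat of order \<open>\<kappa>\<close>, so expanding the Cauchy kernel into a geometric
  series costs \<open>\<Gamma>(1 + n / \<kappa>)\<close> in the \<open>n\<close>-th remainder (\<open>jump_expansion\<close>). This is done in the coordinate \<open>- ln \<epsilon>\<close>, in which
  all contours are boundaries of rectangles. The estimate holds only away from the rays, but the division of the
  circle can be rotated, and uniqueness of asymptotic expansions identifies the expansions found for different
  directions (\<open>ramis_sibuya\<close>).

  \<^emph>\<open>Summability.\<close> On a sector of opening larger than \<open>\<pi> / \<kappa>\<close> the inverse Laplace transform of order \<open>\<kappa>\<close>, taken along
  vertical lines in the variable \<open>(\<tau> / \<epsilon>)\<^sup>\<kappa>\<close>, defines a function of \<open>\<tau>\<close> on an unbounded sector, with exponential growth of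
  order \<open>\<kappa>\<close>. Its Laplace transform is the given function, by Fubini's theorem and Cauchy's formula for a half-plane
  (\<open>laplace_borel_transform\<close>). Near 0 it is the sum of the formal Borel transform: applied to the remainder of
  order \<open>n\<close>, on a line at distance \<open>n / \<kappa>\<close> from the origin, it is bounded by a geometric sequence
  (\<open>borel_transform_taylor\<close>). So it is the analytic continuation that summability asks for
  (\<open>gevrey_is_kappa_sum\<close>).
\<close>

section \<open>Sectors\<close>

lemma sector_eq_Int_ball: "sector d \<theta> \<rho> = unbounded_sector d \<theta> \<inter> ball 0 \<rho>"
proof (rule set_eqI, rule iffI)
  fix z assume "z \<in> sector d \<theta> \<rho>"
  then show "z \<in> unbounded_sector d \<theta> \<inter> ball 0 \<rho>"
    by (auto simp: sector_def unbounded_sector_def norm_mult)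
next
  fix z assume z: "z \<in> unbounded_sector d \<theta> \<inter> ball 0 \<rho>"
  then obtain r \<phi> where "z = of_real r * cis \<phi>" "0 < r" "\<bar>\<phi> - d\<bar> < \<theta> / 2"
    by (auto simp: unbounded_sector_def)
  moreover from this z have "r < \<rho>" by (simp add: norm_mult)
  ultimately show "z \<in> sector d \<theta> \<rho>" by (auto simp: sector_def)
qed

lemma unbounded_sectorI:
  "0 < r \<Longrightarrow> \<bar>\<phi> - d\<bar> < \<theta> / 2 \<Longrightarrow> of_real r * cis \<phi> \<in> unbounded_sector d \<theta>"
  by (auto simp: unbounded_sector_def)

lemma sectorI:
  "0 < r \<Longrightarrow> r < \<rho> \<Longrightarrow> \<bar>\<phi> - d\<bar> < \<theta> / 2 \<Longrightarrow> of_real r * cis \<phi> \<in> sector d \<theta> \<rho>"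
  by (auto simp: sector_def)

lemma unbounded_sector_nonzero: "z \<in> unbounded_sector d \<theta> \<Longrightarrow> z \<noteq> 0"
  by (auto simp: unbounded_sector_def)

lemma sector_nonzero: "z \<in> sector d \<theta> \<rho> \<Longrightarrow> z \<noteq> 0"
  by (auto simp: sector_def)

lemma unbounded_sector_mono:
  assumes "\<theta> \<le> \<theta>'"
  shows "unbounded_sector d \<theta> \<subseteq> unbounded_sector d \<theta>'"
proof
  fix z assume "z \<in> unbounded_sector d \<theta>"
  then obtain s \<phi> where "z = of_real s * cis \<phi>" "0 < s" "\<bar>\<phi> - d\<bar> < \<theta> / 2"
    by (auto simp: unbounded_sector_def)
  then show "z \<in> unbounded_sector d \<theta>'"
    using assms by (auto intro: unbounded_sectorI)
qed

lemma unbounded_sector_scale: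
  assumes "z \<in> unbounded_sector d \<theta>" "0 < r"
  shows "of_real r * z \<in> unbounded_sector d \<theta>"
proof -
  obtain s \<phi> where z: "z = of_real s * cis \<phi>" "0 < s" "\<bar>\<phi> - d\<bar> < \<theta> / 2"
    using assms(1) by (auto simp: unbounded_sector_def)
  have "of_real (r * s) * cis \<phi> \<in> unbounded_sector d \<theta>"
    using z assms(2) by (intro unbounded_sectorI) auto
  then show ?thesis using z by (simp add: mult.assoc)
qed

text \<open>The cosine of the angle to the bisecting direction decides about membership, as long as the sector
  does not overlap itself. Both sides of the inequality depend continuously on \<open>z\<close>.\<close>

lemma unbounded_sector_iff:
  assumes "0 < \<theta>" "\<theta> \<le> 2 * pi"
  shows "z \<in> unbounded_sector d \<theta> \<longleftrightarrow> cmod z * cos (\<theta> / 2) < Re (z * cis (- d))"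
proof
  assume "z \<in> unbounded_sector d \<theta>"
  then obtain r \<phi> where z: "z = of_real r * cis \<phi>" "0 < r" and \<phi>: "\<bar>\<phi> - d\<bar> < \<theta> / 2"
    by (auto simp: unbounded_sector_def)
  have "z * cis (- d) = of_real r * cis (\<phi> - d)"
    by (simp add: z cis_mult mult.assoc)
  then have "Re (z * cis (- d)) = r * cos \<bar>\<phi> - d\<bar>"
    by simp
  moreover have "cos (\<theta> / 2) < cos \<bar>\<phi> - d\<bar>"
    by (rule cos_monotone_0_pi) (use \<phi> assms in auto)
  ultimately show "cmod z * cos (\<theta> / 2) < Re (z * cis (- d))"
    using z by (simp add: norm_mult)
next
  assume L: "cmod z * cos (\<theta> / 2) < Re (z * cis (- d))"
  then have z0: "z \<noteq> 0" by auto
  define \<alpha> where "\<alpha> = Arg (z * cis (- d))"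
  have eq: "z * cis (- d) = of_real (cmod z) * cis \<alpha>"
    using rcis_cmod_Arg[of "z * cis (- d)"] by (simp add: \<alpha>_def rcis_def norm_mult)
  have "z = z * cis (- d) * cis d"
    by (simp add: cis_mult mult.assoc)
  then have z: "z = of_real (cmod z) * cis (d + \<alpha>)"
    by (simp add: eq cis_mult mult.assoc add.commute)
  have "cos (\<theta> / 2) < cos \<bar>\<alpha>\<bar>"
    using L z0 unfolding eq by simp
  moreover have "\<bar>\<alpha>\<bar> \<le> pi"
    using Arg_bounded[of "z * cis (- d)"] by (auto simp: \<alpha>_def)
  ultimately have "\<bar>\<alpha>\<bar> < \<theta> / 2"
    using cos_mono_less_eq[of "\<theta> / 2" "\<bar>\<alpha>\<bar>"] assms by auto
  then show "z \<in> unbounded_sector d \<theta>"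
    using z0 by (subst z) (intro unbounded_sectorI, auto)
qed

lemma open_unbounded_sector: "open (unbounded_sector d \<theta>)"
proof (rule openI)
  fix z assume "z \<in> unbounded_sector d \<theta>"
  then obtain r \<phi> where z: "z = of_real r * cis \<phi>" "0 < r" and \<phi>: "\<bar>\<phi> - d\<bar> < \<theta> / 2"
    by (auto simp: unbounded_sector_def)
  \<comment> \<open>a sector of small opening about the direction of \<open>z\<close> lies inside\<close>
  define \<eta> where "\<eta> = min (2 * pi) (\<theta> - 2 * \<bar>\<phi> - d\<bar>)"
  have \<eta>: "0 < \<eta>" "\<eta> \<le> 2 * pi" using \<phi> by (auto simp: \<eta>_def)
  have "unbounded_sector \<phi> \<eta> \<subseteq> unbounded_sector d \<theta>"
  proof
    fix w assume "w \<in> unbounded_sector \<phi> \<eta>"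
    then obtain s \<psi> where w: "w = of_real s * cis \<psi>" "0 < s" "\<bar>\<psi> - \<phi>\<bar> < \<eta> / 2"
      by (auto simp: unbounded_sector_def)
    have "\<bar>\<psi> - d\<bar> < \<theta> / 2"
    proof -
      have "\<bar>\<psi> - d\<bar> \<le> \<bar>\<psi> - \<phi>\<bar> + \<bar>\<phi> - d\<bar>" by simp
      moreover have "\<eta> \<le> \<theta> - 2 * \<bar>\<phi> - d\<bar>" by (simp add: \<eta>_def)
      ultimately show ?thesis using w(3) by argo
    qed
    with w show "w \<in> unbounded_sector d \<theta>" by (auto intro: unbounded_sectorI)
  qed
  moreover have "open (unbounded_sector \<phi> \<eta>)"
  proof -
    have "unbounded_sector \<phi> \<eta> = {w. cmod w * cos (\<eta> / 2) < Re (w * cis (- \<phi>))}"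
      using unbounded_sector_iff[OF \<eta>] by auto
    also have "open \<dots>"
      by (intro open_Collect_less continuous_intros)
    finally show ?thesis .
  qed
  moreover have "z \<in> unbounded_sector \<phi> \<eta>"
    using z \<eta> by (auto intro: unbounded_sectorI)
  ultimately show "\<exists>e>0. ball z e \<subseteq> unbounded_sector d \<theta>"
    by (meson open_contains_ball order_trans)
qed

lemma open_sector: "open (sector d \<theta> \<rho>)"
  by (simp add: sector_eq_Int_ball open_Int open_unbounded_sector)

lemma connected_sector: "connected (sector d \<theta> \<rho>)"
proof -
  have "sector d \<theta> \<rho> = (\<lambda>(r, \<phi>). of_real r * cis \<phi>) ` ({0<..<\<rho>} \<times> {d - \<theta> / 2<..<d + \<theta> / 2})"
  proof (rule set_eqI, rule iffI)
    fix z assume "z \<in> sector d \<theta> \<rho>"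
    then obtain r \<phi> where "z = of_real r * cis \<phi>" "0 < r" "r < \<rho>" "\<bar>\<phi> - d\<bar> < \<theta> / 2"
      by (auto simp: sector_def)
    moreover from this have "d - \<theta> / 2 < \<phi>" "\<phi> < d + \<theta> / 2" by linarith+
    ultimately show "z \<in> (\<lambda>(r, \<phi>). of_real r * cis \<phi>) ` ({0<..<\<rho>} \<times> {d - \<theta> / 2<..<d + \<theta> / 2})"
      by (intro image_eqI[of _ _ "(r, \<phi>)"]) auto
  next
    fix z assume "z \<in> (\<lambda>(r, \<phi>). of_real r * cis \<phi>) ` ({0<..<\<rho>} \<times> {d - \<theta> / 2<..<d + \<theta> / 2})"
    then obtain r \<phi> where z: "z = of_real r * cis \<phi>" "0 < r" "r < \<rho>"
      and \<phi>: "d - \<theta> / 2 < \<phi>" "\<phi> < d + \<theta> / 2"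
      by auto
    have "\<bar>\<phi> - d\<bar> < \<theta> / 2" using \<phi> by linarith
    with z show "z \<in> sector d \<theta> \<rho>" by (auto intro: sectorI)
  qed
  moreover have "continuous_on A (\<lambda>(r::real, \<phi>). of_real r * cis \<phi>)" for A
    unfolding case_prod_beta cis_conv_exp by (intro continuous_intros)
  ultimately show ?thesis
    by (simp add: connected_continuous_image convex_connected convex_Times)
qed

section \<open>The nerve of a good covering\<close>

text \<open>A sector that meets another one without being contained in it crosses one of its two edges;
  being a sector, it then contains that edge.\<close>

lemma sector_contains_edge:
  assumes \<theta>: "0 < \<theta>" "\<theta> \<le> 2 * pi"
    and meet: "sector d' \<theta>' \<rho> \<inter> sector d \<theta> \<rho> \<noteq> {}"
    and ncont: "\<not> sector d' \<theta>' \<rho> \<subseteq> sector d \<theta> \<rho>"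
  shows "\<exists>s\<in>{- 1, 1}. \<forall>r. 0 < r \<and> r < \<rho> \<longrightarrow> of_real r * cis (d + s * \<theta> / 2) \<in> sector d' \<theta>' \<rho>"
proof -
  \<comment> \<open>the cosine of the angle to the bisecting direction of the second sector\<close>
  define c where "c z = Re (z * cis (- d)) / cmod z" for z
  have in_iff: "z \<in> sector d \<theta> \<rho> \<longleftrightarrow> cos (\<theta> / 2) < c z" if "z \<in> sector d' \<theta>' \<rho>" for z
  proof -
    have "z \<noteq> 0" "z \<in> ball 0 \<rho>" using that by (auto simp: sector_nonzero sector_eq_Int_ball)
    then show ?thesis
      using unbounded_sector_iff[OF \<theta>, of z d]
      by (simp add: sector_eq_Int_ball c_def field_simps)
  qed
  have "connected (c ` sector d' \<theta>' \<rho>)"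
    unfolding c_def
    by (intro connected_continuous_image connected_sector continuous_intros)
      (auto simp: sector_nonzero)
  moreover obtain z1 where "z1 \<in> sector d' \<theta>' \<rho>" "cos (\<theta> / 2) < c z1"
    using meet in_iff by auto
  moreover obtain z2 where "z2 \<in> sector d' \<theta>' \<rho>" "c z2 \<le> cos (\<theta> / 2)"
    using ncont in_iff by (meson linorder_not_le subsetI)
  \<comment> \<open>the connected image has points on both sides of the value at the edges\<close>
  ultimately have "cos (\<theta> / 2) \<in> c ` sector d' \<theta>' \<rho>"
    by (meson connectedD_interval imageI less_imp_le)
  then obtain z where z: "z \<in> sector d' \<theta>' \<rho>" and cz: "c z = cos (\<theta> / 2)" by auto
  have z0: "z \<noteq> 0" using z by (simp add: sector_nonzero)
  define \<alpha> where "\<alpha> = Arg (z * cis (- d))"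
  have eq: "z * cis (- d) = of_real (cmod z) * cis \<alpha>"
    using rcis_cmod_Arg[of "z * cis (- d)"] by (simp add: \<alpha>_def rcis_def norm_mult)
  have "z = z * cis (- d) * cis d"
    by (simp add: cis_mult mult.assoc)
  then have zeq: "z = of_real (cmod z) * cis (d + \<alpha>)"
    by (simp add: eq cis_mult mult.assoc add.commute)
  have "cos \<bar>\<alpha>\<bar> = cos (\<theta> / 2)"
    using cz z0 unfolding c_def eq by simp
  moreover have "\<bar>\<alpha>\<bar> \<le> pi"
    using Arg_bounded[of "z * cis (- d)"] by (auto simp: \<alpha>_def)
  ultimately have "\<bar>\<alpha>\<bar> = \<theta> / 2"
    using cos_inj_pi[of "\<bar>\<alpha>\<bar>" "\<theta> / 2"] \<theta> by auto
  then obtain s :: real where s: "s \<in> {- 1, 1}" "\<alpha> = s * \<theta> / 2"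
    by (cases "\<alpha> \<ge> 0") (use that[of 1] that[of "- 1"] in auto)
  have "of_real r * cis (d + s * \<theta> / 2) \<in> sector d' \<theta>' \<rho>" if r: "0 < r" "r < \<rho>" for r
  proof -
    have "of_real (r / cmod z) * z \<in> unbounded_sector d' \<theta>'"
      using z z0 r by (intro unbounded_sector_scale) (auto simp: sector_eq_Int_ball)
    also have "of_real (r / cmod z) * z = of_real r * cis (d + s * \<theta> / 2)"
      using z0 s(2) by (subst (2) zeq) (simp only: of_real_divide, simp)
    finally show ?thesis using r by (simp add: sector_eq_Int_ball norm_mult)
  qed
  with s show ?thesis by blast
qed

text \<open>An edge of a sector belongs to the closure of the sector.\<close>

lemma edge_nbhd_meets_sector:
  assumes "0 < \<theta>" "s \<in> {- 1, 1}" "0 < r" "r < \<rho>"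
    and "open A" "of_real r * cis (d + s * \<theta> / 2) \<in> A"
  shows "A \<inter> sector d \<theta> \<rho> \<noteq> {}"
proof -
  have "((\<lambda>x. of_real r * cis (d + s * x)) \<longlongrightarrow> of_real r * cis (d + s * (\<theta> / 2))) (at_left (\<theta> / 2))"
    unfolding cis_conv_exp by (intro tendsto_intros)
  then have "eventually (\<lambda>x. of_real r * cis (d + s * x) \<in> A) (at_left (\<theta> / 2))"
    using assms(5,6) topological_tendstoD by fastforce
  moreover have "eventually (\<lambda>x. x \<in> {0<..<\<theta> / 2}) (at_left (\<theta> / 2))"
    by (rule eventually_at_leftI[of 0]) (use assms in auto)
  ultimately have "eventually (\<lambda>x. of_real r * cis (d + s * x) \<in> A \<and> x \<in> {0<..<\<theta> / 2}) (at_left (\<theta> / 2))"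
    by (rule eventually_conj)
  then obtain x where "of_real r * cis (d + s * x) \<in> A" "x \<in> {0<..<\<theta> / 2}"
    using eventually_happens[of _ "at_left (\<theta> / 2)"] by (auto simp: trivial_limit_at_left_real)
  moreover from this have "of_real r * cis (d + s * x) \<in> sector d \<theta> \<rho>"
    using assms by (intro sectorI) auto
  ultimately show ?thesis by blast
qed

text \<open>Every sector that meets \<open>E\<^sub>p\<close> contains one of the two edges of \<open>E\<^sub>p\<close>, and two different ones
  cannot contain the same edge, since no three sectors have a common point. So \<open>E\<^sub>p\<close> meets at most two
  others, which are therefore its cyclic neighbours.\<close>

lemma good_covering_meet_adjacent:
  assumes gc: "good_covering n d \<theta> \<rho>" and "0 < \<rho>" and pq: "p < n" "q < n" "p \<noteq> q"
    and meet: "sector (d p) (\<theta> p) \<rho> \<inter> sector (d q) (\<theta> q) \<rho> \<noteq> {}"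
  shows "q = (p + 1) mod n \<or> p = (q + 1) mod n"
proof (rule ccontr)
  assume na: "\<not> ?thesis"
  define E where "E i = sector (d i) (\<theta> i) \<rho>" for i
  note gc' = gc[unfolded good_covering_def, folded E_def]
  have n2: "2 \<le> n" and \<theta>: "\<And>i. i < n \<Longrightarrow> 0 < \<theta> i \<and> \<theta> i \<le> 2 * pi"
    and nxt: "\<And>i. i < n \<Longrightarrow> E i \<inter> E ((i + 1) mod n) \<noteq> {}"
    using gc' by simp_all
  have trip: "\<And>i j l. i < n \<Longrightarrow> j < n \<Longrightarrow> l < n \<Longrightarrow> i \<noteq> j \<Longrightarrow> j \<noteq> l \<Longrightarrow> i \<noteq> l \<Longrightarrow> E i \<inter> E j \<inter> E l = {}"
    using gc' by simp
  define a b where "a = (p + 1) mod n" and "b = (p + n - 1) mod n"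
  have ab: "a < n" "b < n" using n2 by (auto simp: a_def b_def)
  have suc_mod: "Suc i mod n = (if Suc i = n then 0 else Suc i)" if "i < n" for i
    using that by auto
  have b_eq: "b = (if p = 0 then n - 1 else p - 1)"
    using pq n2 by (auto simp: b_def mod_if)
  have pb: "p = (b + 1) mod n"
    using pq n2 by (auto simp: b_eq suc_mod)
  \<comment> \<open>among at most three sectors all are cyclic neighbours of each other\<close>
  have n3: "n > 3"
  proof (rule ccontr)
    assume "\<not> n > 3"
    then have n: "n = 2 \<or> n = 3" using n2 by auto
    then have "p = 0 \<or> p = 1 \<or> p = 2" "q = 0 \<or> q = 1 \<or> q = 2" using pq by auto
    with n show False using na pq by (elim disjE) simp_all
  qed
  have dist: "a \<noteq> b" "a \<noteq> p" "b \<noteq> p" "q \<noteq> a" "q \<noteq> b"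
    using n3 pq na suc_mod[of p] suc_mod[of q] by (auto simp: a_def b_eq split: if_splits)
  have meets: "E j \<inter> E p \<noteq> {}" if "j \<in> {a, b, q}" for j
    using that nxt[of p] nxt[of b] meet pq ab pb by (auto simp: a_def E_def)
  \<comment> \<open>otherwise the two neighbours of \<open>E j\<close> meet it inside \<open>E p\<close>, and one of them is not \<open>E p\<close>\<close>
  have ncont: "\<not> E j \<subseteq> E p" if j: "j < n" "j \<noteq> p" for j
  proof
    assume sub: "E j \<subseteq> E p"
    define i where "i = (j + 1) mod n"
    define i' where "i' = (if j = 0 then n - 1 else j - 1)"
    have "i < n" "i' < n" "(i' + 1) mod n = j" using j by (auto simp: i_def i'_def suc_mod)
    then have "E j \<inter> E i \<noteq> {}" "E j \<inter> E i' \<noteq> {}"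
      using nxt[of j] nxt[of i'] j by (auto simp: i_def)
    moreover have "i \<noteq> j" "i' \<noteq> j" "i \<noteq> i'" using n3 j by (auto simp: i_def i'_def suc_mod)
    moreover have "E j \<inter> E i = {}" if "i \<noteq> p" using trip[of j p i] sub that j pq \<open>i < n\<close> \<open>i \<noteq> j\<close> by auto
    moreover have "E j \<inter> E i' = {}" if "i' \<noteq> p" using trip[of j p i'] sub that j pq \<open>i' < n\<close> \<open>i' \<noteq> j\<close> by auto
    ultimately show False by auto
  qed
  have "\<forall>j\<in>{a, b, q}. \<exists>s\<in>{- 1, 1}. of_real (\<rho> / 2) * cis (d p + s * \<theta> p / 2) \<in> E j"
  proof
    fix j assume j: "j \<in> {a, b, q}"
    then have "j < n" "j \<noteq> p" using ab pq dist by auto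
    then have "\<exists>s\<in>{- 1, 1}. \<forall>r. 0 < r \<and> r < \<rho> \<longrightarrow> of_real r * cis (d p + s * \<theta> p / 2) \<in> E j"
      unfolding E_def
      by (intro sector_contains_edge) (use \<theta>[of p] pq meets[OF j] ncont[of j] in \<open>simp_all add: E_def\<close>)
    moreover have "0 < \<rho> / 2" "\<rho> / 2 < \<rho>" using \<open>0 < \<rho>\<close> by simp_all
    ultimately show "\<exists>s\<in>{- 1, 1}. of_real (\<rho> / 2) * cis (d p + s * \<theta> p / 2) \<in> E j"
      by blast
  qed
  then obtain s where s: "\<And>j. j \<in> {a, b, q} \<Longrightarrow> s j \<in> {- 1, 1::real}"
      "\<And>j. j \<in> {a, b, q} \<Longrightarrow> of_real (\<rho> / 2) * cis (d p + s j * \<theta> p / 2) \<in> E j"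
    by metis
  \<comment> \<open>two sectors with a common edge of \<open>E p\<close> would have a point in common with \<open>E p\<close>\<close>
  have two: False if ij: "i \<in> {a, b, q}" "j \<in> {a, b, q}" "i \<noteq> j" "s i = s j" for i j
  proof -
    have "(E i \<inter> E j) \<inter> sector (d p) (\<theta> p) \<rho> \<noteq> {}"
    proof (rule edge_nbhd_meets_sector[where s = "s i" and r = "\<rho> / 2"])
      show "open (E i \<inter> E j)" by (simp add: E_def open_sector open_Int)
      show "of_real (\<rho> / 2) * cis (d p + s i * \<theta> p / 2) \<in> E i \<inter> E j" using s(2)[OF ij(1)] s(2)[OF ij(2)] ij(4) by (metis IntI)
    qed (use \<theta> pq s(1) ij(1) \<open>0 < \<rho>\<close> in auto)
    moreover have "E i \<inter> E j \<inter> E p = {}"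
      using ij ab pq dist by (intro trip) auto
    ultimately show False by (simp add: E_def)
  qed
  \<comment> \<open>three sectors, but only two edges\<close>
  have "s a = s b \<or> s a = s q \<or> s b = s q"
    using s(1)[of a] s(1)[of b] s(1)[of q] by auto
  then show False
    using two[of a b] two[of a q] two[of b q] dist by auto
qed

section \<open>Bounded holomorphic functions as a function space\<close>

lemma sup_norm_bounds:
  assumes "D \<noteq> {}" "\<And>x. x \<in> D \<Longrightarrow> cmod (h x) \<le> B"
  shows "0 \<le> sup_norm D h" "sup_norm D h \<le> B"
proof -
  obtain x where "x \<in> D" using assms(1) by auto
  moreover have "bdd_above ((\<lambda>x. cmod (h x)) ` D)" using assms(2) by (rule bdd_aboveI2)
  ultimately show "0 \<le> sup_norm D h"
    unfolding sup_norm_def by (intro cSUP_upper2[of _ _ x]) auto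
  show "sup_norm D h \<le> B"
    unfolding sup_norm_def using assms by (intro cSUP_least) auto
qed

text \<open>Cauchy's estimates for the first two Taylor terms. The quadratic remainder estimate has a constant
  that depends on the function only through its bound, so it survives pointwise limits and integration.\<close>

lemma taylor_quadratic:
  assumes hol: "f holomorphic_on ball e \<rho>" and M: "\<And>w. w \<in> ball e \<rho> \<Longrightarrow> cmod (f w) \<le> M" and "0 < \<rho>"
  shows "cmod (deriv f e) \<le> 2 * M / \<rho>"
    and "w \<in> ball e (\<rho> / 2) \<Longrightarrow>
           cmod (f w - f e - deriv f e * (w - e)) \<le> 32 * M / \<rho>\<^sup>2 * cmod (w - e) ^ 2"
proof -
  have bnd: "cmod ((deriv ^^ n) f z) \<le> fact n * M / r ^ n" if "0 < r" "cball z r \<subseteq> ball e \<rho>" for n z r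
  proof (rule Cauchy_inequality)
    show "f holomorphic_on ball z r"
      using hol that(2) ball_subset_cball holomorphic_on_subset by (meson order_trans)
    show "continuous_on (cball z r) f"
      using hol that(2) holomorphic_on_imp_continuous_on continuous_on_subset by blast
    show "cmod (f x) \<le> M" if "cmod (z - x) = r" for x
      using \<open>cball z r \<subseteq> ball e \<rho>\<close> that by (intro M) (auto simp: dist_norm subset_iff)
  qed (use that in auto)
  show "cmod (deriv f e) \<le> 2 * M / \<rho>"
    using bnd[of "\<rho> / 2" e 1] \<open>0 < \<rho>\<close> by (auto simp: subset_iff field_simps)
  assume w: "w \<in> ball e (\<rho> / 2)"
  have "cmod ((deriv ^^ 0) f w - (\<Sum>i\<le>1. (deriv ^^ i) f e * (w - e) ^ i / fact i))
      \<le> (32 * M / \<rho>\<^sup>2) * cmod (w - e) ^ Suc 1 / fact 1"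
  proof (rule complex_Taylor[where S = "ball e (\<rho> / 2)"])
    show "((deriv ^^ i) f has_field_derivative (deriv ^^ Suc i) f x) (at x within ball e (\<rho> / 2))"
      if "x \<in> ball e (\<rho> / 2)" for i x
    proof -
      have "(deriv ^^ i) f holomorphic_on ball e \<rho>" by (intro holomorphic_higher_deriv hol) auto
      moreover have "x \<in> ball e \<rho>" using that \<open>0 < \<rho>\<close> by auto
      ultimately have "((deriv ^^ i) f has_field_derivative deriv ((deriv ^^ i) f) x) (at x)"
        using holomorphic_derivI[of _ "ball e \<rho>" x] by auto
      then show ?thesis by (simp add: has_field_derivative_at_within)
    qed
    show "cmod ((deriv ^^ Suc 1) f x) \<le> 32 * M / \<rho>\<^sup>2" if "x \<in> ball e (\<rho> / 2)" for x
    proof -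
      have "cball x (\<rho> / 4) \<subseteq> ball e \<rho>"
      proof
        fix y assume "y \<in> cball x (\<rho> / 4)"
        then have "dist e y \<le> dist e x + \<rho> / 4" using dist_triangle[of e y x] by auto
        then show "y \<in> ball e \<rho>" using that \<open>0 < \<rho>\<close> by auto
      qed
      from bnd[OF _ this, of 2] \<open>0 < \<rho>\<close> show ?thesis
        by (simp add: power2_eq_square numeral_2_eq_2 field_simps)
    qed
  qed (use w \<open>0 < \<rho>\<close> in auto)
  then show "cmod (f w - f e - deriv f e * (w - e)) \<le> 32 * M / \<rho>\<^sup>2 * cmod (w - e) ^ 2"
    by (simp add: algebra_simps power2_eq_square)
qed

lemma holomorphic2_quadratic:
  assumes hol: "holomorphic2_on f (ball x \<rho>)" and M: "\<And>w. w \<in> ball x \<rho> \<Longrightarrow> cmod (f w) \<le> M" and "0 < \<rho>"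
  obtains a b where "cmod a \<le> 2 * M / \<rho>" "cmod b \<le> 2 * M / \<rho>"
    "\<And>h1 h2. norm (h1, h2) < \<rho> / 2 \<Longrightarrow>
       cmod (f (x + (h1, h2)) - f x - (a * h1 + b * h2)) \<le> 32 * M / \<rho>\<^sup>2 * norm (h1, h2) ^ 2"
proof -
  obtain a b where ab: "(f has_derivative (\<lambda>(v, w). a * v + b * w)) (at x)"
    using hol \<open>0 < \<rho>\<close> unfolding holomorphic2_on_def by (meson centre_in_ball)
  \<comment> \<open>restriction to the complex line through \<open>x\<close> in the direction \<open>h\<close>\<close>
  have line: "cmod (a * h1 + b * h2) \<le> 2 * M / (\<rho> / norm (h1, h2)) \<and>
      (1 < \<rho> / norm (h1, h2) / 2 \<longrightarrow>
      cmod (f (x + (h1, h2)) - f x - (a * h1 + b * h2)) \<le> 32 * M / (\<rho> / norm (h1, h2))\<^sup>2)"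
    if h: "(h1, h2) \<noteq> 0" for h1 h2
  proof -
    define \<phi> where "\<phi> l = f (x + (l * h1, l * h2))" for l
    define r where "r = \<rho> / norm (h1, h2)"
    have r: "0 < r" using h \<open>0 < \<rho>\<close> by (simp add: r_def)
    have nrm: "norm (l * h1, l * h2) = cmod l * norm (h1, h2)" for l :: complex
      by (simp add: norm_Pair norm_mult power_mult_distrib real_sqrt_mult flip: distrib_left)
    have inb: "x + (l * h1, l * h2) \<in> ball x \<rho>" if "l \<in> ball 0 r" for l :: complex
    proof -
      have "dist x (x + (l * h1, l * h2)) = cmod l * norm (h1, h2)"
        by (metis add_diff_cancel_left' dist_commute dist_norm nrm)
      also have "\<dots> < \<rho>" using that h by (simp add: r_def field_simps)
      finally show ?thesis by simp
    qed
    have der: "(\<phi> has_field_derivative (a' * h1 + b' * h2)) (at l)"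
      if "(f has_derivative (\<lambda>(v, w). a' * v + b' * w)) (at (x + (l * h1, l * h2)))" for a' b' l
    proof -
      have "((\<lambda>l. x + (l * h1, l * h2)) has_derivative (\<lambda>d. (d * h1, d * h2))) (at l)"
        by (auto intro!: derivative_eq_intros)
      from has_derivative_compose[OF this that] show ?thesis
        unfolding has_field_derivative_def \<phi>_def
        by (rule has_derivative_eq_rhs) (auto simp: algebra_simps)
    qed
    have "\<phi> holomorphic_on ball 0 r"
    proof (rule holomorphic_onI)
      fix l :: complex assume "l \<in> ball 0 r"
      then obtain a' b' where "(f has_derivative (\<lambda>(v, w). a' * v + b' * w)) (at (x + (l * h1, l * h2)))"
        using hol inb unfolding holomorphic2_on_def by blast
      from der[OF this] show "\<phi> field_differentiable (at l within ball 0 r)"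
        by (meson field_differentiable_at_within field_differentiable_def)
    qed
    moreover have "cmod (\<phi> l) \<le> M" if "l \<in> ball 0 r" for l
      unfolding \<phi>_def using inb[OF that] by (rule M)
    moreover have "deriv \<phi> 0 = a * h1 + b * h2"
      using ab by (intro DERIV_imp_deriv der) (simp flip: zero_prod_def)
    moreover have "\<phi> 0 = f x" "\<phi> 1 = f (x + (h1, h2))" by (simp_all add: \<phi>_def flip: zero_prod_def)
    ultimately show ?thesis
      using taylor_quadratic[of \<phi> 0 r M] taylor_quadratic(2)[of \<phi> 0 r M 1] r
      by (auto simp flip: r_def)
  qed
  show ?thesis
  proof (rule that[of a b])
    show "cmod a \<le> 2 * M / \<rho>" using line[of 1 0] by (simp add: norm_Pair zero_prod_def)
    show "cmod b \<le> 2 * M / \<rho>" using line[of 0 1] by (simp add: norm_Pair zero_prod_def)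
    fix h1 h2 :: complex assume h: "norm (h1, h2) < \<rho> / 2"
    show "cmod (f (x + (h1, h2)) - f x - (a * h1 + b * h2)) \<le> 32 * M / \<rho>\<^sup>2 * norm (h1, h2) ^ 2"
    proof (cases "(h1, h2) = 0")
      case True
      then have "h1 = 0" "h2 = 0" by (simp_all add: zero_prod_def)
      then show ?thesis by (simp flip: zero_prod_def)
    next
      case False
      then have "0 < norm (h1, h2)" by (metis zero_less_norm_iff)
      with h have "1 < \<rho> / norm (h1, h2) / 2" by (simp add: field_simps)
      with line[OF False] show ?thesis by (simp add: power_divide mult.commute)
    qed
  qed
qed

text \<open>Quadratic estimates that hold uniformly pass to limits and integrals, and give differentiability there.\<close>

lemma holomorphic2_onI_quadratic:
  assumes "\<And>x. x \<in> A \<Longrightarrow> \<exists>\<rho>>0. \<exists>K a b. \<forall>h1 h2. norm (h1, h2) < \<rho> \<longrightarrow>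
       cmod (f (x + (h1, h2)) - f x - (a * h1 + b * h2)) \<le> K * norm (h1, h2) ^ 2"
  shows "holomorphic2_on f A"
  unfolding holomorphic2_on_def
proof
  fix x assume "x \<in> A"
  then obtain \<rho> K a b where "0 < \<rho>" and q: "\<And>h1 h2. norm (h1, h2) < \<rho> \<Longrightarrow>
       cmod (f (x + (h1, h2)) - f x - (a * h1 + b * h2)) \<le> K * norm (h1, h2) ^ 2"
    using assms by blast
  have "(f has_derivative (\<lambda>(v, w). a * v + b * w)) (at x)"
    unfolding has_derivative_at
  proof
    show "bounded_linear (\<lambda>(v, w). a * v + b * w)"
      unfolding case_prod_beta
      by (intro bounded_linear_add bounded_linear_const_mult bounded_linear_fst bounded_linear_snd)
    have "eventually (\<lambda>h. norm (norm (f (x + h) - f x - (case h of (v, w) \<Rightarrow> a * v + b * w)) / norm h)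
        \<le> K * norm h) (at 0)"
      unfolding eventually_at
    proof (intro exI[of _ \<rho>] conjI ballI impI, goal_cases)
      case (2 h)
      obtain h1 h2 where h: "h = (h1, h2)" by (cases h)
      have "norm h > 0" "norm h < \<rho>" using 2 by auto
      then show ?case using q[of h1 h2] by (simp add: h field_simps power2_eq_square)
    qed (use \<open>0 < \<rho>\<close> in auto)
    moreover have "((\<lambda>h::complex \<times> complex. K * norm h) \<longlongrightarrow> 0) (at 0)"
      by (intro tendsto_eq_intros) auto
    ultimately show "((\<lambda>h. norm (f (x + h) - f x - (case h of (v, w) \<Rightarrow> a * v + b * w)) / norm h) \<longlongrightarrow> 0) (at 0)"
      by (rule Lim_null_comparison)
  qed
  then show "\<exists>a b. (f has_derivative (\<lambda>(v, w). a * v + b * w)) (at x)" by blast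
qed

text \<open>The coefficients of the linear terms are bounded, so they converge along a subsequence, and the
  quadratic estimate passes to the limit.\<close>

lemma holomorphic2_on_pointwise_limit:
  assumes "open A" and hol: "\<And>n. holomorphic2_on (f n) A"
    and M: "\<And>n x. x \<in> A \<Longrightarrow> cmod (f n x) \<le> M"
    and lim: "\<And>x. x \<in> A \<Longrightarrow> (\<lambda>n::nat. f n x) \<longlonglongrightarrow> g x"
  shows "holomorphic2_on g A"
proof (rule holomorphic2_onI_quadratic)
  fix x assume "x \<in> A"
  then obtain \<rho> where \<rho>: "0 < \<rho>" "ball x \<rho> \<subseteq> A" using \<open>open A\<close> by (meson openE)
  have "\<exists>a b. cmod a \<le> 2 * M / \<rho> \<and> cmod b \<le> 2 * M / \<rho> \<and>
    (\<forall>h1 h2. norm (h1, h2) < \<rho> / 2 \<longrightarrow>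
       cmod (f n (x + (h1, h2)) - f n x - (a * h1 + b * h2)) \<le> 32 * M / \<rho>\<^sup>2 * norm (h1, h2) ^ 2)" for n
  proof -
    have "holomorphic2_on (f n) (ball x \<rho>)" using hol \<rho>(2) by (auto simp: holomorphic2_on_def)
    moreover have "cmod (f n w) \<le> M" if "w \<in> ball x \<rho>" for w using M[of w n] \<rho>(2) that by blast
    ultimately show ?thesis using holomorphic2_quadratic[OF _ _ \<rho>(1)] by metis
  qed
  then obtain a b where ab: "\<And>n. cmod (a n) \<le> 2 * M / \<rho>" "\<And>n. cmod (b n) \<le> 2 * M / \<rho>"
    and q: "\<And>n h1 h2. norm (h1, h2) < \<rho> / 2 \<Longrightarrow>
       cmod (f n (x + (h1, h2)) - f n x - (a n * h1 + b n * h2)) \<le> 32 * M / \<rho>\<^sup>2 * norm (h1, h2) ^ 2"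
    by metis
  have "bounded (range (\<lambda>n. (a n, b n)))"
    by (rule bounded_subset[OF bounded_Times[of "cball 0 (2 * M / \<rho>)" "cball 0 (2 * M / \<rho>)"]])
      (use ab in auto)
  then obtain l r where lr: "strict_mono (r :: nat \<Rightarrow> nat)" "((\<lambda>n. (a n, b n)) \<circ> r) \<longlonglongrightarrow> l"
    using bounded_imp_convergent_subsequence by blast
  have l1: "(\<lambda>n. a (r n)) \<longlonglongrightarrow> fst l" and l2: "(\<lambda>n. b (r n)) \<longlonglongrightarrow> snd l"
    using tendsto_fst[OF lr(2)] tendsto_snd[OF lr(2)] by (simp_all add: o_def)
  have flim: "(\<lambda>n. f (r n) y) \<longlonglongrightarrow> g y" if "y \<in> A" for y
    using LIMSEQ_subseq_LIMSEQ[OF lim[OF that] lr(1)] by (simp add: o_def)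
  have "cmod (g (x + (h1, h2)) - g x - (fst l * h1 + snd l * h2)) \<le> 32 * M / \<rho>\<^sup>2 * norm (h1, h2) ^ 2"
    if h: "norm (h1, h2) < \<rho> / 2" for h1 h2
  proof (rule LIMSEQ_le_const2)
    have "dist x (x + (h1, h2)) = norm (h1, h2)"
      by (metis add_diff_cancel_left' dist_commute dist_norm)
    then have "x + (h1, h2) \<in> A" using h \<rho> by (intro subsetD[OF \<rho>(2)]) simp
    then show "(\<lambda>n. cmod (f (r n) (x + (h1, h2)) - f (r n) x - (a (r n) * h1 + b (r n) * h2)))
        \<longlonglongrightarrow> cmod (g (x + (h1, h2)) - g x - (fst l * h1 + snd l * h2))"
      by (intro tendsto_intros flim l1 l2 \<open>x \<in> A\<close>)
  qed (use q[OF h] in blast)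
  then show "\<exists>\<rho>>0. \<exists>K a b. \<forall>h1 h2. norm (h1, h2) < \<rho> \<longrightarrow>
       cmod (g (x + (h1, h2)) - g x - (a * h1 + b * h2)) \<le> K * norm (h1, h2) ^ 2"
    using half_gt_zero[OF \<rho>(1)] by blast
qed

text \<open>The quadratic estimate is integrated in the parameter, with the dominating function in the constant.\<close>

lemma holomorphic2_on_integral:
  fixes G :: "real \<Rightarrow> complex \<times> complex \<Rightarrow> complex"
  assumes "open A" and hol: "\<And>y. holomorphic2_on (G y) A"
    and meas: "\<And>x. x \<in> A \<Longrightarrow> (\<lambda>y. G y x) \<in> borel_measurable lborel"
    and bnd: "\<And>y x. x \<in> A \<Longrightarrow> cmod (G y x) \<le> B y" and int: "integrable lborel B"
  shows "holomorphic2_on (\<lambda>x. LINT y|lborel. G y x) A"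
proof (rule holomorphic2_onI_quadratic)
  fix x assume x: "x \<in> A"
  then obtain \<rho> where \<rho>: "0 < \<rho>" "ball x \<rho> \<subseteq> A" using \<open>open A\<close> by (meson openE)
  have inA: "x + (h1, h2) \<in> A" if "norm (h1, h2) < \<rho> / 2" for h1 h2
  proof -
    have "dist x (x + (h1, h2)) = norm (h1, h2)"
      by (metis add_diff_cancel_left' dist_commute dist_norm)
    then show ?thesis using that \<rho> by (intro subsetD[OF \<rho>(2)]) simp
  qed
  have "\<exists>a b. cmod a \<le> 2 * B y / \<rho> \<and> cmod b \<le> 2 * B y / \<rho> \<and>
    (\<forall>h1 h2. norm (h1, h2) < \<rho> / 2 \<longrightarrow>
       cmod (G y (x + (h1, h2)) - G y x - (a * h1 + b * h2)) \<le> 32 * B y / \<rho>\<^sup>2 * norm (h1, h2) ^ 2)" for y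
  proof -
    have "holomorphic2_on (G y) (ball x \<rho>)" using hol \<rho>(2) by (auto simp: holomorphic2_on_def)
    moreover have "cmod (G y w) \<le> B y" if "w \<in> ball x \<rho>" for w using bnd[of w y] \<rho>(2) that by blast
    ultimately show ?thesis using holomorphic2_quadratic[OF _ _ \<rho>(1)] by metis
  qed
  then obtain a b where ab: "\<And>y. cmod (a y) \<le> 2 * B y / \<rho>" "\<And>y. cmod (b y) \<le> 2 * B y / \<rho>"
    and q: "\<And>y h1 h2. norm (h1, h2) < \<rho> / 2 \<Longrightarrow>
       cmod (G y (x + (h1, h2)) - G y x - (a y * h1 + b y * h2)) \<le> 32 * B y / \<rho>\<^sup>2 * norm (h1, h2) ^ 2"
    by metis
  \<comment> \<open>the coefficients are limits of difference quotients, hence measurable in the parameter\<close>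
  have meas_coeff: "(\<lambda>y. a y * h1 + b y * h2) \<in> borel_measurable lborel"
    if h: "norm (h1, h2) < \<rho> / 2" "(h1, h2) \<noteq> 0" for h1 h2
  proof (rule borel_measurable_LIMSEQ_metric)
    define s where "s n = 1 / real (Suc n)" for n
    have s: "0 < s n" "s n \<le> 1" for n by (auto simp: s_def)
    define h' where "h' n = (of_real (s n) * h1, of_real (s n) * h2)" for n
    have nh: "norm (h' n) = s n * norm (h1, h2)" for n
    proof -
      have "norm (h' n) = norm (s n *\<^sub>R (h1, h2))" by (simp add: h'_def scaleR_conv_of_real)
      also have "\<dots> = s n * norm (h1, h2)" using s(1)[of n] by (simp only: norm_scaleR abs_of_pos)
      finally show ?thesis .
    qed
    have sm: "norm (h' n) < \<rho> / 2" for n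
      using h(1) s[of n] mult_right_mono[of "s n" 1 "norm (h1, h2)"] unfolding nh by simp
    show "(\<lambda>y. (G y (x + h' n) - G y x) / of_real (s n)) \<in> borel_measurable lborel" for n
      using sm[of n] by (intro borel_measurable_divide borel_measurable_diff meas x borel_measurable_const)
        (simp add: h'_def inA)
    fix y :: real
    have "cmod ((G y (x + h' n) - G y x) / of_real (s n) - (a y * h1 + b y * h2))
        \<le> 32 * B y / \<rho>\<^sup>2 * norm (h1, h2) ^ 2 * s n" for n
    proof -
      have "(G y (x + h' n) - G y x) / of_real (s n) - (a y * h1 + b y * h2)
          = (G y (x + h' n) - G y x - (a y * fst (h' n) + b y * snd (h' n))) / of_real (s n)"
        using s(1)[of n] by (simp add: h'_def field_simps)
      also have "cmod \<dots> \<le> (32 * B y / \<rho>\<^sup>2 * norm (h' n) ^ 2) / s n"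
        unfolding norm_divide norm_of_real abs_of_pos[OF s(1)[of n]]
        using q[of "fst (h' n)" "snd (h' n)" y] sm[of n] s(1)[of n]
        by (intro divide_right_mono) simp_all
      also have "\<dots> = 32 * B y / \<rho>\<^sup>2 * norm (h1, h2) ^ 2 * s n"
        using s(1)[of n] unfolding nh by (simp add: power2_eq_square)
      finally show ?thesis .
    qed
    moreover have "(\<lambda>n. 32 * B y / \<rho>\<^sup>2 * norm (h1, h2) ^ 2 * s n) \<longlonglongrightarrow> 0"
    proof (rule tendsto_mult_right_zero)
      show "s \<longlonglongrightarrow> 0" unfolding s_def by real_asymp
    qed
    ultimately have "(\<lambda>n. (G y (x + h' n) - G y x) / of_real (s n) - (a y * h1 + b y * h2)) \<longlonglongrightarrow> 0"
      by (rule Lim_null_comparison[OF always_eventually, OF allI])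
    then show "(\<lambda>n. (G y (x + h' n) - G y x) / of_real (s n)) \<longlonglongrightarrow> a y * h1 + b y * h2"
      by (simp add: LIM_zero_iff)
  qed
  have ma: "a \<in> borel_measurable lborel"
  proof -
    have "(\<lambda>y. a y * of_real (\<rho> / 4) + b y * 0) \<in> borel_measurable lborel"
      using \<rho> by (intro meas_coeff) (auto simp: norm_Pair zero_prod_def)
    then have "(\<lambda>y. (a y * of_real (\<rho> / 4) + b y * 0) / of_real (\<rho> / 4)) \<in> borel_measurable lborel"
      by (intro borel_measurable_divide) auto
    then show ?thesis using \<rho> by simp
  qed
  have mb: "b \<in> borel_measurable lborel"
  proof -
    have "(\<lambda>y. a y * 0 + b y * of_real (\<rho> / 4)) \<in> borel_measurable lborel"
      using \<rho> by (intro meas_coeff) (auto simp: norm_Pair zero_prod_def)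
    then have "(\<lambda>y. (a y * 0 + b y * of_real (\<rho> / 4)) / of_real (\<rho> / 4)) \<in> borel_measurable lborel"
      by (intro borel_measurable_divide) auto
    then show ?thesis using \<rho> by simp
  qed
  have Bnn: "0 \<le> B y" for y using bnd[OF x, of y] norm_ge_zero order_trans by blast
  have ia: "integrable lborel a"
    by (rule Bochner_Integration.integrable_bound[where f = "\<lambda>y. 2 * B y / \<rho>"])
      (use int ma ab Bnn \<rho> in auto)
  have ib: "integrable lborel b"
    by (rule Bochner_Integration.integrable_bound[where f = "\<lambda>y. 2 * B y / \<rho>"])
      (use int mb ab Bnn \<rho> in auto)
  have iG: "integrable lborel (\<lambda>y. G y z)" if "z \<in> A" for z
    by (rule Bochner_Integration.integrable_bound[OF int]) (use meas bnd Bnn that in auto)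
  have "cmod ((LINT y|lborel. G y (x + (h1, h2))) - (LINT y|lborel. G y x) -
      ((LINT y|lborel. a y) * h1 + (LINT y|lborel. b y) * h2))
      \<le> (LINT y|lborel. 32 * B y / \<rho>\<^sup>2) * norm (h1, h2) ^ 2" if h: "norm (h1, h2) < \<rho> / 2" for h1 h2
  proof -
    have "(LINT y|lborel. G y (x + (h1, h2))) - (LINT y|lborel. G y x) -
      ((LINT y|lborel. a y) * h1 + (LINT y|lborel. b y) * h2)
      = (LINT y|lborel. G y (x + (h1, h2)) - G y x - (a y * h1 + b y * h2))"
      using ia ib iG[OF x] iG[OF inA[OF h]] by simp
    also have "cmod \<dots> \<le> (LINT y|lborel. 32 * B y / \<rho>\<^sup>2 * norm (h1, h2) ^ 2)"
      by (rule Bochner_Integration.integral_norm_bound_integral)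
        (use ia ib iG[OF x] iG[OF inA[OF h]] int q[OF h] in auto)
    finally show ?thesis by simp
  qed
  then show "\<exists>\<rho>>0. \<exists>K a b. \<forall>h1 h2. norm (h1, h2) < \<rho> \<longrightarrow>
       cmod ((LINT y|lborel. G y (x + (h1, h2))) - (LINT y|lborel. G y x) - (a * h1 + b * h2))
         \<le> K * norm (h1, h2) ^ 2"
    using half_gt_zero[OF \<rho>(1)] by blast
qed

lemma holomorphic_on_integral:
  fixes G :: "real \<Rightarrow> complex \<Rightarrow> complex"
  assumes "open A" and hol: "\<And>y. G y holomorphic_on A"
    and meas: "\<And>x. x \<in> A \<Longrightarrow> (\<lambda>y. G y x) \<in> borel_measurable lborel"
    and bnd: "\<And>y x. x \<in> A \<Longrightarrow> cmod (G y x) \<le> B y" and int: "integrable lborel B"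
  shows "(\<lambda>x. LINT y|lborel. G y x) holomorphic_on A"
proof -
  \<comment> \<open>functions of one variable are functions of two variables that do not depend on the second\<close>
  have "holomorphic2_on (\<lambda>x. LINT y|lborel. (\<lambda>y x. G y (fst x)) y x) (A \<times> UNIV)"
  proof (rule holomorphic2_on_integral)
    show "holomorphic2_on (\<lambda>x. G y (fst x)) (A \<times> UNIV)" for y
      unfolding holomorphic2_on_def
    proof
      fix x :: "complex \<times> complex" assume "x \<in> A \<times> UNIV"
      then have "(G y has_field_derivative deriv (G y) (fst x)) (at (fst x))"
        using holomorphic_derivI[OF hol[of y] \<open>open A\<close>, of "fst x" UNIV] by auto
      then have "(G y has_derivative (\<lambda>h. deriv (G y) (fst x) * h)) (at (fst x))"
        by (simp add: has_field_derivative_def)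
      from has_derivative_compose[OF has_derivative_fst[OF has_derivative_ident] this]
      have "((\<lambda>x. G y (fst x)) has_derivative (\<lambda>(v, w). deriv (G y) (fst x) * v + 0 * w)) (at x)"
        by (simp add: case_prod_beta')
      then show "\<exists>a b. ((\<lambda>x. G y (fst x)) has_derivative (\<lambda>(v, w). a * v + b * w)) (at x)" by blast
    qed
  qed (use assms in \<open>auto intro: open_Times\<close>)
  then have h2: "holomorphic2_on (\<lambda>x. LINT y|lborel. G y (fst x)) (A \<times> UNIV)" by simp
  show ?thesis
  proof (rule holomorphic_onI)
    fix z assume "z \<in> A"
    then obtain a b where "((\<lambda>x. LINT y|lborel. G y (fst x)) has_derivative (\<lambda>(v, w). a * v + b * w)) (at (z, 0))"
      using h2 unfolding holomorphic2_on_def by blast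
    moreover have "((\<lambda>z. (z, 0::complex)) has_derivative (\<lambda>d. (d, 0))) (at z)"
      by (auto intro!: derivative_eq_intros)
    ultimately have "((\<lambda>x. LINT y|lborel. G y x) has_field_derivative a) (at z)"
      unfolding has_field_derivative_def
      using has_derivative_compose[of "\<lambda>z. (z, 0::complex)" "\<lambda>d. (d, 0)" z UNIV] by fastforce
    then show "(\<lambda>x. LINT y|lborel. G y x) field_differentiable (at z within A)"
      by (meson field_differentiable_at_within field_differentiable_def)
  qed
qed

lemma holomorphic2_on_cong:
  assumes "open D" "holomorphic2_on f D" "\<And>x. x \<in> D \<Longrightarrow> f x = g x"
  shows "holomorphic2_on g D"
  unfolding holomorphic2_on_def
proof
  fix x assume x: "x \<in> D"
  then obtain a b where "(f has_derivative (\<lambda>(v, w). a * v + b * w)) (at x)"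
    using assms(2) unfolding holomorphic2_on_def by blast
  from has_derivative_transform_within_open[OF this assms(1) x assms(3)]
  show "\<exists>a b. (g has_derivative (\<lambda>(v, w). a * v + b * w)) (at x)" by blast
qed

lemma bounded_holomorphicI:
  "holomorphic2_on h D \<Longrightarrow> (\<And>x. x \<in> D \<Longrightarrow> cmod (h x) \<le> M) \<Longrightarrow> (\<And>x. x \<notin> D \<Longrightarrow> h x = 0) \<Longrightarrow>
   h \<in> bounded_holomorphic D"
  unfolding bounded_holomorphic_def bounded_iff by (simp add: ball_simps) blast

lemma holomorphic2_on_lincomb:
  assumes "holomorphic2_on f A" "holomorphic2_on g A"
  shows "holomorphic2_on (\<lambda>x. c * f x + e * g x) A"
  unfolding holomorphic2_on_def
proof
  fix x assume "x \<in> A"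
  then obtain a b a' b' where "(f has_derivative (\<lambda>(v, w). a * v + b * w)) (at x)"
      "(g has_derivative (\<lambda>(v, w). a' * v + b' * w)) (at x)"
    using assms unfolding holomorphic2_on_def by meson
  then have "((\<lambda>x. c * f x + e * g x) has_derivative
      (\<lambda>h. c * (case h of (v, w) \<Rightarrow> a * v + b * w) + e * (case h of (v, w) \<Rightarrow> a' * v + b' * w))) (at x)"
    by (intro derivative_intros)
  also have "(\<lambda>h. c * (case h of (v, w) \<Rightarrow> a * v + b * w) + e * (case h of (v, w) \<Rightarrow> a' * v + b' * w))
     = (\<lambda>(v, w). (c * a + e * a') * v + (c * b + e * b') * w)"
    by (auto simp: algebra_simps)
  finally show "\<exists>a b. ((\<lambda>x. c * f x + e * g x) has_derivative (\<lambda>(v, w). a * v + b * w)) (at x)" by blast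
qed

lemma bounded_holomorphic_lincomb:
  assumes "f \<in> bounded_holomorphic D" "g \<in> bounded_holomorphic D"
  shows "(\<lambda>x. c * f x + e * g x) \<in> bounded_holomorphic D"
proof -
  obtain M where f: "holomorphic2_on f D" "\<And>x. x \<in> D \<Longrightarrow> cmod (f x) \<le> M" "\<And>x. x \<notin> D \<Longrightarrow> f x = 0"
    using assms(1) unfolding bounded_holomorphic_def bounded_iff by blast
  obtain M' where g: "holomorphic2_on g D" "\<And>x. x \<in> D \<Longrightarrow> cmod (g x) \<le> M'" "\<And>x. x \<notin> D \<Longrightarrow> g x = 0"
    using assms(2) unfolding bounded_holomorphic_def bounded_iff by blast
  show ?thesis
  proof (rule bounded_holomorphicI)
    show "holomorphic2_on (\<lambda>x. c * f x + e * g x) D" using f g by (intro holomorphic2_on_lincomb)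
    show "cmod (c * f x + e * g x) \<le> cmod c * M + cmod e * M'" if "x \<in> D" for x
      by (rule order_trans[OF norm_triangle_ineq])
        (use f(2)[OF that] g(2)[OF that] in \<open>auto simp: norm_mult intro!: add_mono mult_left_mono\<close>)
  qed (use f g in auto)
qed

lemma bounded_holomorphic_zero: "(\<lambda>x. 0) \<in> bounded_holomorphic D"
proof (rule bounded_holomorphicI[where M = 0])
  have "((\<lambda>x. 0) has_derivative (\<lambda>(v, w). 0 * v + 0 * w)) (at x)" for x :: "complex \<times> complex"
    by (simp add: case_prod_beta')
  then show "holomorphic2_on (\<lambda>x. 0) D" unfolding holomorphic2_on_def by blast
qed auto

lemma bounded_holomorphic_sum:
  "(\<And>i. i \<in> I \<Longrightarrow> f i \<in> bounded_holomorphic D) \<Longrightarrow> (\<lambda>x. \<Sum>i\<in>I. f i x * c i) \<in> bounded_holomorphic D"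
proof (induction I rule: infinite_finite_induct)
  case (insert i I)
  then have "(\<lambda>x. c i * f i x + 1 * (\<Sum>i\<in>I. f i x * c i)) \<in> bounded_holomorphic D"
    by (intro bounded_holomorphic_lincomb) auto
  then show ?case using insert by (simp add: mult.commute)
qed (auto simp: bounded_holomorphic_zero)

lemma bounded_holomorphic_pointwise_limit:
  assumes D: "open D" and f: "\<And>n. f n \<in> bounded_holomorphic D"
    and M: "\<And>n x. x \<in> D \<Longrightarrow> cmod (f n x) \<le> M"
    and lim: "\<And>x. x \<in> D \<Longrightarrow> (\<lambda>n::nat. f n x) \<longlonglongrightarrow> g x" and off: "\<And>x. x \<notin> D \<Longrightarrow> g x = 0"
  shows "g \<in> bounded_holomorphic D"
proof (rule bounded_holomorphicI)
  show "holomorphic2_on g D"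
  proof (rule holomorphic2_on_pointwise_limit[OF D _ M lim])
    show "holomorphic2_on (f n) D" for n
      using f[of n] by (simp add: bounded_holomorphic_def)
  qed
  show "cmod (g x) \<le> M" if "x \<in> D" for x
    using tendsto_norm[OF lim[OF that]] M[OF that] by (intro LIMSEQ_le_const2) auto
qed (use off in auto)

text \<open>For families that are locally bounded uniformly on \<open>D\<close>, holomorphy with values in the Banach space is
  holomorphy at every point of \<open>D\<close>: the remainder estimate above is uniform.\<close>

lemma vholomorphic_on_bounded_holomorphic:
  assumes D: "open D" "D \<noteq> {}"
    and mem: "\<And>e. e \<in> A \<Longrightarrow> g e \<in> bounded_holomorphic D"
    and hol: "\<And>x. x \<in> D \<Longrightarrow> (\<lambda>e. g e x) holomorphic_on A"
    and loc: "\<And>e. e \<in> A \<Longrightarrow> \<exists>r>0. \<exists>M. ball e r \<subseteq> A \<and> (\<forall>w\<in>ball e r. \<forall>x\<in>D. cmod (g w x) \<le> M)"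
  shows "vholomorphic_on (bounded_holomorphic D) (sup_norm D) g A"
  unfolding vholomorphic_on_def
proof (intro ballI conjI)
  fix e assume e: "e \<in> A"
  show "g e \<in> bounded_holomorphic D" by (rule mem[OF e])
  obtain r M where r: "0 < r" "ball e r \<subseteq> A" and M: "\<And>w x. w \<in> ball e r \<Longrightarrow> x \<in> D \<Longrightarrow> cmod (g w x) \<le> M"
    using loc[OF e] by meson
  define g' where "g' x = (if x \<in> D then deriv (\<lambda>e. g e x) e else 0)" for x
  have hb: "(\<lambda>e. g e x) holomorphic_on ball e r" if "x \<in> D" for x
    using hol[OF that] r(2) by (rule holomorphic_on_subset)
  have d1: "cmod (g' x) \<le> 2 * M / r" if "x \<in> D" for x
    using taylor_quadratic(1)[OF hb[OF that] M r(1)] that by (simp add: g'_def)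
  have d2: "cmod ((g w x - g e x) / (w - e) - g' x) \<le> 32 * M / r\<^sup>2 * cmod (w - e)"
    if "x \<in> D" "w \<in> ball e (r / 2)" "w \<noteq> e" for x w
  proof -
    have "(g w x - g e x) / (w - e) - g' x = (g w x - g e x - g' x * (w - e)) / (w - e)"
      using that by (simp add: field_simps)
    also have "cmod \<dots> \<le> 32 * M / r\<^sup>2 * cmod (w - e) ^ 2 / cmod (w - e)"
      using taylor_quadratic(2)[OF hb[OF that(1)] M r(1) that(2)] that
      by (simp only: g'_def norm_divide if_True) (rule divide_right_mono, simp_all)
    also have "\<dots> = 32 * M / r\<^sup>2 * cmod (w - e)" using that(3) by (simp add: power2_eq_square)
    finally show ?thesis .
  qed
  have M0: "0 \<le> M" using D(2) M[of e] r(1) norm_ge_zero order_trans by (meson centre_in_ball equals0I)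
  have "((\<lambda>w. sup_norm D (\<lambda>x. (g w x - g e x) / (w - e) - g' x)) \<longlongrightarrow> 0) (at e within A)"
  proof (rule Lim_null_comparison)
    show "eventually (\<lambda>w. norm (sup_norm D (\<lambda>x. (g w x - g e x) / (w - e) - g' x)) \<le> 32 * M / r\<^sup>2 * cmod (w - e))
        (at e within A)"
      unfolding eventually_at
    proof (intro exI[of _ "r / 2"] conjI ballI impI)
      fix w assume w: "w \<in> A" "w \<noteq> e \<and> dist w e < r / 2"
      then have "cmod ((g w x - g e x) / (w - e) - g' x) \<le> 32 * M / r\<^sup>2 * cmod (w - e)" if "x \<in> D" for x
        using d2[OF that] by (auto simp: dist_commute)
      from sup_norm_bounds[OF D(2) this]
      show "norm (sup_norm D (\<lambda>x. (g w x - g e x) / (w - e) - g' x)) \<le> 32 * M / r\<^sup>2 * cmod (w - e)"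
        by simp
    qed (use r in auto)
    have "((\<lambda>w. 32 * M / r\<^sup>2 * cmod (w - e)) \<longlongrightarrow> 32 * M / r\<^sup>2 * cmod (e - e)) (at e within A)"
      by (intro tendsto_intros)
    then show "((\<lambda>w. 32 * M / r\<^sup>2 * cmod (w - e)) \<longlongrightarrow> 0) (at e within A)" by simp
  qed
  \<comment> \<open>the derivative is a limit of difference quotients, which are bounded uniformly\<close>
  moreover have "g' \<in> bounded_holomorphic D"
  proof (rule bounded_holomorphic_pointwise_limit[OF D(1)])
    define s where "s n = r / 4 / real (Suc n)" for n
    have s: "0 < s n" "s n \<le> r / 4" for n using r(1) by (auto simp: s_def field_simps)
    have in_ball: "e + of_real (s n) \<in> ball e (r / 2)" "e + of_real (s n) \<in> A" for n
      using s[of n] r by (auto simp: dist_norm subset_iff)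
    have "(\<lambda>x. 1 / of_real (s n) * g (e + of_real (s n)) x + (- 1 / of_real (s n)) * g e x) \<in> bounded_holomorphic D" for n
      by (intro bounded_holomorphic_lincomb mem e in_ball)
    then show "(\<lambda>x. (g (e + of_real (s n)) x - g e x) / of_real (s n)) \<in> bounded_holomorphic D" for n
      by (simp add: diff_divide_distrib)
    have q: "cmod ((g (e + of_real (s n)) x - g e x) / of_real (s n) - g' x) \<le> 32 * M / r\<^sup>2 * s n"
      if "x \<in> D" for x n
      using d2[OF that in_ball(1)[of n]] s(1)[of n] by simp
    have "32 * M / r\<^sup>2 * s n \<le> 32 * M / r\<^sup>2 * (r / 4)" for n
      using s[of n] M0 by (intro mult_left_mono) auto
    then show "cmod ((g (e + of_real (s n)) x - g e x) / of_real (s n)) \<le> 2 * M / r + 32 * M / r\<^sup>2 * (r / 4)"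
      if "x \<in> D" for x n
      using q[OF that, of n] d1[OF that]
        norm_triangle_sub[of "(g (e + of_real (s n)) x - g e x) / of_real (s n)" "g' x"] order_trans
      by (smt (verit, best))
    fix x assume x: "x \<in> D"
    have "(\<lambda>n. (g (e + of_real (s n)) x - g e x) / of_real (s n) - g' x) \<longlonglongrightarrow> 0"
    proof (rule Lim_null_comparison[OF always_eventually])
      show "\<forall>n. cmod ((g (e + of_real (s n)) x - g e x) / of_real (s n) - g' x) \<le> 32 * M / r\<^sup>2 * s n"
        using q[OF x] by blast
      have "s \<longlonglongrightarrow> 0" unfolding s_def by real_asymp
      then show "(\<lambda>n. 32 * M / r\<^sup>2 * s n) \<longlonglongrightarrow> 0" by (rule tendsto_mult_right_zero)
    qed
    then show "(\<lambda>n. (g (e + of_real (s n)) x - g e x) / of_real (s n)) \<longlonglongrightarrow> g' x"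
      by (simp add: LIM_zero_iff)
  qed (simp add: g'_def)
  ultimately show "\<exists>g'\<in>bounded_holomorphic D.
      ((\<lambda>w. sup_norm D (\<lambda>x. (g w x - g e x) / (w - e) - g' x)) \<longlongrightarrow> 0) (at e within A)"
    by blast
qed

section \<open>Estimates for the Gamma function\<close>

text \<open>In Euler's integral over \<open>t \<ge> x\<close> the integrand is at least \<open>x\<^sup>a exp (- t)\<close>.\<close>

lemma powr_exp_le_Gamma:
  fixes a x :: real
  assumes "0 \<le> a" "0 < x"
  shows "x powr a * exp (- x) \<le> Gamma (1 + a)"
proof (rule has_integral_le)
  show "((\<lambda>t. t powr a / exp t) has_integral Gamma (1 + a)) {0..}"
    using Gamma_integral_real[of "1 + a"] assms by simp
  have "((\<lambda>t. x powr a * exp (- 1 * t)) has_integral x powr a * (exp (- 1 * x) / 1)) {x..}"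
    by (intro has_integral_mult_right has_integral_exp_minus_to_infinity) auto
  then have "((\<lambda>t. if t \<in> {x..} then x powr a * exp (- t) else 0) has_integral x powr a * exp (- x)) {0..}"
    using assms by (subst has_integral_restrict) auto
  then show "((\<lambda>t. if t \<in> {x..} then x powr a * exp (- t) else 0) has_integral x powr a * exp (- x)) {0..}" .
  fix t :: real assume "t \<in> {0..}"
  then show "(if t \<in> {x..} then x powr a * exp (- t) else 0) \<le> t powr a / exp t"
    using assms by (auto simp: exp_minus divide_inverse intro!: mult_right_mono powr_mono2)
qed

text \<open>The Gamma function decreases on a part of \<open>[1, 2]\<close>, so monotonicity costs a constant. It comes from
  \<open>t\<^sup>a \<le> 1 + t\<^sup>b\<close> in Euler's integral and a lower bound for \<open>\<Gamma> (1 + b)\<close>.\<close>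

lemma Gamma_le_Gamma:
  fixes a b :: real
  assumes "0 \<le> a" "a \<le> b"
  shows "Gamma (1 + a) \<le> 4 * Gamma (1 + b)"
proof -
  have "Gamma (1 + a) \<le> 1 + Gamma (1 + b)"
  proof (rule has_integral_le)
    show "((\<lambda>t. t powr a / exp t) has_integral Gamma (1 + a)) {0..}"
      using Gamma_integral_real[of "1 + a"] assms by simp
    have "((\<lambda>t::real. exp (- 1 * t)) has_integral exp (- 1 * 0) / 1) {0..}"
      by (rule has_integral_exp_minus_to_infinity) auto
    then have "((\<lambda>t::real. exp (- t)) has_integral 1) {0..}" by simp
    moreover have "((\<lambda>t. t powr b / exp t) has_integral Gamma (1 + b)) {0..}"
      using Gamma_integral_real[of "1 + b"] assms by simp
    ultimately show "((\<lambda>t. exp (- t) + t powr b / exp t) has_integral (1 + Gamma (1 + b))) {0..}"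
      by (rule has_integral_add)
    fix t :: real assume "t \<in> {0..}"
    have "t powr a \<le> 1 + t powr b"
    proof (cases "t \<le> 1")
      case True
      then have "t powr a \<le> 1" using \<open>t \<in> {0..}\<close> assms by (intro powr_le1) auto
      then show ?thesis using powr_ge_zero[of t b] by linarith
    next
      case False
      then have "t powr a \<le> t powr b" using assms by (intro powr_mono) auto
      then show ?thesis by simp
    qed
    then have "t powr a / exp t \<le> (1 + t powr b) / exp t" by (intro divide_right_mono) auto
    also have "\<dots> = exp (- t) + t powr b / exp t"
      by (simp add: exp_minus divide_inverse distrib_right)
    finally show "t powr a / exp t \<le> exp (- t) + t powr b / exp t" .
  qed
  moreover have "1 \<le> 3 * Gamma (1 + b)"
  proof -
    have "1 \<le> exp 1 * Gamma (1 + b)"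
      using powr_exp_le_Gamma[of b 1] assms by (simp add: exp_minus field_simps)
    also have "\<dots> \<le> 3 * Gamma (1 + b)"
      using assms exp_le Gamma_real_pos[of "1 + b"] by (intro mult_right_mono) auto
    finally show ?thesis .
  qed
  ultimately show ?thesis by simp
qed

text \<open>Half of Stirling's formula, up to a geometric factor: the function \<open>t\<^sup>a exp (- t / 2)\<close> is largest at
  \<open>t = 2 a\<close>, and the remaining factor \<open>exp (- t / 2)\<close> has integral 2.\<close>

lemma Gamma_le_powr_exp:
  fixes a :: real
  assumes "0 < a"
  shows "Gamma (1 + a) \<le> 2 * (2 * a) powr a * exp (- a)"
proof -
  have "Gamma (1 + a) \<le> (2 * a) powr a * exp (- a) * (exp (- (1 / 2) * 0) / (1 / 2))"
  proof (rule has_integral_le)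
    show "((\<lambda>t. t powr a / exp t) has_integral Gamma (1 + a)) {0..}"
      using Gamma_integral_real[of "1 + a"] assms by simp
    show "((\<lambda>t. (2 * a) powr a * exp (- a) * exp (- (1 / 2) * t)) has_integral
        (2 * a) powr a * exp (- a) * (exp (- (1 / 2) * 0) / (1 / 2))) {0..}"
      by (intro has_integral_mult_right has_integral_exp_minus_to_infinity) auto
    fix t :: real assume t: "t \<in> {0..}"
    show "t powr a / exp t \<le> (2 * a) powr a * exp (- a) * exp (- (1 / 2) * t)"
    proof (cases "t = 0")
      case False
      with t have t0: "0 < t" by simp
      have "ln (t / (2 * a)) \<le> t / (2 * a) - 1" using t0 assms by (intro ln_le_minus_one) auto
      then have "a * ln (t / (2 * a)) \<le> a * (t / (2 * a) - 1)"
        using assms by (intro mult_left_mono) auto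
      also have "\<dots> = t / 2 - a" using assms by (simp add: field_simps)
      finally have "a * ln t \<le> a * ln (2 * a) + t / 2 - a"
        using t0 assms by (simp add: ln_div algebra_simps)
      then have "exp (a * ln t - t) \<le> exp (a * ln (2 * a) + (- a) + (- (1 / 2) * t))"
        by simp
      moreover have "exp (a * ln t - t) = t powr a / exp t"
        using t0 by (simp add: powr_def exp_diff)
      moreover have "exp (a * ln (2 * a) + (- a) + (- (1 / 2) * t)) = (2 * a) powr a * exp (- a) * exp (- (1 / 2) * t)"
        using assms by (simp only: powr_def exp_add) auto
      ultimately show ?thesis by metis
    qed (use assms in auto)
  qed
  then show ?thesis by simp
qed

section \<open>Integrals along vertical lines\<close>

lemma norm_Complex_ge:
  assumes "0 < R"
  shows "R \<le> cmod (Complex R y)" "\<bar>y\<bar> \<le> cmod (Complex R y)" "R + \<bar>y\<bar> \<le> 2 * cmod (Complex R y)"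
  using abs_Re_le_cmod[of "Complex R y"] abs_Im_le_cmod[of "Complex R y"] assms by auto

text \<open>Comparison with \<open>((R + \<bar>y\<bar>) / 2)\<^sup>-\<^sup>p\<close>.\<close>

lemma vertical_line_integral:
  assumes p: "1 < p" and R: "0 < R"
  shows "integrable lborel (\<lambda>y. cmod (Complex R y) powr - p)"
    and "(LINT y|lborel. cmod (Complex R y) powr - p) \<le> 2 * 2 powr p * R powr (1 - p) / (p - 1)"
proof -
  define f where "f x = indicator {R..} x *\<^sub>R (x powr - p)" for x
  have hi: "((\<lambda>x. x powr - p) has_integral R powr (1 - p) / (p - 1)) {R..}"
  proof -
    have "- (R powr (- p + 1)) / (- p + 1) = R powr (1 - p) / (p - 1)"
      by (metis add.commute minus_diff_eq minus_divide_divide uminus_add_conv_diff)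
    then show ?thesis using has_integral_powr_to_inf[of "- p" R] p R by simp
  qed
  then have "(\<lambda>x. x powr - p) absolutely_integrable_on {R..}"
    by (intro nonnegative_absolutely_integrable_1) auto
  then have si: "set_integrable lborel {R..} (\<lambda>x. x powr - p)"
    by (simp add: set_integrable_def integrable_completion)
  then have fi: "integrable lborel f" unfolding set_integrable_def f_def[abs_def] .
  have fI: "(LINT x|lborel. f x) = R powr (1 - p) / (p - 1)"
    using set_borel_integral_eq_integral[OF si] integral_unique[OF hi]
    by (simp add: set_lebesgue_integral_def f_def)
  define g where "g y = 2 powr p * (f (R + 1 * y) + f (R + (- 1) * y))" for y
  have i1: "integrable lborel (\<lambda>y. f (R + 1 * y))" "integrable lborel (\<lambda>y. f (R + (- 1) * y))"
    using lborel_integrable_real_affine[OF fi, of 1 R] lborel_integrable_real_affine[OF fi, of "- 1" R] by auto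
  then have gi: "integrable lborel g" unfolding g_def by auto
  have "(LINT y|lborel. g y) = 2 powr p * ((LINT y|lborel. f (R + 1 * y)) + (LINT y|lborel. f (R + (- 1) * y)))"
    using i1 by (simp add: g_def)
  also have "\<dots> = 2 powr p * (2 * (R powr (1 - p) / (p - 1)))"
    using lborel_integral_real_affine[of 1 f R] lborel_integral_real_affine[of "- 1" f R] by (simp add: fI)
  finally have gI: "(LINT y|lborel. g y) = 2 * 2 powr p * R powr (1 - p) / (p - 1)" by simp
  have fnn: "0 \<le> f x" for x by (simp add: f_def)
  have le: "cmod (Complex R y) powr - p \<le> g y" for y
  proof -
    have "cmod (Complex R y) powr - p \<le> ((R + \<bar>y\<bar>) / 2) powr - p"
      using norm_Complex_ge[OF R, of y] R p by (intro powr_mono2') auto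
    also have "\<dots> = 2 powr p * (R + \<bar>y\<bar>) powr - p"
      by (simp only: powr_divide powr_minus inverse_eq_divide) simp
    also have "(R + \<bar>y\<bar>) powr - p = f (R + \<bar>y\<bar>)" by (simp add: f_def)
    also have "f (R + \<bar>y\<bar>) \<le> f (R + 1 * y) + f (R + (- 1) * y)"
      using fnn[of "R + y"] fnn[of "R - y"] by (cases "0 \<le> y") simp_all
    finally show ?thesis by (simp add: g_def mult_left_mono)
  qed
  have meas: "(\<lambda>y. cmod (Complex R y) powr - p) \<in> borel_measurable lborel"
    unfolding Complex_eq by measurable
  show int: "integrable lborel (\<lambda>y. cmod (Complex R y) powr - p)"
  proof (rule Bochner_Integration.integrable_bound[OF gi meas], intro AE_I2)
    fix y
    show "norm (cmod (Complex R y) powr - p) \<le> norm (g y)"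
      using le[of y] by (simp only: real_norm_def abs_of_nonneg powr_ge_zero)
  qed
  show "(LINT y|lborel. cmod (Complex R y) powr - p) \<le> 2 * 2 powr p * R powr (1 - p) / (p - 1)"
    unfolding gI[symmetric] by (rule integral_mono[OF int gi le])
qed

lemma measurable_vertical:
  fixes F :: "complex \<Rightarrow> complex"
  assumes "F holomorphic_on {z. R0 < Re z}" "R0 < R"
  shows "(\<lambda>y. F (Complex R y)) \<in> borel_measurable lborel"
proof -
  have "continuous_on UNIV (\<lambda>y. F (Complex R y))"
    by (rule continuous_on_compose2[OF holomorphic_on_imp_continuous_on[OF assms(1)]])
      (use assms(2) in \<open>auto simp: Complex_eq intro!: continuous_intros\<close>)
  then show ?thesis by (simp add: borel_measurable_continuous_onI)
qed

lemma tendsto_integral_symmetric: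
  fixes f :: "real \<Rightarrow> complex"
  assumes "integrable lborel f"
  shows "(\<lambda>n. integral {- real n..real n} f) \<longlonglongrightarrow> (LINT y|lborel. f y)"
proof -
  have si: "set_integrable lborel A f" if "A \<in> sets lborel" for A
    using assms that unfolding set_integrable_def by (intro integrable_mult_indicator)
  have "(\<lambda>n. set_lebesgue_integral lborel {- real n..real n} f) \<longlonglongrightarrow>
      set_lebesgue_integral lborel (\<Union>n. {- real n..real n}) f"
    by (rule set_integral_cont_up) (auto simp: incseq_def intro!: si)
  moreover have "(\<Union>n. {- real n..real n}) = UNIV"
  proof (intro equalityI subsetI UN_I)
    fix x :: real
    show "x \<in> {- real (nat \<lceil>\<bar>x\<bar>\<rceil>)..real (nat \<lceil>\<bar>x\<bar>\<rceil>)}"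
      using real_nat_ceiling_ge[of "\<bar>x\<bar>"] abs_le_iff[of x "real (nat \<lceil>\<bar>x\<bar>\<rceil>)"]
      by (simp only: atLeastAtMost_iff) linarith
  qed auto
  moreover have "set_lebesgue_integral lborel {- real n..real n} f = integral {- real n..real n} f" for n
    by (rule set_borel_integral_eq_integral(2)) (rule si, simp)
  ultimately show ?thesis by (simp add: set_lebesgue_integral_def)
qed

text \<open>The contour integral along the positively oriented boundary of \<open>[a, b] \<times> [c, e]\<close>, as a combination of
  integrals over the sides, so that common sides of adjacent rectangles cancel by plain arithmetic.\<close>

definition rect_integral :: "(complex \<Rightarrow> complex) \<Rightarrow> real \<Rightarrow> real \<Rightarrow> real \<Rightarrow> real \<Rightarrow> complex" where
  "rect_integral F a b c e =
     integral {a..b} (\<lambda>x. F (Complex x c)) + \<i> * integral {c..e} (\<lambda>y. F (Complex b y)) -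
     integral {a..b} (\<lambda>x. F (Complex x e)) - \<i> * integral {c..e} (\<lambda>y. F (Complex a y))"

lemma rect_integral_holomorphic:
  fixes F :: "complex \<Rightarrow> complex"
  assumes "a \<le> b" "c \<le> e" and S: "open S" "convex S" and hol: "F holomorphic_on S"
    and sub: "\<And>x y. a \<le> x \<Longrightarrow> x \<le> b \<Longrightarrow> c \<le> y \<Longrightarrow> y \<le> e \<Longrightarrow> Complex x y \<in> S"
  shows "rect_integral F a b c e = 0"
proof -
  obtain P where P: "\<And>z. z \<in> S \<Longrightarrow> (P has_field_derivative F z) (at z within S)"
    using holomorphic_convex_primitive'[OF S(2,1) hol] by blast
  then have P': "(P has_field_derivative F z) (at z)" if "z \<in> S" for z
    using S(1) that by (metis at_within_open)
  have horiz: "integral {a..b} (\<lambda>x. F (Complex x y)) = P (Complex b y) - P (Complex a y)"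
    if "c \<le> y" "y \<le> e" for y
  proof (intro integral_unique fundamental_theorem_of_calculus \<open>a \<le> b\<close>)
    fix x assume x: "x \<in> {a..b}"
    have "((\<lambda>x. Complex x y) has_vector_derivative 1) (at x within {a..b})"
      unfolding Complex_eq by (auto intro!: derivative_eq_intros)
    from field_vector_diff_chain_within[OF this] P'[OF sub[of x y]] x that
    show "((\<lambda>x. P (Complex x y)) has_vector_derivative F (Complex x y)) (at x within {a..b})"
      by (simp add: o_def has_field_derivative_at_within)
  qed
  have vert: "\<i> * integral {c..e} (\<lambda>y. F (Complex x y)) = P (Complex x e) - P (Complex x c)"
    if "a \<le> x" "x \<le> b" for x
  proof -
    have "((\<lambda>y. \<i> * F (Complex x y)) has_integral P (Complex x e) - P (Complex x c)) {c..e}"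
    proof (intro fundamental_theorem_of_calculus \<open>c \<le> e\<close>)
      fix y assume y: "y \<in> {c..e}"
      have "((\<lambda>y. Complex x y) has_vector_derivative \<i>) (at y within {c..e})"
        unfolding Complex_eq by (auto intro!: derivative_eq_intros)
      from field_vector_diff_chain_within[OF this] P'[OF sub[of x y]] y that
      show "((\<lambda>y. P (Complex x y)) has_vector_derivative \<i> * F (Complex x y)) (at y within {c..e})"
        by (simp add: o_def has_field_derivative_at_within)
    qed
    then show ?thesis by (metis integral_mult_right integral_unique)
  qed
  show ?thesis
    using assms by (simp add: rect_integral_def horiz vert)
qed

text \<open>The horizontal sides of long rectangles between the two lines contribute nothing in the limit.\<close>

lemma vertical_line_shift:
  fixes F :: "complex \<Rightarrow> complex"
  assumes hol: "F holomorphic_on {z. R0 < Re z}" and R: "R0 < R1" "R1 \<le> R2"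
    and int: "integrable lborel (\<lambda>y. F (Complex R1 y))" "integrable lborel (\<lambda>y. F (Complex R2 y))"
    and bnd: "\<And>x y. R1 \<le> x \<Longrightarrow> x \<le> R2 \<Longrightarrow> Y0 \<le> \<bar>y\<bar> \<Longrightarrow> cmod (F (Complex x y)) \<le> A / \<bar>y\<bar>"
  shows "(LINT y|lborel. F (Complex R1 y)) = (LINT y|lborel. F (Complex R2 y))"
proof -
  have cont: "continuous_on {R1..R2} (\<lambda>x. F (Complex x y))" for y
    by (rule continuous_on_compose2[OF holomorphic_on_imp_continuous_on[OF hol]])
      (use R in \<open>auto simp: Complex_eq intro!: continuous_intros\<close>)
  have hb: "cmod (integral {R1..R2} (\<lambda>x. F (Complex x y))) \<le> A / \<bar>y\<bar> * (R2 - R1)" if "Y0 \<le> \<bar>y\<bar>" for y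
    using integral_bound[of R1 R2 "\<lambda>x. F (Complex x y)" "A / \<bar>y\<bar>"] R cont bnd that by auto
  have eq: "cmod (integral {- real n..real n} (\<lambda>y. F (Complex R2 y)) - integral {- real n..real n} (\<lambda>y. F (Complex R1 y)))
      \<le> 2 * (A * (R2 - R1)) * (1 / real n)" if "Y0 \<le> real n" for n
  proof -
    have "rect_integral F R1 R2 (- real n) (real n) = 0"
      by (rule rect_integral_holomorphic[OF _ _ _ _ hol])
        (use R in \<open>auto simp: open_halfspace_Re_gt convex_halfspace_Re_gt\<close>)
    then have "\<i> * (integral {- real n..real n} (\<lambda>y. F (Complex R2 y)) - integral {- real n..real n} (\<lambda>y. F (Complex R1 y)))
       = integral {R1..R2} (\<lambda>x. F (Complex x (real n))) - integral {R1..R2} (\<lambda>x. F (Complex x (- real n)))"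
      unfolding rect_integral_def by (simp add: algebra_simps)
    then have "cmod (integral {- real n..real n} (\<lambda>y. F (Complex R2 y)) - integral {- real n..real n} (\<lambda>y. F (Complex R1 y)))
       = cmod (integral {R1..R2} (\<lambda>x. F (Complex x (real n))) - integral {R1..R2} (\<lambda>x. F (Complex x (- real n))))"
      by (metis norm_ii norm_mult mult_1)
    also have "\<dots> \<le> A / \<bar>real n\<bar> * (R2 - R1) + A / \<bar>- real n\<bar> * (R2 - R1)"
      using that by (intro order_trans[OF norm_triangle_ineq4] add_mono hb) auto
    finally show ?thesis by simp
  qed
  have "(\<lambda>n. integral {- real n..real n} (\<lambda>y. F (Complex R2 y)) - integral {- real n..real n} (\<lambda>y. F (Complex R1 y))) \<longlonglongrightarrow> 0"
  proof (rule Lim_null_comparison)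
    show "eventually (\<lambda>n. cmod (integral {- real n..real n} (\<lambda>y. F (Complex R2 y)) -
        integral {- real n..real n} (\<lambda>y. F (Complex R1 y))) \<le> 2 * (A * (R2 - R1)) * (1 / real n)) sequentially"
      using eventually_ge_at_top[of "nat \<lceil>Y0\<rceil>"] by eventually_elim (rule eq, linarith)
    show "(\<lambda>n. 2 * (A * (R2 - R1)) * (1 / real n)) \<longlonglongrightarrow> 0"
      by (intro tendsto_mult_right_zero lim_1_over_n)
  qed
  moreover have "(\<lambda>n. integral {- real n..real n} (\<lambda>y. F (Complex R2 y)) - integral {- real n..real n} (\<lambda>y. F (Complex R1 y)))
      \<longlonglongrightarrow> (LINT y|lborel. F (Complex R2 y)) - (LINT y|lborel. F (Complex R1 y))"
    by (intro tendsto_diff tendsto_integral_symmetric int)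
  ultimately show ?thesis using LIMSEQ_unique by fastforce
qed

section \<open>Inversion of the Laplace transform\<close>

lemma norm_Complex_diff_ge:
  assumes "0 < \<delta>" "\<delta> \<le> cmod (z - \<omega>)"
  shows "cmod z \<le> (1 + cmod \<omega> / \<delta>) * cmod (z - \<omega>)"
proof -
  have "cmod \<omega> = cmod \<omega> / \<delta> * \<delta>" using assms by simp
  also have "\<dots> \<le> cmod \<omega> / \<delta> * cmod (z - \<omega>)" using assms by (intro mult_left_mono) auto
  finally show ?thesis using norm_triangle_sub[of z \<omega>] by (simp add: algebra_simps)
qed

lemma integrable_vertical:
  fixes F :: "complex \<Rightarrow> complex"
  assumes hol: "F holomorphic_on {z. R0 < Re z}" and R: "R0 < R" "0 < R" and "1 < p"
    and bnd: "\<And>y. cmod (F (Complex R y)) \<le> K * cmod (Complex R y) powr - p"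
  shows "integrable lborel (\<lambda>y. F (Complex R y))"
    and "cmod (LINT y|lborel. F (Complex R y)) \<le> K * (2 * 2 powr p * R powr (1 - p) / (p - 1))"
proof -
  note v = vertical_line_integral[OF \<open>1 < p\<close> \<open>0 < R\<close>]
  have K: "0 \<le> K"
  proof -
    have "0 \<le> K * cmod (Complex R 0) powr - p" using bnd[of 0] norm_ge_zero order_trans by blast
    moreover have "0 < cmod (Complex R 0) powr - p" using R by (simp add: complex_eq_iff)
    ultimately show ?thesis by (simp add: zero_le_mult_iff)
  qed
  show i: "integrable lborel (\<lambda>y. F (Complex R y))"
  proof (rule Bochner_Integration.integrable_bound)
    show "integrable lborel (\<lambda>y. K * cmod (Complex R y) powr - p)" using v(1) by simp
    show "(\<lambda>y. F (Complex R y)) \<in> borel_measurable lborel" by (rule measurable_vertical[OF hol R(1)])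
    show "AE y in lborel. norm (F (Complex R y)) \<le> norm (K * cmod (Complex R y) powr - p)"
      using bnd K by (intro AE_I2) simp
  qed
  have "cmod (LINT y|lborel. F (Complex R y)) \<le> (LINT y|lborel. K * cmod (Complex R y) powr - p)"
    using i v(1) bnd by (intro Bochner_Integration.integral_norm_bound_integral) auto
  also have "\<dots> = K * (LINT y|lborel. cmod (Complex R y) powr - p)" by simp
  also have "\<dots> \<le> K * (2 * 2 powr p * R powr (1 - p) / (p - 1))" using v(2) K by (rule mult_left_mono)
  finally show "cmod (LINT y|lborel. F (Complex R y)) \<le> K * (2 * 2 powr p * R powr (1 - p) / (p - 1))" .
qed

text \<open>The primitive is a difference of two logarithms. Towards either end of the line their real parts
  agree in the limit, and their imaginary parts differ by \<open>\<pi>\<close> at one end and by \<open>-\<pi>\<close> at the other.\<close>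

lemma integral_two_poles:
  assumes "0 < R" "R < Re \<omega>"
  shows "integrable lborel (\<lambda>y. \<omega> / (Complex R y * (\<omega> - Complex R y)))"
    and "(LINT y|lborel. \<omega> / (Complex R y * (\<omega> - Complex R y))) = 2 * pi"
proof -
  define \<delta> where "\<delta> = Re \<omega> - R"
  have \<delta>: "0 < \<delta>" "\<And>y. \<delta> \<le> cmod (Complex R y - \<omega>)"
    using assms abs_Re_le_cmod[of "Complex R y - \<omega>" for y] by (auto simp: \<delta>_def)
  have nz: "Complex R y \<noteq> 0" "\<omega> - Complex R y \<noteq> 0" for y
    using assms by (auto simp: complex_eq_iff)
  define f where "f y = \<omega> / (Complex R y * (\<omega> - Complex R y))" for y
  have cont: "continuous_on UNIV f"
    unfolding f_def Complex_eq using nz by (intro continuous_intros) (auto simp: Complex_eq)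
  have bnd: "cmod (f y) \<le> cmod \<omega> * (1 + cmod \<omega> / \<delta>) * cmod (Complex R y) powr - 2" for y
  proof -
    have a: "0 < cmod (Complex R y)" using nz by simp
    have b: "0 < cmod (\<omega> - Complex R y)" using nz by simp
    have c: "cmod (Complex R y) \<le> (1 + cmod \<omega> / \<delta>) * cmod (\<omega> - Complex R y)"
      using norm_Complex_diff_ge[OF \<delta>(1) \<delta>(2)[of y]] by (simp add: norm_minus_commute)
    have "cmod (f y) = cmod \<omega> / (cmod (Complex R y) * cmod (\<omega> - Complex R y))"
      by (simp add: f_def norm_divide norm_mult)
    also have "\<dots> \<le> cmod \<omega> * (1 + cmod \<omega> / \<delta>) / (cmod (Complex R y) * cmod (Complex R y))"
    proof -
      have "1 / cmod (\<omega> - Complex R y) \<le> (1 + cmod \<omega> / \<delta>) / cmod (Complex R y)"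
        using a b c by (simp add: field_simps)
      then have "cmod \<omega> / cmod (Complex R y) * (1 / cmod (\<omega> - Complex R y)) \<le>
          cmod \<omega> / cmod (Complex R y) * ((1 + cmod \<omega> / \<delta>) / cmod (Complex R y))"
        by (intro mult_left_mono) auto
      then show ?thesis by (simp add: mult.assoc)
    qed
    also have "\<dots> = cmod \<omega> * (1 + cmod \<omega> / \<delta>) * cmod (Complex R y) powr - 2"
      using a by (simp add: powr_minus powr_numeral power2_eq_square divide_inverse)
    finally show ?thesis .
  qed
  show int: "integrable lborel (\<lambda>y. \<omega> / (Complex R y * (\<omega> - Complex R y)))"
  proof (rule Bochner_Integration.integrable_bound)
    show "integrable lborel (\<lambda>y. cmod \<omega> * (1 + cmod \<omega> / \<delta>) * cmod (Complex R y) powr - 2)"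
      using vertical_line_integral(1)[of 2 R] assms by simp
    show "(\<lambda>y. \<omega> / (Complex R y * (\<omega> - Complex R y))) \<in> borel_measurable lborel"
      using cont by (simp add: borel_measurable_continuous_onI f_def)
    show "AE y in lborel. norm (\<omega> / (Complex R y * (\<omega> - Complex R y))) \<le>
        norm (cmod \<omega> * (1 + cmod \<omega> / \<delta>) * cmod (Complex R y) powr - 2)"
      using bnd \<delta>(1) by (intro AE_I2) (simp add: f_def abs_of_nonneg)
  qed
  define P where "P y = (Ln (Complex R y) - Ln (\<omega> - Complex R y)) / \<i>" for y
  have P: "(P has_vector_derivative f y) (at y within A)" for y A
  proof -
    have "((\<lambda>y. Complex R y) has_vector_derivative \<i>) (at y within A)"
      unfolding Complex_eq by (auto intro!: derivative_eq_intros)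
    moreover have "((\<lambda>z. (Ln z - Ln (\<omega> - z)) / \<i>) has_field_derivative (1 / Complex R y + 1 / (\<omega> - Complex R y)) / \<i>)
        (at (Complex R y))"
      using assms nz by (auto intro!: derivative_eq_intros simp: complex_nonpos_Reals_iff divide_inverse)
    ultimately have "((\<lambda>z. (Ln z - Ln (\<omega> - z)) / \<i>) \<circ> (\<lambda>y. Complex R y) has_vector_derivative
        \<i> * ((1 / Complex R y + 1 / (\<omega> - Complex R y)) / \<i>)) (at y within A)"
      by (rule field_vector_diff_chain_within[OF _ has_field_derivative_at_within])
    moreover have "\<i> * ((1 / Complex R y + 1 / (\<omega> - Complex R y)) / \<i>) = f y"
      using nz[of y] by (simp add: f_def field_simps)
    ultimately show ?thesis by (simp add: o_def P_def[abs_def])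
  qed
  have "integral {- real n..real n} f = P (real n) - P (- real n)" for n
    by (intro integral_unique fundamental_theorem_of_calculus P) auto
  then have 1: "(\<lambda>n. P (real n) - P (- real n)) \<longlonglongrightarrow> (LINT y|lborel. f y)"
    using tendsto_integral_symmetric[of f] int by (simp add: f_def[abs_def])
  define a b c where "a = Re \<omega> - R" and "b = Im \<omega>" and "c = R"
  have ac: "0 < a" "0 < c" using assms by (auto simp: a_def c_def)
  have rePeq: "Im (P y) = ln (sqrt (a\<^sup>2 + (b - y)\<^sup>2)) - ln (sqrt (c\<^sup>2 + y\<^sup>2))"
    and imPeq: "Re (P y) = arctan (y / c) - arctan ((b - y) / a)" for y
    using nz[of y] ac assms
    by (simp_all add: P_def Im_Ln_eq a_def b_def c_def Re_divide Im_divide cmod_def)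
  have re: "(\<lambda>n. Re (P (real n)) - Re (P (- real n))) \<longlonglongrightarrow> 2 * pi"
  proof -
    have "(\<lambda>n. arctan (real n / c)) \<longlonglongrightarrow> pi / 2" "(\<lambda>n. arctan ((b - real n) / a)) \<longlonglongrightarrow> - pi / 2"
      "(\<lambda>n. arctan (- real n / c)) \<longlonglongrightarrow> - pi / 2" "(\<lambda>n. arctan ((b + real n) / a)) \<longlonglongrightarrow> pi / 2"
      using ac by real_asymp+
    from tendsto_diff[OF tendsto_diff[OF this(1,2)] tendsto_diff[OF this(3,4)]]
    show ?thesis by (simp add: imPeq)
  qed
  have im: "(\<lambda>n. Im (P (real n)) - Im (P (- real n))) \<longlonglongrightarrow> 0"
    unfolding rePeq using ac by real_asymp
  have "(\<lambda>n. P (real n) - P (- real n)) \<longlonglongrightarrow> Complex (2 * pi) 0"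
    by (intro tendsto_complex_iff[THEN iffD2]) (use re im in simp)
  from LIMSEQ_unique[OF 1 this]
  show "(LINT y|lborel. \<omega> / (Complex R y * (\<omega> - Complex R y))) = 2 * pi"
    by (simp add: f_def Complex_eq)
qed

text \<open>Cauchy's formula for a half-plane. Subtracting \<open>\<Psi> \<omega> * \<omega> / z\<close>, which has the same value as \<open>\<Psi>\<close> at
  \<open>\<omega>\<close>, removes the pole; the remaining integral does not change when the line moves to the right, where
  it tends to 0.\<close>

lemma half_plane_Cauchy:
  fixes \<Psi> :: "complex \<Rightarrow> complex"
  assumes hol: "\<Psi> holomorphic_on {z. R0 < Re z}" and R: "R0 < R" "0 < R" "R < Re \<omega>"
    and bnd: "\<And>z. R \<le> Re z \<Longrightarrow> cmod (\<Psi> z) \<le> A / cmod z"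
  shows "integrable lborel (\<lambda>y. \<Psi> (Complex R y) / (\<omega> - Complex R y))"
    and "(LINT y|lborel. \<Psi> (Complex R y) / (\<omega> - Complex R y)) = 2 * pi * \<Psi> \<omega>"
proof -
  define R0' where "R0' = max R0 0"
  define g where "g z = \<Psi> z - \<Psi> \<omega> * \<omega> / z" for z
  define F where "F z = (if z = \<omega> then deriv g \<omega> else (g z - g \<omega>) / (z - \<omega>))" for z
  have \<omega>0: "\<omega> \<noteq> 0" using R by auto
  have g\<omega>: "g \<omega> = 0" using \<omega>0 by (simp add: g_def)
  have R0': "R0' < R" using R by (simp add: R0'_def)
  have "g holomorphic_on {z. R0' < Re z}"
    unfolding g_def
    by (intro holomorphic_intros holomorphic_on_subset[OF hol]) (auto simp: R0'_def)
  then have holF: "F holomorphic_on {z. R0' < Re z}"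
    unfolding F_def[abs_def] by (intro pole_lemma_open) (auto simp: open_halfspace_Re_gt)
  define K where "K = A + cmod (\<Psi> \<omega> * \<omega>)"
  have gb: "cmod (g z) \<le> K / cmod z" if "R \<le> Re z" for z
    using bnd[OF that] norm_triangle_ineq4[of "\<Psi> z" "\<Psi> \<omega> * \<omega> / z"]
    by (simp add: g_def K_def norm_divide add_divide_distrib)
  have K0: "0 \<le> K"
  proof -
    have "0 \<le> K / cmod \<omega>" using gb[of \<omega>] R norm_ge_zero order_trans by (meson less_imp_le)
    then show ?thesis using \<omega>0 by (simp add: zero_le_divide_iff)
  qed
  \<comment> \<open>away from the pole, \<open>F\<close> decays quadratically\<close>
  have Fb: "cmod (F z) \<le> K * (1 + cmod \<omega> / \<delta>) * cmod z powr - 2"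
    if z: "R \<le> Re z" "0 < \<delta>" "\<delta> \<le> cmod (z - \<omega>)" for z \<delta>
  proof -
    have z0: "0 < cmod z" "0 < cmod (z - \<omega>)" using z R by auto
    have "cmod (F z) = cmod (g z) * (1 / cmod (z - \<omega>))"
      using z0 by (auto simp: F_def g\<omega> norm_divide)
    also have "\<dots> \<le> K / cmod z * ((1 + cmod \<omega> / \<delta>) / cmod z)"
    proof (intro mult_mono gb z)
      show "1 / cmod (z - \<omega>) \<le> (1 + cmod \<omega> / \<delta>) / cmod z"
        using norm_Complex_diff_ge[OF z(2,3)] z0 by (simp add: field_simps)
    qed (use K0 in auto)
    also have "\<dots> = K * (1 + cmod \<omega> / \<delta>) * cmod z powr - 2"
      using z0 by (simp add: powr_minus powr_numeral power2_eq_square divide_inverse)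
    finally show ?thesis .
  qed
  define \<delta> where "\<delta> = min 1 (Re \<omega> - R)"
  have \<delta>: "0 < \<delta>" using R by (simp add: \<delta>_def)
  define K' where "K' = K * (1 + cmod \<omega> / \<delta>)"
  have far: "cmod (F z) \<le> K' * cmod z powr - 2" if "R \<le> Re z" "\<delta> \<le> \<bar>Re z - Re \<omega>\<bar> \<or> \<delta> \<le> \<bar>Im z - Im \<omega>\<bar>" for z
    unfolding K'_def
    using that abs_Re_le_cmod[of "z - \<omega>"] abs_Im_le_cmod[of "z - \<omega>"] \<delta> by (intro Fb) auto
  have K'0: "0 \<le> K'" using K0 \<delta> by (simp add: K'_def)
  have int: "integrable lborel (\<lambda>y. F (Complex R' y))"
    and nrm: "cmod (LINT y|lborel. F (Complex R' y)) \<le> K' * (2 * 2 powr 2 * R' powr (1 - 2) / (2 - 1))"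
    if "R' = R \<or> Re \<omega> + 1 \<le> R'" for R'
    by (rule integrable_vertical[OF holF]; use that R R0' in \<open>auto simp: \<delta>_def intro!: far\<close>)+
  have shift: "(LINT y|lborel. F (Complex R y)) = (LINT y|lborel. F (Complex R' y))" if R': "Re \<omega> + 1 \<le> R'" for R'
  proof (rule vertical_line_shift[OF holF R0'])
    show "R \<le> R'" using R' R by linarith
    show "integrable lborel (\<lambda>y. F (Complex R y))" "integrable lborel (\<lambda>y. F (Complex R' y))"
      using int R' by auto
    fix x y assume xy: "R \<le> x" "x \<le> R'" "\<bar>Im \<omega>\<bar> + 1 \<le> \<bar>y\<bar>"
    have y1: "1 \<le> cmod (Complex x y)" "\<bar>y\<bar> \<le> cmod (Complex x y)"
      using abs_Im_le_cmod[of "Complex x y"] xy by auto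
    have "cmod (F (Complex x y)) \<le> K' * cmod (Complex x y) powr - 2"
      using xy by (intro far) (auto simp: \<delta>_def)
    also have "\<dots> \<le> K' * cmod (Complex x y) powr - 1"
      using y1 K'0 by (intro mult_left_mono powr_mono) auto
    also have "\<dots> = K' / cmod (Complex x y)" using y1 by (simp add: powr_minus_divide)
    also have "\<dots> \<le> K' / \<bar>y\<bar>" using y1 xy K'0 by (intro divide_left_mono) (auto intro!: mult_pos_pos)
    finally show "cmod (F (Complex x y)) \<le> K' / \<bar>y\<bar>" .
  qed
  have F0: "(LINT y|lborel. F (Complex R y)) = 0"
  proof -
    have "(\<lambda>n. K' * (2 * 2 powr 2 * (real n) powr (1 - 2) / (2 - 1))) \<longlonglongrightarrow> 0" by real_asymp
    moreover have "eventually (\<lambda>n. cmod (LINT y|lborel. F (Complex R y)) \<le>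
        K' * (2 * 2 powr 2 * (real n) powr (1 - 2) / (2 - 1))) sequentially"
      using eventually_ge_at_top[of "nat \<lceil>Re \<omega> + 1\<rceil>"]
    proof eventually_elim
      case (elim n)
      then have "Re \<omega> + 1 \<le> real n" by linarith
      then show ?case using nrm[of "real n"] shift[of "real n"] by simp
    qed
    ultimately have "cmod (LINT y|lborel. F (Complex R y)) \<le> 0"
      by (intro tendsto_lowerbound[of _ 0 sequentially]) auto
    then show ?thesis by simp
  qed
  have split: "\<Psi> (Complex R y) / (\<omega> - Complex R y)
      = \<Psi> \<omega> * (\<omega> / (Complex R y * (\<omega> - Complex R y))) - F (Complex R y)" for y
  proof -
    have "Complex R y \<noteq> 0" "\<omega> - Complex R y \<noteq> 0" "Complex R y \<noteq> \<omega>" "Complex R y - \<omega> \<noteq> 0"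
      using R by (auto simp: complex_eq_iff)
    then show ?thesis using \<omega>0
      by (simp add: F_def g\<omega> g_def divide_simps) (simp add: algebra_simps)
  qed
  note two = integral_two_poles[OF R(2,3)]
  show "integrable lborel (\<lambda>y. \<Psi> (Complex R y) / (\<omega> - Complex R y))"
    unfolding split using int[of R]
    by (intro Bochner_Integration.integrable_diff integrable_mult_right two(1)) auto
  have "(LINT y|lborel. \<Psi> (Complex R y) / (\<omega> - Complex R y))
     = \<Psi> \<omega> * (LINT y|lborel. \<omega> / (Complex R y * (\<omega> - Complex R y))) - (LINT y|lborel. F (Complex R y))"
    unfolding split using two(1) int[of R]
    by (subst Bochner_Integration.integral_diff)
      (simp_all only: integrable_mult_right Bochner_Integration.integral_mult_right_zero simp_thms)
  then show "(LINT y|lborel. \<Psi> (Complex R y) / (\<omega> - Complex R y)) = 2 * pi * \<Psi> \<omega>"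
    using two(2) F0 by (simp add: mult.commute)
qed

lemma has_vector_derivative_exp_powr:
  fixes \<kappa> s :: real and \<mu> :: complex
  assumes "0 < s"
  shows "((\<lambda>s. exp (- (\<mu> * complex_of_real (s powr \<kappa>)))) has_vector_derivative
     - (\<mu> * exp (- (\<mu> * complex_of_real (s powr \<kappa>))) * complex_of_real (\<kappa> * s powr (\<kappa> - 1)))) (at s)"
proof -
  have "((\<lambda>s. s powr \<kappa>) has_real_derivative \<kappa> * s powr (\<kappa> - 1)) (at s)"
    using assms by (auto intro!: derivative_eq_intros)
  then have "((\<lambda>s. complex_of_real (s powr \<kappa>)) has_vector_derivative complex_of_real (\<kappa> * s powr (\<kappa> - 1))) (at s)"
    by (intro has_vector_derivative_of_real) (simp add: has_real_derivative_iff_has_vector_derivative)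
  moreover have "((\<lambda>z. exp (- (\<mu> * z))) has_field_derivative - (\<mu> * exp (- (\<mu> * z)))) (at z within A)" for z A
    by (auto intro!: derivative_eq_intros)
  ultimately have "((\<lambda>z. exp (- (\<mu> * z))) \<circ> (\<lambda>s. complex_of_real (s powr \<kappa>)) has_vector_derivative
     complex_of_real (\<kappa> * s powr (\<kappa> - 1)) * - (\<mu> * exp (- (\<mu> * complex_of_real (s powr \<kappa>))))) (at s)"
    by (intro field_vector_diff_chain_at) auto
  then show ?thesis by (simp add: o_def algebra_simps)
qed

text \<open>In the variable \<open>s\<^bsup>\<kappa>\<^esup>\<close> this is the Laplace transform of the constant function.\<close>

lemma integral_exp_powr:
  fixes \<kappa> :: real and \<mu> :: complex
  assumes \<kappa>: "0 < \<kappa>" and \<mu>: "0 < Re \<mu>"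
  shows "set_integrable lborel {0<..} (\<lambda>s. exp (- (\<mu> * complex_of_real (s powr \<kappa>))) * complex_of_real (\<kappa> * s powr (\<kappa> - 1)))"
    and "(LINT s:{0<..}|lborel. exp (- (\<mu> * complex_of_real (s powr \<kappa>))) * complex_of_real (\<kappa> * s powr (\<kappa> - 1))) = 1 / \<mu>"
proof -
  define m where "m = Re \<mu>"
  have ei: "einterval 0 \<infinity> = {0<..}" by (auto simp: einterval_def)
  have lim0: "((\<lambda>s. exp (- (\<nu> * complex_of_real (s powr \<kappa>)))) \<longlongrightarrow> 1) (at_right 0)" for \<nu> :: complex
  proof -
    have "((\<lambda>s. s powr \<kappa>) \<longlongrightarrow> 0) (at_right 0)"
      using \<kappa> by real_asymp
    then have "((\<lambda>s. exp (- (\<nu> * complex_of_real (s powr \<kappa>)))) \<longlongrightarrow> exp (- (\<nu> * complex_of_real 0))) (at_right 0)"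
      by (intro tendsto_intros)
    then show ?thesis by simp
  qed
  have limr: "((\<lambda>s. exp (- (m * s powr \<kappa>))) \<longlongrightarrow> 0) at_top"
    using \<kappa> \<mu> unfolding m_def[symmetric] by real_asymp
  have nrm: "cmod (exp (- (\<mu> * complex_of_real (s powr \<kappa>)))) = exp (- (m * s powr \<kappa>))" for s
    by (simp add: m_def)
  have liminf: "((\<lambda>s. exp (- (\<mu> * complex_of_real (s powr \<kappa>)))) \<longlongrightarrow> 0) at_top"
    by (rule tendsto_norm_zero_cancel) (simp only: nrm limr)
  have real_int: "set_integrable lborel (einterval 0 \<infinity>) (\<lambda>s. m * exp (- (m * s powr \<kappa>)) * (\<kappa> * s powr (\<kappa> - 1)))"
  proof (rule interval_integral_FTC_nonneg(1)[where F = "\<lambda>s. - exp (- (m * s powr \<kappa>))" and A = "- 1" and B = 0])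
    show "((\<lambda>s. - exp (- (m * s powr \<kappa>))) has_real_derivative m * exp (- (m * s powr \<kappa>)) * (\<kappa> * s powr (\<kappa> - 1))) (at s)"
      if "0 < ereal s" for s
      using that by (auto intro!: derivative_eq_intros)
    show "isCont (\<lambda>s. m * exp (- (m * s powr \<kappa>)) * (\<kappa> * s powr (\<kappa> - 1))) s" if "0 < ereal s" for s
      using that by (intro continuous_intros) auto
    show "AE s in lborel. 0 < ereal s \<longrightarrow> ereal s < \<infinity> \<longrightarrow> 0 \<le> m * exp (- (m * s powr \<kappa>)) * (\<kappa> * s powr (\<kappa> - 1))"
      using \<kappa> \<mu> by (intro AE_I2) (auto simp: m_def)
    have "((\<lambda>s. - exp (- (m * s powr \<kappa>))) \<longlongrightarrow> - 1) (at_right 0)" using \<kappa> \<mu> unfolding m_def[symmetric] by real_asymp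
    then show "(((\<lambda>s. - exp (- (m * s powr \<kappa>))) \<circ> real_of_ereal) \<longlongrightarrow> - 1) (at_right 0)"
      by (simp add: zero_ereal_def ereal_tendsto_simps)
    show "(((\<lambda>s. - exp (- (m * s powr \<kappa>))) \<circ> real_of_ereal) \<longlongrightarrow> 0) (at_left \<infinity>)"
      using tendsto_minus[OF limr] by (simp add: ereal_tendsto_simps)
  qed auto
  then have ri: "integrable lborel (\<lambda>s. (1 / m) * (indicator {0<..} s *\<^sub>R (m * exp (- (m * s powr \<kappa>)) * (\<kappa> * s powr (\<kappa> - 1)))))"
    unfolding ei set_integrable_def by (rule integrable_mult_right)
  show si: "set_integrable lborel {0<..} (\<lambda>s. exp (- (\<mu> * complex_of_real (s powr \<kappa>))) * complex_of_real (\<kappa> * s powr (\<kappa> - 1)))"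
    unfolding set_integrable_def
  proof (rule Bochner_Integration.integrable_bound[OF ri])
    show "(\<lambda>s. indicat_real {0<..} s *\<^sub>R (exp (- (\<mu> * complex_of_real (s powr \<kappa>))) * complex_of_real (\<kappa> * s powr (\<kappa> - 1)))) \<in> borel_measurable lborel"
      by measurable
    show "AE s in lborel. norm (indicat_real {0<..} s *\<^sub>R (exp (- (\<mu> * complex_of_real (s powr \<kappa>))) * complex_of_real (\<kappa> * s powr (\<kappa> - 1))))
       \<le> norm (1 / m * (indicat_real {0<..} s *\<^sub>R (m * exp (- (m * s powr \<kappa>)) * (\<kappa> * s powr (\<kappa> - 1)))))"
      using \<kappa> \<mu> by (intro AE_I2) (simp add: norm_mult nrm m_def abs_mult)
  qed
  have \<mu>0: "\<mu> \<noteq> 0" using \<mu> by auto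
  have "(LBINT s=0..\<infinity>. exp (- (\<mu> * complex_of_real (s powr \<kappa>))) * complex_of_real (\<kappa> * s powr (\<kappa> - 1))) = 0 - (- (1 / \<mu>) * 1)"
  proof (rule interval_integral_FTC_integrable[where F = "\<lambda>s. - (1 / \<mu>) * exp (- (\<mu> * complex_of_real (s powr \<kappa>)))"])
    show "((\<lambda>s. - (1 / \<mu>) * exp (- (\<mu> * complex_of_real (s powr \<kappa>)))) has_vector_derivative
        exp (- (\<mu> * complex_of_real (s powr \<kappa>))) * complex_of_real (\<kappa> * s powr (\<kappa> - 1))) (at s)" if "0 < ereal s" for s
    proof -
      from that have "0 < s" by simp
      from has_vector_derivative_mult_right[OF has_vector_derivative_exp_powr[OF this, of \<mu> \<kappa>], of "- (1 / \<mu>)"] \<mu>0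
      show ?thesis by simp
    qed
    show "isCont (\<lambda>s. exp (- (\<mu> * complex_of_real (s powr \<kappa>))) * complex_of_real (\<kappa> * s powr (\<kappa> - 1))) s" if "0 < ereal s" for s
      using that by (intro continuous_intros) auto
    have "((\<lambda>s. - (1 / \<mu>) * exp (- (\<mu> * complex_of_real (s powr \<kappa>)))) \<longlongrightarrow> - (1 / \<mu>) * 1) (at_right 0)"
      by (intro tendsto_mult tendsto_const lim0)
    then show "(((\<lambda>s. - (1 / \<mu>) * exp (- (\<mu> * complex_of_real (s powr \<kappa>)))) \<circ> real_of_ereal) \<longlongrightarrow> - (1 / \<mu>) * 1) (at_right 0)"
      unfolding zero_ereal_def ereal_tendsto_simps .
    have "((\<lambda>s. - (1 / \<mu>) * exp (- (\<mu> * complex_of_real (s powr \<kappa>)))) \<longlongrightarrow> 0) at_top"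
      by (intro tendsto_mult_right_zero liminf)
    then show "(((\<lambda>s. - (1 / \<mu>) * exp (- (\<mu> * complex_of_real (s powr \<kappa>)))) \<circ> real_of_ereal) \<longlongrightarrow> 0) (at_left \<infinity>)"
      unfolding ereal_tendsto_simps .
  qed (use si ei in auto)
  then show "(LINT s:{0<..}|lborel. exp (- (\<mu> * complex_of_real (s powr \<kappa>))) * complex_of_real (\<kappa> * s powr (\<kappa> - 1))) = 1 / \<mu>"
    by (simp add: interval_lebesgue_integral_def ei)
qed

text \<open>By Fubini's theorem the Laplace transform of the Bromwich integral is a Cauchy integral along the
  line.\<close>

lemma laplace_bromwich:
  fixes \<kappa> :: real and \<Phi> :: "complex \<Rightarrow> complex"
  assumes "0 < \<kappa>" "0 < b" and hol: "\<Phi> holomorphic_on {z. R0 < Re z}" and R: "R0 < R" "0 < R" "R < Re \<omega>"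
    and bnd: "\<And>z. R \<le> Re z \<Longrightarrow> cmod (\<Phi> z) \<le> A * cmod z powr - b"
  defines "G \<equiv> \<lambda>s. (LINT y|lborel. exp (complex_of_real (s powr \<kappa>) * Complex R y) * \<Phi> (Complex R y) / Complex R y) / complex_of_real (2 * pi)"
  shows "set_integrable lborel {0<..} (\<lambda>s. G s * (\<omega> * exp (- (\<omega> * complex_of_real (s powr \<kappa>))) * complex_of_real (\<kappa> * s powr (\<kappa> - 1))))"
    and "(LINT s:{0<..}|lborel. G s * (\<omega> * exp (- (\<omega> * complex_of_real (s powr \<kappa>))) * complex_of_real (\<kappa> * s powr (\<kappa> - 1)))) = \<Phi> \<omega>"
proof -
  define q where "q y = \<Phi> (Complex R y) / Complex R y * (\<omega> / complex_of_real (2 * pi))" for y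
  define H where "H s y = indicator {0<..} s *\<^sub>R
      (exp (- ((\<omega> - Complex R y) * complex_of_real (s powr \<kappa>))) * complex_of_real (\<kappa> * s powr (\<kappa> - 1))) * q y" for s y :: real
  define m where "m = Re \<omega> - R"
  have m: "0 < Re (\<omega> - Complex R y)" "0 < Re (complex_of_real m)" for y using R by (auto simp: m_def)
  have Cnz: "Complex R y \<noteq> 0" for y using R by (auto simp: complex_eq_iff)
  define R0' where "R0' = max R0 0"
  have R0': "R0' < R" using R by (simp add: R0'_def)
  have holq: "(\<lambda>z. \<Phi> z / z * (\<omega> / complex_of_real (2 * pi))) holomorphic_on {z. R0' < Re z}"
    by (intro holomorphic_intros holomorphic_on_subset[OF hol]) (auto simp: R0'_def)
  have A: "0 \<le> A"
  proof -
    have "0 \<le> A * cmod (Complex R 0) powr - b" using order_trans[OF norm_ge_zero bnd[of "Complex R 0"]] by simp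
    moreover have "0 < cmod (Complex R 0) powr - b" using Cnz by simp
    ultimately show ?thesis by (simp add: zero_le_mult_iff)
  qed
  have qb: "cmod (q y) \<le> A * cmod (\<omega> / complex_of_real (2 * pi)) * cmod (Complex R y) powr - (1 + b)" for y
  proof -
    have "cmod (q y) = cmod (\<Phi> (Complex R y)) / cmod (Complex R y) * cmod (\<omega> / complex_of_real (2 * pi))"
      by (simp add: q_def norm_mult norm_divide)
    also have "\<dots> \<le> A * cmod (Complex R y) powr - b / cmod (Complex R y) * cmod (\<omega> / complex_of_real (2 * pi))"
      using bnd[of "Complex R y"] by (intro mult_right_mono divide_right_mono) auto
    also have "\<dots> = A * cmod (\<omega> / complex_of_real (2 * pi)) * cmod (Complex R y) powr - (1 + b)"
    proof -
      have "- (1 + b) = - b - 1" by simp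
      then show ?thesis using Cnz[of y] by (simp only: powr_diff) simp
    qed
    finally show ?thesis .
  qed
  have qi: "integrable lborel q"
    unfolding q_def[abs_def] by (rule integrable_vertical(1)[OF holq R0' R(2) _ qb[unfolded q_def]]) (use \<open>0 < b\<close> in simp)
  have [measurable]: "q \<in> borel_measurable borel" using qi by auto
  have [measurable]: "(\<lambda>y. Complex R y) \<in> borel_measurable borel"
    unfolding Complex_eq by measurable
  have Hn: "norm (H s y) = norm (indicator {0<..} s *\<^sub>R (exp (- (complex_of_real m * complex_of_real (s powr \<kappa>))) * complex_of_real (\<kappa> * s powr (\<kappa> - 1)))) * norm (q y)" for s y
    by (simp add: H_def norm_mult m_def)
  have i0: "integrable lborel (\<lambda>s. indicator {0<..} s *\<^sub>R (exp (- (complex_of_real m * complex_of_real (s powr \<kappa>))) * complex_of_real (\<kappa> * s powr (\<kappa> - 1))))"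
    using integral_exp_powr(1)[OF \<open>0 < \<kappa>\<close> m(2)] by (simp add: set_integrable_def)
  have Hint: "integrable (lborel \<Otimes>\<^sub>M lborel) (case_prod H)"
  proof (rule lborel_pair.Fubini_integrable)
    show "case_prod H \<in> borel_measurable (lborel \<Otimes>\<^sub>M lborel)"
      unfolding H_def by measurable
    show "integrable lborel (\<lambda>s. LINT y|lborel. norm (case (s, y) of (x, xa) \<Rightarrow> H x xa))"
      by (simp only: case_prod_conv Hn Bochner_Integration.integral_mult_right_zero)
        (intro integrable_mult_left integrable_norm i0)
    have "integrable lborel (\<lambda>y. H s y)" for s
    proof (rule Bochner_Integration.integrable_bound)
      show "integrable lborel (\<lambda>y. norm (indicator {0<..} s *\<^sub>R (exp (- (complex_of_real m * complex_of_real (s powr \<kappa>))) * complex_of_real (\<kappa> * s powr (\<kappa> - 1)))) * norm (q y))"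
        using qi by simp
      show "(\<lambda>y. H s y) \<in> borel_measurable lborel" unfolding H_def by measurable
    qed (intro AE_I2, simp only: Hn real_norm_def abs_mult abs_norm_cancel order_refl)
    then show "AE s in lborel. integrable lborel (\<lambda>y. case (s, y) of (x, xa) \<Rightarrow> H x xa)" by simp
  qed
  have inner: "(LINT y|lborel. H s y) = indicator {0<..} s *\<^sub>R (G s * (\<omega> * exp (- (\<omega> * complex_of_real (s powr \<kappa>))) * complex_of_real (\<kappa> * s powr (\<kappa> - 1))))" for s
  proof -
    define c where "c = indicator {0<..} s *\<^sub>R (\<omega> * exp (- (\<omega> * complex_of_real (s powr \<kappa>))) * complex_of_real (\<kappa> * s powr (\<kappa> - 1))) / complex_of_real (2 * pi)"
    have "H s y = c * (exp (complex_of_real (s powr \<kappa>) * Complex R y) * \<Phi> (Complex R y) / Complex R y)" for y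
    proof -
      have "exp (- ((\<omega> - Complex R y) * complex_of_real (s powr \<kappa>))) =
          exp (- (\<omega> * complex_of_real (s powr \<kappa>))) * exp (complex_of_real (s powr \<kappa>) * Complex R y)"
        by (simp add: exp_add[symmetric] algebra_simps)
      then show ?thesis unfolding H_def q_def c_def by (simp add: scaleR_conv_of_real mult_ac)
    qed
    then have "(LINT y|lborel. H s y) = (LINT y|lborel. c * (exp (complex_of_real (s powr \<kappa>) * Complex R y) * \<Phi> (Complex R y) / Complex R y))"
      by (simp only:)
    also have "\<dots> = c * (complex_of_real (2 * pi) * G s)"
      by (simp only: Bochner_Integration.integral_mult_right_zero) (simp add: G_def)
    finally have "(LINT y|lborel. H s y) = c * (complex_of_real (2 * pi) * G s)" .
    then show ?thesis by (simp add: c_def scaleR_conv_of_real)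
  qed
  show "set_integrable lborel {0<..} (\<lambda>s. G s * (\<omega> * exp (- (\<omega> * complex_of_real (s powr \<kappa>))) * complex_of_real (\<kappa> * s powr (\<kappa> - 1))))"
    using lborel_pair.integrable_fst[OF Hint] unfolding set_integrable_def inner[symmetric] .
  have "(LINT s:{0<..}|lborel. G s * (\<omega> * exp (- (\<omega> * complex_of_real (s powr \<kappa>))) * complex_of_real (\<kappa> * s powr (\<kappa> - 1))))
     = (LINT s|lborel. (LINT y|lborel. H s y))"
    by (simp add: set_lebesgue_integral_def inner)
  also have "\<dots> = (LINT y|lborel. (LINT s|lborel. H s y))"
    using lborel_pair.Fubini_integral[OF Hint] by simp
  also have "\<dots> = (LINT y|lborel. (\<omega> / complex_of_real (2 * pi)) * (\<Phi> (Complex R y) / Complex R y / (\<omega> - Complex R y)))"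
  proof (intro Bochner_Integration.integral_cong refl)
    fix y
    have "(LINT s|lborel. H s y) = (LINT s:{0<..}|lborel. exp (- ((\<omega> - Complex R y) * complex_of_real (s powr \<kappa>))) * complex_of_real (\<kappa> * s powr (\<kappa> - 1))) * q y"
      unfolding H_def set_lebesgue_integral_def by (simp only: Bochner_Integration.integral_mult_left_zero)
    also have "\<dots> = 1 / (\<omega> - Complex R y) * q y"
      using integral_exp_powr(2)[OF \<open>0 < \<kappa>\<close> m(1)] by simp
    finally show "(LINT s|lborel. H s y) = (\<omega> / complex_of_real (2 * pi)) * (\<Phi> (Complex R y) / Complex R y / (\<omega> - Complex R y))"
      by (simp add: q_def mult_ac)
  qed
  also have "\<dots> = (\<omega> / complex_of_real (2 * pi)) * (LINT y|lborel. \<Phi> (Complex R y) / Complex R y / (\<omega> - Complex R y))"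
    by (simp only: Bochner_Integration.integral_mult_right_zero)
  also have "(LINT y|lborel. \<Phi> (Complex R y) / Complex R y / (\<omega> - Complex R y)) = complex_of_real (2 * pi) * (\<Phi> \<omega> / \<omega>)"
  proof (rule half_plane_Cauchy(2))
    show "(\<lambda>z. \<Phi> z / z) holomorphic_on {z. R0' < Re z}"
      by (intro holomorphic_intros holomorphic_on_subset[OF hol]) (auto simp: R0'_def)
    fix z :: complex assume z: "R \<le> Re z"
    then have Rz: "R \<le> cmod z" using complex_Re_le_cmod[of z] by linarith
    have "cmod (\<Phi> z / z) \<le> A * cmod z powr - b / cmod z"
      using bnd[OF z] by (simp add: norm_divide divide_right_mono)
    also have "\<dots> \<le> A * R powr - b / cmod z"
      using A Rz R \<open>0 < b\<close> by (intro divide_right_mono mult_left_mono powr_mono2') auto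
    finally show "cmod (\<Phi> z / z) \<le> A * R powr - b / cmod z" .
  qed (use R R0' in auto)
  also have "\<omega> / complex_of_real (2 * pi) * (complex_of_real (2 * pi) * (\<Phi> \<omega> / \<omega>)) = \<Phi> \<omega>" using R by auto
  finally show "(LINT s:{0<..}|lborel. G s * (\<omega> * exp (- (\<omega> * complex_of_real (s powr \<kappa>))) * complex_of_real (\<kappa> * s powr (\<kappa> - 1)))) = \<Phi> \<omega>" .
qed

section \<open>The Borel transform of a function on a wide sector\<close>

text \<open>In the variables \<open>\<sigma> = (\<tau> / \<epsilon>)\<^sup>\<kappa>\<close> this is the inverse Laplace transform of order \<open>\<kappa>\<close> of \<open>g\<close>, taken
  along the line \<open>Re \<sigma> = R\<close>. Only principal branches occur, because \<open>\<sigma>\<close> stays in the right half-plane.\<close>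

definition bromwich :: "real \<Rightarrow> (complex \<Rightarrow> complex) \<Rightarrow> real \<Rightarrow> complex \<Rightarrow> complex" where
  "bromwich \<kappa> g R \<tau> = (LINT y|lborel. exp (Complex R y) *
     g (\<tau> * exp (- Ln (Complex R y) / complex_of_real \<kappa>)) / Complex R y) / complex_of_real (2 * pi)"

text \<open>The value is the same for all \<open>R > (\<bar>\<tau>\<bar> / \<rho>)\<^sup>\<kappa>\<close>, where \<open>\<rho>\<close> is the radius of the sector.\<close>

definition borel_transform :: "real \<Rightarrow> real \<Rightarrow> (complex \<Rightarrow> complex) \<Rightarrow> complex \<Rightarrow> complex" where
  "borel_transform \<kappa> \<rho> g \<tau> = bromwich \<kappa> g (1 + (cmod \<tau> / \<rho>) powr \<kappa>) \<tau>"

lemma norm_exp_neg_Ln_divide: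
  "\<sigma> \<noteq> 0 \<Longrightarrow> cmod (exp (- Ln \<sigma> / complex_of_real \<kappa>)) = cmod \<sigma> powr (- 1 / \<kappa>)"
  by (simp add: powr_def Re_Ln)

text \<open>Division by \<open>\<sigma>\<^sup>1\<^sup>/\<^sup>\<kappa>\<close> with \<open>Re \<sigma> > 0\<close> turns \<open>\<tau>\<close> by less than \<open>\<pi> / (2 \<kappa>)\<close>. This is why the Borel transform of a
  function on a sector of opening \<open>\<Theta>\<close> lives on a sector of opening \<open>\<Theta> - \<pi> / \<kappa>\<close>.\<close>

lemma rotated_in_sector:
  assumes \<kappa>: "0 < \<kappa>" and \<rho>: "0 < \<rho>" and \<tau>: "\<tau> \<in> unbounded_sector d (\<Theta> - pi / \<kappa>)"
    and \<sigma>: "0 < Re \<sigma>" "(cmod \<tau> / \<rho>) powr \<kappa> < Re \<sigma>"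
  shows "\<tau> * exp (- Ln \<sigma> / complex_of_real \<kappa>) \<in> sector d \<Theta> \<rho>"
proof -
  obtain r \<phi> where r: "\<tau> = of_real r * cis \<phi>" "0 < r" and \<phi>: "\<bar>\<phi> - d\<bar> < (\<Theta> - pi / \<kappa>) / 2"
    using \<tau> by (auto simp: unbounded_sector_def)
  have \<sigma>0: "\<sigma> \<noteq> 0" using \<sigma> by auto
  define s \<alpha> where "s = cmod \<sigma> powr (- 1 / \<kappa>)" and "\<alpha> = Im (Ln \<sigma>) / \<kappa>"
  have e: "exp (- Ln \<sigma> / complex_of_real \<kappa>) = of_real s * cis (- \<alpha>)"
    using \<sigma>0 by (simp add: exp_eq_polar s_def \<alpha>_def powr_def Re_Ln)
  have eq: "\<tau> * exp (- Ln \<sigma> / complex_of_real \<kappa>) = of_real (r * s) * cis (\<phi> - \<alpha>)"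
    unfolding e r by (simp add: cis_mult[symmetric] cis_divide[symmetric] diff_conv_add_uminus del: add_uminus_conv_diff)
  have "\<bar>Im (Ln \<sigma>)\<bar> < pi / 2" using Re_Ln_pos_lt[OF \<sigma>0] \<sigma> by simp
  then have "\<bar>\<alpha>\<bar> < pi / \<kappa> / 2" using \<kappa> by (simp add: \<alpha>_def field_simps)
  then have ang: "\<bar>(\<phi> - \<alpha>) - d\<bar> < \<Theta> / 2" 
  proof -
    have "\<bar>(\<phi> - \<alpha>) - d\<bar> \<le> \<bar>\<phi> - d\<bar> + \<bar>\<alpha>\<bar>" by simp
    moreover have "(\<Theta> - pi / \<kappa>) / 2 = \<Theta> / 2 - pi / \<kappa> / 2" by (rule diff_divide_distrib)
    ultimately show ?thesis using \<phi> \<open>\<bar>\<alpha>\<bar> < pi / \<kappa> / 2\<close> by linarith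
  qed
  have "(r / \<rho>) powr \<kappa> < cmod \<sigma>" using \<sigma> complex_Re_le_cmod[of \<sigma>] r by (simp add: norm_mult)
  then have "((r / \<rho>) powr \<kappa>) powr (1 / \<kappa>) < cmod \<sigma> powr (1 / \<kappa>)"
    using \<kappa> by (intro powr_less_mono2) auto
  then have "r / \<rho> < cmod \<sigma> powr (1 / \<kappa>)" using \<kappa> \<rho> r by (simp add: powr_powr)
  then have "r < \<rho> * cmod \<sigma> powr (1 / \<kappa>)" using \<rho> by (simp add: field_simps)
  moreover have "s * cmod \<sigma> powr (1 / \<kappa>) = 1" using \<sigma>0 by (simp add: s_def powr_add[symmetric])
  moreover have "0 < s" using \<sigma>0 by (simp add: s_def)
  ultimately have "r * s < \<rho>"
    using mult_strict_right_mono[of r "\<rho> * cmod \<sigma> powr (1 / \<kappa>)" s] by (simp add: mult_ac)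
  then show ?thesis unfolding eq using ang r \<open>0 < s\<close> by (intro sectorI) auto
qed

context
  fixes \<kappa> d \<Theta> \<rho> b A :: real and g :: "complex \<Rightarrow> complex"
  assumes \<kappa>: "0 < \<kappa>" and \<rho>: "0 < \<rho>" and b: "0 < b"
    and hol: "g holomorphic_on sector d \<Theta> \<rho>"
    and bnd: "\<And>e. e \<in> sector d \<Theta> \<rho> \<Longrightarrow> cmod (g e) \<le> A * cmod e powr b"
begin

lemma integrand_holomorphic:
  assumes "\<tau> \<in> unbounded_sector d (\<Theta> - pi / \<kappa>)"
  shows "(\<lambda>\<sigma>. g (\<tau> * exp (- Ln \<sigma> / complex_of_real \<kappa>))) holomorphic_on {\<sigma>. (cmod \<tau> / \<rho>) powr \<kappa> < Re \<sigma>}"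
proof -
  have pos: "0 < Re \<sigma>" if "(cmod \<tau> / \<rho>) powr \<kappa> < Re \<sigma>" for \<sigma>
    using that powr_ge_zero[of "cmod \<tau> / \<rho>" \<kappa>] by linarith
  have "(\<lambda>\<sigma>. \<tau> * exp (- Ln \<sigma> / complex_of_real \<kappa>)) holomorphic_on {\<sigma>. (cmod \<tau> / \<rho>) powr \<kappa> < Re \<sigma>}"
    using \<kappa> by (intro holomorphic_intros) (fastforce dest: pos simp: complex_nonpos_Reals_iff)+
  then have "(g \<circ> (\<lambda>\<sigma>. \<tau> * exp (- Ln \<sigma> / complex_of_real \<kappa>))) holomorphic_on {\<sigma>. (cmod \<tau> / \<rho>) powr \<kappa> < Re \<sigma>}"
    by (rule holomorphic_on_compose_gen[OF _ hol])
      (intro image_subsetI rotated_in_sector \<kappa> \<rho> assms, auto dest: pos)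
  then show ?thesis by (simp add: o_def)
qed

lemma integrand_bound:
  assumes "\<tau> \<in> unbounded_sector d (\<Theta> - pi / \<kappa>)" "(cmod \<tau> / \<rho>) powr \<kappa> < Re \<sigma>"
  shows "cmod (g (\<tau> * exp (- Ln \<sigma> / complex_of_real \<kappa>))) \<le> A * cmod \<tau> powr b * cmod \<sigma> powr - (b / \<kappa>)"
proof -
  have "0 < Re \<sigma>" using assms(2) powr_ge_zero[of "cmod \<tau> / \<rho>" \<kappa>] by linarith
  then have \<sigma>0: "\<sigma> \<noteq> 0" by auto
  have "cmod (\<tau> * exp (- Ln \<sigma> / complex_of_real \<kappa>)) powr b = cmod \<tau> powr b * cmod \<sigma> powr - (b / \<kappa>)"
    unfolding norm_mult norm_exp_neg_Ln_divide[OF \<sigma>0]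
    by (simp add: powr_mult powr_powr)
  then show ?thesis
    using bnd[OF rotated_in_sector[OF \<kappa> \<rho> assms(1) \<open>0 < Re \<sigma>\<close> assms(2)]] by (simp add: mult.assoc)
qed

text \<open>The order \<open>b > 0\<close> of vanishing of \<open>g\<close> at 0 supplies the factor \<open>\<bar>\<sigma>\<bar>\<^sup>-\<^sup>b\<^sup>/\<^sup>\<kappa>\<close> that makes the integral converge
  absolutely.\<close>

lemma bromwich_integrand:
  assumes \<tau>: "\<tau> \<in> unbounded_sector d (\<Theta> - pi / \<kappa>)" and R: "(cmod \<tau> / \<rho>) powr \<kappa> < R"
  defines "F \<equiv> \<lambda>\<sigma>. exp \<sigma> * g (\<tau> * exp (- Ln \<sigma> / complex_of_real \<kappa>)) / \<sigma>"
  shows "F holomorphic_on {\<sigma>. (cmod \<tau> / \<rho>) powr \<kappa> < Re \<sigma>}"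
    and "(cmod \<tau> / \<rho>) powr \<kappa> < Re \<sigma> \<Longrightarrow> cmod (F \<sigma>) \<le> exp (Re \<sigma>) * A * cmod \<tau> powr b * cmod \<sigma> powr - (1 + b / \<kappa>)"
    and "integrable lborel (\<lambda>y. F (Complex R y))"
    and "cmod (bromwich \<kappa> g R \<tau>) \<le> exp R * A * cmod \<tau> powr b * (\<kappa> / b) * (2 / R) powr (b / \<kappa>)"
proof -
  have pos: "0 < Re \<sigma>" if "(cmod \<tau> / \<rho>) powr \<kappa> < Re \<sigma>" for \<sigma>
    using that powr_ge_zero[of "cmod \<tau> / \<rho>" \<kappa>] by linarith
  show holF: "F holomorphic_on {\<sigma>. (cmod \<tau> / \<rho>) powr \<kappa> < Re \<sigma>}"
    unfolding F_def using pos by (intro holomorphic_intros integrand_holomorphic \<tau>) auto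
  show Fb: "cmod (F \<sigma>) \<le> exp (Re \<sigma>) * A * cmod \<tau> powr b * cmod \<sigma> powr - (1 + b / \<kappa>)"
    if \<sigma>: "(cmod \<tau> / \<rho>) powr \<kappa> < Re \<sigma>" for \<sigma>
  proof -
    have \<sigma>0: "\<sigma> \<noteq> 0" using pos[OF \<sigma>] by auto
    have "cmod (F \<sigma>) \<le> exp (Re \<sigma>) * (A * cmod \<tau> powr b * cmod \<sigma> powr - (b / \<kappa>)) / cmod \<sigma>"
      unfolding F_def norm_divide norm_mult norm_exp_eq_Re
      by (intro divide_right_mono mult_left_mono integrand_bound \<tau> \<sigma>) auto
    moreover have "cmod \<sigma> powr - (1 + b / \<kappa>) = cmod \<sigma> powr - (b / \<kappa>) / cmod \<sigma>"
    proof -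
      have "- (1 + b / \<kappa>) = - (b / \<kappa>) - 1" by simp
      then show ?thesis using \<sigma>0 by (simp only: powr_diff) simp
    qed
    ultimately show ?thesis by (simp add: mult.assoc)
  qed
  have R0: "0 < R" using R powr_ge_zero[of "cmod \<tau> / \<rho>" \<kappa>] by linarith
  define K where "K = exp R * A * cmod \<tau> powr b"
  have K: "cmod (F (Complex R y)) \<le> K * cmod (Complex R y) powr - (1 + b / \<kappa>)" for y
    using Fb[of "Complex R y"] R by (simp add: K_def)
  have p: "1 < 1 + b / \<kappa>" using b \<kappa> by simp
  note iv = integrable_vertical[OF holF R R0 p K]
  show "integrable lborel (\<lambda>y. F (Complex R y))" by (rule iv(1))
  define a where "a = b / \<kappa>"
  have a: "0 < a" using b \<kappa> by (simp add: a_def)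
  have A0: "0 \<le> K"
  proof -
    have "0 \<le> K * cmod (Complex R 0) powr - (1 + b / \<kappa>)" using order_trans[OF norm_ge_zero K[of 0]] .
    moreover have "0 < cmod (Complex R 0) powr - (1 + b / \<kappa>)" using R0 by (simp add: complex_eq_iff)
    ultimately show ?thesis by (simp add: zero_le_mult_iff)
  qed
  have "cmod (bromwich \<kappa> g R \<tau>) = cmod (LINT y|lborel. F (Complex R y)) / (2 * pi)"
    unfolding bromwich_def F_def norm_divide by simp
  also have "\<dots> \<le> K * (2 * 2 powr (1 + a) * R powr (1 - (1 + a)) / (1 + a - 1)) / (2 * pi)"
    using iv(2) unfolding a_def by (rule divide_right_mono) simp
  also have "\<dots> = K * (1 / a) * ((2 / R) powr a * (2 / pi))"
  proof -
    have "2 powr (1 + a) = 2 * 2 powr a" by (simp add: powr_add)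
    moreover have "R powr (1 - (1 + a)) = 1 / R powr a" by (simp add: powr_minus_divide)
    moreover have "(2 / R) powr a = 2 powr a / R powr a" using R0 by (simp add: powr_divide)
    ultimately show ?thesis by (simp add: mult_ac)
  qed
  also have "\<dots> \<le> K * (1 / a) * ((2 / R) powr a * 1)"
    using pi_ge_two a A0 by (intro mult_left_mono) auto
  finally show "cmod (bromwich \<kappa> g R \<tau>) \<le> exp R * A * cmod \<tau> powr b * (\<kappa> / b) * (2 / R) powr (b / \<kappa>)"
    by (simp add: K_def a_def)
qed

lemma bromwich_independent:
  assumes \<tau>: "\<tau> \<in> unbounded_sector d (\<Theta> - pi / \<kappa>)"
    and R: "(cmod \<tau> / \<rho>) powr \<kappa> < R" "(cmod \<tau> / \<rho>) powr \<kappa> < R'"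
  shows "bromwich \<kappa> g R \<tau> = bromwich \<kappa> g R' \<tau>"
proof -
  have *: "bromwich \<kappa> g R1 \<tau> = bromwich \<kappa> g R2 \<tau>"
    if R: "(cmod \<tau> / \<rho>) powr \<kappa> < R1" "R1 \<le> R2" for R1 R2
  proof -
    define F where "F = (\<lambda>\<sigma>. exp \<sigma> * g (\<tau> * exp (- Ln \<sigma> / complex_of_real \<kappa>)) / \<sigma>)"
    have bi: "F holomorphic_on {\<sigma>. (cmod \<tau> / \<rho>) powr \<kappa> < Re \<sigma>}"
      "(cmod \<tau> / \<rho>) powr \<kappa> < Re \<sigma> \<Longrightarrow> cmod (F \<sigma>) \<le> exp (Re \<sigma>) * A * cmod \<tau> powr b * cmod \<sigma> powr - (1 + b / \<kappa>)"
      "(cmod \<tau> / \<rho>) powr \<kappa> < R \<Longrightarrow> integrable lborel (\<lambda>y. F (Complex R y))" for \<sigma> R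
      unfolding F_def using bromwich_integrand[OF \<tau>] R(1) by blast+
    have R2: "(cmod \<tau> / \<rho>) powr \<kappa> < R2" using R by linarith
    have R10: "0 < R1" using R powr_ge_zero[of "cmod \<tau> / \<rho>" \<kappa>] by linarith
    have A0: "0 \<le> A * cmod \<tau> powr b"
    proof -
      have "0 \<le> A * cmod \<tau> powr b * cmod (of_real R1 :: complex) powr - (b / \<kappa>)"
        using order_trans[OF norm_ge_zero integrand_bound[OF \<tau>, of "of_real R1"]] R by simp
      moreover have "0 < cmod (of_real R1 :: complex) powr - (b / \<kappa>)" using R10 by simp
      ultimately show ?thesis using zero_le_mult_iff[of "A * cmod \<tau> powr b"] by auto
    qed
    have "(LINT y|lborel. F (Complex R1 y)) = (LINT y|lborel. F (Complex R2 y))"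
    proof (rule vertical_line_shift[OF bi(1) R bi(3)[OF R(1)] bi(3)[OF R2], of 1])
      fix x y :: real assume xy: "R1 \<le> x" "x \<le> R2" "1 \<le> \<bar>y\<bar>"
      define z where "z = Complex x y"
      have z: "0 < cmod z" "\<bar>y\<bar> \<le> cmod z" "R1 \<le> cmod z"
        using abs_Im_le_cmod[of z] abs_Re_le_cmod[of z] xy R10 by (auto simp: z_def)
      have xR: "(cmod \<tau> / \<rho>) powr \<kappa> < x" using R xy by linarith
      have "cmod (F z) \<le> exp x * A * cmod \<tau> powr b * cmod z powr - (1 + b / \<kappa>)"
        using bi(2)[of z] xR by (simp add: z_def)
      also have "\<dots> = exp x * (A * cmod \<tau> powr b) * (cmod z powr - (b / \<kappa>) / cmod z)"
      proof -
        have "- (1 + b / \<kappa>) = - (b / \<kappa>) - 1" by simp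
        then have "cmod z powr - (1 + b / \<kappa>) = cmod z powr - (b / \<kappa>) / cmod z"
          using z by (simp only: powr_diff) simp
        then show ?thesis by (simp only: mult.assoc)
      qed
      also have "\<dots> \<le> exp R2 * (A * cmod \<tau> powr b) * (R1 powr - (b / \<kappa>) / \<bar>y\<bar>)"
      proof (rule mult_mono)
        show "exp x * (A * cmod \<tau> powr b) \<le> exp R2 * (A * cmod \<tau> powr b)"
          by (rule mult_right_mono) (use xy A0 in auto)
        have "cmod z powr - (b / \<kappa>) \<le> R1 powr - (b / \<kappa>)"
          by (rule powr_mono2') (use z R10 b \<kappa> in auto)
        then show "cmod z powr - (b / \<kappa>) / cmod z \<le> R1 powr - (b / \<kappa>) / \<bar>y\<bar>"
          using z(2) xy(3) by (intro frac_le powr_ge_zero) linarith+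
        show "0 \<le> exp R2 * (A * cmod \<tau> powr b)" by (rule mult_nonneg_nonneg[OF _ A0]) simp
      qed auto
      finally show "cmod (F (Complex x y)) \<le> (exp R2 * (A * cmod \<tau> powr b) * R1 powr - (b / \<kappa>)) / \<bar>y\<bar>"
        by (simp add: z_def)
    qed
    then show ?thesis by (simp add: bromwich_def F_def)
  qed
  show ?thesis
    using *[OF R(1), of R'] *[OF R(2), of R] linear[of R R'] by metis
qed

lemma borel_transform_eq_bromwich:
  assumes "\<tau> \<in> unbounded_sector d (\<Theta> - pi / \<kappa>)" "(cmod \<tau> / \<rho>) powr \<kappa> < R"
  shows "borel_transform \<kappa> \<rho> g \<tau> = bromwich \<kappa> g R \<tau>"
  unfolding borel_transform_def using assms by (intro bromwich_independent) auto

text \<open>On the line \<open>R = 1 + (\<bar>\<tau>\<bar> / \<rho>)\<^sup>\<kappa>\<close> the exponential factor has exactly the growth that is allowed.\<close>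

lemma borel_transform_bound:
  assumes \<tau>: "\<tau> \<in> unbounded_sector d (\<Theta> - pi / \<kappa>)"
  shows "cmod (borel_transform \<kappa> \<rho> g \<tau>) \<le>
    exp 1 * \<bar>A\<bar> * (\<kappa> / b) * \<rho> powr b * 2 powr (b / \<kappa>) * exp (\<rho> powr - \<kappa> * cmod \<tau> powr \<kappa>)"
proof -
  define R where "R = 1 + (cmod \<tau> / \<rho>) powr \<kappa>"
  have R: "(cmod \<tau> / \<rho>) powr \<kappa> < R" by (simp add: R_def)
  have R0: "0 < R" using powr_ge_zero[of "cmod \<tau> / \<rho>" \<kappa>] unfolding R_def by linarith
  have "cmod \<tau> powr b = \<rho> powr b * ((cmod \<tau> / \<rho>) powr \<kappa>) powr (b / \<kappa>)"
    using \<rho> \<kappa> by (simp add: powr_powr powr_divide)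
  also have "\<dots> \<le> \<rho> powr b * R powr (b / \<kappa>)"
    using R b \<kappa> by (intro mult_left_mono powr_mono2) auto
  finally have tb: "cmod \<tau> powr b * (2 / R) powr (b / \<kappa>) \<le> \<rho> powr b * R powr (b / \<kappa>) * (2 / R) powr (b / \<kappa>)"
    by (rule mult_right_mono) simp
  also have "\<dots> = \<rho> powr b * 2 powr (b / \<kappa>)" using R0 by (simp add: powr_divide)
  finally have tb: "cmod \<tau> powr b * (2 / R) powr (b / \<kappa>) \<le> \<rho> powr b * 2 powr (b / \<kappa>)" .
  have eR: "exp R = exp 1 * exp (\<rho> powr - \<kappa> * cmod \<tau> powr \<kappa>)"
  proof -
    have "(cmod \<tau> / \<rho>) powr \<kappa> = \<rho> powr - \<kappa> * cmod \<tau> powr \<kappa>"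
      using \<rho> by (simp add: powr_divide powr_minus_divide)
    then show ?thesis by (simp add: R_def exp_add)
  qed
  have "cmod (borel_transform \<kappa> \<rho> g \<tau>) \<le> exp R * A * cmod \<tau> powr b * (\<kappa> / b) * (2 / R) powr (b / \<kappa>)"
    unfolding borel_transform_def R_def[symmetric] by (rule bromwich_integrand(4)[OF \<tau> R])
  also have "\<dots> = A * (exp R * (\<kappa> / b) * (cmod \<tau> powr b * (2 / R) powr (b / \<kappa>)))" by simp
  also have "\<dots> \<le> \<bar>A\<bar> * (exp R * (\<kappa> / b) * (\<rho> powr b * 2 powr (b / \<kappa>)))"
  proof (rule mult_mono[OF abs_ge_self])
    show "exp R * (\<kappa> / b) * (cmod \<tau> powr b * (2 / R) powr (b / \<kappa>)) \<le> exp R * (\<kappa> / b) * (\<rho> powr b * 2 powr (b / \<kappa>))"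
      by (rule mult_left_mono[OF tb]) (use b \<kappa> in auto)
  qed (use b \<kappa> in auto)
  finally show ?thesis unfolding eR by (simp add: mult_ac)
qed

lemma measurable_bromwich_integrand:
  assumes "\<tau> \<in> unbounded_sector d (\<Theta> - pi / \<kappa>)" "(cmod \<tau> / \<rho>) powr \<kappa> < R"
  shows "(\<lambda>y. exp (Complex R y) * g (\<tau> * exp (- Ln (Complex R y) / complex_of_real \<kappa>)) / Complex R y) \<in> borel_measurable lborel"
  using measurable_vertical[OF bromwich_integrand(1)[OF assms] assms(2)] .

lemma powr_quotient_less:
  assumes "0 < R" "cmod \<tau> < \<rho> * R powr (1 / \<kappa>)"
  shows "(cmod \<tau> / \<rho>) powr \<kappa> < R"
proof -
  have "(cmod \<tau> / \<rho>) powr \<kappa> < (R powr (1 / \<kappa>)) powr \<kappa>"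
    using assms \<rho> \<kappa> by (intro powr_less_mono2) (auto simp: field_simps)
  then show ?thesis using assms \<kappa> by (simp add: powr_powr)
qed

text \<open>For \<open>\<tau>\<close> in a bounded set a single line can be used, and then the integrand depends holomorphically on \<open>\<tau>\<close>.\<close>

lemma borel_transform_holomorphic:
  "borel_transform \<kappa> \<rho> g holomorphic_on unbounded_sector d (\<Theta> - pi / \<kappa>)"
proof -
  have loc: "borel_transform \<kappa> \<rho> g holomorphic_on (unbounded_sector d (\<Theta> - pi / \<kappa>) \<inter> ball 0 (\<rho> * R powr (1 / \<kappa>)))"
    if R: "0 < R" for R
  proof -
    let ?U = "unbounded_sector d (\<Theta> - pi / \<kappa>) \<inter> ball 0 (\<rho> * R powr (1 / \<kappa>))"
    have U: "\<tau> \<in> unbounded_sector d (\<Theta> - pi / \<kappa>)" "(cmod \<tau> / \<rho>) powr \<kappa> < R" if "\<tau> \<in> ?U" for \<tau>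
      using that powr_quotient_less[OF R] by auto
    have "(\<lambda>\<tau>. LINT y|lborel. exp (Complex R y) * g (\<tau> * exp (- Ln (Complex R y) / complex_of_real \<kappa>)) / Complex R y) holomorphic_on ?U"
    proof (rule holomorphic_on_integral)
      show "open ?U" by (simp add: open_Int open_unbounded_sector)
      show "(\<lambda>\<tau>. exp (Complex R y) * g (\<tau> * exp (- Ln (Complex R y) / complex_of_real \<kappa>)) / Complex R y) holomorphic_on ?U" for y
      proof -
        have nz: "Complex R y \<noteq> 0" using R by (auto simp: complex_eq_iff)
        have "(g \<circ> (\<lambda>\<tau>. \<tau> * exp (- Ln (Complex R y) / complex_of_real \<kappa>))) holomorphic_on ?U"
        proof (rule holomorphic_on_compose_gen[OF _ hol])
          show "(\<lambda>\<tau>. \<tau> * exp (- Ln (Complex R y) / complex_of_real \<kappa>)) holomorphic_on ?U"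
            by (intro holomorphic_intros)
          show "(\<lambda>\<tau>. \<tau> * exp (- Ln (Complex R y) / complex_of_real \<kappa>)) ` ?U \<subseteq> sector d \<Theta> \<rho>"
            using U R \<kappa> \<rho> by (intro image_subsetI rotated_in_sector) auto
        qed
        then show ?thesis using nz by (intro holomorphic_intros) (auto simp: o_def)
      qed
      show "(\<lambda>y. exp (Complex R y) * g (\<tau> * exp (- Ln (Complex R y) / complex_of_real \<kappa>)) / Complex R y) \<in> borel_measurable lborel"
        if "\<tau> \<in> ?U" for \<tau> by (rule measurable_bromwich_integrand[OF U[OF that]])
      define K where "K = exp R * \<bar>A\<bar> * (\<rho> * R powr (1 / \<kappa>)) powr b"
      show "cmod (exp (Complex R y) * g (\<tau> * exp (- Ln (Complex R y) / complex_of_real \<kappa>)) / Complex R y)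
          \<le> K * cmod (Complex R y) powr - (1 + b / \<kappa>)" if "\<tau> \<in> ?U" for \<tau> y
      proof -
        have "cmod (exp (Complex R y) * g (\<tau> * exp (- Ln (Complex R y) / complex_of_real \<kappa>)) / Complex R y)
          \<le> exp R * A * cmod \<tau> powr b * cmod (Complex R y) powr - (1 + b / \<kappa>)"
          using bromwich_integrand(2)[OF U[OF that], of "Complex R y"] U(2)[OF that] by simp
        also have "\<dots> = A * (exp R * cmod \<tau> powr b) * cmod (Complex R y) powr - (1 + b / \<kappa>)"
          by simp
        also have "\<dots> \<le> \<bar>A\<bar> * (exp R * (\<rho> * R powr (1 / \<kappa>)) powr b) * cmod (Complex R y) powr - (1 + b / \<kappa>)"
          using that b by (intro mult_right_mono mult_mono mult_left_mono powr_mono2) auto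
        also have "\<dots> = K * cmod (Complex R y) powr - (1 + b / \<kappa>)" by (simp add: K_def)
        finally show ?thesis .
      qed
      show "integrable lborel (\<lambda>y. K * cmod (Complex R y) powr - (1 + b / \<kappa>))"
        using vertical_line_integral(1)[of "1 + b / \<kappa>" R] R b \<kappa> by simp
    qed
    then have "(\<lambda>\<tau>. bromwich \<kappa> g R \<tau>) holomorphic_on ?U"
      unfolding bromwich_def by (intro holomorphic_intros) auto
    then show ?thesis
      by (rule holomorphic_transform) (rule borel_transform_eq_bromwich[OF U, symmetric])
  qed
  have "borel_transform \<kappa> \<rho> g field_differentiable (at \<tau>)" if \<tau>: "\<tau> \<in> unbounded_sector d (\<Theta> - pi / \<kappa>)" for \<tau>
  proof -
    define R where "R = 1 + (cmod \<tau> / \<rho>) powr \<kappa>"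
    have R0: "0 < R" using powr_ge_zero[of "cmod \<tau> / \<rho>" \<kappa>] unfolding R_def by linarith
    have "((cmod \<tau> / \<rho>) powr \<kappa>) powr (1 / \<kappa>) < R powr (1 / \<kappa>)"
      using \<kappa> by (intro powr_less_mono2) (auto simp: R_def)
    then have "cmod \<tau> < \<rho> * R powr (1 / \<kappa>)" using \<kappa> \<rho> by (simp add: powr_powr field_simps)
    then show ?thesis
      using \<tau> loc[OF R0] by (intro holomorphic_on_imp_differentiable_at[OF loc[OF R0]])
        (auto simp: open_Int open_unbounded_sector)
  qed
  then show ?thesis by (meson field_differentiable_at_within holomorphic_on_def)
qed

end

text \<open>Substitution of \<open>s\<^sup>\<kappa> \<sigma>\<close> for \<open>\<sigma>\<close> moves the dependence on \<open>\<bar>\<tau>\<bar>\<close> from \<open>g\<close> into the exponential, as in an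
  inverse Laplace transform in the variable \<open>s\<^sup>\<kappa>\<close>.\<close>

lemma bromwich_scale:
  assumes s: "0 < s" and R: "0 < R" and \<kappa>: "0 < \<kappa>"
  shows "bromwich \<kappa> g (s powr \<kappa> * R) (complex_of_real s * \<tau>) =
    (LINT y|lborel. exp (complex_of_real (s powr \<kappa>) * Complex R y) *
      g (\<tau> * exp (- Ln (Complex R y) / complex_of_real \<kappa>)) / Complex R y) / complex_of_real (2 * pi)"
proof -
  define c where "c = s powr \<kappa>"
  have c: "0 < c" using s by (simp add: c_def)
  define F where "F y = exp (Complex (c * R) y) *
     g (of_real s * \<tau> * exp (- Ln (Complex (c * R) y) / complex_of_real \<kappa>)) / Complex (c * R) y" for y
  have "(LINT y|lborel. F y) = \<bar>c\<bar> *\<^sub>R (LINT y|lborel. F (0 + c * y))"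
    using c by (intro lborel_integral_real_affine) auto
  also have "\<dots> = (LINT y|lborel. complex_of_real c * F (c * y))"
    using c by (simp add: scaleR_conv_of_real)
  also have "\<dots> = (LINT y|lborel. exp (complex_of_real c * Complex R y) *
      g (\<tau> * exp (- Ln (Complex R y) / complex_of_real \<kappa>)) / Complex R y)"
  proof (intro Bochner_Integration.integral_cong refl)
    fix y
    have nz: "Complex R y \<noteq> 0" using R by (auto simp: complex_eq_iff)
    have eq: "Complex (c * R) (c * y) = of_real c * Complex R y" by (simp add: complex_eq_iff)
    have "Ln (of_real c * Complex R y) = of_real (\<kappa> * ln s) + Ln (Complex R y)"
      using Ln_times_of_real[OF c nz] s by (simp add: c_def ln_powr Ln_of_real)
    then have "exp (- Ln (of_real c * Complex R y) / complex_of_real \<kappa>)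
        = exp (- of_real (ln s) + - Ln (Complex R y) / complex_of_real \<kappa>)"
      using \<kappa> by (simp add: add_divide_distrib diff_divide_distrib)
    also have "\<dots> = exp (- Ln (Complex R y) / complex_of_real \<kappa>) / of_real s"
      using s by (simp add: exp_add exp_diff exp_minus exp_of_real divide_inverse)
    finally have e: "of_real s * \<tau> * exp (- Ln (of_real c * Complex R y) / complex_of_real \<kappa>)
        = \<tau> * exp (- Ln (Complex R y) / complex_of_real \<kappa>)"
      using s by simp
    show "complex_of_real c * F (c * y) = exp (complex_of_real c * Complex R y) *
      g (\<tau> * exp (- Ln (Complex R y) / complex_of_real \<kappa>)) / Complex R y"
      unfolding F_def eq e using c by simp
  qed
  finally show ?thesis by (simp add: bromwich_def F_def[abs_def] c_def)
qed

text \<open>Laplace transformation of order \<open>\<kappa>\<close> along any ray in the domain of the Borel transform gives back the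
  function. The parameter \<open>\<omega>\<close> stands for \<open>(cis \<gamma> / \<epsilon>)\<^sup>\<kappa>\<close>, where \<open>\<epsilon>\<close> is the argument of the function.\<close>

lemma laplace_borel_transform:
  assumes \<kappa>: "0 < \<kappa>" and \<rho>: "0 < \<rho>" and b: "0 < b"
    and hol: "g holomorphic_on sector d \<Theta> \<rho>"
    and bnd: "\<And>e. e \<in> sector d \<Theta> \<rho> \<Longrightarrow> cmod (g e) \<le> A * cmod e powr b"
    and \<gamma>: "\<bar>\<gamma> - d\<bar> < (\<Theta> - pi / \<kappa>) / 2" and \<omega>: "\<rho> powr - \<kappa> < Re \<omega>"
  shows "set_integrable lborel {0<..} (\<lambda>s. borel_transform \<kappa> \<rho> g (complex_of_real s * cis \<gamma>) *
      (\<omega> * exp (- (\<omega> * complex_of_real (s powr \<kappa>))) * complex_of_real (\<kappa> * s powr (\<kappa> - 1))))"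
    and "(LINT s:{0<..}|lborel. borel_transform \<kappa> \<rho> g (complex_of_real s * cis \<gamma>) *
      (\<omega> * exp (- (\<omega> * complex_of_real (s powr \<kappa>))) * complex_of_real (\<kappa> * s powr (\<kappa> - 1)))) =
      g (cis \<gamma> * exp (- Ln \<omega> / complex_of_real \<kappa>))"
proof -
  define \<Phi> where "\<Phi> \<sigma> = g (cis \<gamma> * exp (- Ln \<sigma> / complex_of_real \<kappa>))" for \<sigma>
  define R where "R = (\<rho> powr - \<kappa> + Re \<omega>) / 2"
  have R: "\<rho> powr - \<kappa> < R" "R < Re \<omega>" using \<omega> by (auto simp: R_def)
  have R0: "0 < R" using R(1) powr_ge_zero[of \<rho> "- \<kappa>"] by linarith
  have cis_in: "cis \<gamma> \<in> unbounded_sector d (\<Theta> - pi / \<kappa>)"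
    using \<gamma> unbounded_sectorI[of 1 \<gamma> d "\<Theta> - pi / \<kappa>"] by simp
  have c1: "(cmod (cis \<gamma>) / \<rho>) powr \<kappa> = \<rho> powr - \<kappa>"
    using \<rho> by (simp add: powr_divide powr_minus_divide)
  have hol\<Phi>: "\<Phi> holomorphic_on {\<sigma>. \<rho> powr - \<kappa> < Re \<sigma>}"
    using integrand_holomorphic[OF \<kappa> \<rho> b hol bnd cis_in] unfolding c1 \<Phi>_def[abs_def] .
  have bnd\<Phi>: "cmod (\<Phi> \<sigma>) \<le> A * cmod \<sigma> powr - (b / \<kappa>)" if "R \<le> Re \<sigma>" for \<sigma>
    using integrand_bound[OF \<kappa> \<rho> b hol bnd cis_in, of \<sigma>] that R unfolding c1 \<Phi>_def by simp
  define G where "G s = (LINT y|lborel. exp (complex_of_real (s powr \<kappa>) * Complex R y) * \<Phi> (Complex R y) / Complex R y) / complex_of_real (2 * pi)" for s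
  have G: "borel_transform \<kappa> \<rho> g (complex_of_real s * cis \<gamma>) = G s" if s: "0 < s" for s
  proof -
    have "(cmod (complex_of_real s * cis \<gamma>) / \<rho>) powr \<kappa> = s powr \<kappa> * \<rho> powr - \<kappa>"
      using s \<rho> by (simp add: norm_mult powr_divide powr_minus_divide)
    also have "\<dots> < s powr \<kappa> * R" using s R by simp
    finally have "borel_transform \<kappa> \<rho> g (complex_of_real s * cis \<gamma>) = bromwich \<kappa> g (s powr \<kappa> * R) (complex_of_real s * cis \<gamma>)"
      using unbounded_sector_scale[OF cis_in s] by (intro borel_transform_eq_bromwich[OF \<kappa> \<rho> b hol bnd])
    then show ?thesis by (simp only: bromwich_scale[OF s R0 \<kappa>] \<Phi>_def G_def)
  qed
  have bk: "0 < b / \<kappa>" using b \<kappa> by simp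
  show "set_integrable lborel {0<..} (\<lambda>s. borel_transform \<kappa> \<rho> g (complex_of_real s * cis \<gamma>) *
      (\<omega> * exp (- (\<omega> * complex_of_real (s powr \<kappa>))) * complex_of_real (\<kappa> * s powr (\<kappa> - 1))))"
  proof (rule iffD1[OF set_integrable_cong[OF refl refl]])
    show "set_integrable lborel {0<..} (\<lambda>s. G s *
      (\<omega> * exp (- (\<omega> * complex_of_real (s powr \<kappa>))) * complex_of_real (\<kappa> * s powr (\<kappa> - 1))))"
      unfolding G_def by (rule laplace_bromwich(1)[OF \<kappa> bk hol\<Phi> R(1) R0 R(2)]) (rule bnd\<Phi>)
  qed (simp add: G)
  have "(LINT s:{0<..}|lborel. borel_transform \<kappa> \<rho> g (complex_of_real s * cis \<gamma>) *
      (\<omega> * exp (- (\<omega> * complex_of_real (s powr \<kappa>))) * complex_of_real (\<kappa> * s powr (\<kappa> - 1)))) =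
      (LINT s:{0<..}|lborel. G s *
      (\<omega> * exp (- (\<omega> * complex_of_real (s powr \<kappa>))) * complex_of_real (\<kappa> * s powr (\<kappa> - 1))))"
    by (rule set_lebesgue_integral_cong) (simp_all add: G)
  also have "\<dots> = g (cis \<gamma> * exp (- Ln \<omega> / complex_of_real \<kappa>))"
    unfolding G_def \<Phi>_def[symmetric] by (rule laplace_bromwich(2)[OF \<kappa> bk hol\<Phi> R(1) R0 R(2)]) (rule bnd\<Phi>)
  finally show "(LINT s:{0<..}|lborel. borel_transform \<kappa> \<rho> g (complex_of_real s * cis \<gamma>) *
      (\<omega> * exp (- (\<omega> * complex_of_real (s powr \<kappa>))) * complex_of_real (\<kappa> * s powr (\<kappa> - 1)))) =
      g (cis \<gamma> * exp (- Ln \<omega> / complex_of_real \<kappa>))" .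
qed

text \<open>Hankel's integral for \<open>1 / \<Gamma>\<close>. The integral is a constant multiple of \<open>\<tau>\<^sup>a\<close>, and the constant is found by
  taking the Laplace transform.\<close>

lemma bromwich_powr:
  assumes a: "0 < a" and R: "0 < R"
  shows "bromwich 1 (\<lambda>e. exp (complex_of_real a * Ln e)) R 1 = 1 / complex_of_real (Gamma (1 + a))"
proof -
  define g where "g e = exp (complex_of_real a * Ln e)" for e
  define h where "h = bromwich 1 g R 1"
  define \<Theta> where "\<Theta> = 3 * pi / 2"
  have hol: "g holomorphic_on sector 0 \<Theta> \<rho>" for \<rho>
  proof -
    have "z \<notin> \<real>\<^sub>\<le>\<^sub>0" if z: "z \<in> sector 0 \<Theta> \<rho>" for z
    proof
      assume "z \<in> \<real>\<^sub>\<le>\<^sub>0"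
      then have "Im z = 0" "Re z \<le> 0" by (auto simp: complex_nonpos_Reals_iff)
      moreover have "z \<in> unbounded_sector 0 \<Theta>" using z by (simp add: sector_eq_Int_ball)
      then have "cmod z * cos (\<Theta> / 2) < Re z"
        using unbounded_sector_iff[of \<Theta> z 0] by (simp add: \<Theta>_def)
      moreover have "cos pi \<le> cos (\<Theta> / 2)" using pi_gt_zero by (intro cos_monotone_0_pi_le) (auto simp: \<Theta>_def)
      then have "- cmod z \<le> cmod z * cos (\<Theta> / 2)" using mult_left_mono[of "- 1" "cos (\<Theta> / 2)" "cmod z"] by simp
      ultimately show False by (simp add: cmod_def)
    qed
    then show ?thesis unfolding g_def by (intro holomorphic_intros) auto
  qed
  have bnd: "cmod (g e) \<le> 1 * cmod e powr a" if "e \<in> sector 0 \<Theta> \<rho>" for e \<rho>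
    using sector_nonzero[OF that] by (simp add: g_def powr_def Re_Ln)
  have pos_in: "complex_of_real s \<in> unbounded_sector 0 (\<Theta> - pi / 1)" if "0 < s" for s
    using unbounded_sectorI[of s 0 0 "\<Theta> - pi / 1"] that by (simp add: \<Theta>_def)
  \<comment> \<open>in the sector of radius 3 the value \<open>\<omega> = 1\<close> is admissible\<close>
  have B: "borel_transform 1 3 g (complex_of_real s) = of_real (s powr a) * h" if s: "0 < s" for s
  proof -
    define R' where "R' = 1 + s + R"
    have "borel_transform 1 3 g (complex_of_real s) = bromwich 1 g R' (complex_of_real s)"
      using s R by (intro borel_transform_eq_bromwich[OF _ _ a hol bnd pos_in]) (auto simp: R'_def)
    also have "bromwich 1 g R' (complex_of_real s) = of_real (s powr a) * bromwich 1 g R' 1"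
    proof -
      have "exp (Complex R' y) * g (complex_of_real s * exp (- Ln (Complex R' y) / complex_of_real 1)) / Complex R' y
         = of_real (s powr a) * (exp (Complex R' y) * g (1 * exp (- Ln (Complex R' y) / complex_of_real 1)) / Complex R' y)" for y
      proof -
        have "Ln (complex_of_real s * exp (- Ln (Complex R' y))) = of_real (ln s) + Ln (exp (- Ln (Complex R' y)))"
          using s by (subst Ln_times_of_real) (auto simp: Ln_of_real)
        then have "g (complex_of_real s * exp (- Ln (Complex R' y))) = of_real (s powr a) * g (exp (- Ln (Complex R' y)))"
          using s by (simp add: g_def distrib_left exp_add powr_def exp_of_real[symmetric])
        then show ?thesis by (simp add: mult_ac)
      qed
      then show ?thesis unfolding bromwich_def by (simp only: Bochner_Integration.integral_mult_right_zero) simp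
    qed
    also have "bromwich 1 g R' 1 = h"
    proof -
      define \<rho> where "\<rho> = 2 / R"
      have "1 \<in> unbounded_sector 0 (\<Theta> - pi / 1)" using pos_in[of 1] by simp
      moreover have "0 < \<rho>" "(cmod 1 / \<rho>) powr 1 < R'" "(cmod 1 / \<rho>) powr 1 < R"
        using R s by (auto simp: \<rho>_def R'_def)
      ultimately show ?thesis
        unfolding h_def by (intro bromwich_independent[OF _ _ a hol bnd]) auto
    qed
    finally show ?thesis .
  qed
  have lap: "(LINT s:{0<..}|lborel. borel_transform 1 3 g (complex_of_real s * cis 0) *
      (1 * exp (- (1 * complex_of_real (s powr 1))) * complex_of_real (1 * s powr (1 - 1))))
      = g (cis 0 * exp (- Ln 1 / complex_of_real 1))"
    by (rule laplace_borel_transform(2)[OF _ _ a hol bnd]) (auto simp: \<Theta>_def powr_minus)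
  have "((\<lambda>s. complex_of_real (s powr a / exp s)) has_integral complex_of_real (Gamma (1 + a))) {0..}"
    by (rule has_integral_of_real) (use Gamma_integral_real[of "1 + a"] a in simp)
  then have hi: "((\<lambda>s. complex_of_real (s powr a / exp s)) has_integral complex_of_real (Gamma (1 + a))) {0<..}"
  proof (rule has_integral_spike_set_eq[THEN iffD1, rotated 2])
    show "negligible {x \<in> {0..} - {0<..}. complex_of_real (x powr a / exp x) \<noteq> 0}"
      by (rule negligible_subset[OF negligible_sing[of 0]]) auto
    have "{x \<in> {0<..} - {0..}. complex_of_real (x powr a / exp x) \<noteq> 0} = {}" by auto
    then show "negligible {x \<in> {0<..} - {0..}. complex_of_real (x powr a / exp x) \<noteq> 0}"
      by (simp only: negligible_empty)
  qed
  have si: "set_integrable lborel {0<..} (\<lambda>s. complex_of_real (s powr a / exp s))"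
  proof -
    have "((\<lambda>s. s powr a / exp s) has_integral Gamma (1 + a)) {0<..}"
      using has_integral_linear[OF hi bounded_linear_Re] by (simp add: o_def)
    then have "(\<lambda>s. s powr a / exp s) absolutely_integrable_on {0<..}"
      by (intro nonnegative_absolutely_integrable_1) auto
    then have "set_integrable lborel {0<..} (\<lambda>s. s powr a / exp s)"
      by (simp add: set_integrable_def integrable_completion)
    then have "integrable lborel (\<lambda>s. complex_of_real (indicat_real {0<..} s *\<^sub>R (s powr a / exp s)))"
      unfolding set_integrable_def by (intro integrable_of_real)
    then show ?thesis by (simp add: set_integrable_def scaleR_conv_of_real)
  qed
  have "(LINT s:{0<..}|lborel. borel_transform 1 3 g (complex_of_real s * cis 0) *
      (1 * exp (- (1 * complex_of_real (s powr 1))) * complex_of_real (1 * s powr (1 - 1))))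
     = (LINT s:{0<..}|lborel. h * complex_of_real (s powr a / exp s))"
    by (rule set_lebesgue_integral_cong)
      (auto simp: B exp_minus exp_of_real divide_inverse)
  also have "\<dots> = h * (LINT s:{0<..}|lborel. complex_of_real (s powr a / exp s))"
    by (rule set_integral_mult_right)
  also have "\<dots> = h * complex_of_real (Gamma (1 + a))"
    by (simp only: set_borel_integral_eq_integral(2)[OF si] integral_unique[OF hi])
  finally have "h * complex_of_real (Gamma (1 + a)) = 1"
    unfolding lap by (simp add: g_def)
  moreover have "complex_of_real (Gamma (1 + a)) \<noteq> 0"
  proof -
    have "0 < Gamma (1 + a)" using a by (intro Gamma_real_pos) simp
    then show ?thesis by (metis less_irrefl of_real_eq_0_iff)
  qed
  ultimately have "h = 1 / complex_of_real (Gamma (1 + a))"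
    by (metis nonzero_eq_divide_eq)
  then show ?thesis by (simp only: h_def g_def[abs_def])
qed

text \<open>On monomials the Borel transform is the formal one. The general case reduces to \<open>\<kappa> = 1\<close> and \<open>\<tau> = 1\<close>, with
  the real exponent \<open>n / \<kappa>\<close>.\<close>

lemma bromwich_power:
  assumes "0 < \<kappa>" "0 < R" "1 \<le> n"
  shows "bromwich \<kappa> (\<lambda>e. e ^ n) R \<tau> = \<tau> ^ n / complex_of_real (Gamma (1 + real n / \<kappa>))"
proof -
  define a where "a = real n / \<kappa>"
  have a: "0 < a" using assms by (simp add: a_def)
  have eq: "(\<tau> * exp (- Ln \<sigma> / complex_of_real \<kappa>)) ^ n = \<tau> ^ n * exp (complex_of_real a * Ln (1 * exp (- Ln \<sigma> / complex_of_real 1)))"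
    if "0 < Re \<sigma>" for \<sigma>
  proof -
    have \<sigma>0: "\<sigma> \<noteq> 0" using that by auto
    have "\<bar>Im (Ln \<sigma>)\<bar> < pi / 2" using Re_Ln_pos_lt[OF \<sigma>0] that by simp
    then have "Ln (exp (- Ln \<sigma>)) = - Ln \<sigma>" using pi_gt_zero by (intro Ln_exp) auto
    moreover have "exp (- Ln \<sigma> / complex_of_real \<kappa>) ^ n = exp (of_nat n * (- Ln \<sigma> / complex_of_real \<kappa>))"
      by (rule exp_of_nat_mult[symmetric])
    ultimately show ?thesis by (simp add: power_mult_distrib a_def)
  qed
  have "exp (Complex R y) * (\<tau> * exp (- Ln (Complex R y) / complex_of_real \<kappa>)) ^ n / Complex R y
    = \<tau> ^ n * (exp (Complex R y) * exp (complex_of_real a * Ln (1 * exp (- Ln (Complex R y) / complex_of_real 1))) / Complex R y)" for y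
    using eq[of "Complex R y"] assms(2) by (simp add: mult_ac)
  then have "bromwich \<kappa> (\<lambda>e. e ^ n) R \<tau> = \<tau> ^ n * bromwich 1 (\<lambda>e. exp (complex_of_real a * Ln e)) R 1"
    unfolding bromwich_def by (simp only: Bochner_Integration.integral_mult_right_zero) simp
  then show ?thesis using bromwich_powr[OF a assms(2)] by (simp add: a_def)
qed

text \<open>After the terms of order less than \<open>n\<close> are removed, the line \<open>R = n / \<kappa>\<close> gives a bound in which the
  factor \<open>\<Gamma>(1 + n / \<kappa>)\<close> of the Gevrey remainder is compensated up to a geometric factor.\<close>

lemma borel_transform_taylor:
  assumes \<kappa>: "0 < \<kappa>" and \<rho>: "0 < \<rho>"
    and hol: "f holomorphic_on sector d \<Theta> \<rho>" and M: "0 < M"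
    and gev: "\<And>n e. 1 \<le> n \<Longrightarrow> e \<in> sector d \<Theta> \<rho> \<Longrightarrow>
      cmod (f e - (\<Sum>m<n. h m * e ^ m)) \<le> C * M ^ n * Gamma (1 + real n / \<kappa>) * cmod e ^ n"
    and \<tau>: "\<tau> \<in> unbounded_sector d (\<Theta> - pi / \<kappa>)" "4 powr (1 / \<kappa>) * M * cmod \<tau> < 1"
  shows "(\<lambda>n. \<Sum>j<n. h j * \<tau> ^ j / complex_of_real (Gamma (1 + real j / \<kappa>)))
     \<longlonglongrightarrow> h 0 + borel_transform \<kappa> \<rho> (\<lambda>e. f e - h 0) \<tau>"
proof -
  define g where "g n e = f e - (\<Sum>m<n. h m * e ^ m)" for n e
  define A where "A n = C * M ^ n * Gamma (1 + real n / \<kappa>)" for n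
  have holg: "g n holomorphic_on sector d \<Theta> \<rho>" for n
    unfolding g_def by (intro holomorphic_intros hol)
  have bnd: "cmod (g n e) \<le> A n * cmod e powr real n" if "1 \<le> n" "e \<in> sector d \<Theta> \<rho>" for n e
    using gev[OF that] sector_nonzero[OF that(2)] by (simp add: g_def A_def powr_realpow)
  have peel: "bromwich \<kappa> (g n) R \<tau> = h n * \<tau> ^ n / complex_of_real (Gamma (1 + real n / \<kappa>)) + bromwich \<kappa> (g (Suc n)) R \<tau>"
    if n: "1 \<le> n" and R: "(cmod \<tau> / \<rho>) powr \<kappa> < R" for n R
  proof -
    have R0: "0 < R" using R powr_ge_zero[of "cmod \<tau> / \<rho>" \<kappa>] by linarith
    define F where "F n y = exp (Complex R y) * g n (\<tau> * exp (- Ln (Complex R y) / complex_of_real \<kappa>)) / Complex R y" for n y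
    have iF: "integrable lborel (F n)" if "1 \<le> n" for n
      unfolding F_def[abs_def]
      by (rule bromwich_integrand(3)[OF \<kappa> \<rho> _ holg bnd[OF that] \<tau>(1) R]) (use that in auto)
    have "(LINT y|lborel. F n y) - (LINT y|lborel. F (Suc n) y) = (LINT y|lborel. F n y - F (Suc n) y)"
      using iF[of n] iF[of "Suc n"] n by simp
    also have "\<dots> = (LINT y|lborel. h n * (exp (Complex R y) * (\<tau> * exp (- Ln (Complex R y) / complex_of_real \<kappa>)) ^ n / Complex R y))"
      by (intro Bochner_Integration.integral_cong refl)
        (simp add: F_def g_def diff_divide_distrib[symmetric] right_diff_distrib[symmetric] mult_ac)
    also have "\<dots> = h n * (LINT y|lborel. exp (Complex R y) * (\<tau> * exp (- Ln (Complex R y) / complex_of_real \<kappa>)) ^ n / Complex R y)"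
      by (simp only: Bochner_Integration.integral_mult_right_zero)
    finally have "bromwich \<kappa> (g n) R \<tau> - bromwich \<kappa> (g (Suc n)) R \<tau> = h n * bromwich \<kappa> (\<lambda>e. e ^ n) R \<tau>"
      unfolding bromwich_def F_def by (simp only: diff_divide_distrib[symmetric] times_divide_eq_right)
    then show ?thesis using bromwich_power[OF \<kappa> R0 n, of \<tau>] by (simp add: algebra_simps)
  qed
  have tele: "bromwich \<kappa> (g 1) R \<tau> = (\<Sum>j\<in>{1..<n}. h j * \<tau> ^ j / complex_of_real (Gamma (1 + real j / \<kappa>))) + bromwich \<kappa> (g n) R \<tau>"
    if "1 \<le> n" and R: "(cmod \<tau> / \<rho>) powr \<kappa> < R" for n R
    using that(1)
  proof (induction n rule: dec_induct)
    case (step n)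
    then show ?case using peel[OF _ R, of n]
      by (simp add: add.assoc)
  qed simp
  define q where "q = 4 powr (1 / \<kappa>) * M * cmod \<tau>"
  have q: "0 \<le> q" "q < 1" using M \<tau>(2) by (auto simp: q_def)
  have C0: "0 \<le> C"
  proof -
    have \<tau>0: "\<tau> \<noteq> 0" by (rule unbounded_sector_nonzero[OF \<tau>(1)])
    define e where "e = of_real (\<rho> / (2 * cmod \<tau>)) * \<tau>"
    have e: "e \<in> unbounded_sector d (\<Theta> - pi / \<kappa>)" "cmod e = \<rho> / 2"
      using unbounded_sector_scale[OF \<tau>(1), of "\<rho> / (2 * cmod \<tau>)"] \<rho> \<tau>0
      by (auto simp: e_def norm_mult norm_divide)
    have "e \<in> sector d \<Theta> \<rho>"
    proof -
      have "unbounded_sector d (\<Theta> - pi / \<kappa>) \<subseteq> unbounded_sector d \<Theta>"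
        using \<kappa> by (intro unbounded_sector_mono) simp
      then show ?thesis using e \<rho> by (auto simp: sector_eq_Int_ball)
    qed
    then have "0 \<le> A 1 * cmod e powr real 1"
      using bnd[of 1 e] norm_ge_zero order_trans by blast
    then have "0 \<le> C * (M * Gamma (1 + 1 / \<kappa>) * (\<rho> / 2))" using e \<rho> by (simp add: A_def mult_ac)
    moreover have "0 < M * Gamma (1 + 1 / \<kappa>) * (\<rho> / 2)"
      using M \<rho> \<kappa> by (intro mult_pos_pos Gamma_real_pos add_pos_pos) auto
    ultimately show ?thesis by (simp add: zero_le_mult_iff)
  qed
  \<comment> \<open>this is where the line \<open>R = n / \<kappa>\<close> enters: \<open>exp R\<close> cancels against Stirling's \<open>exp (- n / \<kappa>)\<close>\<close>
  have rem: "cmod (bromwich \<kappa> (g n) (real n / \<kappa>) \<tau>) \<le> 2 * C * \<kappa> * q ^ n"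
    if n: "1 \<le> n" and R: "(cmod \<tau> / \<rho>) powr \<kappa> < real n / \<kappa>" for n
  proof -
    define a where "a = real n / \<kappa>"
    have a: "0 < a" using n \<kappa> by (simp add: a_def)
    have "cmod (bromwich \<kappa> (g n) a \<tau>) \<le> exp a * A n * cmod \<tau> powr real n * (\<kappa> / real n) * (2 / a) powr a"
      using bromwich_integrand(4)[OF \<kappa> \<rho> _ holg bnd[OF n] \<tau>(1) R] n by (simp add: a_def)
    also have "\<dots> \<le> exp a * (C * M ^ n * (2 * (2 * a) powr a * exp (- a))) * cmod \<tau> powr real n * \<kappa> * (2 / a) powr a"
    proof (intro mult_right_mono mult_mono)
      show "A n \<le> C * M ^ n * (2 * (2 * a) powr a * exp (- a))"
        unfolding A_def a_def[symmetric] using C0 M by (intro mult_left_mono Gamma_le_powr_exp a) auto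
      show "\<kappa> / real n \<le> \<kappa>" using n \<kappa> by (simp add: field_simps)
      have "0 < Gamma (1 + real n / \<kappa>)" using \<kappa> by (intro Gamma_real_pos add_pos_nonneg) auto
      then show "0 \<le> A n" using C0 M by (simp add: A_def)
      show "0 \<le> exp a * (C * M ^ n * (2 * (2 * a) powr a * exp (- a))) * cmod \<tau> powr real n"
        using C0 M by auto
    qed (use C0 M \<kappa> n a in auto)
    also have "\<dots> = 2 * C * \<kappa> * (M ^ n * cmod \<tau> powr real n * ((2 * a) powr a * (2 / a) powr a))"
      by (simp add: exp_minus field_simps)
    also have "(2 * a) powr a * (2 / a) powr a = (4 powr (1 / \<kappa>)) ^ n"
    proof -
      have "(2 * a) powr a * (2 / a) powr a = (2 * a * (2 / a)) powr a" using a by (simp add: powr_mult[symmetric])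
      also have "2 * a * (2 / a) = 4" using a by simp
      also have "4 powr a = 4 powr (1 / \<kappa> * real n)" by (simp add: a_def)
      also have "\<dots> = (4 powr (1 / \<kappa>)) ^ n" using powr_realpow[of "4 powr (1 / \<kappa>)" n] by (simp add: powr_powr)
      finally show ?thesis .
    qed
    also have "cmod \<tau> powr real n = cmod \<tau> ^ n"
      using unbounded_sector_nonzero[OF \<tau>(1)] by (simp add: powr_realpow)
    also have "M ^ n * cmod \<tau> ^ n * (4 powr (1 / \<kappa>)) ^ n = q ^ n"
      by (simp add: q_def power_mult_distrib mult_ac)
    finally show ?thesis by (simp add: a_def)
  qed
  define S where "S n = (\<Sum>j<n. h j * \<tau> ^ j / complex_of_real (Gamma (1 + real j / \<kappa>)))" for n
  define L where "L = h 0 + borel_transform \<kappa> \<rho> (\<lambda>e. f e - h 0) \<tau>"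
  have "(\<lambda>n. S n - L) \<longlonglongrightarrow> 0"
  proof (rule Lim_null_comparison)
    show "(\<lambda>n. 2 * C * \<kappa> * q ^ n) \<longlonglongrightarrow> 0"
      using q by (intro tendsto_mult_right_zero LIMSEQ_realpow_zero) auto
    show "eventually (\<lambda>n. norm (S n - L) \<le> 2 * C * \<kappa> * q ^ n) sequentially"
      using eventually_gt_at_top[of "nat \<lceil>\<kappa> * ((cmod \<tau> / \<rho>) powr \<kappa>)\<rceil>"] eventually_ge_at_top[of 1]
    proof eventually_elim
      case (elim n)
      have "\<kappa> * ((cmod \<tau> / \<rho>) powr \<kappa>) < real n" using elim(1) by linarith
      then have R: "(cmod \<tau> / \<rho>) powr \<kappa> < real n / \<kappa>" using \<kappa> by (simp add: field_simps)
      have g1: "g 1 = (\<lambda>e. f e - h 0)" by (auto simp: g_def)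
      have "borel_transform \<kappa> \<rho> (g 1) \<tau> = bromwich \<kappa> (g 1) (real n / \<kappa>) \<tau>"
        by (rule borel_transform_eq_bromwich[OF \<kappa> \<rho> _ holg bnd \<tau>(1) R]) auto
      also have "\<dots> = (\<Sum>j\<in>{1..<n}. h j * \<tau> ^ j / complex_of_real (Gamma (1 + real j / \<kappa>))) + bromwich \<kappa> (g n) (real n / \<kappa>) \<tau>"
        by (rule tele[OF elim(2) R])
      finally have "S n - L = - bromwich \<kappa> (g n) (real n / \<kappa>) \<tau>"
        using elim(2) by (simp add: S_def L_def g1[symmetric] lessThan_atLeast0 sum.atLeast_Suc_lessThan[of 0 n])
      then show ?case using rem[OF elim(2) R] by simp
    qed
  qed
  then show ?thesis by (simp add: S_def L_def LIM_zero_iff)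
qed

section \<open>Cauchy's formula for a function with jumps along rays\<close>

text \<open>In the coordinate \<open>v\<close> with \<open>\<zeta> = exp (- v)\<close>, sectors of the \<open>\<zeta>\<close>-plane become half-strips and
  truncated sectors become rectangles. The Cauchy kernel \<open>d\<zeta> / (\<epsilon> - \<zeta>)\<close> becomes \<open>dv / (1 - \<epsilon> exp v)\<close>.\<close>

definition ckernel :: "complex \<Rightarrow> complex \<Rightarrow> complex" where
  "ckernel \<epsilon> v = 1 / (1 - \<epsilon> * exp v)"

lemma ckernel_periodic: "ckernel \<epsilon> (Complex x (y + 2 * pi)) = ckernel \<epsilon> (Complex x y)"
proof -
  have "Complex x (y + 2 * pi) = Complex x y + 2 * pi * \<i>" by (simp add: complex_eq_iff)
  then show ?thesis by (simp add: ckernel_def exp_add)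
qed

lemma exp_eq_1_strip:
  assumes "exp z = 1" "\<bar>Im z\<bar> < 2 * pi"
  shows "z = 0"
proof -
  obtain n :: int where n: "Re z = 0" "Im z = of_int (2 * n) * pi"
    using assms(1) by (auto simp: exp_eq_1)
  then have "\<bar>of_int n\<bar> < (1::real)" using assms(2) by (simp add: abs_mult)
  then have "n = 0" by linarith
  with n show ?thesis by (simp add: complex_eq_iff)
qed

text \<open>The kernel has simple poles with a period of \<open>2 \<pi> \<i>\<close>. In a strip around one pole this function is the
  product of the kernel with the linear factor.\<close>

lemma holomorphic_pole_factor: "(\<lambda>z. if z = 0 then - 1 else z / (1 - exp z)) holomorphic_on {z. \<bar>Im z\<bar> < 2 * pi}"
proof -
  define E where "E z = (if z = 0 then deriv exp 0 else (exp z - exp 0) / (z - 0))" for z :: complex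
  have E: "E holomorphic_on UNIV"
    unfolding E_def[abs_def] by (rule pole_lemma_open) (auto intro!: holomorphic_intros)
  have d1: "deriv exp (0::complex) = 1"
    using DERIV_imp_deriv[OF DERIV_exp[of "0::complex"]] by simp
  have E0: "E z \<noteq> 0" if "\<bar>Im z\<bar> < 2 * pi" for z
    using exp_eq_1_strip[of z] that by (auto simp: E_def d1)
  have "(\<lambda>z. - (1 / E z)) holomorphic_on {z. \<bar>Im z\<bar> < 2 * pi}"
    by (intro holomorphic_intros holomorphic_on_subset[OF E]) (use E0 in auto)
  moreover have "- (1 / E z) = (if z = 0 then - 1 else z / (1 - exp z))" for z
  proof (cases "z = 0")
    case False
    then have "- (1 / E z) = - (z / (exp z - 1))" by (simp add: E_def)
    also have "\<dots> = z / (1 - exp z)" by (metis minus_diff_eq minus_divide_right)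
    finally show ?thesis using False by simp
  qed (simp add: E_def d1)
  ultimately show ?thesis by simp
qed

text \<open>The kernel is holomorphic off its poles, and multiplication by a holomorphic function that vanishes at
  the pole removes it.\<close>

lemma rect_integral_pole_free:
  assumes ab: "a \<le> b" "c \<le> e" and \<epsilon>: "\<epsilon> = exp (- w)"
    and hol: "f holomorphic_on {v. s < Re v \<and> c - \<eta> < Im v \<and> Im v < e + \<eta>}" "s < a" "0 < \<eta>"
    and pole: "\<And>v. s < Re v \<Longrightarrow> c - \<eta> < Im v \<Longrightarrow> Im v < e + \<eta> \<Longrightarrow> exp (v - w) \<noteq> 1"
  shows "rect_integral (\<lambda>v. f v * ckernel \<epsilon> v) a b c e = 0"
proof (rule rect_integral_holomorphic[OF ab])
  let ?S = "{v. s < Re v \<and> c - \<eta> < Im v \<and> Im v < e + \<eta>}"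
  have S: "?S = {v. s < Re v} \<inter> {v. c - \<eta> < Im v} \<inter> {v. Im v < e + \<eta>}" by auto
  show "open ?S" unfolding S by (intro open_Int open_halfspace_Re_gt open_halfspace_Im_gt open_halfspace_Im_lt)
  show "convex ?S" unfolding S
    by (intro convex_Int convex_halfspace_Re_gt convex_halfspace_Im_gt convex_halfspace_Im_lt)
  have "1 - \<epsilon> * exp v \<noteq> 0" if "v \<in> ?S" for v
    using pole[of v] that by (simp add: \<epsilon> exp_add[symmetric] exp_diff exp_minus field_simps)
  then show "(\<lambda>v. f v * ckernel \<epsilon> v) holomorphic_on ?S"
    unfolding ckernel_def by (intro holomorphic_intros hol) auto
qed (use hol in auto)

lemma rect_integral_pole:
  assumes \<epsilon>: "\<epsilon> = exp (- w)"
    and hol: "f holomorphic_on {v. s < Re v \<and> c - \<eta> < Im v \<and> Im v < e + \<eta>}" "s < a" "0 < \<eta>"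
    and w: "a < Re w" "Re w < b" "c < Im w" "Im w < e" and small: "e - c + 2 * \<eta> \<le> 2 * pi"
  shows "rect_integral (\<lambda>v. (f v - f w) * ckernel \<epsilon> v) a b c e = 0"
proof -
  let ?S = "{v. s < Re v \<and> c - \<eta> < Im v \<and> Im v < e + \<eta>}"
  define q where "q z = (if z = 0 then - 1 else z / (1 - exp z))" for z :: complex
  define F where "F v = (if v = w then deriv f w else (f v - f w) / (v - w)) * q (v - w)" for v
  have S: "?S = {v. s < Re v} \<inter> {v. c - \<eta> < Im v} \<inter> {v. Im v < e + \<eta>}" by auto
  have oS: "open ?S" unfolding S by (intro open_Int open_halfspace_Re_gt open_halfspace_Im_gt open_halfspace_Im_lt)
  have cS: "convex ?S" unfolding S
    by (intro convex_Int convex_halfspace_Re_gt convex_halfspace_Im_gt convex_halfspace_Im_lt)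
  have near: "\<bar>Im (v - w)\<bar> < 2 * pi" if "v \<in> ?S" for v
    using that w small hol(3) by (auto simp: abs_less_iff)
  have "(q \<circ> (\<lambda>v. v - w)) holomorphic_on ?S"
    unfolding q_def[abs_def]
    by (rule holomorphic_on_compose_gen[OF _ holomorphic_pole_factor]) (use near in \<open>auto intro!: holomorphic_intros\<close>)
  then have holF: "F holomorphic_on ?S"
    unfolding F_def[abs_def] o_def by (intro holomorphic_on_mult pole_lemma_open hol oS)
  have ab: "a \<le> b" "c \<le> e" using w by auto
  have eq: "(f v - f w) * ckernel \<epsilon> v = F v" if v: "v \<in> ?S" "v \<noteq> w" for v
  proof -
    have "\<epsilon> * exp v = exp (v - w)" by (simp add: \<epsilon> exp_add[symmetric])
    moreover have "exp (v - w) \<noteq> 1" using exp_eq_1_strip[of "v - w"] near[OF v(1)] v(2) by auto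
    ultimately show ?thesis using v(2) by (simp add: F_def q_def ckernel_def)
  qed
  have "integral {a..b} (\<lambda>x. (f (Complex x y) - f w) * ckernel \<epsilon> (Complex x y)) = integral {a..b} (\<lambda>x. F (Complex x y))"
    if "y = c \<or> y = e" for y
    by (rule Henstock_Kurzweil_Integration.integral_cong, rule eq) (use that w ab hol in auto)
  moreover have "integral {c..e} (\<lambda>y. (f (Complex x y) - f w) * ckernel \<epsilon> (Complex x y)) = integral {c..e} (\<lambda>y. F (Complex x y))"
    if "x = a \<or> x = b" for x
    by (rule Henstock_Kurzweil_Integration.integral_cong, rule eq) (use that w ab hol in auto)
  ultimately have "rect_integral (\<lambda>v. (f v - f w) * ckernel \<epsilon> v) a b c e = rect_integral F a b c e"
    by (simp add: rect_integral_def)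
  also have "\<dots> = 0"
    by (rule rect_integral_holomorphic[OF ab oS cS holF]) (use hol in auto)
  finally show ?thesis .
qed

text \<open>The circle of radius \<open>exp (- a)\<close> encloses \<open>\<epsilon>\<close>. A primitive is \<open>v - Ln (1 - \<epsilon> exp v)\<close>, and its logarithm is
  periodic.\<close>

lemma integral_ckernel_period_left:
  assumes "cmod (\<epsilon> * exp (of_real a)) < 1"
  shows "integral {c..c + 2 * pi} (\<lambda>y. ckernel \<epsilon> (Complex a y)) = 2 * pi"
proof -
  have m: "cmod (\<epsilon> * exp (Complex a y)) < 1" for y
    using assms by (simp add: norm_mult)
  define P where "P y = (Complex a y - Ln (1 - \<epsilon> * exp (Complex a y))) / \<i>" for y
  have d: "(P has_vector_derivative ckernel \<epsilon> (Complex a y)) (at y within A)" for y A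
  proof -
    have re: "0 < Re (1 - \<epsilon> * exp (Complex a y))"
      using m[of y] complex_Re_le_cmod[of "\<epsilon> * exp (Complex a y)"] by simp
    then have nz: "1 - \<epsilon> * exp (Complex a y) \<noteq> 0" by (metis less_irrefl zero_complex.simps(1))
    have "((\<lambda>y. Complex a y) has_vector_derivative \<i>) (at y within A)"
      unfolding Complex_eq by (auto intro!: derivative_eq_intros)
    moreover have "((\<lambda>z. (z - Ln (1 - \<epsilon> * exp z)) / \<i>) has_field_derivative ckernel \<epsilon> (Complex a y) / \<i>) (at (Complex a y))"
    proof -
      have "1 - \<epsilon> * exp (Complex a y) \<notin> \<real>\<^sub>\<le>\<^sub>0" using re by (auto simp: complex_nonpos_Reals_iff)
      then show ?thesis using nz
        by (auto intro!: derivative_eq_intros simp: ckernel_def field_simps)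
    qed
    ultimately have "((\<lambda>z. (z - Ln (1 - \<epsilon> * exp z)) / \<i>) \<circ> (\<lambda>y. Complex a y) has_vector_derivative
        \<i> * (ckernel \<epsilon> (Complex a y) / \<i>)) (at y within A)"
      by (rule field_vector_diff_chain_within[OF _ has_field_derivative_at_within])
    then show ?thesis by (simp add: o_def P_def[abs_def])
  qed
  have "integral {c..c + 2 * pi} (\<lambda>y. ckernel \<epsilon> (Complex a y)) = P (c + 2 * pi) - P c"
    by (intro integral_unique fundamental_theorem_of_calculus d) auto
  also have "\<dots> = 2 * pi"
  proof -
    have eq: "Complex a (c + 2 * pi) = Complex a c + 2 * pi * \<i>" by (simp add: complex_eq_iff)
    then show ?thesis by (simp add: P_def eq exp_add field_simps)
  qed
  finally show ?thesis .
qed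

text \<open>The circle of radius \<open>exp (- Y)\<close> does not enclose \<open>\<epsilon>\<close>, and the primitive \<open>- Ln (1 - 1 / (\<epsilon> exp v))\<close> is periodic.\<close>

lemma integral_ckernel_period_right:
  assumes "1 < cmod (\<epsilon> * exp (of_real Y))"
  shows "integral {c..c + 2 * pi} (\<lambda>y. ckernel \<epsilon> (Complex Y y)) = 0"
proof -
  have \<epsilon>0: "\<epsilon> \<noteq> 0" using assms by auto
  have m: "cmod (inverse (\<epsilon> * exp (Complex Y y))) < 1" for y
  proof -
    have "1 < cmod (\<epsilon> * exp (Complex Y y))" using assms by (simp add: norm_mult)
    then show ?thesis by (simp only: norm_inverse inverse_less_1_iff simp_thms)
  qed
  define P where "P y = - Ln (1 - inverse (\<epsilon> * exp (Complex Y y))) / \<i>" for y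
  have d: "(P has_vector_derivative ckernel \<epsilon> (Complex Y y)) (at y within A)" for y A
  proof -
    have re: "0 < Re (1 - inverse (\<epsilon> * exp (Complex Y y)))"
      using m[of y] complex_Re_le_cmod[of "inverse (\<epsilon> * exp (Complex Y y))"] by simp
    then have nz: "1 - inverse (\<epsilon> * exp (Complex Y y)) \<noteq> 0" by (metis less_irrefl zero_complex.simps(1))
    have "((\<lambda>y. Complex Y y) has_vector_derivative \<i>) (at y within A)"
      unfolding Complex_eq by (auto intro!: derivative_eq_intros)
    moreover have "((\<lambda>z. - Ln (1 - inverse (\<epsilon> * exp z)) / \<i>) has_field_derivative ckernel \<epsilon> (Complex Y y) / \<i>) (at (Complex Y y))"
    proof -
      have np: "1 - inverse (\<epsilon> * exp (Complex Y y)) \<notin> \<real>\<^sub>\<le>\<^sub>0" using re by (auto simp: complex_nonpos_Reals_iff)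
      define X where "X = \<epsilon> * exp (Complex Y y)"
      have X1: "1 - inverse X \<noteq> 0" using nz by (simp only: X_def simp_thms)
      have X: "X \<noteq> 0" using \<epsilon>0 by (simp add: X_def)
      moreover have "X \<noteq> 1" using X1 by auto
      ultimately have X: "X \<noteq> 0" "1 - X \<noteq> 0" by auto
      have "((\<lambda>z. - Ln (1 - inverse (\<epsilon> * exp z)) / \<i>) has_field_derivative
          - (inverse (1 - inverse X) * (inverse X * X * inverse X)) / \<i>) (at (Complex Y y))"
        using np \<epsilon>0 unfolding X_def by (auto intro!: derivative_eq_intros simp: divide_inverse mult_ac)
      also have "- (inverse (1 - inverse X) * (inverse X * X * inverse X)) / \<i> = ckernel \<epsilon> (Complex Y y) / \<i>"
        using X X1 unfolding ckernel_def X_def[symmetric] by (simp add: field_simps)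
      finally show ?thesis .
    qed
    ultimately have "((\<lambda>z. - Ln (1 - inverse (\<epsilon> * exp z)) / \<i>) \<circ> (\<lambda>y. Complex Y y) has_vector_derivative
        \<i> * (ckernel \<epsilon> (Complex Y y) / \<i>)) (at y within A)"
      by (rule field_vector_diff_chain_within[OF _ has_field_derivative_at_within])
    then show ?thesis by (simp add: o_def P_def[abs_def])
  qed
  have "integral {c..c + 2 * pi} (\<lambda>y. ckernel \<epsilon> (Complex Y y)) = P (c + 2 * pi) - P c"
    by (intro integral_unique fundamental_theorem_of_calculus d) auto
  also have "\<dots> = 0"
  proof -
    have eq: "Complex Y (c + 2 * pi) = Complex Y c + 2 * pi * \<i>" by (simp add: complex_eq_iff)
    then show ?thesis by (simp add: P_def eq exp_add)
  qed
  finally show ?thesis .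
qed

text \<open>The residue at the pole. Completed to a full period, the rectangle has horizontal sides that cancel by
  periodicity, and its vertical sides are known.\<close>

lemma rect_integral_ckernel:
  assumes \<epsilon>: "\<epsilon> = exp (- w)" and ab: "a < Re w" "Re w < Y"
    and w: "c + \<eta> < Im w" "Im w < e - \<eta>" and e: "e < c + 2 * pi" and \<eta>: "0 < \<eta>"
  shows "rect_integral (ckernel \<epsilon>) a Y c e = - 2 * pi * \<i>"
proof -
  have nz: "1 - \<epsilon> * exp v \<noteq> 0" if "Re v = a \<or> Re v = Y \<or> (e - \<eta> < Im v \<and> Im v < c + 2 * pi + \<eta>)" for v
  proof
    assume "1 - \<epsilon> * exp v = 0"
    then have e1: "exp (v - w) = 1" by (simp add: \<epsilon> exp_add[symmetric] exp_diff exp_minus field_simps)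
    then have "cmod (exp (v - w)) = 1" by simp
    then have "Re v = Re w" by simp
    with that ab have "e - \<eta> < Im v" "Im v < c + 2 * pi + \<eta>" by auto
    then have "0 < Im (v - w)" "Im (v - w) < 2 * pi" using w by auto
    then show False using exp_eq_1_strip[OF e1] by auto
  qed
  have cont: "continuous_on {c..c + 2 * pi} (\<lambda>y. ckernel \<epsilon> (Complex x y))" if "x = a \<or> x = Y" for x
    unfolding ckernel_def Complex_eq using nz[of "Complex x y" for y] that
    by (intro continuous_intros) (auto simp: Complex_eq)
  have comb: "integral {c..e} (\<lambda>y. ckernel \<epsilon> (Complex x y)) + integral {e..c + 2 * pi} (\<lambda>y. ckernel \<epsilon> (Complex x y))
      = integral {c..c + 2 * pi} (\<lambda>y. ckernel \<epsilon> (Complex x y))" if "x = a \<or> x = Y" for x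
    using w \<eta> e by (intro Henstock_Kurzweil_Integration.integral_combine integrable_continuous_interval cont that) auto
  have \<epsilon>n: "cmod (\<epsilon> * exp (of_real x)) = exp (x - Re w)" for x :: real
    by (simp add: \<epsilon> norm_mult exp_add[symmetric])
  \<comment> \<open>the complementary rectangle contains no pole\<close>
  have "rect_integral (\<lambda>v. (\<lambda>_. 1) v * ckernel \<epsilon> v) a Y e (c + 2 * pi) = 0"
  proof (rule rect_integral_pole_free[OF _ _ \<epsilon>, where s = "a - 1" and \<eta> = \<eta>])
    fix v assume "e - \<eta> < Im v" "Im v < c + 2 * pi + \<eta>"
    then show "exp (v - w) \<noteq> 1" using nz[of v] by (auto simp: \<epsilon> exp_add[symmetric] exp_diff exp_minus field_simps)
  qed (use ab e \<eta> in auto)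
  then have "rect_integral (ckernel \<epsilon>) a Y e (c + 2 * pi) = 0" by simp
  then have "rect_integral (ckernel \<epsilon>) a Y c e = rect_integral (ckernel \<epsilon>) a Y c e + rect_integral (ckernel \<epsilon>) a Y e (c + 2 * pi)"
    by simp
  also have "\<dots> = integral {a..Y} (\<lambda>x. ckernel \<epsilon> (Complex x c)) - integral {a..Y} (\<lambda>x. ckernel \<epsilon> (Complex x (c + 2 * pi)))
     + \<i> * (integral {c..e} (\<lambda>y. ckernel \<epsilon> (Complex Y y)) + integral {e..c + 2 * pi} (\<lambda>y. ckernel \<epsilon> (Complex Y y)))
     - \<i> * (integral {c..e} (\<lambda>y. ckernel \<epsilon> (Complex a y)) + integral {e..c + 2 * pi} (\<lambda>y. ckernel \<epsilon> (Complex a y)))"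
    unfolding rect_integral_def by (simp only: distrib_left) simp
  also have "\<dots> = \<i> * integral {c..c + 2 * pi} (\<lambda>y. ckernel \<epsilon> (Complex Y y)) - \<i> * integral {c..c + 2 * pi} (\<lambda>y. ckernel \<epsilon> (Complex a y))"
    by (simp only: comb ckernel_periodic simp_thms) simp
  also have "\<dots> = - 2 * pi * \<i>"
    using ab by (subst integral_ckernel_period_left integral_ckernel_period_right; simp only: \<epsilon>n; simp)+
  finally show ?thesis .
qed

lemma rect_integral_add_cmul:
  assumes F: "continuous_on {v. a \<le> Re v \<and> Re v \<le> b \<and> c \<le> Im v \<and> Im v \<le> e \<and> (Re v \<in> {a, b} \<or> Im v \<in> {c, e})} F"
    and G: "continuous_on {v. a \<le> Re v \<and> Re v \<le> b \<and> c \<le> Im v \<and> Im v \<le> e \<and> (Re v \<in> {a, b} \<or> Im v \<in> {c, e})} G"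
    and "a \<le> b" "c \<le> e"
  shows "rect_integral (\<lambda>v. F v + k * G v) a b c e = rect_integral F a b c e + k * rect_integral G a b c e"
proof -
  let ?B = "{v. a \<le> Re v \<and> Re v \<le> b \<and> c \<le> Im v \<and> Im v \<le> e \<and> (Re v \<in> {a, b} \<or> Im v \<in> {c, e})}"
  have h: "(\<lambda>x. H (Complex x y)) integrable_on {a..b}" if "continuous_on ?B H" "y \<in> {c, e}" for H :: "complex \<Rightarrow> complex" and y
    by (intro integrable_continuous_interval continuous_on_compose2[OF that(1)])
      (use that(2) assms(3,4) in \<open>auto simp: Complex_eq intro!: continuous_intros\<close>)
  have v: "(\<lambda>y. H (Complex x y)) integrable_on {c..e}" if "continuous_on ?B H" "x \<in> {a, b}" for H :: "complex \<Rightarrow> complex" and x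
    by (intro integrable_continuous_interval continuous_on_compose2[OF that(1)])
      (use that(2) assms(3,4) in \<open>auto simp: Complex_eq intro!: continuous_intros\<close>)
  have I: "integral {p..q} (\<lambda>x. F (j x) + k * G (j x)) = integral {p..q} (\<lambda>x. F (j x)) + k * integral {p..q} (\<lambda>x. G (j x))"
    if "(\<lambda>x. F (j x)) integrable_on {p..q}" "(\<lambda>x. G (j x)) integrable_on {p..q}" for p q :: real and j
    using that by (simp add: Henstock_Kurzweil_Integration.integral_add integrable_on_mult_right)
  show ?thesis
    unfolding rect_integral_def
    using I[OF h[OF F] h[OF G], of c] I[OF h[OF F] h[OF G], of e] I[OF v[OF F] v[OF G], of a] I[OF v[OF F] v[OF G], of b]
    by (simp add: algebra_simps)
qed

text \<open>The distance of 1 from a ray at an angle of at least \<open>\<eta>\<close> to the positive axis.\<close>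

lemma norm_one_minus_ge_sin:
  assumes "0 < \<eta>" "\<eta> \<le> pi / 2" "\<eta> \<le> \<alpha>" "\<alpha> \<le> 2 * pi - \<eta>" "0 \<le> r"
  shows "sin \<eta> \<le> cmod (1 - of_real r * cis \<alpha>)"
proof -
  have c: "cos \<alpha> \<le> cos \<eta>"
  proof (cases "\<alpha> \<le> pi")
    case True
    then show ?thesis using assms by (intro cos_monotone_0_pi_le) auto
  next
    case False
    then have "cos (2 * pi - \<alpha>) \<le> cos \<eta>" using assms by (intro cos_monotone_0_pi_le) auto
    then show ?thesis by (simp add: cos_diff)
  qed
  have "(sin \<eta>)\<^sup>2 = 1 - (cos \<eta>)\<^sup>2" by (simp add: sin_squared_eq)
  also have "\<dots> \<le> 1 - 2 * (r * cos \<eta>) + r\<^sup>2"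
    using zero_le_power2[of "r - cos \<eta>"] by (simp add: power2_diff)
  also have "\<dots> \<le> 1 - 2 * (r * cos \<alpha>) + r\<^sup>2"
    using mult_left_mono[OF c \<open>0 \<le> r\<close>] by simp
  also have "\<dots> = (1 - r * cos \<alpha>)\<^sup>2 + (r * sin \<alpha>)\<^sup>2"
  proof -
    have "r\<^sup>2 * (sin \<alpha>)\<^sup>2 + r\<^sup>2 * (cos \<alpha>)\<^sup>2 = r\<^sup>2"
      by (simp only: distrib_left[symmetric] sin_cos_squared_add mult_1_right)
    then show ?thesis by (simp add: power2_diff power_mult_distrib)
  qed
  also have "\<dots> = (cmod (1 - of_real r * cis \<alpha>))\<^sup>2"
    by (simp add: cmod_power2)
  finally show ?thesis by (rule power2_le_imp_le) simp
qed

text \<open>In the coordinate \<open>x = - ln \<bar>\<epsilon>\<bar>\<close>: a flat function of order \<open>\<kappa>\<close> divided by \<open>\<epsilon>\<^sup>n\<close> is bounded by a Gamma value.\<close>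

lemma flat_times_exp_le:
  fixes M \<kappa> x :: real
  assumes "0 < M" "0 < \<kappa>"
  shows "exp (real n * x) * exp (- (M * exp (\<kappa> * x))) \<le> M powr - (real n / \<kappa>) * Gamma (1 + real n / \<kappa>)"
proof -
  define z where "z = M * exp (\<kappa> * x)"
  have z: "0 < z" using assms by (simp add: z_def)
  have "z powr (real n / \<kappa>) = M powr (real n / \<kappa>) * exp (real n * x)"
  proof -
    have lz: "ln z = ln M + \<kappa> * x" using assms by (simp add: z_def ln_mult)
    have "real n / \<kappa> * ln z = real n / \<kappa> * ln M + real n * x"
      using assms unfolding lz by (simp add: field_simps)
    then show ?thesis using assms z by (simp add: powr_def exp_add)
  qed
  then have "exp (real n * x) * exp (- z) = M powr - (real n / \<kappa>) * (z powr (real n / \<kappa>) * exp (- z))"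
    using assms by (simp add: powr_minus)
  also have "\<dots> \<le> M powr - (real n / \<kappa>) * Gamma (1 + real n / \<kappa>)"
    using assms z by (intro mult_left_mono powr_exp_le_Gamma) auto
  finally show ?thesis by (simp add: z_def)
qed

text \<open>One rectangle contains the pole of the kernel and the others do not. In the sum over all rectangles each
  ray occurs twice, with the functions on both sides of it, so that only the jumps remain.\<close>

lemma cauchy_formula_jumps:
  fixes f :: "nat \<Rightarrow> complex \<Rightarrow> complex" and N :: nat and \<psi> :: "nat \<Rightarrow> real"
  assumes \<psi>_def: "\<And>i. \<psi> i = \<psi>0 + 2 * pi * real i / real N"
    and N: "2 \<le> N" and \<eta>: "0 < \<eta>" "\<eta> \<le> pi / 2" and sa: "s < a"
    and hol: "\<And>i. i < N \<Longrightarrow> f i holomorphic_on {v. s < Re v \<and> \<psi> i - \<eta> < Im v \<and> Im v < \<psi> (Suc i) + \<eta>}"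
    and per: "\<And>t. f N (Complex t (\<psi> N)) = f 0 (Complex t (\<psi> 0))"
    and w: "a < Re w" "Re w < Y" "\<psi> 0 + \<eta> < Im w" "Im w < \<psi> 1 - \<eta>" and \<epsilon>: "\<epsilon> = exp (- w)"
  shows "2 * pi * \<i> * f 0 w =
    (\<Sum>i<N. integral {a..Y} (\<lambda>x. (f i (Complex x (\<psi> (Suc i))) - f (Suc i) (Complex x (\<psi> (Suc i)))) * ckernel \<epsilon> (Complex x (\<psi> (Suc i)))))
    + \<i> * (\<Sum>i<N. integral {\<psi> i..\<psi> (Suc i)} (\<lambda>y. f i (Complex a y) * ckernel \<epsilon> (Complex a y)))
    - \<i> * (\<Sum>i<N. integral {\<psi> i..\<psi> (Suc i)} (\<lambda>y. f i (Complex Y y) * ckernel \<epsilon> (Complex Y y)))"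
proof -
  have \<psi>S: "\<psi> (Suc i) = \<psi> i + 2 * pi / real N" for i
    by (simp add: \<psi>_def add_divide_distrib distrib_left)
  have step: "0 < 2 * pi / real N" "2 * pi / real N \<le> pi"
    using N by (auto simp: field_simps)
  have \<psi>le: "\<psi> i \<le> \<psi> j" if "i \<le> j" for i j
    using that N by (auto simp: \<psi>_def intro!: divide_right_mono)
  have \<psi>N: "\<psi> N = \<psi> 0 + 2 * pi" using N by (simp add: \<psi>_def)
  have aY: "a \<le> Y" using w by linarith
  define S where "S i = {v. s < Re v \<and> \<psi> i - \<eta> < Im v \<and> Im v < \<psi> (Suc i) + \<eta>}" for i
  have away: "exp (v - w) \<noteq> 1" if "i < N" "v \<in> S i" "v \<noteq> w" for i v
  proof
    assume e1: "exp (v - w) = 1"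
    have "\<psi> (Suc i) \<le> \<psi> 0 + 2 * pi" using \<psi>le[of "Suc i" N] that \<psi>N by simp
    moreover have "\<psi> 0 \<le> \<psi> i" by (rule \<psi>le) simp
    moreover have "\<psi> 1 \<le> \<psi> 0 + pi" using \<psi>S[of 0] step by simp
    ultimately have "Im v - Im w < 2 * pi" "- (2 * pi) < Im v - Im w"
      using that(2) w \<eta> by (auto simp: S_def)
    then have "\<bar>Im (v - w)\<bar> < 2 * pi" by (simp add: abs_less_iff)
    then show False using exp_eq_1_strip[OF e1] that(3) by auto
  qed
  have nz: "1 - \<epsilon> * exp v \<noteq> 0" if "i < N" "v \<in> S i" "v \<noteq> w" for i v
    using away[OF that] by (simp add: \<epsilon> exp_add[symmetric] exp_diff exp_minus field_simps)
  have cont: "continuous_on A (\<lambda>v. f i v * ckernel \<epsilon> v)" "continuous_on A (ckernel \<epsilon>)"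
    if "i < N" "A \<subseteq> S i" "w \<notin> A" for i A
  proof -
    have "continuous_on A (f i)"
      using hol[OF that(1)] that(2) by (intro continuous_on_subset[OF holomorphic_on_imp_continuous_on]) (auto simp: S_def)
    moreover show "continuous_on A (ckernel \<epsilon>)"
      unfolding ckernel_def using nz[OF that(1)] that(2,3) by (intro continuous_intros) auto
    ultimately show "continuous_on A (\<lambda>v. f i v * ckernel \<epsilon> v)" by (rule continuous_on_mult)
  qed
  have rect: "rect_integral (\<lambda>v. f i v * ckernel \<epsilon> v) a Y (\<psi> i) (\<psi> (Suc i)) = (if i = 0 then - 2 * pi * \<i> * f 0 w else 0)"
    if i: "i < N" for i
  proof (cases "i = 0")
    case False
    have "rect_integral (\<lambda>v. f i v * ckernel \<epsilon> v) a Y (\<psi> i) (\<psi> (Suc i)) = 0"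
    proof (rule rect_integral_pole_free[OF aY _ \<epsilon> hol[OF i] sa \<eta>(1)])
      fix v assume v: "s < Re v" "\<psi> i - \<eta> < Im v" "Im v < \<psi> (Suc i) + \<eta>"
      have "\<psi> 1 \<le> \<psi> i" using False by (intro \<psi>le) auto
      then have "v \<noteq> w" using v w by auto
      then show "exp (v - w) \<noteq> 1" using away[OF i] v by (auto simp: S_def)
    qed (rule \<psi>le, simp)
    then show ?thesis using False by simp
  next
    case True
    let ?B = "{v. a \<le> Re v \<and> Re v \<le> Y \<and> \<psi> 0 \<le> Im v \<and> Im v \<le> \<psi> (Suc 0) \<and> (Re v \<in> {a, Y} \<or> Im v \<in> {\<psi> 0, \<psi> (Suc 0)})}"
    have N0: "0 < N" using N by simp
    have B: "?B \<subseteq> S 0" "w \<notin> ?B" using sa \<eta> w by (auto simp: S_def)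
    have z: "rect_integral (\<lambda>v. (f 0 v - f 0 w) * ckernel \<epsilon> v) a Y (\<psi> 0) (\<psi> (Suc 0)) = 0"
      by (rule rect_integral_pole[OF \<epsilon> hol[OF N0] sa \<eta>(1)]) (use w \<eta> \<psi>S[of 0] step in auto)
    have c: "continuous_on ?B (\<lambda>v. (f 0 v - f 0 w) * ckernel \<epsilon> v)"
      unfolding left_diff_distrib by (intro continuous_intros cont[OF N0 B])
    have "rect_integral (\<lambda>v. f 0 v * ckernel \<epsilon> v) a Y (\<psi> 0) (\<psi> (Suc 0)) =
        rect_integral (\<lambda>v. (f 0 v - f 0 w) * ckernel \<epsilon> v + f 0 w * ckernel \<epsilon> v) a Y (\<psi> 0) (\<psi> (Suc 0))"
      by (simp add: left_diff_distrib)
    also have "\<dots> = f 0 w * rect_integral (ckernel \<epsilon>) a Y (\<psi> 0) (\<psi> (Suc 0))"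
      using rect_integral_add_cmul[OF c cont(2)[OF N0 B] aY \<psi>le] by (simp only: z) simp
    also have "rect_integral (ckernel \<epsilon>) a Y (\<psi> 0) (\<psi> (Suc 0)) = - 2 * pi * \<i>"
      by (rule rect_integral_ckernel[OF \<epsilon> w(1,2) _ _ _ \<eta>(1)]) (use w \<psi>S[of 0] step in auto)
    finally show ?thesis using True by simp
  qed
  define b where "b i = integral {a..Y} (\<lambda>x. f i (Complex x (\<psi> i)) * ckernel \<epsilon> (Complex x (\<psi> i)))" for i
  define t where "t i = integral {a..Y} (\<lambda>x. f i (Complex x (\<psi> (Suc i))) * ckernel \<epsilon> (Complex x (\<psi> (Suc i))))" for i
  define V where "V x i = integral {\<psi> i..\<psi> (Suc i)} (\<lambda>y. f i (Complex x y) * ckernel \<epsilon> (Complex x y))" for x i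
  have line: "(\<lambda>x. f i (Complex x y) * ckernel \<epsilon> (Complex x y)) integrable_on {a..Y}"
    if i: "i < N" and y: "y = \<psi> i \<or> y = \<psi> (Suc i)" for i y
  proof (intro integrable_continuous_interval continuous_on_compose2[OF cont(1)[OF i, of "(\<lambda>x. Complex x y) ` {a..Y}"]])
    have \<psi>01: "\<psi> 0 \<le> \<psi> i" "i = 0 \<or> \<psi> 1 \<le> \<psi> i" "\<psi> i \<le> \<psi> (Suc i)" by (cases i; auto intro: \<psi>le)+
    show "(\<lambda>x. Complex x y) ` {a..Y} \<subseteq> S i" using y sa \<eta> \<psi>01 by (auto simp: S_def)
    show "w \<notin> (\<lambda>x. Complex x y) ` {a..Y}" using y w \<eta> \<psi>01 by auto
  qed (auto simp: Complex_eq intro!: continuous_intros)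
  have lineN: "(\<lambda>x. f i (Complex x (\<psi> i)) * ckernel \<epsilon> (Complex x (\<psi> i))) integrable_on {a..Y}" if "i \<le> N" for i
  proof (cases "i = N")
    case True
    have "(\<lambda>x. f 0 (Complex x (\<psi> 0)) * ckernel \<epsilon> (Complex x (\<psi> 0))) integrable_on {a..Y}"
      using N by (intro line) auto
    then show ?thesis unfolding True by (simp only: per) (simp only: \<psi>N ckernel_periodic)
  qed (use that line in auto)
  \<comment> \<open>the last ray is the first one again\<close>
  have bN: "b N = b 0" unfolding b_def by (simp only: per) (simp only: \<psi>N ckernel_periodic)
  have "(\<Sum>i<N. b i) + b N = b 0 + (\<Sum>i<N. b (Suc i))"
    using sum.lessThan_Suc[of b N] sum.lessThan_Suc_shift[of b N] by simp
  then have shift: "(\<Sum>i<N. b i) = (\<Sum>i<N. b (Suc i))" by (simp add: bN)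
  have diff: "t i - b (Suc i) = integral {a..Y} (\<lambda>x. (f i (Complex x (\<psi> (Suc i))) - f (Suc i) (Complex x (\<psi> (Suc i)))) * ckernel \<epsilon> (Complex x (\<psi> (Suc i))))"
    if "i < N" for i
    unfolding t_def b_def left_diff_distrib
    by (rule Henstock_Kurzweil_Integration.integral_diff[symmetric]) (use that line lineN in auto)
  have "(\<Sum>i<N. rect_integral (\<lambda>v. f i v * ckernel \<epsilon> v) a Y (\<psi> i) (\<psi> (Suc i))) = (\<Sum>i<N. b i + \<i> * V Y i - t i - \<i> * V a i)"
    by (intro sum.cong refl) (simp add: rect_integral_def b_def t_def V_def)
  also have "\<dots> = (\<Sum>i<N. b (Suc i)) + \<i> * (\<Sum>i<N. V Y i) - (\<Sum>i<N. t i) - \<i> * (\<Sum>i<N. V a i)"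
    by (simp add: sum.distrib sum_subtractf sum_distrib_left shift)
  finally have A: "(\<Sum>i<N. rect_integral (\<lambda>v. f i v * ckernel \<epsilon> v) a Y (\<psi> i) (\<psi> (Suc i)))
     = - (\<Sum>i<N. t i - b (Suc i)) - \<i> * (\<Sum>i<N. V a i) + \<i> * (\<Sum>i<N. V Y i)"
    by (simp add: sum_subtractf)
  have "(\<Sum>i<N. rect_integral (\<lambda>v. f i v * ckernel \<epsilon> v) a Y (\<psi> i) (\<psi> (Suc i))) = (\<Sum>i<N. if i = 0 then - 2 * pi * \<i> * f 0 w else 0)"
    by (intro sum.cong refl rect) auto
  also have "\<dots> = - 2 * pi * \<i> * f 0 w" using N by (subst sum.delta) auto
  finally have "2 * pi * \<i> * f 0 w = (\<Sum>i<N. t i - b (Suc i)) + \<i> * (\<Sum>i<N. V a i) - \<i> * (\<Sum>i<N. V Y i)"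
    using A by (simp add: algebra_simps)
  also have "(\<Sum>i<N. t i - b (Suc i)) = (\<Sum>i<N. integral {a..Y} (\<lambda>x. (f i (Complex x (\<psi> (Suc i))) - f (Suc i) (Complex x (\<psi> (Suc i)))) * ckernel \<epsilon> (Complex x (\<psi> (Suc i)))))"
    by (intro sum.cong refl diff) auto
  finally show ?thesis by (simp only: V_def)
qed

text \<open>The finite geometric series with its remainder.\<close>

lemma ckernel_expansion:
  assumes "1 - \<epsilon> * exp v \<noteq> 0"
  shows "ckernel \<epsilon> v = (\<Sum>m<n. \<epsilon> ^ m * exp (of_nat m * v)) + \<epsilon> ^ n * exp (of_nat n * v) * ckernel \<epsilon> v"
proof -
  define X where "X = \<epsilon> * exp v"
  have X: "1 - X \<noteq> 0" using assms by (simp add: X_def)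
  have pw: "\<epsilon> ^ m * exp (of_nat m * v) = X ^ m" for m
    by (simp add: X_def power_mult_distrib exp_of_nat_mult)
  have "1 - X ^ n = (1 - X) * (\<Sum>m<n. X ^ m)" by (rule one_diff_power_eq)
  then show ?thesis using X unfolding pw ckernel_def X_def[symmetric] by (simp add: field_simps)
qed

text \<open>Expanding the kernel in the jump formula gives the coefficients as integrals that do not depend on
  \<open>\<epsilon>\<close>. In the remainder the kernel is bounded, because \<open>\<epsilon>\<close> stays away from all rays, and the flatness of the
  jumps of order \<open>\<kappa>\<close> makes up for the factor \<open>\<zeta>\<^bsup>-n\<^esup>\<close> at the price of \<open>\<Gamma>(1 + n / \<kappa>)\<close>.\<close>

lemma jump_expansion:
  fixes f :: "nat \<Rightarrow> complex \<Rightarrow> complex" and N :: nat and \<psi> :: "nat \<Rightarrow> real"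
  assumes \<psi>_def: "\<And>i. \<psi> i = \<psi>0 + 2 * pi * real i / real N"
    and N: "2 \<le> N" and \<eta>: "0 < \<eta>" "\<eta> \<le> pi / 2" and sa: "s < a" and \<kappa>: "0 < \<kappa>" and M: "0 < M" and K: "0 \<le> K"
    and hol: "\<And>i. i < N \<Longrightarrow> f i holomorphic_on {v. s < Re v \<and> \<psi> i - \<eta> < Im v \<and> Im v < \<psi> (Suc i) + \<eta>}"
    and bnd: "\<And>i v. i < N \<Longrightarrow> s < Re v \<Longrightarrow> \<psi> i \<le> Im v \<Longrightarrow> Im v \<le> \<psi> (Suc i) \<Longrightarrow> cmod (f i v) \<le> B"
    and per: "\<And>t. f N (Complex t (\<psi> N)) = f 0 (Complex t (\<psi> 0))"
    and jump: "\<And>i t. i < N \<Longrightarrow> s < t \<Longrightarrow>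
      cmod (f i (Complex t (\<psi> (Suc i))) - f (Suc i) (Complex t (\<psi> (Suc i)))) \<le> K * exp (- (M * exp (\<kappa> * t)))"
  shows "\<exists>h. \<forall>n w. a + ln 2 \<le> Re w \<longrightarrow> \<psi> 0 + \<eta> < Im w \<longrightarrow> Im w < \<psi> 1 - \<eta> \<longrightarrow>
    cmod (f 0 w - (\<Sum>m<n. h m * exp (- w) ^ m)) \<le>
      (real N * K * exp (- a) * ((M / 2) powr - (1 / \<kappa>) * Gamma (1 + 1 / \<kappa>)) / sin \<eta> + 16 * pi * B) *
      ((M / 2) powr - (1 / \<kappa>) + exp a) ^ n * Gamma (1 + real n / \<kappa>) * cmod (exp (- w)) ^ n"
proof -
  have \<psi>S: "\<psi> (Suc i) = \<psi> i + 2 * pi / real N" for i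
    by (simp add: \<psi>_def add_divide_distrib distrib_left)
  have step: "0 < 2 * pi / real N" "2 * pi / real N \<le> pi"
    using N by (auto simp: field_simps)
  have \<psi>le: "\<psi> i \<le> \<psi> j" if "i \<le> j" for i j
    using that N by (auto simp: \<psi>_def intro!: divide_right_mono)
  have \<psi>N: "\<psi> N = \<psi> 0 + 2 * pi" using N by (simp add: \<psi>_def)
  have sin\<eta>: "0 < sin \<eta>" using \<eta> by (intro sin_gt_zero) auto
  have B0: "0 \<le> B"
    using order_trans[OF norm_ge_zero bnd[of 0 "Complex a (\<psi> 0)"]] N sa \<psi>le[of 0 1] by auto
  define p where "p i x = Complex x (\<psi> (Suc i))" for i x
  define \<Delta> where "\<Delta> i x = f i (p i x) - f (Suc i) (p i x)" for i x
  define c where "c = (M / 2) powr - (1 / \<kappa>) * Gamma (1 + 1 / \<kappa>)"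
  define G where "G n = (M / 2) powr - (real n / \<kappa>) * Gamma (1 + real n / \<kappa>)" for n
  have G0: "0 \<le> G n" for n
  proof -
    have "0 < Gamma (1 + real n / \<kappa>)" using \<kappa> by (intro Gamma_real_pos add_pos_nonneg) auto
    then show ?thesis by (simp add: G_def)
  qed
  have c0: "0 \<le> c" using G0[of 1] by (simp add: c_def G_def)
  have contf: "continuous_on {a..} (\<lambda>x. f i (Complex x y))" if "i < N" "y = \<psi> i \<or> y = \<psi> (Suc i)" for i y
    by (rule continuous_on_compose2[OF holomorphic_on_imp_continuous_on[OF hol[OF that(1)]]])
      (use that(2) sa \<eta> \<psi>le[of i "Suc i"] in \<open>auto simp: Complex_eq intro!: continuous_intros\<close>)
  have cont\<Delta>: "continuous_on {a..} (\<Delta> i)" if i: "i < N" for i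
  proof -
    have "continuous_on {a..} (\<lambda>x. f (Suc i) (p i x))"
    proof (cases "Suc i = N")
      case True
      have "continuous_on {a..} (\<lambda>x. f 0 (Complex x (\<psi> 0)))" using N by (intro contf) auto
      then show ?thesis unfolding p_def True by (simp only: per)
    next
      case False
      then show ?thesis unfolding p_def using i by (intro contf) auto
    qed
    moreover have "continuous_on {a..} (\<lambda>x. f i (p i x))" unfolding p_def using i by (intro contf) auto
    ultimately show ?thesis unfolding \<Delta>_def by (intro continuous_intros)
  qed
  \<comment> \<open>half of the flatness absorbs \<open>exp (n x)\<close>, the other half gives decay in \<open>x\<close>\<close>
  have \<Delta>b: "cmod (\<Delta> i x * exp (of_nat n * p i x)) \<le> K * G n * c * exp (- x)" if i: "i < N" and x: "a \<le> x" for i x n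
  proof -
    have e: "cmod (exp (of_nat n * p i x)) = exp (real n * x)" by (simp add: p_def)
    have "cmod (\<Delta> i x * exp (of_nat n * p i x)) \<le> K * exp (- (M * exp (\<kappa> * x))) * exp (real n * x)"
      unfolding norm_mult e using jump[OF i, of x] x sa by (intro mult_right_mono) (auto simp: \<Delta>_def p_def)
    also have "\<dots> = K * ((exp (real n * x) * exp (- (M / 2 * exp (\<kappa> * x)))) * (exp (real 1 * x) * exp (- (M / 2 * exp (\<kappa> * x)))) * exp (- x))"
      by (simp add: exp_add[symmetric])
    also have "\<dots> \<le> K * (G n * c * exp (- x))"
    proof (intro mult_left_mono mult_right_mono K)
      have "exp (real n * x) * exp (- (M / 2 * exp (\<kappa> * x))) \<le> G n"
        unfolding G_def by (rule flat_times_exp_le) (use M \<kappa> in auto)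
      moreover have "exp (real 1 * x) * exp (- (M / 2 * exp (\<kappa> * x))) \<le> c"
        using flat_times_exp_le[of "M / 2" \<kappa> 1 x] M \<kappa> by (simp add: c_def)
      ultimately show "exp (real n * x) * exp (- (M / 2 * exp (\<kappa> * x))) * (exp (real 1 * x) * exp (- (M / 2 * exp (\<kappa> * x)))) \<le> G n * c"
        using G0[of n] by (intro mult_mono) auto
    qed simp_all
    finally show ?thesis by (simp add: mult.assoc)
  qed
  have exp_int: "set_integrable lborel {a..} (\<lambda>x. exp (- x))" "(LINT x:{a..}|lborel. exp (- x)) = exp (- a)"
  proof -
    have hi: "((\<lambda>x. exp (- 1 * x)) has_integral exp (- 1 * a) / 1) {a..}"
      by (rule has_integral_exp_minus_to_infinity) simp
    then have "(\<lambda>x. exp (- 1 * x)) absolutely_integrable_on {a..}"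
      by (intro nonnegative_absolutely_integrable_1) auto
    then show si: "set_integrable lborel {a..} (\<lambda>x. exp (- x))"
      by (simp add: set_integrable_def integrable_completion)
    show "(LINT x:{a..}|lborel. exp (- x)) = exp (- a)"
      using set_borel_integral_eq_integral(2)[OF si] integral_unique[OF hi] by simp
  qed
  \<comment> \<open>integrals along the rays against a bounded factor\<close>
  have ray: "set_integrable lborel {a..} (\<lambda>x. \<Delta> i x * exp (of_nat n * p i x) * q x)"
    "cmod (LINT x:{a..}|lborel. \<Delta> i x * exp (of_nat n * p i x) * q x) \<le> K * G n * c * Q * exp (- a)"
    if i: "i < N" and q: "continuous_on {a..} q" "\<And>x. a \<le> x \<Longrightarrow> cmod (q x) \<le> Q" for i n q Q
  proof -
    have Q0: "0 \<le> Q" using order_trans[OF norm_ge_zero q(2)[of a]] by simp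
    have m: "set_borel_measurable lborel {a..} (\<lambda>x. \<Delta> i x * exp (of_nat n * p i x) * q x)"
      unfolding set_borel_measurable_def
    proof -
      have "continuous_on {a..} (\<lambda>x. \<Delta> i x * exp (of_nat n * p i x) * q x)"
        unfolding p_def Complex_eq by (intro continuous_intros q(1) cont\<Delta>[OF i])
      then show "(\<lambda>x. indicat_real {a..} x *\<^sub>R (\<Delta> i x * exp (of_nat n * p i x) * q x)) \<in> borel_measurable lborel"
        using borel_measurable_continuous_on_indicator[of "{a..}"] by simp
    qed
    have b: "cmod (\<Delta> i x * exp (of_nat n * p i x) * q x) \<le> K * G n * c * Q * exp (- x)" if "a \<le> x" for x
    proof -
      have "cmod (\<Delta> i x * exp (of_nat n * p i x) * q x) \<le> (K * G n * c * exp (- x)) * Q"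
        unfolding norm_mult[of _ "q x"] using \<Delta>b[OF i that, of n] q(2)[OF that] K G0[of n] c0
        by (intro mult_mono) auto
      then show ?thesis by (simp add: mult_ac)
    qed
    have bi: "set_integrable lborel {a..} (\<lambda>x. K * G n * c * Q * exp (- x))"
      using exp_int(1) by (rule set_integrable_mult_right)
    show si: "set_integrable lborel {a..} (\<lambda>x. \<Delta> i x * exp (of_nat n * p i x) * q x)"
      by (rule set_integrable_bound[OF bi m]) (use b K G0[of n] c0 Q0 in \<open>auto intro!: AE_I2\<close>)
    have "cmod (LINT x:{a..}|lborel. \<Delta> i x * exp (of_nat n * p i x) * q x) \<le> (LINT x:{a..}|lborel. K * G n * c * Q * exp (- x))"
      unfolding set_lebesgue_integral_def
      by (rule Bochner_Integration.integral_norm_bound_integral)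
        (use si bi b in \<open>auto simp: set_integrable_def indicator_def\<close>)
    also have "\<dots> = K * G n * c * Q * exp (- a)"
      using exp_int(2) by (simp only: set_integral_mult_right)
    finally show "cmod (LINT x:{a..}|lborel. \<Delta> i x * exp (of_nat n * p i x) * q x) \<le> K * G n * c * Q * exp (- a)" .
  qed
  have contV: "continuous_on {\<psi> i..\<psi> (Suc i)} (\<lambda>y. f i (Complex x y))" if "i < N" "s < x" for i x
    by (rule continuous_on_compose2[OF holomorphic_on_imp_continuous_on[OF hol[OF that(1)]]])
      (use that(2) \<eta> in \<open>auto simp: Complex_eq intro!: continuous_intros\<close>)
  define h where "h m = ((\<Sum>i<N. LINT x:{a..}|lborel. \<Delta> i x * exp (of_nat m * p i x))
     + \<i> * (\<Sum>i<N. integral {\<psi> i..\<psi> (Suc i)} (\<lambda>y. f i (Complex a y) * exp (of_nat m * Complex a y)))) / (2 * pi * \<i>)" for m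
  show ?thesis
  proof (intro exI[of _ h] allI impI)
    fix n w assume w: "a + ln 2 \<le> Re w" "\<psi> 0 + \<eta> < Im w" "Im w < \<psi> 1 - \<eta>"
    define \<epsilon> where "\<epsilon> = exp (- w)"
    have aw: "a < Re w" using w(1) ln_gt_zero[of 2] by linarith
    have X: "\<epsilon> * exp (Complex x y) = of_real (exp (x - Re w)) * cis (y - Im w)" for x y
    proof -
      have "\<epsilon> * exp (Complex x y) = exp (Complex x y - w)"
        by (simp add: \<epsilon>_def exp_minus exp_diff divide_inverse mult.commute)
      then show ?thesis by (simp add: exp_eq_polar)
    qed
    \<comment> \<open>on the rays the kernel is bounded because \<open>Im w\<close> keeps the distance \<open>\<eta>\<close> from all of them\<close>
    have kray: "sin \<eta> \<le> cmod (1 - \<epsilon> * exp (p i x))" if "i < N" for i x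
      unfolding X p_def
    proof (rule norm_one_minus_ge_sin[OF \<eta>])
      show "\<eta> \<le> \<psi> (Suc i) - Im w" using \<psi>le[of 1 "Suc i"] w by auto
      show "\<psi> (Suc i) - Im w \<le> 2 * pi - \<eta>" using \<psi>le[of "Suc i" N] that w \<psi>N by auto
    qed simp
    then have kray_nz: "1 - \<epsilon> * exp (p i x) \<noteq> 0" if "i < N" for i x
      using that sin\<eta> by (metis less_le_trans norm_zero less_irrefl)
    have kray_b: "cmod (ckernel \<epsilon> (p i x)) \<le> 1 / sin \<eta>" if "i < N" for i x
      unfolding ckernel_def norm_divide norm_one using kray[OF that, of x] kray_nz[OF that, of x] sin\<eta>
      by (intro divide_left_mono mult_pos_pos) auto
    have kray_c: "continuous_on A (\<lambda>x. ckernel \<epsilon> (p i x))" if "i < N" for i A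
      using kray_nz[OF that] unfolding ckernel_def p_def Complex_eq by (intro continuous_intros) auto
    have Xa: "cmod (\<epsilon> * exp (Complex a y)) \<le> 1 / 2" for y
    proof -
      have "exp (a - Re w) \<le> exp (- ln 2)" using w(1) by simp
      then show ?thesis by (simp add: X norm_mult exp_minus)
    qed
    \<comment> \<open>on the left sides it is bounded because \<open>\<epsilon>\<close> is at most half the radius of the circle \<open>Re v = a\<close>\<close>
    have kleft: "1 / 2 \<le> cmod (1 - \<epsilon> * exp (Complex a y))" for y
      using norm_triangle_ineq2[of 1 "\<epsilon> * exp (Complex a y)"] Xa[of y] by simp
    then have kleft_nz: "1 - \<epsilon> * exp (Complex a y) \<noteq> 0" for y
      by (metis norm_zero half_gt_zero_iff less_le_not_le zero_less_one)
    have kleft_b: "cmod (ckernel \<epsilon> (Complex a y)) \<le> 2" for y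
      unfolding ckernel_def norm_divide norm_one using kleft[of y] by (simp add: divide_simps)
    have kleft_c: "continuous_on A (\<lambda>y. ckernel \<epsilon> (Complex a y))" for A
      using kleft_nz unfolding ckernel_def Complex_eq by (intro continuous_intros) auto
    have right: "cmod (\<Sum>i<N. integral {\<psi> i..\<psi> (Suc i)} (\<lambda>y. f i (Complex Y y) * ckernel \<epsilon> (Complex Y y)))
        \<le> real N * (B / (exp (Y - Re w) - 1) * (2 * pi / real N))" if Y: "Re w < Y" for Y
    proof -
      have XY: "exp (Y - Re w) - 1 \<le> cmod (1 - \<epsilon> * exp (Complex Y y))" for y
        using norm_triangle_ineq2[of "\<epsilon> * exp (Complex Y y)" 1] by (simp add: X norm_mult norm_minus_commute)
      have eY: "0 < exp (Y - Re w) - 1" using Y by simp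
      have nz: "1 - \<epsilon> * exp (Complex Y y) \<noteq> 0" for y using XY[of y] eY by (metis less_le_trans norm_zero less_irrefl)
      have "cmod (integral {\<psi> i..\<psi> (Suc i)} (\<lambda>y. f i (Complex Y y) * ckernel \<epsilon> (Complex Y y)))
          \<le> B / (exp (Y - Re w) - 1) * (\<psi> (Suc i) - \<psi> i)" if i: "i < N" for i
      proof (rule integral_bound)
        show "continuous_on {\<psi> i..\<psi> (Suc i)} (\<lambda>y. f i (Complex Y y) * ckernel \<epsilon> (Complex Y y))"
          using nz Y aw sa unfolding ckernel_def
          by (intro continuous_intros contV i) (auto simp: Complex_eq intro!: continuous_intros)
        fix y assume y: "y \<in> {\<psi> i..\<psi> (Suc i)}"
        have "cmod (f i (Complex Y y) * ckernel \<epsilon> (Complex Y y)) \<le> B * (1 / (exp (Y - Re w) - 1))"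
          unfolding norm_mult
        proof (rule mult_mono)
          show "cmod (f i (Complex Y y)) \<le> B" using y Y aw sa by (intro bnd i) auto
          show "cmod (ckernel \<epsilon> (Complex Y y)) \<le> 1 / (exp (Y - Re w) - 1)"
            unfolding ckernel_def norm_divide norm_one using XY[of y] eY nz[of y] by (intro divide_left_mono mult_pos_pos) auto
        qed (use B0 in auto)
        then show "cmod (f i (Complex Y y) * ckernel \<epsilon> (Complex Y y)) \<le> B / (exp (Y - Re w) - 1)" by simp
      qed (rule \<psi>le, simp)
      then have "cmod (integral {\<psi> i..\<psi> (Suc i)} (\<lambda>y. f i (Complex Y y) * ckernel \<epsilon> (Complex Y y)))
          \<le> B / (exp (Y - Re w) - 1) * (2 * pi / real N)" if "i < N" for i using that by (simp add: \<psi>S)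
      then have "cmod (\<Sum>i<N. integral {\<psi> i..\<psi> (Suc i)} (\<lambda>y. f i (Complex Y y) * ckernel \<epsilon> (Complex Y y)))
        \<le> (\<Sum>i<N. B / (exp (Y - Re w) - 1) * (2 * pi / real N))" by (intro sum_norm_le) auto
      then show ?thesis by simp
    qed
    define L where "L = 2 * pi * \<i> * f 0 w - \<i> * (\<Sum>i<N. integral {\<psi> i..\<psi> (Suc i)} (\<lambda>y. f i (Complex a y) * ckernel \<epsilon> (Complex a y)))"
    have rayint: "set_integrable lborel {a..} (\<lambda>x. \<Delta> i x * ckernel \<epsilon> (p i x))" if "i < N" for i
      using ray(1)[OF that kray_c[OF that] kray_b[OF that], of 0] by simp
    \<comment> \<open>the right sides of the rectangles move off to infinity\<close>
    have L1: "((\<lambda>Y. \<Sum>i<N. integral {a..Y} (\<lambda>x. \<Delta> i x * ckernel \<epsilon> (p i x))) \<longlongrightarrow> L) at_top"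
    proof -
      have "((\<lambda>Y. (\<Sum>i<N. integral {a..Y} (\<lambda>x. \<Delta> i x * ckernel \<epsilon> (p i x))) - L) \<longlongrightarrow> 0) at_top"
      proof (rule Lim_null_comparison)
        show "((\<lambda>Y. real N * (B / (exp (Y - Re w) - 1) * (2 * pi / real N))) \<longlongrightarrow> 0) at_top" by real_asymp
        show "eventually (\<lambda>Y. norm ((\<Sum>i<N. integral {a..Y} (\<lambda>x. \<Delta> i x * ckernel \<epsilon> (p i x))) - L)
            \<le> real N * (B / (exp (Y - Re w) - 1) * (2 * pi / real N))) at_top"
          using eventually_gt_at_top[of "Re w"]
        proof eventually_elim
          case (elim Y)
          from cauchy_formula_jumps[OF \<psi>_def N \<eta> sa hol per aw elim w(2,3) \<epsilon>_def]
          have "(\<Sum>i<N. integral {a..Y} (\<lambda>x. \<Delta> i x * ckernel \<epsilon> (p i x))) - L =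
             \<i> * (\<Sum>i<N. integral {\<psi> i..\<psi> (Suc i)} (\<lambda>y. f i (Complex Y y) * ckernel \<epsilon> (Complex Y y)))"
            by (simp add: L_def \<Delta>_def p_def)
          then show ?case using right[OF elim] by (simp add: norm_mult)
        qed
      qed
      then show ?thesis by (simp add: LIM_zero_iff)
    qed
    have L2: "((\<lambda>Y. \<Sum>i<N. integral {a..Y} (\<lambda>x. \<Delta> i x * ckernel \<epsilon> (p i x))) \<longlongrightarrow>
        (\<Sum>i<N. LINT x:{a..}|lborel. \<Delta> i x * ckernel \<epsilon> (p i x))) at_top"
    proof (intro tendsto_sum)
      fix i assume "i \<in> {..<N}"
      then have i: "i < N" by simp
      have "((\<lambda>Y. LINT x:{a..Y}|lborel. \<Delta> i x * ckernel \<epsilon> (p i x)) \<longlongrightarrow> (LINT x:{a..}|lborel. \<Delta> i x * ckernel \<epsilon> (p i x))) at_top"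
        by (rule tendsto_set_lebesgue_integral_at_top[OF _ rayint[OF i]]) simp
      moreover have "(LINT x:{a..Y}|lborel. \<Delta> i x * ckernel \<epsilon> (p i x)) = integral {a..Y} (\<lambda>x. \<Delta> i x * ckernel \<epsilon> (p i x))" for Y
        by (rule set_borel_integral_eq_integral(2), rule set_integrable_subset[OF rayint[OF i]]) auto
      ultimately show "((\<lambda>Y. integral {a..Y} (\<lambda>x. \<Delta> i x * ckernel \<epsilon> (p i x))) \<longlongrightarrow> (LINT x:{a..}|lborel. \<Delta> i x * ckernel \<epsilon> (p i x))) at_top"
        by simp
    qed
    have L: "L = (\<Sum>i<N. LINT x:{a..}|lborel. \<Delta> i x * ckernel \<epsilon> (p i x))"
      by (rule tendsto_unique[OF _ L1 L2]) simp
    have rexp: "(LINT x:{a..}|lborel. \<Delta> i x * ckernel \<epsilon> (p i x)) =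
       (\<Sum>m<n. \<epsilon> ^ m * (LINT x:{a..}|lborel. \<Delta> i x * exp (of_nat m * p i x)))
       + \<epsilon> ^ n * (LINT x:{a..}|lborel. \<Delta> i x * exp (of_nat n * p i x) * ckernel \<epsilon> (p i x))" if i: "i < N" for i
    proof -
      have i1: "set_integrable lborel {a..} (\<lambda>x. \<Delta> i x * exp (of_nat m * p i x))" for m
        using ray(1)[OF i, of "\<lambda>x. 1" 1 m] by simp
      note i1m = set_integrable_mult_right[OF i1, unfolded set_integrable_def]
      have i3: "set_integrable lborel {a..} (\<lambda>x. \<Sum>m<n. \<epsilon> ^ m * (\<Delta> i x * exp (of_nat m * p i x)))"
        unfolding set_integrable_def scaleR_sum_right
        by (rule Bochner_Integration.integrable_sum) (rule i1m)
      have i2: "set_integrable lborel {a..} (\<lambda>x. \<Delta> i x * exp (of_nat n * p i x) * ckernel \<epsilon> (p i x))"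
        by (rule ray(1)[OF i kray_c[OF i] kray_b[OF i]])
      have "\<Delta> i x * ckernel \<epsilon> (p i x) = (\<Sum>m<n. \<epsilon> ^ m * (\<Delta> i x * exp (of_nat m * p i x)))
          + \<epsilon> ^ n * (\<Delta> i x * exp (of_nat n * p i x) * ckernel \<epsilon> (p i x))" for x
        by (subst ckernel_expansion[OF kray_nz[OF i], of _ n]) (simp add: distrib_left sum_distrib_left mult_ac)
      then have "(LINT x:{a..}|lborel. \<Delta> i x * ckernel \<epsilon> (p i x)) = (LINT x:{a..}|lborel. (\<Sum>m<n. \<epsilon> ^ m * (\<Delta> i x * exp (of_nat m * p i x)))
          + \<epsilon> ^ n * (\<Delta> i x * exp (of_nat n * p i x) * ckernel \<epsilon> (p i x)))" by simp
      also have "\<dots> = (LINT x:{a..}|lborel. (\<Sum>m<n. \<epsilon> ^ m * (\<Delta> i x * exp (of_nat m * p i x))))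
          + (LINT x:{a..}|lborel. \<epsilon> ^ n * (\<Delta> i x * exp (of_nat n * p i x) * ckernel \<epsilon> (p i x)))"
        by (intro set_integral_add(2) set_integrable_mult_right i3 i2)
      also have "(LINT x:{a..}|lborel. (\<Sum>m<n. \<epsilon> ^ m * (\<Delta> i x * exp (of_nat m * p i x)))) =
          (\<Sum>m<n. LINT x:{a..}|lborel. \<epsilon> ^ m * (\<Delta> i x * exp (of_nat m * p i x)))"
        unfolding set_lebesgue_integral_def scaleR_sum_right
        by (rule Bochner_Integration.integral_sum) (rule i1m)
      finally show ?thesis by (simp only: set_integral_mult_right)
    qed
    have vexp: "integral {\<psi> i..\<psi> (Suc i)} (\<lambda>y. f i (Complex a y) * ckernel \<epsilon> (Complex a y)) =
       (\<Sum>m<n. \<epsilon> ^ m * integral {\<psi> i..\<psi> (Suc i)} (\<lambda>y. f i (Complex a y) * exp (of_nat m * Complex a y)))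
       + \<epsilon> ^ n * integral {\<psi> i..\<psi> (Suc i)} (\<lambda>y. f i (Complex a y) * exp (of_nat n * Complex a y) * ckernel \<epsilon> (Complex a y))" if i: "i < N" for i
    proof -
      have i1: "(\<lambda>y. f i (Complex a y) * exp (of_nat m * Complex a y)) integrable_on {\<psi> i..\<psi> (Suc i)}" for m
        unfolding Complex_eq
        by (intro integrable_continuous_interval continuous_intros contV[OF i sa, unfolded Complex_eq])
      have i2: "(\<lambda>y. f i (Complex a y) * exp (of_nat n * Complex a y) * ckernel \<epsilon> (Complex a y)) integrable_on {\<psi> i..\<psi> (Suc i)}"
        unfolding Complex_eq
        by (intro integrable_continuous_interval continuous_intros contV[OF i sa, unfolded Complex_eq] kleft_c[unfolded Complex_eq])
      have "f i (Complex a y) * ckernel \<epsilon> (Complex a y) = (\<Sum>m<n. \<epsilon> ^ m * (f i (Complex a y) * exp (of_nat m * Complex a y)))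
          + \<epsilon> ^ n * (f i (Complex a y) * exp (of_nat n * Complex a y) * ckernel \<epsilon> (Complex a y))" for y
        by (subst ckernel_expansion[OF kleft_nz, of _ n]) (simp add: distrib_left sum_distrib_left mult_ac)
      then have "integral {\<psi> i..\<psi> (Suc i)} (\<lambda>y. f i (Complex a y) * ckernel \<epsilon> (Complex a y))
         = integral {\<psi> i..\<psi> (Suc i)} (\<lambda>y. (\<Sum>m<n. \<epsilon> ^ m * (f i (Complex a y) * exp (of_nat m * Complex a y)))
          + \<epsilon> ^ n * (f i (Complex a y) * exp (of_nat n * Complex a y) * ckernel \<epsilon> (Complex a y)))" by simp
      also have "\<dots> = integral {\<psi> i..\<psi> (Suc i)} (\<lambda>y. \<Sum>m<n. \<epsilon> ^ m * (f i (Complex a y) * exp (of_nat m * Complex a y)))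
          + integral {\<psi> i..\<psi> (Suc i)} (\<lambda>y. \<epsilon> ^ n * (f i (Complex a y) * exp (of_nat n * Complex a y) * ckernel \<epsilon> (Complex a y)))"
        by (intro Henstock_Kurzweil_Integration.integral_add integrable_sum integrable_on_mult_right i1 i2) auto
      also have "integral {\<psi> i..\<psi> (Suc i)} (\<lambda>y. \<Sum>m<n. \<epsilon> ^ m * (f i (Complex a y) * exp (of_nat m * Complex a y)))
         = (\<Sum>m<n. integral {\<psi> i..\<psi> (Suc i)} (\<lambda>y. \<epsilon> ^ m * (f i (Complex a y) * exp (of_nat m * Complex a y))))"
        by (intro Henstock_Kurzweil_Integration.integral_sum integrable_on_mult_right i1) auto
      finally show ?thesis by (simp only: Henstock_Kurzweil_Integration.integral_mult_right)
    qed
    define r1 where "r1 i = (LINT x:{a..}|lborel. \<Delta> i x * exp (of_nat n * p i x) * ckernel \<epsilon> (p i x))" for i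
    define r2 where "r2 i = integral {\<psi> i..\<psi> (Suc i)} (\<lambda>y. f i (Complex a y) * exp (of_nat n * Complex a y) * ckernel \<epsilon> (Complex a y))" for i
    have swap: "(\<Sum>i<N. \<Sum>m<n. \<epsilon> ^ m * H m i) = (\<Sum>m<n. \<epsilon> ^ m * (\<Sum>i<N. H m i))" for H :: "nat \<Rightarrow> nat \<Rightarrow> complex"
      by (subst sum.swap) (simp add: sum_distrib_left)
    define a1 where "a1 m = (\<Sum>i<N. LINT x:{a..}|lborel. \<Delta> i x * exp (of_nat m * p i x))" for m
    define a2 where "a2 m = (\<Sum>i<N. integral {\<psi> i..\<psi> (Suc i)} (\<lambda>y. f i (Complex a y) * exp (of_nat m * Complex a y)))" for m
    have hm: "2 * pi * \<i> * h m = a1 m + \<i> * a2 m" for m by (simp add: h_def a1_def a2_def)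
    have hs: "(\<Sum>m<n. \<epsilon> ^ m * (2 * pi * \<i> * h m)) = (\<Sum>m<n. \<epsilon> ^ m * a1 m) + \<i> * (\<Sum>m<n. \<epsilon> ^ m * a2 m)"
      by (simp only: hm distrib_left sum.distrib sum_distrib_left mult.left_commute)
    have "2 * pi * \<i> * f 0 w = L + \<i> * (\<Sum>i<N. integral {\<psi> i..\<psi> (Suc i)} (\<lambda>y. f i (Complex a y) * ckernel \<epsilon> (Complex a y)))"
      by (simp add: L_def)
    also have "\<dots> = (\<Sum>i<N. (\<Sum>m<n. \<epsilon> ^ m * (LINT x:{a..}|lborel. \<Delta> i x * exp (of_nat m * p i x))) + \<epsilon> ^ n * r1 i)
      + \<i> * (\<Sum>i<N. (\<Sum>m<n. \<epsilon> ^ m * integral {\<psi> i..\<psi> (Suc i)} (\<lambda>y. f i (Complex a y) * exp (of_nat m * Complex a y))) + \<epsilon> ^ n * r2 i)"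
      unfolding L r1_def r2_def by (simp add: rexp vexp)
    also have "\<dots> = (\<Sum>m<n. \<epsilon> ^ m * (2 * pi * \<i> * h m)) + \<epsilon> ^ n * ((\<Sum>i<N. r1 i) + \<i> * (\<Sum>i<N. r2 i))"
      unfolding hs sum.distrib swap a1_def[symmetric] a2_def[symmetric] sum_distrib_left[of "\<epsilon> ^ n", symmetric]
      by (simp add: distrib_left)
    finally have E: "2 * pi * \<i> * (f 0 w - (\<Sum>m<n. h m * \<epsilon> ^ m)) = \<epsilon> ^ n * ((\<Sum>i<N. r1 i) + \<i> * (\<Sum>i<N. r2 i))"
      by (simp add: right_diff_distrib sum_distrib_left mult_ac)
    have r1b: "cmod (r1 i) \<le> K * G n * c * (1 / sin \<eta>) * exp (- a)" if "i < N" for i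
      unfolding r1_def by (rule ray(2)[OF that kray_c[OF that] kray_b[OF that]])
    have r2b: "cmod (r2 i) \<le> B * exp (real n * a) * 2 * (2 * pi / real N)" if i: "i < N" for i
    proof -
      have "cmod (r2 i) \<le> B * exp (real n * a) * 2 * (\<psi> (Suc i) - \<psi> i)"
        unfolding r2_def
      proof (rule integral_bound)
        show "continuous_on {\<psi> i..\<psi> (Suc i)} (\<lambda>y. f i (Complex a y) * exp (of_nat n * Complex a y) * ckernel \<epsilon> (Complex a y))"
          unfolding Complex_eq
          by (intro continuous_intros contV[OF i sa, unfolded Complex_eq] kleft_c[unfolded Complex_eq])
        fix y assume y: "y \<in> {\<psi> i..\<psi> (Suc i)}"
        show "cmod (f i (Complex a y) * exp (of_nat n * Complex a y) * ckernel \<epsilon> (Complex a y)) \<le> B * exp (real n * a) * 2"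
          unfolding norm_mult using y sa kleft_b B0 by (intro mult_mono bnd i) auto
      qed (rule \<psi>le, simp)
      then show ?thesis by (simp add: \<psi>S)
    qed
    have "2 * pi * cmod (f 0 w - (\<Sum>m<n. h m * \<epsilon> ^ m)) = cmod \<epsilon> ^ n * cmod ((\<Sum>i<N. r1 i) + \<i> * (\<Sum>i<N. r2 i))"
      using arg_cong[OF E, of cmod] by (simp add: norm_mult norm_power)
    also have "\<dots> \<le> cmod \<epsilon> ^ n * (real N * (K * G n * c * (1 / sin \<eta>) * exp (- a)) + real N * (B * exp (real n * a) * 2 * (2 * pi / real N)))"
    proof (intro mult_left_mono order_trans[OF norm_triangle_ineq] add_mono)
      have "cmod (\<Sum>i<N. r1 i) \<le> (\<Sum>i<N. K * G n * c * (1 / sin \<eta>) * exp (- a))" using r1b by (intro sum_norm_le) auto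
      then show "cmod (\<Sum>i<N. r1 i) \<le> real N * (K * G n * c * (1 / sin \<eta>) * exp (- a))" by simp
      have "cmod (\<Sum>i<N. r2 i) \<le> (\<Sum>i<N. B * exp (real n * a) * 2 * (2 * pi / real N))" using r2b by (intro sum_norm_le) auto
      then show "cmod (\<i> * (\<Sum>i<N. r2 i)) \<le> real N * (B * exp (real n * a) * 2 * (2 * pi / real N))" by (simp add: norm_mult)
    qed auto
    also have "real N * (B * exp (real n * a) * 2 * (2 * pi / real N)) = 4 * pi * B * exp (real n * a)" using N by simp
    finally have F: "2 * pi * cmod (f 0 w - (\<Sum>m<n. h m * \<epsilon> ^ m)) \<le> cmod \<epsilon> ^ n * (real N * K * exp (- a) * c / sin \<eta> * G n + 4 * pi * B * exp (real n * a))"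
      by (simp add: mult_ac)
    define A1 where "A1 = (M / 2) powr - (1 / \<kappa>) + exp a"
    define g where "g = Gamma (1 + real n / \<kappa>)"
    have g0: "0 < g" unfolding g_def using \<kappa> by (intro Gamma_real_pos add_pos_nonneg) auto
    have "(M / 2) powr - (real n / \<kappa>) = ((M / 2) powr - (1 / \<kappa>)) ^ n"
      using M by (simp add: powr_realpow[symmetric] powr_powr)
    then have Gn: "G n \<le> A1 ^ n * g"
      unfolding G_def g_def[symmetric] A1_def using g0 by (auto intro!: mult_right_mono power_mono)
    have "1 \<le> 4 * g" using Gamma_le_Gamma[of 0 "real n / \<kappa>"] \<kappa> by (simp add: g_def)
    moreover have "exp (real n * a) = exp a ^ n" by (rule exp_of_nat_mult)
    moreover have "exp a ^ n \<le> A1 ^ n" unfolding A1_def by (intro power_mono) auto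
    ultimately have en: "exp (real n * a) \<le> A1 ^ n * (4 * g)"
      using mult_mono[of "exp a ^ n" "A1 ^ n" 1 "4 * g"] by (simp add: A1_def)
    have C1: "0 \<le> real N * K * exp (- a) * c / sin \<eta>" using K c0 sin\<eta> by simp
    have "real N * K * exp (- a) * c / sin \<eta> * G n + 4 * pi * B * exp (real n * a)
      \<le> real N * K * exp (- a) * c / sin \<eta> * (A1 ^ n * g) + 4 * pi * B * (A1 ^ n * (4 * g))"
      using C1 B0 by (intro add_mono mult_left_mono Gn en) auto
    also have "\<dots> = (real N * K * exp (- a) * c / sin \<eta> + 16 * pi * B) * A1 ^ n * g" by (simp add: algebra_simps)
    finally have "cmod \<epsilon> ^ n * (real N * K * exp (- a) * c / sin \<eta> * G n + 4 * pi * B * exp (real n * a)) \<le>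
       cmod \<epsilon> ^ n * ((real N * K * exp (- a) * c / sin \<eta> + 16 * pi * B) * A1 ^ n * g)"
      by (rule mult_left_mono) simp
    moreover have "1 * cmod (f 0 w - (\<Sum>m<n. h m * \<epsilon> ^ m)) \<le> 2 * pi * cmod (f 0 w - (\<Sum>m<n. h m * \<epsilon> ^ m))"
      using pi_ge_two by (intro mult_right_mono) auto
    ultimately have "cmod (f 0 w - (\<Sum>m<n. h m * \<epsilon> ^ m)) \<le> (real N * K * exp (- a) * c / sin \<eta> + 16 * pi * B) * A1 ^ n * g * cmod \<epsilon> ^ n"
      using F by (simp add: mult.commute)
    then show "cmod (f 0 w - (\<Sum>m<n. h m * exp (- w) ^ m)) \<le>
      (real N * K * exp (- a) * ((M / 2) powr - (1 / \<kappa>) * Gamma (1 + 1 / \<kappa>)) / sin \<eta> + 16 * pi * B) *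
      ((M / 2) powr - (1 / \<kappa>) + exp a) ^ n * Gamma (1 + real n / \<kappa>) * cmod (exp (- w)) ^ n"
      unfolding \<epsilon>_def A1_def c_def g_def .
  qed
qed

section \<open>The Ramis--Sibuya theorem\<close>

lemma dist_cis_le: "dist (cis a) (cis b) \<le> \<bar>a - b\<bar>"
proof -
  have "cis a - cis b = cis b * (exp (\<i> * complex_of_real (a - b)) - 1)"
  proof -
    have "cis b * exp (\<i> * complex_of_real (a - b)) = cis a"
      by (simp only: cis_conv_exp[symmetric] cis_mult) simp
    then show ?thesis by (simp only: right_diff_distrib mult_1_right)
  qed
  then have "dist (cis a) (cis b) = 2 * \<bar>sin ((a - b) / 2)\<bar>"
    by (simp only: dist_norm norm_mult norm_cis dist_exp_i_1)
  also have "\<dots> \<le> 2 * \<bar>(a - b) / 2\<bar>" by (intro mult_left_mono abs_sin_x_le_abs_x) auto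
  finally show ?thesis by simp
qed

text \<open>Uniqueness of asymptotic expansions, along a single ray.\<close>

lemma asymptotic_coeff_zero:
  fixes a :: "nat \<Rightarrow> complex"
  assumes est: "\<And>n. \<exists>C. \<forall>t. 0 < t \<longrightarrow> t < r \<longrightarrow> cmod (\<Sum>m<n. a m * (complex_of_real t * \<omega>) ^ m) \<le> C * t ^ n"
    and "0 < r" "cmod \<omega> = 1"
  shows "a m = 0"
proof (induction m rule: less_induct)
  case (less m)
  obtain C where C: "\<And>t. 0 < t \<Longrightarrow> t < r \<Longrightarrow> cmod (\<Sum>i<Suc m. a i * (complex_of_real t * \<omega>) ^ i) \<le> C * t ^ Suc m"
    using est by blast
  have le: "cmod (a m) \<le> C * t" if t: "0 < t" "t < r" for t
  proof -
    have "(\<Sum>i<Suc m. a i * (complex_of_real t * \<omega>) ^ i) = a m * (complex_of_real t * \<omega>) ^ m"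
      using less by simp
    then have "cmod (a m) * t ^ m \<le> C * t ^ Suc m"
      using C[OF t] t assms(3) by (simp add: norm_mult norm_power power_mult_distrib)
    then show ?thesis using t by (simp add: mult.left_commute mult.commute)
  qed
  have "((\<lambda>t. C * t) \<longlongrightarrow> C * 0) (at_right 0)" by (intro tendsto_intros)
  moreover have "eventually (\<lambda>t. cmod (a m) \<le> C * t) (at_right 0)"
    using eventually_at_right_less[of 0] eventually_at_right_real[OF \<open>0 < r\<close>]
    by eventually_elim (use le in auto)
  ultimately have "cmod (a m) \<le> C * 0"
    by (intro tendsto_lowerbound[of "\<lambda>t. C * t" _ "at_right 0"]) auto
  then show ?case by simp
qed

text \<open>The coefficient is a difference of two consecutive remainders, divided by the power, in the limit.\<close>

lemma asymptotic_coeff_bound: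
  fixes h :: "nat \<Rightarrow> complex"
  assumes est: "\<And>n t. 0 < t \<Longrightarrow> t < r \<Longrightarrow>
      cmod (G t - (\<Sum>m<n. h m * (complex_of_real t * \<omega>) ^ m)) \<le> c n * t ^ n"
    and "0 < r" "cmod \<omega> = 1"
  shows "cmod (h m) \<le> c m"
proof -
  have le: "cmod (h m) \<le> c m + c (Suc m) * t" if t: "0 < t" "t < r" for t
  proof -
    have "h m * (complex_of_real t * \<omega>) ^ m =
        (G t - (\<Sum>i<m. h i * (complex_of_real t * \<omega>) ^ i)) - (G t - (\<Sum>i<Suc m. h i * (complex_of_real t * \<omega>) ^ i))"
      by simp
    then have "cmod (h m * (complex_of_real t * \<omega>) ^ m) \<le> c m * t ^ m + c (Suc m) * t ^ Suc m"
      by (simp only:) (intro order_trans[OF norm_triangle_ineq4] add_mono est t)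
    then have "cmod (h m) * t ^ m \<le> (c m + c (Suc m) * t) * t ^ m"
      using t assms(3) by (simp add: norm_mult norm_power power_mult_distrib algebra_simps)
    then show ?thesis using t by simp
  qed
  have "((\<lambda>t. c m + c (Suc m) * t) \<longlongrightarrow> c m + c (Suc m) * 0) (at_right 0)" by (intro tendsto_intros)
  moreover have "eventually (\<lambda>t. cmod (h m) \<le> c m + c (Suc m) * t) (at_right 0)"
    using eventually_at_right_less[of 0] eventually_at_right_real[OF \<open>0 < r\<close>]
    by eventually_elim (use le in auto)
  ultimately have "cmod (h m) \<le> c m + c (Suc m) * 0"
    by (intro tendsto_lowerbound[of "\<lambda>t. c m + c (Suc m) * t" _ "at_right 0"]) auto
  then show ?thesis by simp
qed

lemma flat_le_gevrey:
  assumes "0 < M" "0 < \<kappa>" "e \<noteq> 0"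
  shows "exp (- (M * cmod e powr - \<kappa>)) \<le> (M powr - (1 / \<kappa>)) ^ n * Gamma (1 + real n / \<kappa>) * cmod e ^ n"
proof -
  define x where "x = - ln (cmod e)"
  have ex: "exp (real n * x) = inverse (cmod e ^ n)"
    using assms by (simp add: x_def exp_minus exp_of_nat_mult)
  have "cmod e powr - \<kappa> = exp (\<kappa> * x)" using assms by (simp add: x_def powr_def)
  then have "exp (real n * x) * exp (- (M * cmod e powr - \<kappa>)) \<le> M powr - (real n / \<kappa>) * Gamma (1 + real n / \<kappa>)"
    using flat_times_exp_le[OF assms(1,2), of n x] by simp
  moreover have "M powr - (real n / \<kappa>) = (M powr - (1 / \<kappa>)) ^ n"
    using assms by (simp add: powr_realpow[symmetric] powr_powr)
  ultimately show ?thesis unfolding ex using assms by (simp add: field_simps)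
qed

text \<open>Enough arcs of the circle of equal length, each with some room inside one of the sectors, give a jump
  formula with uniform constants whose first arc is centred at any prescribed direction.\<close>

lemma local_expansion:
  fixes F :: "nat \<Rightarrow> complex \<Rightarrow> 'x \<Rightarrow> complex"
  assumes \<kappa>: "0 < \<kappa>" and \<rho>: "0 < \<rho>" and K: "0 \<le> K" and M: "0 < M"
    and cover: "UNIV - {0} \<subseteq> (\<Union>p<n. unbounded_sector (d p) (\<theta> p))"
    and hol: "\<And>p x. p < n \<Longrightarrow> x \<in> D \<Longrightarrow> (\<lambda>e. F p e x) holomorphic_on sector (d p) (\<theta> p) \<rho>"
    and bnd: "\<And>p e x. p < n \<Longrightarrow> e \<in> sector (d p) (\<theta> p) \<rho> \<Longrightarrow> x \<in> D \<Longrightarrow> cmod (F p e x) \<le> B"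
    and flat: "\<And>p q e x. p < n \<Longrightarrow> q < n \<Longrightarrow> e \<in> sector (d p) (\<theta> p) \<rho> \<Longrightarrow> e \<in> sector (d q) (\<theta> q) \<rho> \<Longrightarrow> x \<in> D \<Longrightarrow>
      cmod (F p e x - F q e x) \<le> K * exp (- (M * cmod e powr - \<kappa>))"
  shows "\<exists>C A R \<eta>. 0 < A \<and> 0 < \<eta> \<and> (\<forall>\<psi>. \<forall>x\<in>D. \<exists>h. \<forall>j w q. R \<le> Re w \<longrightarrow> \<bar>Im w - \<psi>\<bar> < \<eta> \<longrightarrow>
    q < n \<longrightarrow> exp (- w) \<in> sector (d q) (\<theta> q) \<rho> \<longrightarrow>
    cmod (F q (exp (- w)) x - (\<Sum>m<j. h m * exp (- w) ^ m)) \<le> C * A ^ j * Gamma (1 + real j / \<kappa>) * cmod (exp (- w)) ^ j)"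
proof -
  define U where "U p = unbounded_sector (d p) (\<theta> p)" for p
  have "sphere (0::complex) 1 \<subseteq> UNIV - {0}" by auto
  also note cover
  also have "(\<Union>p<n. unbounded_sector (d p) (\<theta> p)) = \<Union> (U ` {..<n})" by (simp add: U_def)
  finally have "sphere 0 1 \<subseteq> \<Union> (U ` {..<n})" .
  moreover have "open G" if "G \<in> U ` {..<n}" for G
    using that by (auto simp: U_def open_unbounded_sector)
  ultimately obtain \<delta> where \<delta>: "0 < \<delta>" "\<And>z. z \<in> sphere 0 1 \<Longrightarrow> \<exists>G\<in>U ` {..<n}. ball z \<delta> \<subseteq> G"
    using Heine_Borel_lemma[OF compact_sphere] by metis
  \<comment> \<open>Lebesgue number: arcs of length \<open>2 pi / N\<close> lie in a single sector with room to spare\<close>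
  define N where "N = nat \<lceil>2 * pi / \<delta>\<rceil> + 2"
  have N: "2 \<le> N" by (simp add: N_def)
  have "2 * pi / \<delta> < real N" unfolding N_def by linarith
  then have N\<delta>: "2 * pi / real N < \<delta>" using \<delta>(1) N by (simp add: field_simps)
  define \<eta> where "\<eta> = pi / (4 * real N)"
  have N0: "0 < real N" using N by simp
  have \<eta>: "0 < \<eta>" "\<eta> \<le> pi / 2" using N by (auto simp: \<eta>_def field_simps)
  have \<eta>N: "pi / real N = 4 * \<eta>" by (simp add: \<eta>_def)
  define s where "s = - ln \<rho>"
  define a where "a = s + 1"
  define C where "C = real N * K * exp (- a) * ((M / 2) powr - (1 / \<kappa>) * Gamma (1 + 1 / \<kappa>)) / sin \<eta> + 16 * pi * \<bar>B\<bar>"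
  define A where "A = (M / 2) powr - (1 / \<kappa>) + exp a"
  define A' where "A' = A + M powr - (1 / \<kappa>)"
  have A0: "0 < A" "0 < A'" by (simp_all add: A_def A'_def add_pos_pos add_nonneg_pos add_pos_nonneg)
  have C0: "0 \<le> C"
  proof -
    have "0 < sin \<eta>" using \<eta> by (intro sin_gt_zero) auto
    moreover have "0 < Gamma (1 + 1 / \<kappa>)" using \<kappa> by (intro Gamma_real_pos add_pos_pos) auto
    ultimately show ?thesis using K by (simp add: C_def)
  qed
  \<comment> \<open>on the first arc \<open>f 0\<close> expands; any other \<open>F q\<close> defined there differs from it by a flat function\<close>
  have "\<exists>h. \<forall>j w q. a + ln 2 \<le> Re w \<longrightarrow> \<bar>Im w - \<psi>c\<bar> < 3 * \<eta> \<longrightarrow>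
    q < n \<longrightarrow> exp (- w) \<in> sector (d q) (\<theta> q) \<rho> \<longrightarrow>
    cmod (F q (exp (- w)) x - (\<Sum>m<j. h m * exp (- w) ^ m)) \<le> (C + K) * A' ^ j * Gamma (1 + real j / \<kappa>) * cmod (exp (- w)) ^ j"
    if x: "x \<in> D" for \<psi>c x
  proof -
    define \<psi> where "\<psi> i = (\<psi>c - pi / real N) + 2 * pi * real i / real N" for i :: nat
    have \<psi>S: "\<psi> (Suc i) = \<psi> i + 8 * \<eta>" for i
      using \<eta>N by (simp add: \<psi>_def add_divide_distrib distrib_left \<eta>_def)
    have \<psi>0: "\<psi> 0 = \<psi>c - 4 * \<eta>" by (simp add: \<psi>_def \<eta>N)
    have \<psi>N: "\<psi> N = \<psi> 0 + 2 * pi" using N by (simp add: \<psi>_def)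
    have "\<exists>p<n. ball (cis (- (\<psi> i + 4 * \<eta>))) \<delta> \<subseteq> U p" for i
      using \<delta>(2)[of "cis (- (\<psi> i + 4 * \<eta>))"] by auto
    then obtain P0 where P0: "\<And>i. P0 i < n" "\<And>i. ball (cis (- (\<psi> i + 4 * \<eta>))) \<delta> \<subseteq> U (P0 i)"
      by metis
    define P where "P i = (if i = N then P0 0 else P0 i)" for i
    have Pn: "P i < n" for i by (simp add: P_def P0)
    have inS: "exp (- v) \<in> sector (d (P i)) (\<theta> (P i)) \<rho>"
      if i: "i < N" and v: "s < Re v" "\<psi> i - \<eta> < Im v" "Im v < \<psi> (Suc i) + \<eta>" for i v
    proof -
      have "dist (cis (- (\<psi> i + 4 * \<eta>))) (cis (- Im v)) \<le> \<bar>- (\<psi> i + 4 * \<eta>) - (- Im v)\<bar>" by (rule dist_cis_le)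
      also have "\<dots> < 8 * \<eta>" using v \<eta> by (simp add: \<psi>S abs_less_iff)
      also have "8 * \<eta> < \<delta>" using N\<delta> \<eta>N by simp
      finally have "cis (- Im v) \<in> U (P i)" using P0(2)[of i] i by (auto simp: P_def)
      then have "of_real (exp (- Re v)) * cis (- Im v) \<in> U (P i)"
        unfolding U_def by (rule unbounded_sector_scale) simp
      moreover have "exp (- v) = of_real (exp (- Re v)) * cis (- Im v)" by (simp add: exp_eq_polar)
      moreover have "exp (- Re v) < \<rho>" using v(1) \<rho> by (simp add: s_def) (metis exp_less_mono exp_ln minus_less_iff)
      ultimately show ?thesis by (simp add: sector_eq_Int_ball U_def norm_mult)
    qed
    define f where "f i v = F (P i) (exp (- v)) x" for i v
    have PN: "exp (- Complex t (\<psi> N)) = exp (- Complex t (\<psi> 0))" for t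
    proof -
      have "- Complex t (\<psi> N) = - Complex t (\<psi> 0) - 2 * pi * \<i>" by (simp add: \<psi>N complex_eq_iff)
      then show ?thesis by (simp add: exp_diff)
    qed
    have "\<exists>h. \<forall>j w. a + ln 2 \<le> Re w \<longrightarrow> \<psi> 0 + \<eta> < Im w \<longrightarrow> Im w < \<psi> 1 - \<eta> \<longrightarrow>
      cmod (f 0 w - (\<Sum>m<j. h m * exp (- w) ^ m)) \<le> C * A ^ j * Gamma (1 + real j / \<kappa>) * cmod (exp (- w)) ^ j"
      unfolding C_def A_def
    proof (rule jump_expansion[where s = s, OF \<psi>_def N \<eta> _ \<kappa> M K])
      show "s < a" by (simp add: a_def)
      fix i assume i: "i < N"
      have "((\<lambda>e. F (P i) e x) \<circ> (\<lambda>v. exp (- v))) holomorphic_on {v. s < Re v \<and> \<psi> i - \<eta> < Im v \<and> Im v < \<psi> (Suc i) + \<eta>}"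
        by (rule holomorphic_on_compose_gen[OF _ hol[OF Pn x]]) (use inS[OF i] in \<open>auto intro!: holomorphic_intros\<close>)
      then show "f i holomorphic_on {v. s < Re v \<and> \<psi> i - \<eta> < Im v \<and> Im v < \<psi> (Suc i) + \<eta>}"
        by (simp add: f_def[abs_def] o_def)
      show "cmod (f i v) \<le> \<bar>B\<bar>" if "s < Re v" "\<psi> i \<le> Im v" "Im v \<le> \<psi> (Suc i)" for v
      proof -
        have "cmod (f i v) \<le> B" unfolding f_def using that \<eta> by (intro bnd Pn x inS i) auto
        then show ?thesis by simp
      qed
      show "cmod (f i (Complex t (\<psi> (Suc i))) - f (Suc i) (Complex t (\<psi> (Suc i)))) \<le> K * exp (- (M * exp (\<kappa> * t)))"
        if t: "s < t" for t
      proof -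
        have 1: "exp (- Complex t (\<psi> (Suc i))) \<in> sector (d (P i)) (\<theta> (P i)) \<rho>"
          using t \<eta> by (intro inS i) (auto simp: \<psi>S)
        have 2: "exp (- Complex t (\<psi> (Suc i))) \<in> sector (d (P (Suc i))) (\<theta> (P (Suc i))) \<rho>"
        proof (cases "Suc i = N")
          case True
          have "exp (- Complex t (\<psi> 0)) \<in> sector (d (P 0)) (\<theta> (P 0)) \<rho>"
            using t \<eta> N by (intro inS) (auto simp: \<psi>S)
          moreover have "P N = P 0" using N by (simp add: P_def)
          ultimately show ?thesis unfolding True PN by simp
        next
          case False
          then show ?thesis using t \<eta> i by (intro inS) (auto simp: \<psi>S)
        qed
        have "cmod (exp (- Complex t (\<psi> (Suc i)))) powr - \<kappa> = exp (\<kappa> * t)" by (simp add: powr_def)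
        then show ?thesis using flat[OF Pn Pn 1 2 x] by (simp add: f_def)
      qed
    next
      show "f N (Complex t (\<psi> N)) = f 0 (Complex t (\<psi> 0))" for t
        using N by (simp add: f_def PN P_def)
    qed
    then obtain h where h: "\<And>j w. a + ln 2 \<le> Re w \<Longrightarrow> \<psi> 0 + \<eta> < Im w \<Longrightarrow> Im w < \<psi> 1 - \<eta> \<Longrightarrow>
      cmod (f 0 w - (\<Sum>m<j. h m * exp (- w) ^ m)) \<le> C * A ^ j * Gamma (1 + real j / \<kappa>) * cmod (exp (- w)) ^ j"
      by blast
    show ?thesis
    proof (intro exI[of _ h] allI impI)
      fix j w q assume w: "a + ln 2 \<le> Re w" "\<bar>Im w - \<psi>c\<bar> < 3 * \<eta>" and q: "q < n" "exp (- w) \<in> sector (d q) (\<theta> q) \<rho>"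
      have w2: "\<psi> 0 + \<eta> < Im w" "Im w < \<psi> 1 - \<eta>"
        using w(2) \<psi>S[of 0] by (auto simp: \<psi>0 abs_less_iff)
      have "s < Re w" 
      proof -
        have "0 < ln (2::real)" by simp
        then show ?thesis using w(1) unfolding a_def by linarith
      qed
      then have in0: "exp (- w) \<in> sector (d (P 0)) (\<theta> (P 0)) \<rho>"
        using w2 \<eta> N by (intro inS) auto
      define g where "g = Gamma (1 + real j / \<kappa>)"
      have g0: "0 < g" unfolding g_def using \<kappa> by (intro Gamma_real_pos add_pos_nonneg) auto
      have "cmod (F q (exp (- w)) x - F (P 0) (exp (- w)) x) \<le> K * exp (- (M * cmod (exp (- w)) powr - \<kappa>))"
        by (rule flat[OF q(1) Pn q(2) in0 x])
      also have "\<dots> \<le> K * ((M powr - (1 / \<kappa>)) ^ j * g * cmod (exp (- w)) ^ j)"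
        unfolding g_def using M \<kappa> K by (intro mult_left_mono flat_le_gevrey) auto
      also have "\<dots> \<le> K * (A' ^ j * g * cmod (exp (- w)) ^ j)"
        using K g0 A0 by (intro mult_left_mono mult_right_mono power_mono) (auto simp: A'_def)
      finally have 1: "cmod (F q (exp (- w)) x - F (P 0) (exp (- w)) x) \<le> K * (A' ^ j * g * cmod (exp (- w)) ^ j)" .
      have "cmod (f 0 w - (\<Sum>m<j. h m * exp (- w) ^ m)) \<le> C * A ^ j * g * cmod (exp (- w)) ^ j"
        unfolding g_def by (rule h[OF w(1) w2])
      also have "\<dots> \<le> C * A' ^ j * g * cmod (exp (- w)) ^ j"
        using C0 g0 A0 by (intro mult_left_mono mult_right_mono power_mono) (auto simp: A'_def)
      finally have 2: "cmod (F (P 0) (exp (- w)) x - (\<Sum>m<j. h m * exp (- w) ^ m)) \<le> C * A' ^ j * g * cmod (exp (- w)) ^ j"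
        by (simp add: f_def)
      have "cmod (F q (exp (- w)) x - (\<Sum>m<j. h m * exp (- w) ^ m)) \<le>
        K * (A' ^ j * g * cmod (exp (- w)) ^ j) + C * A' ^ j * g * cmod (exp (- w)) ^ j"
        using norm_triangle_ineq[of "F q (exp (- w)) x - F (P 0) (exp (- w)) x" "F (P 0) (exp (- w)) x - (\<Sum>m<j. h m * exp (- w) ^ m)"] 1 2
        by simp
      then show "cmod (F q (exp (- w)) x - (\<Sum>m<j. h m * exp (- w) ^ m)) \<le> (C + K) * A' ^ j * Gamma (1 + real j / \<kappa>) * cmod (exp (- w)) ^ j"
        by (simp add: g_def algebra_simps)
    qed
  qed
  then show ?thesis
    using A0(2) \<eta>(1) by (intro exI[of _ "C + K"] exI[of _ A'] exI[of _ "a + ln 2"] exI[of _ "3 * \<eta>"]) auto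
qed

text \<open>The coefficients found in neighbouring directions agree by uniqueness of asymptotic expansions, so
  they agree in all directions. Far from 0 the estimate holds trivially, with a larger constant.\<close>

theorem ramis_sibuya:
  fixes F :: "nat \<Rightarrow> complex \<Rightarrow> 'x \<Rightarrow> complex"
  assumes \<kappa>: "0 < \<kappa>" and \<rho>: "0 < \<rho>" and K: "0 \<le> K" and M: "0 < M"
    and cover: "UNIV - {0} \<subseteq> (\<Union>p<n. unbounded_sector (d p) (\<theta> p))"
    and hol: "\<And>p x. p < n \<Longrightarrow> x \<in> D \<Longrightarrow> (\<lambda>e. F p e x) holomorphic_on sector (d p) (\<theta> p) \<rho>"
    and bnd: "\<And>p e x. p < n \<Longrightarrow> e \<in> sector (d p) (\<theta> p) \<rho> \<Longrightarrow> x \<in> D \<Longrightarrow> cmod (F p e x) \<le> B"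
    and flat: "\<And>p q e x. p < n \<Longrightarrow> q < n \<Longrightarrow> e \<in> sector (d p) (\<theta> p) \<rho> \<Longrightarrow> e \<in> sector (d q) (\<theta> q) \<rho> \<Longrightarrow> x \<in> D \<Longrightarrow>
      cmod (F p e x - F q e x) \<le> K * exp (- (M * cmod e powr - \<kappa>))"
  shows "\<exists>h C A. 0 < C \<and> 0 < A \<and> (\<forall>p<n. \<forall>j. \<forall>e\<in>sector (d p) (\<theta> p) \<rho>. \<forall>x\<in>D.
    cmod (F p e x - (\<Sum>m<j. h m x * e ^ m)) \<le> C * A ^ j * Gamma (1 + real j / \<kappa>) * cmod e ^ j)"
proof -
  have "\<exists>C A R \<eta>. 0 < A \<and> 0 < \<eta> \<and> (\<forall>\<psi>. \<forall>x\<in>D. \<exists>h. \<forall>j w q. R \<le> Re w \<longrightarrow> \<bar>Im w - \<psi>\<bar> < \<eta> \<longrightarrow>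
    q < n \<longrightarrow> exp (- w) \<in> sector (d q) (\<theta> q) \<rho> \<longrightarrow>
    cmod (F q (exp (- w)) x - (\<Sum>m<j. h m * exp (- w) ^ m)) \<le> C * A ^ j * Gamma (1 + real j / \<kappa>) * cmod (exp (- w)) ^ j)"
    by (rule local_expansion[OF \<kappa> \<rho> K M cover]) (rule hol, assumption, assumption, rule bnd, assumption, assumption, assumption,
        rule flat, assumption+)
  then obtain C A R \<eta> where A: "0 < A" and \<eta>: "0 < \<eta>" and loc: "\<forall>\<psi>. \<forall>x\<in>D. \<exists>h. \<forall>j w q. R \<le> Re w \<longrightarrow> \<bar>Im w - \<psi>\<bar> < \<eta> \<longrightarrow>
    q < n \<longrightarrow> exp (- w) \<in> sector (d q) (\<theta> q) \<rho> \<longrightarrow>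
    cmod (F q (exp (- w)) x - (\<Sum>m<j. h m * exp (- w) ^ m)) \<le> C * A ^ j * Gamma (1 + real j / \<kappa>) * cmod (exp (- w)) ^ j"
    by (elim exE conjE)
  define g where "g j = Gamma (1 + real j / \<kappa>)" for j
  have g0: "0 < g j" for j unfolding g_def using \<kappa> by (intro Gamma_real_pos add_pos_nonneg) auto
  obtain H where H: "\<And>\<psi> x j w q. x \<in> D \<Longrightarrow> R \<le> Re w \<Longrightarrow> \<bar>Im w - \<psi>\<bar> < \<eta> \<Longrightarrow>
    q < n \<Longrightarrow> exp (- w) \<in> sector (d q) (\<theta> q) \<rho> \<Longrightarrow>
    cmod (F q (exp (- w)) x - (\<Sum>m<j. H \<psi> x m * exp (- w) ^ m)) \<le> C * A ^ j * g j * cmod (exp (- w)) ^ j"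
  proof -
    define Pr where "Pr \<psi> x h \<longleftrightarrow> (\<forall>j w q. R \<le> Re w \<longrightarrow> \<bar>Im w - \<psi>\<bar> < \<eta> \<longrightarrow>
      q < n \<longrightarrow> exp (- w) \<in> sector (d q) (\<theta> q) \<rho> \<longrightarrow>
      cmod (F q (exp (- w)) x - (\<Sum>m<j. h m * exp (- w) ^ m)) \<le> C * A ^ j * g j * cmod (exp (- w)) ^ j)" for \<psi> x h
    define H where "H \<psi> x = (SOME h. Pr \<psi> x h)" for \<psi> x
    have "Pr \<psi> x (H \<psi> x)" if "x \<in> D" for \<psi> x
    proof -
      have "\<exists>h. Pr \<psi> x h" unfolding Pr_def g_def by (rule bspec[OF spec[OF loc] that])
      then have "Pr \<psi> x (SOME h. Pr \<psi> x h)" by (rule someI_ex)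
      then show ?thesis by (simp only: H_def)
    qed
    then show ?thesis unfolding Pr_def by (intro that[of H]) blast
  qed
  define r where "r = min \<rho> (exp (- R))"
  have r: "0 < r" using \<rho> by (simp add: r_def)
  \<comment> \<open>the expansion along a single ray\<close>
  have ray: "\<exists>q<n. \<forall>t. 0 < t \<longrightarrow> t < r \<longrightarrow> of_real t * cis (- \<psi>) \<in> sector (d q) (\<theta> q) \<rho>" for \<psi>
  proof -
    have "cis (- \<psi>) \<in> (\<Union>p<n. unbounded_sector (d p) (\<theta> p))"
      using cover by (rule subsetD) simp
    then obtain q where q: "q < n" "cis (- \<psi>) \<in> unbounded_sector (d q) (\<theta> q)" by auto
    then have "of_real t * cis (- \<psi>) \<in> sector (d q) (\<theta> q) \<rho>" if "0 < t" "t < r" for t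
      using unbounded_sector_scale[OF q(2) that(1)] that by (simp add: sector_eq_Int_ball norm_mult r_def)
    with q(1) show ?thesis by blast
  qed
  have on_ray: "cmod (F q (of_real t * cis (- \<psi>)) x - (\<Sum>m<j. H \<psi>' x m * (of_real t * cis (- \<psi>)) ^ m)) \<le> C * A ^ j * g j * t ^ j"
    if "x \<in> D" "q < n" "of_real t * cis (- \<psi>) \<in> sector (d q) (\<theta> q) \<rho>" "\<bar>\<psi> - \<psi>'\<bar> < \<eta>" "0 < t" "t < r" for x q t \<psi> \<psi>' j
  proof -
    have eq: "exp (- Complex (- ln t) \<psi>) = of_real t * cis (- \<psi>)"
      using that(5) by (simp add: exp_eq_polar)
    have "R \<le> - ln t"
    proof -
      have "ln t \<le> ln (exp (- R))" using that(5,6) by (subst ln_le_cancel_iff) (auto simp: r_def)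
      then show ?thesis by simp
    qed
    then show ?thesis
      using H[of x "Complex (- ln t) \<psi>" \<psi>' q j] that unfolding eq by (simp add: norm_mult)
  qed
  \<comment> \<open>on a common ray of two neighbouring directions one function has both expansions\<close>
  have near: "H \<psi> x m = H \<psi>' x m" if x: "x \<in> D" and \<psi>: "\<bar>\<psi> - \<psi>'\<bar> < \<eta>" for \<psi> \<psi>' x m
  proof -
    obtain q where q: "q < n" "\<And>t. 0 < t \<Longrightarrow> t < r \<Longrightarrow> of_real t * cis (- \<psi>) \<in> sector (d q) (\<theta> q) \<rho>"
      using ray by blast
    have "H \<psi> x m - H \<psi>' x m = 0"
    proof (rule asymptotic_coeff_zero[where a = "\<lambda>m. H \<psi> x m - H \<psi>' x m", OF _ r])
      show "\<exists>C'. \<forall>t. 0 < t \<longrightarrow> t < r \<longrightarrow> cmod (\<Sum>m<j. (H \<psi> x m - H \<psi>' x m) * (of_real t * cis (- \<psi>)) ^ m) \<le> C' * t ^ j" for j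
      proof (intro exI[of _ "2 * (C * A ^ j * g j)"] allI impI)
        fix t assume t: "0 < t" "t < r"
        define E where "E = F q (of_real t * cis (- \<psi>)) x"
        have "(\<Sum>m<j. (H \<psi> x m - H \<psi>' x m) * (of_real t * cis (- \<psi>)) ^ m) =
          (E - (\<Sum>m<j. H \<psi>' x m * (of_real t * cis (- \<psi>)) ^ m)) - (E - (\<Sum>m<j. H \<psi> x m * (of_real t * cis (- \<psi>)) ^ m))"
          by (simp add: left_diff_distrib sum_subtractf)
        also have "cmod \<dots> \<le> C * A ^ j * g j * t ^ j + C * A ^ j * g j * t ^ j"
          unfolding E_def using \<psi> \<eta>
          by (intro order_trans[OF norm_triangle_ineq4] add_mono on_ray x q t) auto
        also have "\<dots> = 2 * (C * A ^ j * g j) * t ^ j" by simp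
        finally show "cmod (\<Sum>m<j. (H \<psi> x m - H \<psi>' x m) * (of_real t * cis (- \<psi>)) ^ m) \<le> 2 * (C * A ^ j * g j) * t ^ j" .
      qed
    qed simp
    then show ?thesis by simp
  qed
  \<comment> \<open>finitely many steps of length less than \<open>\<eta>\<close> lead to any direction\<close>
  have far: "\<bar>\<psi>\<bar> \<le> real k * (\<eta> / 2) \<Longrightarrow> x \<in> D \<Longrightarrow> H \<psi> x m = H 0 x m" for k \<psi> x m
  proof (induction k arbitrary: \<psi>)
    case (Suc k)
    define \<psi>' where "\<psi>' = real k / real (Suc k) * \<psi>"
    have "\<bar>\<psi>'\<bar> = real k / real (Suc k) * \<bar>\<psi>\<bar>" by (simp add: \<psi>'_def abs_mult)
    also have "\<dots> \<le> real k / real (Suc k) * (real (Suc k) * (\<eta> / 2))" using Suc.prems by (intro mult_left_mono) auto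
    finally have "\<bar>\<psi>'\<bar> \<le> real k * (\<eta> / 2)" by (simp del: of_nat_Suc)
    then have "H \<psi>' x m = H 0 x m" using Suc by blast
    moreover have "\<bar>\<psi> - \<psi>'\<bar> < \<eta>"
    proof -
      have "\<psi> - \<psi>' = \<psi> / real (Suc k)" by (simp add: \<psi>'_def field_simps)
      then have "\<bar>\<psi> - \<psi>'\<bar> = \<bar>\<psi>\<bar> / real (Suc k)" by simp
      also have "\<dots> \<le> \<eta> / 2" using Suc.prems by (simp add: field_simps del: of_nat_Suc)
      finally show ?thesis using \<eta> by linarith
    qed
    ultimately show ?case using near Suc.prems by metis
  qed simp
  define h where "h m x = H 0 x m" for m x
  have H0: "H \<psi> x m = h m x" if "x \<in> D" for \<psi> x m
  proof -
    have "\<bar>\<psi>\<bar> \<le> real (nat \<lceil>\<bar>\<psi>\<bar> / (\<eta> / 2)\<rceil>) * (\<eta> / 2)"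
      using real_nat_ceiling_ge[of "\<bar>\<psi>\<bar> / (\<eta> / 2)"] \<eta> by (subst (asm) pos_divide_le_eq) auto
    then show ?thesis using far that by (simp add: h_def)
  qed
  have small: "cmod (F p e x - (\<Sum>m<j. h m x * e ^ m)) \<le> C * A ^ j * g j * cmod e ^ j"
    if p: "p < n" and e: "e \<in> sector (d p) (\<theta> p) \<rho>" and x: "x \<in> D" and sm: "cmod e < r" for p e x j
  proof -
    have e0: "e \<noteq> 0" using e by (rule sector_nonzero)
    have eq: "of_real (cmod e) * cis (- (- Arg e)) = e"
      using rcis_cmod_Arg[of e] by (simp add: rcis_def)
    show ?thesis
      using on_ray[OF x p, of "cmod e" "- Arg e" "- Arg e" j] e e0 sm \<eta> unfolding eq by (simp add: H0[OF x])
  qed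
  have hb: "cmod (h m x) \<le> C * A ^ m * g m" if x: "x \<in> D" for m x
  proof -
    obtain q where q: "q < n" "\<And>t. 0 < t \<Longrightarrow> t < r \<Longrightarrow> of_real t * cis (- 0) \<in> sector (d q) (\<theta> q) \<rho>"
      using ray by blast
    show ?thesis
    proof (rule asymptotic_coeff_bound[where \<omega> = "cis (- 0)" and G = "\<lambda>t. F q (of_real t * cis (- 0)) x" and h = "\<lambda>m. h m x", OF _ r])
      show "cmod (F q (of_real t * cis (- 0)) x - (\<Sum>m<j. h m x * (of_real t * cis (- 0)) ^ m)) \<le> C * A ^ j * g j * t ^ j"
        if "0 < t" "t < r" for j t
        using on_ray[OF x q(1) q(2)[OF that] _ that, of 0 j] \<eta> by (simp add: h_def)
    qed simp
  qed
  \<comment> \<open>near 0 the local constants suffice; for \<open>cmod e \<ge> r\<close> each term is dominated by \<open>(A' / 2 * cmod e) ^ j\<close>\<close>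
  define A' where "A' = 2 * (A + 1 / r)"
  define C' where "C' = 1 + \<bar>C\<bar> + 4 * \<bar>B\<bar> + 4 * \<bar>C\<bar>"
  have A': "A \<le> A' / 2" "1 / r \<le> A' / 2" "0 < A'" using A r by (auto simp: A'_def add_pos_pos)
  have "cmod (F p e x - (\<Sum>m<j. h m x * e ^ m)) \<le> C' * A' ^ j * g j * cmod e ^ j"
    if p: "p < n" and e: "e \<in> sector (d p) (\<theta> p) \<rho>" and x: "x \<in> D" for p e x j
  proof (cases "cmod e < r")
    case True
    have "C * A ^ j \<le> C' * A' ^ j"
      using A A' by (intro mult_mono power_mono) (auto simp: C'_def)
    then have "C * A ^ j * g j * cmod e ^ j \<le> C' * A' ^ j * g j * cmod e ^ j"
      using g0[of j] by (intro mult_right_mono) auto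
    with small[OF p e x True, of j] show ?thesis by linarith
  next
    case False
    then have er: "r \<le> cmod e" by simp
    have gg: "g m \<le> 4 * g j" if "m \<le> j" for m
      unfolding g_def using \<kappa> that by (intro Gamma_le_Gamma) (auto intro!: divide_right_mono)
    have g1: "1 \<le> 4 * g j" using gg[of 0] by (simp add: g_def)
    define q where "q = A' / 2"
    have q: "0 < q" "A \<le> q" "1 / r \<le> q" using A' by (auto simp: q_def)
    have qe: "1 \<le> (q * cmod e) ^ k" for k
    proof -
      have "1 \<le> q * r" using q(3) r by (simp add: field_simps)
      also have "\<dots> \<le> q * cmod e" using er q by (intro mult_left_mono) auto
      finally show ?thesis by (rule one_le_power)
    qed
    have summand: "cmod (h m x * e ^ m) \<le> 4 * \<bar>C\<bar> * g j * (q * cmod e) ^ j" if m: "m < j" for m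
    proof -
      have "cmod (h m x) \<le> \<bar>C\<bar> * q ^ m * (4 * g j)"
      proof -
        have "C * A ^ m * g m \<le> \<bar>C\<bar> * q ^ m * (4 * g j)"
          using A q gg[of m] g0[of m] m by (intro mult_mono power_mono) auto
        then show ?thesis using hb[OF x, of m] by linarith
      qed
      then have "cmod (h m x * e ^ m) \<le> \<bar>C\<bar> * q ^ m * (4 * g j) * cmod e ^ m"
        by (simp add: norm_mult norm_power mult_right_mono)
      also have "\<dots> = 4 * \<bar>C\<bar> * g j * (q * cmod e) ^ m" by (simp add: power_mult_distrib mult_ac)
      also have "\<dots> \<le> 4 * \<bar>C\<bar> * g j * (q * cmod e) ^ j"
        using m g0[of j] qe[of 1] by (intro mult_left_mono power_increasing) auto
      finally show ?thesis .
    qed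
    have "cmod (F p e x) \<le> \<bar>B\<bar> * (4 * g j * (q * cmod e) ^ j)"
    proof -
      have "cmod (F p e x) \<le> \<bar>B\<bar> * (1 * 1)" using bnd[OF p e x] by simp
      also have "\<dots> \<le> \<bar>B\<bar> * (4 * g j * (q * cmod e) ^ j)"
        using g1 qe[of j] by (intro mult_left_mono mult_mono) auto
      finally show ?thesis .
    qed
    moreover have "cmod (\<Sum>m<j. h m x * e ^ m) \<le> real j * (4 * \<bar>C\<bar> * g j * (q * cmod e) ^ j)"
    proof -
      have "cmod (\<Sum>m<j. h m x * e ^ m) \<le> (\<Sum>m<j. 4 * \<bar>C\<bar> * g j * (q * cmod e) ^ j)"
        using summand by (intro sum_norm_le) auto
      then show ?thesis by simp
    qed
    ultimately have "cmod (F p e x - (\<Sum>m<j. h m x * e ^ m)) \<le>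
       (4 * \<bar>B\<bar> * 1 + 4 * \<bar>C\<bar> * real j) * (g j * (q * cmod e) ^ j)"
      using norm_triangle_ineq4[of "F p e x" "\<Sum>m<j. h m x * e ^ m"] by (simp add: algebra_simps)
    also have "\<dots> \<le> (4 * \<bar>B\<bar> * 2 ^ j + 4 * \<bar>C\<bar> * 2 ^ j) * (g j * (q * cmod e) ^ j)"
    proof (rule mult_right_mono)
      have "real j \<le> 2 ^ j" by (metis less_exp less_imp_le of_nat_le_iff of_nat_numeral of_nat_power)
      then show "4 * \<bar>B\<bar> * 1 + 4 * \<bar>C\<bar> * real j \<le> 4 * \<bar>B\<bar> * 2 ^ j + 4 * \<bar>C\<bar> * 2 ^ j"
        by (intro add_mono mult_left_mono) auto
      show "0 \<le> g j * (q * cmod e) ^ j" using g0[of j] q by simp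
    qed
    also have "\<dots> = (4 * \<bar>B\<bar> + 4 * \<bar>C\<bar>) * (A' ^ j * g j * cmod e ^ j)"
      by (simp add: q_def power_mult_distrib power_divide field_simps)
    also have "\<dots> \<le> C' * (A' ^ j * g j * cmod e ^ j)"
      using g0[of j] A' by (intro mult_right_mono) (auto simp: C'_def)
    finally show ?thesis by (simp add: mult.assoc)
  qed
  then show ?thesis
    using A'(3) unfolding g_def by (intro exI[of _ h] exI[of _ C'] exI[of _ A']) (auto simp: C'_def)
qed

section \<open>Summability on wide sectors\<close>

text \<open>Uniqueness of the coefficients makes them limits of elements of the function space.\<close>

lemma gevrey_coeff_mem:
  fixes h :: "nat \<Rightarrow> complex \<times> complex \<Rightarrow> complex"
  assumes D: "open D" and S: "unbounded_sector d \<Theta> \<noteq> {}" and \<rho>: "0 < \<rho>"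
    and mem: "\<And>e. e \<in> sector d \<Theta> \<rho> \<Longrightarrow> f e \<in> bounded_holomorphic D"
    and gev: "\<And>j e x. e \<in> sector d \<Theta> \<rho> \<Longrightarrow> x \<in> D \<Longrightarrow> cmod (f e x - (\<Sum>m<j. h m x * e ^ m)) \<le> c j * cmod e ^ j"
    and off: "\<And>m x. x \<notin> D \<Longrightarrow> h m x = 0"
  shows "h m \<in> bounded_holomorphic D"
proof (induction m rule: less_induct)
  case (less n)
  obtain z where z: "z \<in> unbounded_sector d \<Theta>" using S by auto
  have z0: "z \<noteq> 0" by (rule unbounded_sector_nonzero[OF z])
  define e where "e i = of_real (\<rho> / (2 * cmod z * real (Suc i))) * z" for i
  have ce: "cmod (e i) = \<rho> / 2 / real (Suc i)" for i
    using z0 \<rho> by (simp add: e_def norm_mult norm_divide del: of_nat_Suc)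
  have eS: "e i \<in> sector d \<Theta> \<rho>" for i
  proof -
    have "e i \<in> unbounded_sector d \<Theta>" unfolding e_def using z0 \<rho> by (intro unbounded_sector_scale z) auto
    moreover have "\<rho> / 2 / real (Suc i) < \<rho>" using \<rho> by (simp add: field_simps add_pos_nonneg)
    ultimately show ?thesis by (simp add: sector_eq_Int_ball ce)
  qed
  have e0: "e i \<noteq> 0" for i by (rule sector_nonzero[OF eS])
  have elim: "(\<lambda>i. cmod (e i)) \<longlonglongrightarrow> 0" unfolding ce by real_asymp
  \<comment> \<open>the coefficient as the limit of difference quotients of order \<open>n\<close> along a sequence tending to 0\<close>
  define q where "q i x = (f (e i) x - (\<Sum>m<n. h m x * e i ^ m)) / e i ^ n" for i x
  show ?case
  proof (rule bounded_holomorphic_pointwise_limit[OF D])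
    fix i
    have "(\<lambda>x. \<Sum>m<n. h m x * e i ^ m) \<in> bounded_holomorphic D"
      using less by (intro bounded_holomorphic_sum) auto
    then have "(\<lambda>x. 1 / e i ^ n * f (e i) x + (- 1 / e i ^ n) * (\<Sum>m<n. h m x * e i ^ m)) \<in> bounded_holomorphic D"
      by (intro bounded_holomorphic_lincomb mem eS)
    then show "q i \<in> bounded_holomorphic D" by (simp add: q_def[abs_def] diff_divide_distrib)
  next
    fix i x assume x: "x \<in> D"
    show "cmod (q i x) \<le> c n"
      using gev[OF eS x, of i n] e0[of i] by (simp add: q_def norm_divide norm_power field_simps)
  next
    fix x assume x: "x \<in> D"
    have le: "cmod (q i x - h n x) \<le> c (Suc n) * cmod (e i)" for i
    proof -
      have eq: "q i x - h n x = (f (e i) x - (\<Sum>m<Suc n. h m x * e i ^ m)) / e i ^ n"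
        using e0[of i] by (simp add: q_def diff_divide_distrib add_divide_distrib)
      show ?thesis
        unfolding eq norm_divide norm_power
        using gev[OF eS x, of i "Suc n"] e0[of i] by (simp add: pos_divide_le_eq mult_ac)
    qed
    have "(\<lambda>i. c (Suc n) * cmod (e i)) \<longlonglongrightarrow> 0" by (intro tendsto_mult_right_zero elim)
    then have "(\<lambda>i. q i x - h n x) \<longlonglongrightarrow> 0"
      by (rule Lim_null_comparison[OF always_eventually, rotated]) (use le in blast)
    then show "(\<lambda>i. q i x) \<longlonglongrightarrow> h n x" by (simp add: LIM_zero_iff)
  qed (rule off)
qed

text \<open>Within a wide sector every direction is close enough to an admissible direction of integration.\<close>

lemma exists_laplace_direction:
  assumes \<kappa>: "1 / 2 < \<kappa>" and \<theta>: "pi / \<kappa> < \<theta>" "\<theta> < pi / \<kappa> + 2 * \<delta>"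
  obtains \<delta>1 where "0 < \<delta>1" "\<And>e \<rho>. e \<in> sector d \<theta> \<rho> \<Longrightarrow> \<exists>\<gamma>. laplace_direction \<kappa> d \<delta> \<delta>1 e \<gamma>"
proof -
  define a where "a = pi / (2 * \<kappa>)"
  define \<delta>' where "\<delta>' = ((\<theta> / 2 - a) + min \<delta> (\<theta> / 2)) / 2"
  define \<mu> where "\<mu> = \<theta> / 2 - \<delta>'"
  have \<kappa>0: "0 < \<kappa>" using \<kappa> by linarith
  have p: "0 < a" "pi / \<kappa> = 2 * a" "a < pi"
    using \<kappa> by (auto simp: a_def field_simps)
  have m: "\<theta> / 2 - a < min \<delta> (\<theta> / 2)" "min \<delta> (\<theta> / 2) \<le> \<delta>" "min \<delta> (\<theta> / 2) \<le> \<theta> / 2"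
    using \<theta> p(1) unfolding p(2) by auto
  have \<delta>': "\<theta> / 2 - a < \<delta>'" "\<delta>' < \<delta>" "\<delta>' < \<theta> / 2" "0 < \<delta>'"
  proof -
    define m0 where "m0 = min \<delta> (\<theta> / 2)"
    have e: "2 * \<delta>' = \<theta> / 2 - a + m0" by (simp add: \<delta>'_def m0_def)
    note m' = m[folded m0_def]
    show "\<theta> / 2 - a < \<delta>'" using e m' by linarith
    show "\<delta>' < \<delta>" using e m' by linarith
    show "\<delta>' < \<theta> / 2" using e m' by linarith
    show "0 < \<delta>'" using e m' \<theta>(1)[unfolded p(2)] p(1) by linarith
  qed
  have \<mu>: "0 < \<mu>" "\<mu> < a" using \<delta>' by (auto simp: \<mu>_def)
  have \<kappa>\<mu>: "0 < \<kappa> * \<mu>" "\<kappa> * \<mu> < pi / 2" using \<mu> \<kappa>0 by (auto simp: a_def field_simps)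
  have \<theta>0: "0 < \<theta>" using \<theta> p by linarith
  show ?thesis
  proof (rule that[of "cos (\<kappa> * \<mu>)"])
    show "0 < cos (\<kappa> * \<mu>)" using \<kappa>\<mu> by (intro cos_gt_zero) auto
    fix e \<rho> assume "e \<in> sector d \<theta> \<rho>"
    then obtain s \<phi> where e: "e = of_real s * cis \<phi>" "0 < s" and \<phi>: "\<bar>\<phi> - d\<bar> < \<theta> / 2"
      by (auto simp: sector_def)
    \<comment> \<open>the direction of \<open>e\<close>, contracted towards \<open>d\<close> so that it stays within \<open>\<delta>'\<close> of \<open>d\<close>\<close>
    define \<gamma> where "\<gamma> = d + (\<phi> - d) * (2 * \<delta>' / \<theta>)"
    have "\<bar>\<gamma> - d\<bar> = \<bar>\<phi> - d\<bar> * (2 * \<delta>' / \<theta>)" using \<delta>' \<theta>0 by (simp add: \<gamma>_def abs_mult)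
    also have "\<dots> \<le> \<theta> / 2 * (2 * \<delta>' / \<theta>)" using \<phi> \<delta>' \<theta>0 by (intro mult_right_mono) auto
    also have "\<dots> = \<delta>'" using \<theta>0 by simp
    finally have \<gamma>d: "\<bar>\<gamma> - d\<bar> < \<delta>" using \<delta>' by linarith
    have "\<gamma> - \<phi> = - ((\<phi> - d) * (1 - 2 * \<delta>' / \<theta>))" by (simp add: \<gamma>_def algebra_simps)
    moreover have nn: "0 \<le> 1 - 2 * \<delta>' / \<theta>" using \<delta>' \<theta>0 by (simp add: field_simps)
    ultimately have "\<bar>\<gamma> - \<phi>\<bar> = \<bar>\<phi> - d\<bar> * (1 - 2 * \<delta>' / \<theta>)"
      by (simp only: abs_minus_cancel abs_mult abs_of_nonneg[OF nn])
    also have "\<dots> \<le> \<theta> / 2 * (1 - 2 * \<delta>' / \<theta>)" using \<phi> \<delta>' \<theta>0 by (intro mult_right_mono) (auto simp: field_simps)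
    also have "\<dots> = \<mu>" using \<theta>0 by (simp add: \<mu>_def field_simps)
    finally have \<gamma>\<phi>: "\<bar>\<gamma> - \<phi>\<bar> \<le> \<mu>" .
    have q: "cis \<gamma> / e = of_real (1 / s) * cis (\<gamma> - \<phi>)"
      using e by (simp add: cis_divide[symmetric])
    have "Arg (cis \<gamma> / e) = \<gamma> - \<phi>"
      unfolding q using e \<gamma>\<phi> \<mu> p by (intro cis_Arg_unique) (auto simp: sgn_mult sgn_of_real)
    moreover have "\<kappa> * \<bar>\<gamma> - \<phi>\<bar> \<le> \<kappa> * \<mu>" using \<gamma>\<phi> \<kappa>0 by (intro mult_left_mono) auto
    then have k: "\<bar>\<kappa> * (\<gamma> - \<phi>)\<bar> \<le> \<kappa> * \<mu>" using \<kappa>0 by (simp add: abs_mult)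
    moreover have "cos (\<kappa> * \<mu>) \<le> cos \<bar>\<kappa> * (\<gamma> - \<phi>)\<bar>"
      using k \<kappa>\<mu> by (intro cos_monotone_0_pi_le) auto
    ultimately have "laplace_direction \<kappa> d \<delta> (cos (\<kappa> * \<mu>)) e \<gamma>"
      unfolding laplace_direction_def using \<gamma>d \<kappa>\<mu> by auto
    then show "\<exists>\<gamma>. laplace_direction \<kappa> d \<delta> (cos (\<kappa> * \<mu>)) e \<gamma>" by blast
  qed
qed

text \<open>The Borel transform along vertical lines continues the sum of the formal Borel transform, since its
  Taylor polynomials converge to it near 0, and its Laplace transform is the given function. The constant
  term is split off, because convergence of the integrals needs a function that vanishes at 0.\<close>

theorem gevrey_is_kappa_sum:
  fixes f :: "complex \<Rightarrow> complex \<times> complex \<Rightarrow> complex"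
  assumes \<kappa>: "1 / 2 < \<kappa>" and \<rho>: "0 < \<rho>" and D: "open D" "D \<noteq> {}" and \<Theta>: "pi / \<kappa> < \<Theta>"
    and memh: "\<And>m. h m \<in> bounded_holomorphic D"
    and memf: "\<And>e. e \<in> sector d \<Theta> \<rho> \<Longrightarrow> f e \<in> bounded_holomorphic D"
    and hol: "\<And>x. x \<in> D \<Longrightarrow> (\<lambda>e. f e x) holomorphic_on sector d \<Theta> \<rho>"
    and C: "0 < C" and A: "0 < A"
    and gev: "\<And>j e x. e \<in> sector d \<Theta> \<rho> \<Longrightarrow> x \<in> D \<Longrightarrow>
      cmod (f e x - (\<Sum>m<j. h m x * e ^ m)) \<le> C * A ^ j * Gamma (1 + real j / \<kappa>) * cmod e ^ j"
  shows "is_kappa_sum_on_sector (bounded_holomorphic D) (sup_norm D) \<kappa> h d \<Theta> \<rho> f"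
proof -
  have \<kappa>0: "0 < \<kappa>" using \<kappa> by linarith
  define \<delta> where "\<delta> = (\<Theta> - pi / \<kappa>) / 2"
  have \<delta>: "0 < \<delta>" using \<Theta> by (simp add: \<delta>_def)
  define S where "S = unbounded_sector d (\<Theta> - pi / \<kappa>)"
  have d2: "2 * \<delta> = \<Theta> - pi / \<kappa>" by (simp add: \<delta>_def)
  then have S2: "unbounded_sector d (2 * \<delta>) = S" by (simp only: S_def)
  have openS: "open S" by (simp add: S_def open_unbounded_sector)
  define gam where "gam j = Gamma (1 + real j / \<kappa>)" for j
  have gam0: "0 < gam j" for j unfolding gam_def using \<kappa>0 by (intro Gamma_real_pos add_pos_nonneg) auto
  have hoff: "h m x = 0" if "x \<notin> D" for m x using memh[of m] that by (cases x) (simp add: bounded_holomorphic_def)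
  have foff: "f e x = 0" if "e \<in> sector d \<Theta> \<rho>" "x \<notin> D" for e x
    using memf[OF that(1)] that(2) by (cases x) (simp add: bounded_holomorphic_def)
  have hb: "cmod (h m x) \<le> C * A ^ m * gam m" if x: "x \<in> D" for m x
  proof (rule asymptotic_coeff_bound[where \<omega> = "cis d" and G = "\<lambda>t. f (of_real t * cis d) x" and h = "\<lambda>m. h m x", OF _ \<rho>])
    show "cmod (f (of_real t * cis d) x - (\<Sum>m<j. h m x * (of_real t * cis d) ^ m)) \<le> C * A ^ j * gam j * t ^ j"
      if "0 < t" "t < \<rho>" for j t
    proof -
      have "0 < \<Theta>" using \<Theta> \<kappa>0 by (meson divide_pos_pos less_trans pi_gt_zero)
      then have "of_real t * cis d \<in> sector d \<Theta> \<rho>" using that by (intro sectorI) auto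
      from gev[OF this x, of j] that show ?thesis by (simp add: gam_def norm_mult)
    qed
  qed simp
  define g where "g x e = f e x - h 0 x" for x e
  define A1 where "A1 = C * A * gam 1"
  have gb: "cmod (g x e) \<le> A1 * cmod e powr 1" if "x \<in> D" "e \<in> sector d \<Theta> \<rho>" for x e
    using gev[OF that(2,1), of 1] by (simp add: g_def A1_def gam_def)
  have holg: "g x holomorphic_on sector d \<Theta> \<rho>" if "x \<in> D" for x
    unfolding g_def[abs_def] by (intro holomorphic_intros hol that)
  define r where "r = 1 / (4 powr (1 / \<kappa>) * A)"
  have r: "0 < r" using A by (simp add: r_def)
  define q where "q = 1 / 4 powr (1 / \<kappa>)"
  have q: "0 < q" "q < 1" using \<kappa>0 gr_one_powr[of 4 "1 / \<kappa>"] by (auto simp: q_def)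
  have ball: "A * cmod \<tau> \<le> q" "4 powr (1 / \<kappa>) * A * cmod \<tau> < 1" if "\<tau> \<in> ball 0 r" for \<tau>
    using that A by (auto simp: r_def q_def field_simps)
  define a where "a j x = h j x / complex_of_real (gam j)" for j x
  define P where "P \<tau> x = (\<Sum>j. a j x * \<tau> ^ j)" for \<tau> x
  have ab: "cmod (a j x * \<tau> ^ j) \<le> C * (A * cmod \<tau>) ^ j" if "x \<in> D" for j x \<tau>
  proof -
    have "cmod (a j x) \<le> C * A ^ j"
      using hb[OF that, of j] gam0[of j] by (simp add: a_def norm_divide field_simps)
    then have "cmod (a j x) * cmod \<tau> ^ j \<le> C * A ^ j * cmod \<tau> ^ j" by (rule mult_right_mono) simp
    then show ?thesis by (simp add: norm_mult norm_power power_mult_distrib mult.assoc)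
  qed
  have geo: "summable (\<lambda>j. C * (A * cmod \<tau>) ^ j)" if "\<tau> \<in> ball 0 r" for \<tau>
    using ball(1)[OF that] q A by (intro summable_mult summable_geometric) auto
  have sums: "(\<lambda>j. a j x * \<tau> ^ j) sums P \<tau> x" if "\<tau> \<in> ball 0 r" "x \<in> D" for \<tau> x
    unfolding P_def
    by (intro summable_sums summable_comparison_test'[OF geo[OF that(1)]]) (use ab[OF that(2)] in simp)
  \<comment> \<open>the tail of the power series, uniformly on \<open>D\<close>\<close>
  have tail: "cmod ((\<Sum>j<n. a j x * \<tau> ^ j) - P \<tau> x) \<le> C * q ^ n / (1 - q)" if "\<tau> \<in> ball 0 r" "x \<in> D" for n \<tau> x
  proof (rule LIMSEQ_le_const2)
    show "(\<lambda>m. cmod ((\<Sum>j<n. a j x * \<tau> ^ j) - (\<Sum>j<m. a j x * \<tau> ^ j))) \<longlonglongrightarrow> cmod ((\<Sum>j<n. a j x * \<tau> ^ j) - P \<tau> x)"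
      using sums[OF that] unfolding sums_def by (intro tendsto_intros)
    show "\<exists>k. \<forall>m\<ge>k. cmod ((\<Sum>j<n. a j x * \<tau> ^ j) - (\<Sum>j<m. a j x * \<tau> ^ j)) \<le> C * q ^ n / (1 - q)"
    proof (intro exI[of _ n] allI impI)
      fix m assume m: "n \<le> m"
      have "(\<Sum>j<m. a j x * \<tau> ^ j) = (\<Sum>j<n. a j x * \<tau> ^ j) + (\<Sum>j\<in>{n..<m}. a j x * \<tau> ^ j)"
        using m by (simp add: lessThan_atLeast0 sum.atLeastLessThan_concat)
      then have "cmod ((\<Sum>j<n. a j x * \<tau> ^ j) - (\<Sum>j<m. a j x * \<tau> ^ j)) = cmod (\<Sum>j\<in>{n..<m}. a j x * \<tau> ^ j)" by simp
      also have "\<dots> \<le> (\<Sum>j\<in>{n..<m}. C * q ^ j)"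
      proof (rule sum_norm_le)
        fix j
        have "C * (A * cmod \<tau>) ^ j \<le> C * q ^ j"
          using ball(1)[OF that(1)] A C by (intro mult_left_mono power_mono) auto
        then show "cmod (a j x * \<tau> ^ j) \<le> C * q ^ j" using ab[OF that(2), of j \<tau>] by linarith
      qed
      also have "\<dots> = C * (\<Sum>j\<in>{n..<m}. q ^ j)" by (simp add: sum_distrib_left)
      also have "(\<Sum>j\<in>{n..<m}. q ^ j) = (q ^ n - q ^ m) / (1 - q)"
      proof -
        have "(1 - q) * (\<Sum>j\<in>{n..<m}. q ^ j) = q ^ n - q ^ m"
          using m by (induction m rule: dec_induct) (simp_all add: distrib_left left_diff_distrib)
        then show ?thesis using q by (simp add: eq_divide_eq mult.commute)
      qed
      also have "C * ((q ^ n - q ^ m) / (1 - q)) \<le> C * (q ^ n / (1 - q))"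
        using C q by (intro mult_left_mono divide_right_mono) auto
      finally show "cmod ((\<Sum>j<n. a j x * \<tau> ^ j) - (\<Sum>j<m. a j x * \<tau> ^ j)) \<le> C * q ^ n / (1 - q)" by simp
    qed
  qed
  have Pb: "cmod (P \<tau> x) \<le> C / (1 - q)" if "\<tau> \<in> ball 0 r" "x \<in> D" for \<tau> x
    using tail[OF that, of 0] by simp
  have Pn: "cmod (\<Sum>j<n. a j x * \<tau> ^ j) \<le> 2 * C / (1 - q)" if "\<tau> \<in> ball 0 r" "x \<in> D" for n \<tau> x
  proof -
    have "C * q ^ n / (1 - q) \<le> C * 1 / (1 - q)"
      using C q by (intro divide_right_mono mult_left_mono power_le_one) auto
    then show ?thesis
      using tail[OF that, of n] Pb[OF that] norm_triangle_sub[of "\<Sum>j<n. a j x * \<tau> ^ j" "P \<tau> x"] by simp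
  qed
  \<comment> \<open>the sum of the power series agrees with the Borel transform where both are defined\<close>
  have glue: "P \<tau> x = h 0 x + borel_transform \<kappa> \<rho> (g x) \<tau>" if "\<tau> \<in> ball 0 r" "\<tau> \<in> S" "x \<in> D" for \<tau> x
  proof (rule LIMSEQ_unique)
    show "(\<lambda>n. \<Sum>j<n. a j x * \<tau> ^ j) \<longlonglongrightarrow> P \<tau> x" using sums[OF that(1,3)] by (simp add: sums_def)
    have "(\<lambda>n. \<Sum>j<n. h j x * \<tau> ^ j / complex_of_real (Gamma (1 + real j / \<kappa>))) \<longlonglongrightarrow> h 0 x + borel_transform \<kappa> \<rho> (\<lambda>e. f e x - h 0 x) \<tau>"
      by (rule borel_transform_taylor[where f = "\<lambda>e. f e x" and h = "\<lambda>j. h j x", OF \<kappa>0 \<rho> hol[OF that(3)] A gev[OF _ that(3)]])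
        (use that ball(2) in \<open>auto simp: S_def\<close>)
    then show "(\<lambda>n. \<Sum>j<n. a j x * \<tau> ^ j) \<longlonglongrightarrow> h 0 x + borel_transform \<kappa> \<rho> (g x) \<tau>"
      by (simp add: a_def gam_def g_def[abs_def])
  qed
  define B where "B \<tau> x = (if x \<in> D then if \<tau> \<in> ball 0 r then P \<tau> x else h 0 x + borel_transform \<kappa> \<rho> (g x) \<tau> else 0)" for \<tau> x
  have BS: "B \<tau> x = h 0 x + borel_transform \<kappa> \<rho> (g x) \<tau>" if "\<tau> \<in> S" "x \<in> D" for \<tau> x
    using glue that by (auto simp: B_def)
  define c where "c = exp 1 * \<bar>A1\<bar> * \<kappa> * \<rho> * 2 powr (1 / \<kappa>)"
  define K where "K = \<rho> powr - \<kappa>"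
  have K: "0 < K" using \<rho> by (simp add: K_def)
  have c0: "0 \<le> c" using \<kappa>0 \<rho> by (simp add: c_def)
  have BSb: "cmod (B \<tau> x) \<le> (C * gam 0 + c) * exp (K * cmod \<tau> powr \<kappa>)" if "\<tau> \<in> S" "x \<in> D" for \<tau> x
  proof -
    have e1: "1 \<le> exp (K * cmod \<tau> powr \<kappa>)" using K by simp
    have "cmod (borel_transform \<kappa> \<rho> (g x) \<tau>) \<le> c * exp (K * cmod \<tau> powr \<kappa>)"
      using borel_transform_bound[OF \<kappa>0 \<rho> _ holg[OF that(2)] gb[OF that(2)], of \<tau>] that(1) \<rho>
      by (simp add: S_def c_def K_def)
    moreover have "cmod (h 0 x) \<le> C * gam 0 * exp (K * cmod \<tau> powr \<kappa>)"
    proof -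
      have "C * gam 0 * 1 \<le> C * gam 0 * exp (K * cmod \<tau> powr \<kappa>)"
        using e1 C gam0[of 0] by (intro mult_left_mono) auto
      moreover have "cmod (h 0 x) \<le> C * gam 0 * 1" using hb[OF that(2), of 0] by simp
      ultimately show ?thesis by linarith
    qed
    ultimately show ?thesis
      unfolding BS[OF that] using norm_triangle_ineq[of "h 0 x" "borel_transform \<kappa> \<rho> (g x) \<tau>"] by (simp add: algebra_simps)
  qed
  have Bball: "cmod (B \<tau> x) \<le> C / (1 - q)" if "\<tau> \<in> ball 0 r" "x \<in> D" for \<tau> x
    using Pb[OF that] that by (simp add: B_def)
  have mem: "B \<tau> \<in> bounded_holomorphic D" if \<tau>: "\<tau> \<in> ball 0 r \<union> S" for \<tau>
  proof (cases "\<tau> \<in> ball 0 r")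
    case True
    show ?thesis
    proof (rule bounded_holomorphic_pointwise_limit[OF D(1)])
      show "(\<lambda>x. \<Sum>j<n. h j x * (\<tau> ^ j / complex_of_real (gam j))) \<in> bounded_holomorphic D" for n
        by (intro bounded_holomorphic_sum memh)
      fix x assume x: "x \<in> D"
      have eq: "(\<Sum>j<n. h j x * (\<tau> ^ j / complex_of_real (gam j))) = (\<Sum>j<n. a j x * \<tau> ^ j)" for n
        by (simp add: a_def)
      show "cmod (\<Sum>j<n. h j x * (\<tau> ^ j / complex_of_real (gam j))) \<le> 2 * C / (1 - q)" for n
        unfolding eq by (rule Pn[OF True x])
      show "(\<lambda>n. \<Sum>j<n. h j x * (\<tau> ^ j / complex_of_real (gam j))) \<longlonglongrightarrow> B \<tau> x"
        unfolding eq using sums[OF True x] True x by (simp add: sums_def B_def)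
    qed (simp add: B_def)
  next
    case False
    with \<tau> have \<tau>S: "\<tau> \<in> S" by simp
    define R where "R = 1 + (cmod \<tau> / \<rho>) powr \<kappa>"
    have R: "(cmod \<tau> / \<rho>) powr \<kappa> < R" by (simp add: R_def)
    have R0: "0 < R" using powr_ge_zero[of "cmod \<tau> / \<rho>" \<kappa>] unfolding R_def by linarith
    define e where "e y = \<tau> * exp (- Ln (Complex R y) / complex_of_real \<kappa>)" for y
    have eS: "e y \<in> sector d \<Theta> \<rho>" for y
      unfolding e_def using \<tau>S R R0 by (intro rotated_in_sector \<kappa>0 \<rho>) (auto simp: S_def)
    define G where "G y x = exp (Complex R y) * g x (e y) / Complex R y" for y x
    have "holomorphic2_on (\<lambda>x. LINT y|lborel. G y x) D"
    proof (rule holomorphic2_on_integral[OF D(1)])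
      show "holomorphic2_on (G y) D" for y
      proof -
        have "(\<lambda>x. exp (Complex R y) / Complex R y * f (e y) x + (- exp (Complex R y) / Complex R y) * h 0 x) \<in> bounded_holomorphic D"
          by (intro bounded_holomorphic_lincomb memf memh eS)
        then show ?thesis
          by (simp add: bounded_holomorphic_def G_def[abs_def] g_def right_diff_distrib diff_divide_distrib)
      qed
      show "(\<lambda>y. G y x) \<in> borel_measurable lborel" if "x \<in> D" for x
        unfolding G_def e_def using \<tau>S R
        by (intro measurable_bromwich_integrand[OF \<kappa>0 \<rho> zero_less_one holg[OF that] gb[OF that]]) (auto simp: S_def)
      show "cmod (G y x) \<le> exp R * A1 * cmod \<tau> powr 1 * cmod (Complex R y) powr - (1 + 1 / \<kappa>)" if "x \<in> D" for y x
        using bromwich_integrand(2)[OF \<kappa>0 \<rho> zero_less_one holg[OF that] gb[OF that], of \<tau> R "Complex R y"] \<tau>S R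
        by (simp add: G_def e_def S_def)
      show "integrable lborel (\<lambda>y. exp R * A1 * cmod \<tau> powr 1 * cmod (Complex R y) powr - (1 + 1 / \<kappa>))"
        using vertical_line_integral(1)[of "1 + 1 / \<kappa>" R] R0 \<kappa>0 by simp
    qed
    moreover have "holomorphic2_on (h 0) D" using memh[of 0] by (simp add: bounded_holomorphic_def)
    ultimately have "holomorphic2_on (\<lambda>x. 1 * h 0 x + (1 / complex_of_real (2 * pi)) * (LINT y|lborel. G y x)) D"
      by (intro holomorphic2_on_lincomb)
    then have "holomorphic2_on (B \<tau>) D"
    proof (rule holomorphic2_on_cong[OF D(1)])
      fix x assume "x \<in> D"
      then show "1 * h 0 x + (1 / complex_of_real (2 * pi)) * (LINT y|lborel. G y x) = B \<tau> x"
        using BS[OF \<tau>S] by (simp add: borel_transform_def bromwich_def R_def[symmetric] G_def e_def)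
    qed
    then show ?thesis
      by (rule bounded_holomorphicI) (use BSb[OF \<tau>S] in \<open>auto simp: B_def\<close>)
  qed
  have holB: "(\<lambda>\<tau>. B \<tau> x) holomorphic_on (ball 0 r \<union> S)" if x: "x \<in> D" for x
  proof (rule holomorphic_on_Un)
    have "(\<lambda>\<tau>. P \<tau> x) holomorphic_on ball 0 r"
      by (rule power_series_holomorphic[where a = "\<lambda>j. a j x"]) (use sums[OF _ x] in simp)
    then show "(\<lambda>\<tau>. B \<tau> x) holomorphic_on ball 0 r"
      by (rule holomorphic_transform) (use x in \<open>simp add: B_def\<close>)
    have "(\<lambda>\<tau>. h 0 x + borel_transform \<kappa> \<rho> (g x) \<tau>) holomorphic_on S"
      unfolding S_def
      by (intro holomorphic_intros borel_transform_holomorphic[OF \<kappa>0 \<rho> zero_less_one holg[OF x] gb[OF x]])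
    then show "(\<lambda>\<tau>. B \<tau> x) holomorphic_on S"
      by (rule holomorphic_transform) (use BS x in simp)
  qed (auto simp: openS)
  have vholB: "vholomorphic_on (bounded_holomorphic D) (sup_norm D) B (ball 0 r \<union> S)"
  proof (rule vholomorphic_on_bounded_holomorphic[OF D mem holB])
    fix e assume "e \<in> ball 0 r \<union> S"
    then obtain t where t: "0 < t" "ball e t \<subseteq> ball 0 r \<union> S"
      using openS by (meson open_Un open_ball openE)
    define M where "M = C / (1 - q) + (C * gam 0 + c) * exp (K * (cmod e + t) powr \<kappa>)"
    have "cmod (B w x) \<le> M" if w: "w \<in> ball e t" and x: "x \<in> D" for w x
    proof -
      have nn: "0 \<le> C / (1 - q)" "0 \<le> (C * gam 0 + c) * exp (K * (cmod e + t) powr \<kappa>)"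
        using C q gam0[of 0] c0 by auto
      show ?thesis
      proof (cases "w \<in> ball 0 r")
        case True
        then show ?thesis using Bball[OF True x] nn by (simp add: M_def)
      next
        case False
        then have wS: "w \<in> S" using t(2) w by auto
        have "cmod w \<le> cmod e + t" using w norm_triangle_sub[of w e] by (auto simp: dist_norm norm_minus_commute)
        then have "cmod w powr \<kappa> \<le> (cmod e + t) powr \<kappa>" using \<kappa>0 by (intro powr_mono2) auto
        then have "exp (K * cmod w powr \<kappa>) \<le> exp (K * (cmod e + t) powr \<kappa>)"
          using K by simp
        then have "(C * gam 0 + c) * exp (K * cmod w powr \<kappa>) \<le> (C * gam 0 + c) * exp (K * (cmod e + t) powr \<kappa>)"
          using C gam0[of 0] c0 by (intro mult_left_mono) auto
        then show ?thesis using BSb[OF wS x] nn by (simp add: M_def)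
      qed
    qed
    then show "\<exists>t>0. \<exists>M. ball e t \<subseteq> ball 0 r \<union> S \<and> (\<forall>w\<in>ball e t. \<forall>x\<in>D. cmod (B w x) \<le> M)"
      using t by blast
  qed
  define C' where "C' = C * gam 0 + c"
  have C': "0 < C'" using C gam0[of 0] c0 by (simp add: C'_def add_pos_nonneg)
  have bc: "borel_continuation (bounded_holomorphic D) (sup_norm D) \<kappa> h d \<delta> C' K B"
    unfolding borel_continuation_def S2
  proof (intro conjI exI[of _ r] ballI)
    fix \<tau> :: complex assume \<tau>: "\<tau> \<in> ball 0 r"
    show "summable (\<lambda>j. sup_norm D (h j) * cmod \<tau> ^ j / Gamma (1 + real j / \<kappa>))"
    proof (rule summable_comparison_test'[OF geo[OF \<tau>], of 0])
      fix j :: nat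
      have N: "0 \<le> sup_norm D (h j)" "sup_norm D (h j) \<le> C * A ^ j * gam j"
        using sup_norm_bounds[OF D(2) hb] by auto
      have "sup_norm D (h j) * cmod \<tau> ^ j / gam j \<le> C * A ^ j * gam j * cmod \<tau> ^ j / gam j"
        using N gam0[of j] by (intro divide_right_mono mult_right_mono) auto
      also have "\<dots> = C * (A * cmod \<tau>) ^ j" using gam0[of j] by (simp add: power_mult_distrib)
      finally show "norm (sup_norm D (h j) * cmod \<tau> ^ j / Gamma (1 + real j / \<kappa>)) \<le> C * (A * cmod \<tau>) ^ j"
        using N gam0[of j] unfolding gam_def[symmetric] by simp
    qed
    show "(\<lambda>n. sup_norm D (\<lambda>x. (\<Sum>j<n. h j x * \<tau> ^ j / complex_of_real (Gamma (1 + real j / \<kappa>))) - B \<tau> x)) \<longlonglongrightarrow> 0"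
    proof (rule Lim_null_comparison[OF always_eventually])
      show "\<forall>n. norm (sup_norm D (\<lambda>x. (\<Sum>j<n. h j x * \<tau> ^ j / complex_of_real (Gamma (1 + real j / \<kappa>))) - B \<tau> x)) \<le> C / (1 - q) * q ^ n"
      proof
        fix n
        have "cmod ((\<Sum>j<n. h j x * \<tau> ^ j / complex_of_real (Gamma (1 + real j / \<kappa>))) - B \<tau> x) \<le> C / (1 - q) * q ^ n"
          if "x \<in> D" for x
          using tail[OF \<tau> that, of n] \<tau> that by (simp add: a_def gam_def B_def)
        from sup_norm_bounds[OF D(2) this]
        show "norm (sup_norm D (\<lambda>x. (\<Sum>j<n. h j x * \<tau> ^ j / complex_of_real (Gamma (1 + real j / \<kappa>))) - B \<tau> x)) \<le> C / (1 - q) * q ^ n"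
          by simp
      qed
      show "(\<lambda>n. C / (1 - q) * q ^ n) \<longlonglongrightarrow> 0"
        using q by (intro tendsto_mult_right_zero LIMSEQ_realpow_zero) auto
    qed
  next
    show "vholomorphic_on (bounded_holomorphic D) (sup_norm D) B (ball 0 r \<union> S)" by (rule vholB)
    fix \<tau> assume "\<tau> \<in> S"
    then show "sup_norm D (B \<tau>) \<le> C' * exp (K * cmod \<tau> powr \<kappa>)"
      using sup_norm_bounds(2)[OF D(2) BSb[of \<tau>]] by (simp add: C'_def)
  qed (rule r)
  have ks: "kappa_summable (bounded_holomorphic D) (sup_norm D) \<kappa> h d"
    unfolding kappa_summable_def using \<kappa> memh \<delta> C' K bc by blast
  have "\<exists>\<rho>'>0. \<rho>' \<le> \<rho> \<and> is_kappa_sum (bounded_holomorphic D) (sup_norm D) \<kappa> h d \<theta> \<rho>' f"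
    if \<theta>: "pi / \<kappa> < \<theta>" "\<theta> < \<Theta>" for \<theta>
  proof -
    have \<theta>\<delta>: "\<theta> < pi / \<kappa> + 2 * \<delta>" using \<theta> by (simp add: d2)
    obtain \<delta>1 where \<delta>1: "0 < \<delta>1" and ex: "\<And>e \<rho>. e \<in> sector d \<theta> \<rho> \<Longrightarrow> \<exists>\<gamma>. laplace_direction \<kappa> d \<delta> \<delta>1 e \<gamma>"
      using exists_laplace_direction[OF \<kappa> \<theta>(1) \<theta>\<delta>] by blast
    define \<rho>' where "\<rho>' = min \<rho> ((\<delta>1 / (2 * K)) powr (1 / \<kappa>))"
    have \<rho>': "0 < \<rho>'" "\<rho>' \<le> \<rho>" using \<rho> \<delta>1 K by (auto simp: \<rho>'_def)
    have "\<rho>' powr \<kappa> \<le> ((\<delta>1 / (2 * K)) powr (1 / \<kappa>)) powr \<kappa>"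
      using \<rho>' \<kappa>0 by (intro powr_mono2) (auto simp: \<rho>'_def)
    also have "\<dots> = \<delta>1 / (2 * K)" using \<kappa>0 \<delta>1 K by (simp add: powr_powr)
    also have "\<dots> < \<delta>1 / K" using \<delta>1 K by (simp add: field_simps)
    finally have \<rho>'K: "\<rho>' powr \<kappa> < \<delta>1 / K" .
    have sub: "sector d \<theta> \<rho>' \<subseteq> sector d \<Theta> \<rho>"
      using unbounded_sector_mono[of \<theta> \<Theta> d] \<theta> \<rho>' by (auto simp: sector_eq_Int_ball)
    have lap: "ray_integrable \<gamma> (laplace_integrand \<kappa> B e x) \<and> f e x = ray_integral \<gamma> (laplace_integrand \<kappa> B e x)"
      if e: "e \<in> sector d \<theta> \<rho>'" and \<gamma>: "laplace_direction \<kappa> d \<delta> \<delta>1 e \<gamma>" for e \<gamma> x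
    proof (cases "x \<in> D")
      case False
      then have "laplace_integrand \<kappa> B e x u = 0" for u by (simp add: laplace_integrand_def B_def)
      then show ?thesis
        using foff[of e x] sub e False
        by (auto simp: ray_integrable_def ray_integral_def set_integrable_def set_lebesgue_integral_def)
    next
      case x: True
      have eS: "e \<in> sector d \<Theta> \<rho>" using sub e by blast
      have e0: "e \<noteq> 0" by (rule sector_nonzero[OF e])
      have er: "cmod e < \<rho>'" using e by (simp add: sector_eq_Int_ball)
      \<comment> \<open>\<open>\<omega>\<close> is \<open>(cis \<gamma> / e)\<^sup>\<kappa>\<close>; the choice of \<open>\<rho>'\<close> and \<open>\<gamma>\<close> puts it into the half-plane of convergence\<close>
      define l where "l = Ln (cis \<gamma> / e)"
      define \<psi> where "\<psi> = Arg (cis \<gamma> / e)"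
      have nz: "cis \<gamma> / e \<noteq> 0" using e0 by simp
      have l: "Re l = - ln (cmod e)" "Im l = \<psi>"
        using nz e0 by (auto simp: l_def \<psi>_def Re_Ln Arg_eq_Im_Ln norm_divide ln_div)
      have \<gamma>': "\<bar>\<gamma> - d\<bar> < \<delta>" "\<bar>\<kappa> * \<psi>\<bar> < pi / 2" "\<delta>1 \<le> cos (\<kappa> * \<psi>)"
        using \<gamma> by (auto simp: laplace_direction_def \<psi>_def)
      define \<omega> where "\<omega> = exp (complex_of_real \<kappa> * l)"
      have "Re \<omega> = cmod e powr - \<kappa> * cos (\<kappa> * \<psi>)"
        using e0 by (simp add: \<omega>_def Re_exp l powr_def)
      moreover have "K < cmod e powr - \<kappa> * \<delta>1"
      proof -
        have "cmod e powr \<kappa> < \<rho>' powr \<kappa>" using er \<kappa>0 by (intro powr_less_mono2) auto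
        then have "K * cmod e powr \<kappa> < \<delta>1" using \<rho>'K K by (simp add: field_simps) (meson less_trans mult_strict_left_mono)
        then show ?thesis using e0 by (simp add: powr_minus field_simps)
      qed
      moreover have "cmod e powr - \<kappa> * \<delta>1 \<le> cmod e powr - \<kappa> * cos (\<kappa> * \<psi>)" using \<gamma>'(3) by (intro mult_left_mono) auto
      ultimately have \<omega>: "\<rho> powr - \<kappa> < Re \<omega>" by (simp add: K_def)
      then have \<omega>0: "0 < Re \<omega>" by (rule less_trans[OF K[unfolded K_def]])
      have Ln\<omega>: "Ln \<omega> = complex_of_real \<kappa> * l"
        unfolding \<omega>_def using \<gamma>'(2) l(2) by (intro Ln_exp) auto
      have recover: "cis \<gamma> * exp (- Ln \<omega> / complex_of_real \<kappa>) = e"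
        using \<kappa>0 nz e0 unfolding Ln\<omega> by (simp add: exp_minus l_def)
      define X where "X s = \<omega> * exp (- (\<omega> * complex_of_real (s powr \<kappa>))) * complex_of_real (\<kappa> * s powr (\<kappa> - 1))" for s
      have integrand: "laplace_integrand \<kappa> B e x (complex_of_real s * cis \<gamma>) * cis \<gamma> =
          h 0 x * X s + borel_transform \<kappa> \<rho> (g x) (complex_of_real s * cis \<gamma>) * X s" if s: "0 < s" for s
      proof -
        have inS: "complex_of_real s * cis \<gamma> \<in> S"
          unfolding S2[symmetric] using s \<gamma>' by (intro unbounded_sectorI) auto
        have "Ln (complex_of_real s * cis \<gamma> / e) = of_real (ln s) + l"
          using Ln_times_of_real[OF s nz] s by (simp add: l_def Ln_of_real)
        then have pw: "(complex_of_real s * cis \<gamma> / e) powr complex_of_real \<kappa> = \<omega> * complex_of_real (s powr \<kappa>)"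
          using s e0 by (simp add: powr_def \<omega>_def distrib_left exp_add exp_of_real[symmetric] mult.commute)
        have "s powr \<kappa> = s * s powr (\<kappa> - 1)" using s by (simp add: powr_diff)
        then have "complex_of_real (s powr \<kappa>) = complex_of_real s * complex_of_real (s powr (\<kappa> - 1))"
          by (simp only: of_real_mult)
        then have "laplace_integrand \<kappa> B e x (complex_of_real s * cis \<gamma>) * cis \<gamma> = B (complex_of_real s * cis \<gamma>) x * X s"
          unfolding laplace_integrand_def pw X_def using s by (simp add: field_simps)
        then show ?thesis by (simp add: BS[OF inS x] distrib_right)
      qed
      have \<gamma>\<Theta>: "\<bar>\<gamma> - d\<bar> < (\<Theta> - pi / \<kappa>) / 2" using \<gamma>'(1) by (simp add: \<delta>_def)
      have i1: "set_integrable lborel {0<..} (\<lambda>s. borel_transform \<kappa> \<rho> (g x) (complex_of_real s * cis \<gamma>) * X s)"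
        unfolding X_def
        by (rule laplace_borel_transform(1)[OF \<kappa>0 \<rho> zero_less_one holg[OF x] gb[OF x] \<gamma>\<Theta> \<omega>])
      have I1: "(LINT s:{0<..}|lborel. borel_transform \<kappa> \<rho> (g x) (complex_of_real s * cis \<gamma>) * X s) = g x e"
        unfolding X_def
        by (subst laplace_borel_transform(2)[OF \<kappa>0 \<rho> zero_less_one holg[OF x] gb[OF x] \<gamma>\<Theta> \<omega>]) (simp_all add: recover[simplified])
      have Xe: "X s = \<omega> * (exp (- (\<omega> * complex_of_real (s powr \<kappa>))) * complex_of_real (\<kappa> * s powr (\<kappa> - 1)))" for s
        by (simp add: X_def)
      have i2: "set_integrable lborel {0<..} (\<lambda>s. h 0 x * X s)"
        unfolding Xe by (intro set_integrable_mult_right integral_exp_powr(1) \<kappa>0 \<omega>0)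
      have I2: "(LINT s:{0<..}|lborel. h 0 x * X s) = h 0 x"
        unfolding Xe using integral_exp_powr(2)[OF \<kappa>0 \<omega>0] \<omega>0 by (simp only: set_integral_mult_right) auto
      have si: "set_integrable lborel {0<..} (\<lambda>s. h 0 x * X s + borel_transform \<kappa> \<rho> (g x) (complex_of_real s * cis \<gamma>) * X s)"
        by (rule set_integral_add(1)[OF i2 i1])
      have "ray_integrable \<gamma> (laplace_integrand \<kappa> B e x)"
        unfolding ray_integrable_def
        by (rule iffD1[OF set_integrable_cong[OF refl refl] si]) (simp add: integrand)
      moreover have "ray_integral \<gamma> (laplace_integrand \<kappa> B e x) =
         (LINT s:{0<..}|lborel. h 0 x * X s + borel_transform \<kappa> \<rho> (g x) (complex_of_real s * cis \<gamma>) * X s)"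
        unfolding ray_integral_def by (rule set_lebesgue_integral_cong) (simp_all add: integrand)
      moreover have "\<dots> = h 0 x + g x e" unfolding set_integral_add(2)[OF i2 i1] I1 I2 ..
      ultimately show ?thesis by (simp add: g_def)
    qed
    have \<theta>0: "0 < \<theta>" using \<theta>(1) \<kappa>0 by (meson divide_pos_pos less_trans pi_gt_zero)
    have sums: "\<forall>e\<in>sector d \<theta> \<rho>'. (\<exists>\<gamma>. laplace_direction \<kappa> d \<delta> \<delta>1 e \<gamma>) \<and>
      (\<forall>\<gamma>. laplace_direction \<kappa> d \<delta> \<delta>1 e \<gamma> \<longrightarrow>
        (\<forall>x. ray_integrable \<gamma> (laplace_integrand \<kappa> B e x) \<and> f e x = ray_integral \<gamma> (laplace_integrand \<kappa> B e x)))"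
      by (intro ballI conjI[OF ex] allI impI lap)
    have "is_kappa_sum (bounded_holomorphic D) (sup_norm D) \<kappa> h d \<theta> \<rho>' f"
      unfolding is_kappa_sum_def
      by (rule conjI[OF \<kappa>], rule conjI, rule allI, rule memh,
          rule exI[of _ \<delta>], rule conjI[OF \<delta>], rule exI[of _ C'], rule conjI[OF C'], rule exI[of _ K], rule conjI[OF K],
          rule exI[of _ \<delta>1], rule conjI[OF \<delta>1], rule exI[of _ B], intro conjI bc \<theta>0 \<theta>\<delta> \<rho>'(1) \<rho>'K sums)
    with \<rho>' show ?thesis by blast
  qed
  then show ?thesis
    unfolding is_kappa_sum_on_sector_def using \<Theta> ks by blast
qed

section \<open>Application to the family of solutions\<close>

lemma holomorphic3_sections:
  assumes "holomorphic3_on (\<lambda>(t, z, e). v t z e) (A \<times> B \<times> E)"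
  shows "t \<in> A \<Longrightarrow> z \<in> B \<Longrightarrow> (\<lambda>e. v t z e) holomorphic_on E"
    and "e \<in> E \<Longrightarrow> holomorphic2_on (\<lambda>(t, z). v t z e) (A \<times> B)"
proof -
  have der: "\<exists>a b c. ((\<lambda>(t, z, e). v t z e) has_derivative (\<lambda>(x, y, w). a * x + b * y + c * w)) (at (t, z, e))"
    if "t \<in> A" "z \<in> B" "e \<in> E" for t z e
    using assms that unfolding holomorphic3_on_def by (meson SigmaI)
  show "(\<lambda>e. v t z e) holomorphic_on E" if tz: "t \<in> A" "z \<in> B"
  proof (rule holomorphic_onI)
    fix e assume "e \<in> E"
    then obtain a b c where D: "((\<lambda>(t, z, e). v t z e) has_derivative (\<lambda>(x, y, w). a * x + b * y + c * w)) (at (t, z, e))"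
      using der tz by blast
    have "((\<lambda>e. (t, z, e)) has_derivative (\<lambda>w. (0, 0, w))) (at e)"
      by (intro has_derivative_Pair has_derivative_const has_derivative_ident)
    from has_derivative_compose[OF this D]
    have "((\<lambda>e. v t z e) has_derivative (\<lambda>w. c * w)) (at e)" by simp
    then have "((\<lambda>e. v t z e) has_field_derivative c) (at e)" by (simp add: has_field_derivative_def)
    then show "(\<lambda>e. v t z e) field_differentiable (at e within E)"
      by (meson field_differentiable_at_within field_differentiable_def)
  qed
  show "holomorphic2_on (\<lambda>(t, z). v t z e) (A \<times> B)" if e: "e \<in> E"
    unfolding holomorphic2_on_def
  proof
    fix x assume "x \<in> A \<times> B"
    then obtain t z where x: "x = (t, z)" "t \<in> A" "z \<in> B" by auto
    obtain a b c where D: "((\<lambda>(t, z, e). v t z e) has_derivative (\<lambda>(x, y, w). a * x + b * y + c * w)) (at (t, z, e))"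
      using der[OF x(2,3) e] by blast
    have "((\<lambda>y. (fst y, snd y, e)) has_derivative (\<lambda>y. (fst y, snd y, 0))) (at (t, z))"
      by (auto intro!: derivative_eq_intros)
    then have "((\<lambda>y. case (fst y, snd y, e) of (t, z, e) \<Rightarrow> v t z e) has_derivative
        (\<lambda>y. case (fst y, snd y, 0) of (x, y, w) \<Rightarrow> a * x + b * y + c * w)) (at (t, z))"
      by (rule has_derivative_compose) (use D in simp)
    then have "((\<lambda>(t, z). v t z e) has_derivative (\<lambda>(x, y). a * x + b * y)) (at x)"
      by (simp add: x(1) case_prod_beta')
    then show "\<exists>a b. ((\<lambda>(t, z). v t z e) has_derivative (\<lambda>(x, y). a * x + b * y)) (at x)" by blast
  qed
qed

lemma open_strip: "open (strip b)"
  unfolding strip_def by (intro open_Collect_less continuous_intros)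

text \<open>Unbounded sectors are cones, so what covers a punctured neighbourhood of 0 covers everything.\<close>

lemma good_covering_unbounded_cover:
  assumes "good_covering n d \<theta> \<rho>" and \<rho>: "0 < \<rho>"
  shows "UNIV - {0} \<subseteq> (\<Union>p<n. unbounded_sector (d p) (\<theta> p))"
proof
  fix z :: complex assume z: "z \<in> UNIV - {0}"
  have "\<exists>N. 0 \<in> interior N \<and> (\<Union>p<n. sector (d p) (\<theta> p) \<rho>) = N - {0}"
    using assms(1) unfolding good_covering_def by (elim conjE)
  then obtain N where N: "0 \<in> interior N" "(\<Union>p<n. sector (d p) (\<theta> p) \<rho>) = N - {0}"
    by (elim exE conjE)
  then obtain r where r: "0 < r" "ball 0 r \<subseteq> N" by (meson mem_interior)
  define w where "w = complex_of_real (r / (2 * cmod z)) * z"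
  have "cmod w = r / (2 * cmod z) * cmod z" using r by (simp only: w_def norm_mult norm_of_real) simp
  then have "cmod w = r / 2" using z by simp
  then have "w \<in> N - {0}" using r by auto
  then obtain p where p: "p < n" "w \<in> unbounded_sector (d p) (\<theta> p)"
    using N(2) by (auto simp: sector_eq_Int_ball)
  have "complex_of_real (2 * cmod z / r) * w \<in> unbounded_sector (d p) (\<theta> p)"
    using z r by (intro unbounded_sector_scale p) auto
  moreover have "complex_of_real (2 * cmod z / r) * w = z" using z r by (simp add: w_def)
  ultimately show "z \<in> (\<Union>p<n. unbounded_sector (d p) (\<theta> p))" using p(1) by auto
qed

text \<open>Sectors of a good covering meet only if they are equal or neighbours, so estimates for
  neighbours give, with worse constants, estimates for all pairs.\<close>

lemma flat_differences_of_adjacent: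
  fixes F :: "nat \<Rightarrow> complex \<Rightarrow> 'x \<Rightarrow> complex"
  assumes gc: "good_covering n d \<theta> \<rho>" and \<rho>: "0 < \<rho>"
    and adj: "\<And>p. p < n \<Longrightarrow> \<exists>K>0. \<exists>M>0. \<forall>e\<in>sector (d ((p + 1) mod n)) (\<theta> ((p + 1) mod n)) \<rho> \<inter> sector (d p) (\<theta> p) \<rho>.
      \<forall>x\<in>D. cmod (F ((p + 1) mod n) e x - F p e x) \<le> K * exp (- M * cmod e powr - \<kappa>)"
  obtains K M where "0 \<le> K" "0 < M"
    "\<And>p q e x. p < n \<Longrightarrow> q < n \<Longrightarrow> e \<in> sector (d p) (\<theta> p) \<rho> \<Longrightarrow> e \<in> sector (d q) (\<theta> q) \<rho> \<Longrightarrow> x \<in> D \<Longrightarrow>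
      cmod (F p e x - F q e x) \<le> K * exp (- (M * cmod e powr - \<kappa>))"
proof -
  define K0 where "K0 p = (SOME K. K > 0 \<and> (\<exists>M>0. \<forall>e\<in>sector (d ((p + 1) mod n)) (\<theta> ((p + 1) mod n)) \<rho> \<inter> sector (d p) (\<theta> p) \<rho>.
      \<forall>x\<in>D. cmod (F ((p + 1) mod n) e x - F p e x) \<le> K * exp (- M * cmod e powr - \<kappa>)))" for p
  have K0: "K0 p > 0 \<and> (\<exists>M>0. \<forall>e\<in>sector (d ((p + 1) mod n)) (\<theta> ((p + 1) mod n)) \<rho> \<inter> sector (d p) (\<theta> p) \<rho>.
      \<forall>x\<in>D. cmod (F ((p + 1) mod n) e x - F p e x) \<le> K0 p * exp (- M * cmod e powr - \<kappa>))" if "p < n" for p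
    unfolding K0_def by (rule someI_ex) (rule adj[OF that])
  then have "\<forall>p. \<exists>M. p < n \<longrightarrow> M > 0 \<and> (\<forall>e\<in>sector (d ((p + 1) mod n)) (\<theta> ((p + 1) mod n)) \<rho> \<inter> sector (d p) (\<theta> p) \<rho>.
      \<forall>x\<in>D. cmod (F ((p + 1) mod n) e x - F p e x) \<le> K0 p * exp (- M * cmod e powr - \<kappa>))" by blast
  then obtain M0 where M0: "\<And>p. p < n \<Longrightarrow> M0 p > 0"
    and est: "\<And>p e x. p < n \<Longrightarrow> e \<in> sector (d ((p + 1) mod n)) (\<theta> ((p + 1) mod n)) \<rho> \<Longrightarrow> e \<in> sector (d p) (\<theta> p) \<rho> \<Longrightarrow> x \<in> D \<Longrightarrow>
      cmod (F ((p + 1) mod n) e x - F p e x) \<le> K0 p * exp (- M0 p * cmod e powr - \<kappa>)"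
    by (metis IntI)
  have n: "n \<noteq> 0" using gc by (simp add: good_covering_def)
  define K where "K = (\<Sum>p<n. K0 p)"
  define M where "M = Min (M0 ` {..<n})"
  have K0K: "K0 p \<le> K" if "p < n" for p
    unfolding K_def using that K0 by (intro member_le_sum) (auto simp: less_imp_le)
  have M0M: "M \<le> M0 p" if "p < n" for p unfolding M_def using that by (intro Min_le) auto
  have Kpos: "0 \<le> K" unfolding K_def using K0 by (intro sum_nonneg) (auto simp: less_imp_le)
  have Mpos: "0 < M" unfolding M_def using M0 n by (subst Min_gr_iff) auto
  have next1: "cmod (F q e x - F p e x) \<le> K * exp (- (M * cmod e powr - \<kappa>))"
    if "p < n" "q = (p + 1) mod n" "e \<in> sector (d p) (\<theta> p) \<rho>" "e \<in> sector (d q) (\<theta> q) \<rho>" "x \<in> D" for p q e x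
  proof -
    have "cmod (F q e x - F p e x) \<le> K0 p * exp (- M0 p * cmod e powr - \<kappa>)"
      using est[OF that(1), of e x] that by simp
    also have "\<dots> \<le> K * exp (- (M * cmod e powr - \<kappa>))"
      using K0K[OF that(1)] M0M[OF that(1)] Kpos by (intro mult_mono) (auto intro!: mult_right_mono)
    finally show ?thesis .
  qed
  show ?thesis
  proof (rule that[OF Kpos Mpos])
    fix p q e x assume *: "p < n" "q < n" "e \<in> sector (d p) (\<theta> p) \<rho>" "e \<in> sector (d q) (\<theta> q) \<rho>" "x \<in> D"
    show "cmod (F p e x - F q e x) \<le> K * exp (- (M * cmod e powr - \<kappa>))"
    proof (cases "p = q")
      case False
      then have "q = (p + 1) mod n \<or> p = (q + 1) mod n"
        using * by (intro good_covering_meet_adjacent[OF gc \<rho>]) auto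
      then show ?thesis
        using next1[of p q e x] next1[of q p e x] * by (auto simp: norm_minus_commute)
    qed (use Kpos in simp)
  qed
qed

text \<open>The expansion is found at each point of \<open>D\<close>, with uniform constants, and this makes it an expansion in the
  sup norm. Its coefficients belong to the function space as limits of elements.\<close>

theorem good_covering_family_expansion:
  fixes F :: "nat \<Rightarrow> complex \<Rightarrow> complex \<times> complex \<Rightarrow> complex"
  assumes \<kappa>: "1 / 2 < \<kappa>" and \<rho>: "0 < \<rho>" and D: "open D" "D \<noteq> {}" and gc: "good_covering n d \<theta> \<rho>"
    and mem: "\<And>p e. p < n \<Longrightarrow> e \<in> sector (d p) (\<theta> p) \<rho> \<Longrightarrow> F p e \<in> bounded_holomorphic D"
    and hol: "\<And>p x. p < n \<Longrightarrow> x \<in> D \<Longrightarrow> (\<lambda>e. F p e x) holomorphic_on sector (d p) (\<theta> p) \<rho>"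
    and bnd: "\<And>p. p < n \<Longrightarrow> \<exists>B. \<forall>e\<in>sector (d p) (\<theta> p) \<rho>. \<forall>x\<in>D. cmod (F p e x) \<le> B"
    and adj: "\<And>p. p < n \<Longrightarrow> \<exists>K>0. \<exists>M>0. \<forall>e\<in>sector (d ((p + 1) mod n)) (\<theta> ((p + 1) mod n)) \<rho> \<inter> sector (d p) (\<theta> p) \<rho>.
      \<forall>x\<in>D. cmod (F ((p + 1) mod n) e x - F p e x) \<le> K * exp (- M * cmod e powr - \<kappa>)"
  obtains h C A where "0 < C" "0 < A" "\<And>m. h m \<in> bounded_holomorphic D"
    "\<And>p. p < n \<Longrightarrow> vholomorphic_on (bounded_holomorphic D) (sup_norm D) (F p) (sector (d p) (\<theta> p) \<rho>)"
    "\<And>p. p < n \<Longrightarrow> \<exists>B. \<forall>e\<in>sector (d p) (\<theta> p) \<rho>. sup_norm D (F p e) \<le> B"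
    "\<And>p j e x. p < n \<Longrightarrow> e \<in> sector (d p) (\<theta> p) \<rho> \<Longrightarrow> x \<in> D \<Longrightarrow>
       cmod (F p e x - (\<Sum>m<j. h m x * e ^ m)) \<le> C * A ^ j * Gamma (1 + real j / \<kappa>) * cmod e ^ j"
    "\<And>p. p < n \<Longrightarrow> pi / \<kappa> < \<theta> p \<Longrightarrow>
       is_kappa_sum_on_sector (bounded_holomorphic D) (sup_norm D) \<kappa> h (d p) (\<theta> p) \<rho> (F p)"
proof -
  have \<kappa>0: "0 < \<kappa>" using \<kappa> by linarith
  have "\<forall>p. \<exists>B. p < n \<longrightarrow> (\<forall>e\<in>sector (d p) (\<theta> p) \<rho>. \<forall>x\<in>D. cmod (F p e x) \<le> B)"
    using bnd by blast
  then obtain B0 where B0: "\<And>p e x. p < n \<Longrightarrow> e \<in> sector (d p) (\<theta> p) \<rho> \<Longrightarrow> x \<in> D \<Longrightarrow> cmod (F p e x) \<le> B0 p"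
    by metis
  define B where "B = (\<Sum>p<n. \<bar>B0 p\<bar>)"
  have B: "cmod (F p e x) \<le> B" if "p < n" "e \<in> sector (d p) (\<theta> p) \<rho>" "x \<in> D" for p e x
  proof -
    have "\<bar>B0 p\<bar> \<le> B" unfolding B_def using that(1) by (intro member_le_sum) auto
    then show ?thesis using B0[OF that] by linarith
  qed
  obtain K M where K: "0 \<le> K" and M: "0 < M" and
    flat: "\<And>p q e x. p < n \<Longrightarrow> q < n \<Longrightarrow> e \<in> sector (d p) (\<theta> p) \<rho> \<Longrightarrow> e \<in> sector (d q) (\<theta> q) \<rho> \<Longrightarrow> x \<in> D \<Longrightarrow>
      cmod (F p e x - F q e x) \<le> K * exp (- (M * cmod e powr - \<kappa>))"
    by (rule flat_differences_of_adjacent[OF gc \<rho> adj]) blast+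
  have "\<exists>h C A. 0 < C \<and> 0 < A \<and> (\<forall>p<n. \<forall>j. \<forall>e\<in>sector (d p) (\<theta> p) \<rho>. \<forall>x\<in>D.
    cmod (F p e x - (\<Sum>m<j. h m x * e ^ m)) \<le> C * A ^ j * Gamma (1 + real j / \<kappa>) * cmod e ^ j)"
    by (rule ramis_sibuya[OF \<kappa>0 \<rho> K M good_covering_unbounded_cover[OF gc \<rho>]])
      (rule hol, assumption, assumption, rule B, assumption, assumption, assumption, rule flat, assumption+)
  then obtain h0 C A where C: "0 < C" and A: "0 < A" and exp0: "\<forall>p<n. \<forall>j. \<forall>e\<in>sector (d p) (\<theta> p) \<rho>. \<forall>x\<in>D.
    cmod (F p e x - (\<Sum>m<j. h0 m x * e ^ m)) \<le> C * A ^ j * Gamma (1 + real j / \<kappa>) * cmod e ^ j"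
    by (elim exE conjE)
  define h where "h m = zero_off D (h0 m)" for m
  have gev: "cmod (F p e x - (\<Sum>m<j. h m x * e ^ m)) \<le> C * A ^ j * Gamma (1 + real j / \<kappa>) * cmod e ^ j"
    if "p < n" "e \<in> sector (d p) (\<theta> p) \<rho>" "x \<in> D" for p j e x
    using exp0 that by (simp add: h_def zero_off_def)
  have n: "0 < n" and \<theta>0: "0 < \<theta> 0" using gc by (auto simp: good_covering_def)
  have "cis (d 0) \<in> unbounded_sector (d 0) (\<theta> 0)"
    using unbounded_sectorI[of 1 "d 0" "d 0" "\<theta> 0"] \<theta>0 by simp
  then have ne: "unbounded_sector (d 0) (\<theta> 0) \<noteq> {}" by blast
  have memh: "h m \<in> bounded_holomorphic D" for m
  proof (rule gevrey_coeff_mem[where f = "F 0" and c = "\<lambda>j. C * A ^ j * Gamma (1 + real j / \<kappa>)", OF D(1) ne \<rho>])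
    show "F 0 e \<in> bounded_holomorphic D" if "e \<in> sector (d 0) (\<theta> 0) \<rho>" for e by (rule mem[OF n that])
    show "cmod (F 0 e x - (\<Sum>m<j. h m x * e ^ m)) \<le> C * A ^ j * Gamma (1 + real j / \<kappa>) * cmod e ^ j"
      if "e \<in> sector (d 0) (\<theta> 0) \<rho>" "x \<in> D" for j e x by (rule gev[OF n that])
  qed (simp add: h_def zero_off_def)
  show ?thesis
  proof (rule that[OF C A memh _ _ gev])
    fix p assume p: "p < n"
    show "vholomorphic_on (bounded_holomorphic D) (sup_norm D) (F p) (sector (d p) (\<theta> p) \<rho>)"
    proof (rule vholomorphic_on_bounded_holomorphic[OF D mem[OF p] hol[OF p]])
      fix e assume "e \<in> sector (d p) (\<theta> p) \<rho>"
      then obtain t where "0 < t" "ball e t \<subseteq> sector (d p) (\<theta> p) \<rho>"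
        using open_sector by (meson openE)
      then show "\<exists>t>0. \<exists>M. ball e t \<subseteq> sector (d p) (\<theta> p) \<rho> \<and> (\<forall>w\<in>ball e t. \<forall>x\<in>D. cmod (F p w x) \<le> M)"
        using B[OF p] by blast
    qed
    show "\<exists>B. \<forall>e\<in>sector (d p) (\<theta> p) \<rho>. sup_norm D (F p e) \<le> B"
      by (intro exI ballI sup_norm_bounds(2)[OF D(2)]) (rule B[OF p])
    assume wide: "pi / \<kappa> < \<theta> p"
    show "is_kappa_sum_on_sector (bounded_holomorphic D) (sup_norm D) \<kappa> h (d p) (\<theta> p) \<rho> (F p)"
      by (rule gevrey_is_kappa_sum[OF \<kappa> \<rho> D wide memh mem[OF p] hol[OF p] C A gev[OF p]])
  qed
qed

theorem theorem2:
  fixes k k' k\<^sub>1 m\<^sub>D \<delta>\<^sub>D n\<^sub>E :: nat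
    and I :: "(nat \<times> nat) set" and \<Delta> :: "nat \<times> nat \<Rightarrow> nat"
    and Q R\<^sub>D :: "complex poly" and R :: "nat \<times> nat \<Rightarrow> complex poly"
    and \<beta> \<mu> \<epsilon>\<^sub>0 K\<^sub>0 T\<^sub>0 \<kappa>\<^sub>1 \<kappa> \<beta>' \<sigma> \<sigma>' :: real
    and C :: "nat \<times> nat \<Rightarrow> real \<Rightarrow> complex \<Rightarrow> complex" and Cb :: "nat \<times> nat \<Rightarrow> real"
    and \<psi> :: "nat \<Rightarrow> real \<Rightarrow> complex \<Rightarrow> complex"
    and d\<^sub>Q \<eta>\<^sub>Q r\<^sub>Q1 r\<^sub>Q2 :: real
    and d\<^sub>E \<theta>\<^sub>E d \<theta>\<^sub>U \<theta>\<^sub>S :: "nat \<Rightarrow> real" and d\<^sub>T \<theta>\<^sub>T r\<^sub>T r :: real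
    and u :: "nat \<Rightarrow> complex \<Rightarrow> complex \<Rightarrow> complex \<Rightarrow> complex"
    and E U S :: "nat \<Rightarrow> complex set" and T H :: "complex set"
    and D :: "(complex \<times> complex) set"
  \<comment> \<open>parameters of the equation\<close>
  assumes "1 \<le> k" and "1 \<le> k'" and "1 \<le> m\<^sub>D" and "1 \<le> \<delta>\<^sub>D" and "k * \<delta>\<^sub>D = m\<^sub>D * k'"
    and "finite I" and "\<And>l1 l2. (l1, l2) \<in> I \<Longrightarrow> 1 + l2 * k' \<le> k * l1"
    and "\<And>l1 l2. (l1, l2) \<in> I \<Longrightarrow> k * l1 \<le> \<Delta> (l1, l2)"
    and "degree Q = degree R\<^sub>D" and "\<And>l. l \<in> I \<Longrightarrow> degree (R l) \<le> degree R\<^sub>D"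
    and "\<And>m::real. poly Q (\<i> * of_real m) \<noteq> 0" and "\<And>m::real. poly R\<^sub>D (\<i> * of_real m) \<noteq> 0"
    and "0 < \<beta>" and "0 < \<mu>" and "0 < \<epsilon>\<^sub>0" and "0 < K\<^sub>0" and "0 < T\<^sub>0"
    and "1 \<le> k\<^sub>1" and "k\<^sub>1 < k'" and "1 / \<kappa>\<^sub>1 = 1 / real k\<^sub>1 - 1 / real k'"
    and "1 / 2 < \<kappa>\<^sub>1" and "\<kappa>\<^sub>1 \<le> real k"
    and "\<And>l. l \<in> I \<Longrightarrow> real (degree (R l)) + 1 < \<mu>"
    and "\<And>l1 l2. (l1, l2) \<in> I \<Longrightarrow>
           real k * real l1 * (1 - real k\<^sub>1 / real k') + real k\<^sub>1 * real l2 + 1 \<le> real k * real \<delta>\<^sub>D"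
  \<comment> \<open>coefficients and forcing term\<close>
    and "\<And>l. l \<in> I \<Longrightarrow>
           vholomorphic_on (E_space \<beta> \<mu>) (E_norm \<beta> \<mu>) (\<lambda>\<epsilon> m. C l m \<epsilon>) (ball 0 \<epsilon>\<^sub>0)"
    and "\<And>l. l \<in> I \<Longrightarrow> 0 < Cb l"
    and "\<And>l \<epsilon>. l \<in> I \<Longrightarrow> \<epsilon> \<in> ball 0 \<epsilon>\<^sub>0 \<Longrightarrow> E_norm \<beta> \<mu> (\<lambda>m. C l m \<epsilon>) \<le> Cb l"
    and "\<And>n. 1 \<le> n \<Longrightarrow>
           vholomorphic_on (E_space \<beta> \<mu>) (E_norm \<beta> \<mu>) (\<lambda>\<epsilon> m. \<psi> n m \<epsilon>) (ball 0 \<epsilon>\<^sub>0)"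
    and "\<And>n \<epsilon>. 1 \<le> n \<Longrightarrow> \<epsilon> \<in> ball 0 \<epsilon>\<^sub>0 \<Longrightarrow> E_norm \<beta> \<mu> (\<lambda>m. \<psi> n m \<epsilon>) \<le> K\<^sub>0 * (1 / T\<^sub>0) ^ n"
  \<comment> \<open>sectorial annulus\<close>
    and "0 < \<eta>\<^sub>Q" and "0 < r\<^sub>Q1" and "r\<^sub>Q1 < r\<^sub>Q2"
    and "\<And>m::real. poly Q (\<i> * of_real m) / poly R\<^sub>D (\<i> * of_real m)
           \<in> sectorial_annulus d\<^sub>Q \<eta>\<^sub>Q r\<^sub>Q1 r\<^sub>Q2"
  \<comment> \<open>admissible data\<close>
    and "admissible k k' (k * \<delta>\<^sub>D) (q_root k k' m\<^sub>D \<delta>\<^sub>D Q R\<^sub>D) n\<^sub>E \<epsilon>\<^sub>0 d\<^sub>E \<theta>\<^sub>E d \<theta>\<^sub>U \<theta>\<^sub>S d\<^sub>T \<theta>\<^sub>T r\<^sub>T r"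
    and "E = (\<lambda>p. sector (d\<^sub>E p) (\<theta>\<^sub>E p) \<epsilon>\<^sub>0)"
    and "U = (\<lambda>p. unbounded_sector (d p) (\<theta>\<^sub>U p))"
    and "S = (\<lambda>p. unbounded_sector (d p) (\<theta>\<^sub>S p))"
    and "T = sector d\<^sub>T \<theta>\<^sub>T r\<^sub>T"
  \<comment> \<open>the family of solutions\<close>
    and "0 < \<beta>'" and "\<beta>' < \<beta>" and "0 < \<sigma>'" and "\<sigma>' < \<sigma>"
    and "H = strip \<beta>'"
    and "\<And>p. p < n\<^sub>E \<Longrightarrow>
           holomorphic3_on (\<lambda>(t, z, \<epsilon>). u p t z \<epsilon>) ((T \<inter> ball 0 \<sigma>) \<times> H \<times> E p)"
    and "\<And>p. p < n\<^sub>E \<Longrightarrow> bounded ((\<lambda>(t, z, \<epsilon>). u p t z \<epsilon>) ` ((T \<inter> ball 0 \<sigma>) \<times> H \<times> E p))"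
    and "\<And>p t z \<epsilon>. p < n\<^sub>E \<Longrightarrow> t \<in> T \<inter> ball 0 \<sigma> \<Longrightarrow> z \<in> H \<Longrightarrow> \<epsilon> \<in> E p \<Longrightarrow>
           satisfies_pde k k' k\<^sub>1 m\<^sub>D \<delta>\<^sub>D I \<Delta> Q R\<^sub>D R C \<psi> (u p) t z \<epsilon>"
    and "\<And>p z \<epsilon>. p < n\<^sub>E \<Longrightarrow> z \<in> H \<Longrightarrow> \<epsilon> \<in> E p \<Longrightarrow> ((\<lambda>t. u p t z \<epsilon>) \<longlongrightarrow> 0) (at 0 within T)"
    and "\<And>p. p < n\<^sub>E \<Longrightarrow>
           double_laplace_form k k' k\<^sub>1 \<kappa>\<^sub>1 \<beta> \<mu> T\<^sub>0 \<epsilon>\<^sub>0 (S p) (U p) r (T \<inter> ball 0 \<sigma>) H (E p) (u p)"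
    and "\<kappa> = real k * real k' / (real k + real k')"
    and "\<And>p. p < n\<^sub>E \<Longrightarrow> \<exists>Kp>0. \<exists>Mp>0.
           \<forall>\<epsilon> \<in> E ((p + 1) mod n\<^sub>E) \<inter> E p. \<forall>t \<in> T \<inter> ball 0 \<sigma>'. \<forall>z \<in> H.
             cmod (u ((p + 1) mod n\<^sub>E) t z \<epsilon> - u p t z \<epsilon>) \<le> Kp * exp (- Mp * cmod \<epsilon> powr (- \<kappa>))"
    and "D = (T \<inter> ball 0 \<sigma>') \<times> H"
  shows
    "\<exists>h :: nat \<Rightarrow> complex \<times> complex \<Rightarrow> complex.
       (\<forall>m. h m \<in> bounded_holomorphic D) \<and>
       (\<forall>p<n\<^sub>E.
          vholomorphic_on (bounded_holomorphic D) (sup_norm D)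
            (\<lambda>\<epsilon>. zero_off D (\<lambda>(t, z). u p t z \<epsilon>)) (E p) \<and>
          (\<exists>B. \<forall>\<epsilon>\<in>E p. sup_norm D (zero_off D (\<lambda>(t, z). u p t z \<epsilon>)) \<le> B) \<and>
          (\<exists>Cp>0. \<exists>Mp>0. \<forall>n\<ge>1. \<forall>\<epsilon>\<in>E p. \<forall>(t, z)\<in>D.
             cmod (u p t z \<epsilon> - (\<Sum>m<n. h m (t, z) * \<epsilon> ^ m))
               \<le> Cp * Mp ^ n * Gamma (1 + real n / \<kappa>) * cmod \<epsilon> ^ n)) \<and>
       (\<forall>p0<n\<^sub>E. pi / \<kappa> < \<theta>\<^sub>E p0 \<longrightarrow>
          is_kappa_sum_on_sector (bounded_holomorphic D) (sup_norm D) \<kappa> h (d\<^sub>E p0) (\<theta>\<^sub>E p0) \<epsilon>\<^sub>0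
            (\<lambda>\<epsilon>. zero_off D (\<lambda>(t, z). u p0 t z \<epsilon>)))"
proof -
  have k: "1 \<le> k" "1 \<le> k'" "1 \<le> k\<^sub>1" "k\<^sub>1 < k'" and \<epsilon>0: "0 < \<epsilon>\<^sub>0" and \<beta>': "0 < \<beta>'" and \<sigma>: "0 < \<sigma>'" "\<sigma>' < \<sigma>" by fact+
  have E: "E = (\<lambda>p. sector (d\<^sub>E p) (\<theta>\<^sub>E p) \<epsilon>\<^sub>0)" and T: "T = sector d\<^sub>T \<theta>\<^sub>T r\<^sub>T" and H: "H = strip \<beta>'"
    and DD: "D = (T \<inter> ball 0 \<sigma>') \<times> H" and \<kappa>_eq: "\<kappa> = real k * real k' / (real k + real k')" by fact+
  have adm: "admissible k k' (k * \<delta>\<^sub>D) (q_root k k' m\<^sub>D \<delta>\<^sub>D Q R\<^sub>D) n\<^sub>E \<epsilon>\<^sub>0 d\<^sub>E \<theta>\<^sub>E d \<theta>\<^sub>U \<theta>\<^sub>S d\<^sub>T \<theta>\<^sub>T r\<^sub>T r" by fact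
  have hol3: "holomorphic3_on (\<lambda>(t, z, \<epsilon>). u p t z \<epsilon>) ((T \<inter> ball 0 \<sigma>) \<times> H \<times> sector (d\<^sub>E p) (\<theta>\<^sub>E p) \<epsilon>\<^sub>0)" if "p < n\<^sub>E" for p
    using that unfolding E[symmetric, THEN fun_cong] by fact
  have bdd: "bounded ((\<lambda>(t, z, \<epsilon>). u p t z \<epsilon>) ` ((T \<inter> ball 0 \<sigma>) \<times> H \<times> sector (d\<^sub>E p) (\<theta>\<^sub>E p) \<epsilon>\<^sub>0))" if "p < n\<^sub>E" for p
    using that unfolding E[symmetric, THEN fun_cong] by fact
  have flat: "\<exists>Kp>0. \<exists>Mp>0.
           \<forall>\<epsilon> \<in> E ((p + 1) mod n\<^sub>E) \<inter> E p. \<forall>t \<in> T \<inter> ball 0 \<sigma>'. \<forall>z \<in> H.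
             cmod (u ((p + 1) mod n\<^sub>E) t z \<epsilon> - u p t z \<epsilon>) \<le> Kp * exp (- Mp * cmod \<epsilon> powr (- \<kappa>))" if "p < n\<^sub>E" for p
    using that by fact
  have gc: "good_covering n\<^sub>E d\<^sub>E \<theta>\<^sub>E \<epsilon>\<^sub>0" using adm unfolding admissible_def by (elim conjE)
  have T0: "0 < \<theta>\<^sub>T" "0 < r\<^sub>T" using adm unfolding admissible_def by simp_all
  \<comment> \<open>\<open>\<kappa>\<close> increases with \<open>k \<ge> 1\<close> and \<open>k' \<ge> 2\<close>, so it is at least 2 / 3\<close>
  have \<kappa>: "1 / 2 < \<kappa>"
  proof -
    have "real k + real k' < 2 * (real k * real k')"
    proof -
      have "real k \<le> real k * real k'" "real k' \<le> real k * real k'" "real k < real k * real k'"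
        using k by simp_all
      then show ?thesis by linarith
    qed
    moreover have "0 < real k + real k'" using k by simp
    ultimately show ?thesis unfolding \<kappa>_eq by (simp add: field_simps)
  qed
  have openD: "open D"
    unfolding DD T H by (intro open_Times open_Int open_sector open_ball open_strip)
  have "complex_of_real (min r\<^sub>T \<sigma>' / 2) * cis d\<^sub>T \<in> T \<inter> ball 0 \<sigma>'"
  proof
    show "complex_of_real (min r\<^sub>T \<sigma>' / 2) * cis d\<^sub>T \<in> T"
      unfolding T using T0 \<sigma> by (intro sectorI) auto
    show "complex_of_real (min r\<^sub>T \<sigma>' / 2) * cis d\<^sub>T \<in> ball 0 \<sigma>'"
      using T0 \<sigma> by (simp add: norm_mult)
  qed
  moreover have "0 \<in> H" using \<beta>' by (simp add: H strip_def)
  ultimately have neD: "D \<noteq> {}" unfolding DD by blast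
  define F where "F p e = zero_off D (\<lambda>(t, z). u p t z e)" for p e
  have F_eq: "F p e (t, z) = u p t z e" if "(t, z) \<in> D" for p e t z
    using that by (simp add: F_def zero_off_def)
  have sub: "t \<in> T \<inter> ball 0 \<sigma> \<and> z \<in> H" if "(t, z) \<in> D" for t z using that \<sigma> by (auto simp: DD)
  have bnd: "\<exists>B. \<forall>e\<in>sector (d\<^sub>E p) (\<theta>\<^sub>E p) \<epsilon>\<^sub>0. \<forall>x\<in>D. cmod (F p e x) \<le> B" if p: "p < n\<^sub>E" for p
  proof -
    obtain B where B: "\<And>y. y \<in> (\<lambda>(t, z, \<epsilon>). u p t z \<epsilon>) ` ((T \<inter> ball 0 \<sigma>) \<times> H \<times> sector (d\<^sub>E p) (\<theta>\<^sub>E p) \<epsilon>\<^sub>0) \<Longrightarrow> cmod y \<le> B"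
      using bdd[OF p] unfolding bounded_iff by blast
    have bt: "cmod (F p e (t, z)) \<le> B" if "e \<in> sector (d\<^sub>E p) (\<theta>\<^sub>E p) \<epsilon>\<^sub>0" "(t, z) \<in> D" for e t z
      unfolding F_eq[OF that(2)] using sub[OF that(2)] that(1) by (intro B image_eqI[of _ _ "(t, z, e)"]) auto
    show ?thesis
    proof (intro exI[of _ B] ballI)
      fix e x assume "e \<in> sector (d\<^sub>E p) (\<theta>\<^sub>E p) \<epsilon>\<^sub>0" "x \<in> D"
      then show "cmod (F p e x) \<le> B" using bt[of e "fst x" "snd x"] by simp
    qed
  qed
  have hol: "(\<lambda>e. F p e x) holomorphic_on sector (d\<^sub>E p) (\<theta>\<^sub>E p) \<epsilon>\<^sub>0" if "p < n\<^sub>E" "x \<in> D" for p x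
  proof -
    obtain t z where x: "x = (t, z)" by (cases x)
    then have D': "(t, z) \<in> D" using that by simp
    show ?thesis
      unfolding x F_eq[OF D'] using sub[OF D'] by (intro holomorphic3_sections(1)[OF hol3[OF that(1)]]) auto
  qed
  have mem: "F p e \<in> bounded_holomorphic D" if p: "p < n\<^sub>E" and e: "e \<in> sector (d\<^sub>E p) (\<theta>\<^sub>E p) \<epsilon>\<^sub>0" for p e
  proof -
    obtain B where B: "\<And>x. x \<in> D \<Longrightarrow> cmod (F p e x) \<le> B" using bnd[OF p] e by blast
    have "holomorphic2_on (\<lambda>(t, z). u p t z e) ((T \<inter> ball 0 \<sigma>) \<times> H)"
      by (rule holomorphic3_sections(2)[OF hol3[OF p] e])
    then have "holomorphic2_on (\<lambda>(t, z). u p t z e) D"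
      using sub unfolding holomorphic2_on_def by force
    then have "holomorphic2_on (F p e) D"
      by (rule holomorphic2_on_cong[OF openD]) (auto simp: F_eq)
    then show ?thesis
      by (rule bounded_holomorphicI[OF _ B]) (simp_all add: F_def zero_off_def)
  qed
  have adj: "\<exists>K>0. \<exists>M>0. \<forall>e\<in>sector (d\<^sub>E ((p + 1) mod n\<^sub>E)) (\<theta>\<^sub>E ((p + 1) mod n\<^sub>E)) \<epsilon>\<^sub>0 \<inter> sector (d\<^sub>E p) (\<theta>\<^sub>E p) \<epsilon>\<^sub>0.
      \<forall>x\<in>D. cmod (F ((p + 1) mod n\<^sub>E) e x - F p e x) \<le> K * exp (- M * cmod e powr - \<kappa>)" if p: "p < n\<^sub>E" for p
  proof -
    obtain K M where "0 < K" "0 < M" and KM: "\<forall>\<epsilon> \<in> E ((p + 1) mod n\<^sub>E) \<inter> E p. \<forall>t \<in> T \<inter> ball 0 \<sigma>'. \<forall>z \<in> H.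
        cmod (u ((p + 1) mod n\<^sub>E) t z \<epsilon> - u p t z \<epsilon>) \<le> K * exp (- M * cmod \<epsilon> powr (- \<kappa>))"
      using flat[OF p] by blast
    have "cmod (F ((p + 1) mod n\<^sub>E) e x - F p e x) \<le> K * exp (- M * cmod e powr - \<kappa>)"
      if e: "e \<in> E ((p + 1) mod n\<^sub>E) \<inter> E p" and x: "x \<in> D" for e x
    proof -
      obtain t z where xe: "x = (t, z)" by (cases x)
      have D': "(t, z) \<in> D" using x xe by simp
      then have tz: "t \<in> T \<inter> ball 0 \<sigma>'" "z \<in> H" by (simp_all add: DD)
      show ?thesis unfolding xe F_eq[OF D'] by (rule bspec[OF bspec[OF bspec[OF KM e] tz(1)] tz(2)])
    qed
    then have "\<forall>e\<in>E ((p + 1) mod n\<^sub>E) \<inter> E p. \<forall>x\<in>D. cmod (F ((p + 1) mod n\<^sub>E) e x - F p e x) \<le> K * exp (- M * cmod e powr - \<kappa>)"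
      by (intro ballI)
    with \<open>0 < K\<close> \<open>0 < M\<close> show ?thesis unfolding E by (intro exI[of _ K] conjI exI[of _ M])
  qed
  obtain h C' A where C: "0 < C'" and A: "0 < A" and memh: "\<And>m. h m \<in> bounded_holomorphic D"
    and vhol: "\<And>p. p < n\<^sub>E \<Longrightarrow> vholomorphic_on (bounded_holomorphic D) (sup_norm D) (F p) (sector (d\<^sub>E p) (\<theta>\<^sub>E p) \<epsilon>\<^sub>0)"
    and sn: "\<And>p. p < n\<^sub>E \<Longrightarrow> \<exists>B. \<forall>e\<in>sector (d\<^sub>E p) (\<theta>\<^sub>E p) \<epsilon>\<^sub>0. sup_norm D (F p e) \<le> B"
    and gev: "\<And>p j e x. p < n\<^sub>E \<Longrightarrow> e \<in> sector (d\<^sub>E p) (\<theta>\<^sub>E p) \<epsilon>\<^sub>0 \<Longrightarrow> x \<in> D \<Longrightarrow>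
       cmod (F p e x - (\<Sum>m<j. h m x * e ^ m)) \<le> C' * A ^ j * Gamma (1 + real j / \<kappa>) * cmod e ^ j"
    and ks: "\<And>p. p < n\<^sub>E \<Longrightarrow> pi / \<kappa> < \<theta>\<^sub>E p \<Longrightarrow>
       is_kappa_sum_on_sector (bounded_holomorphic D) (sup_norm D) \<kappa> h (d\<^sub>E p) (\<theta>\<^sub>E p) \<epsilon>\<^sub>0 (F p)"
    by (rule good_covering_family_expansion[OF \<kappa> \<epsilon>0 openD neD gc mem hol bnd adj]) (assumption | rule that)+
  have F: "(\<lambda>\<epsilon>. zero_off D (\<lambda>(t, z). u p t z \<epsilon>)) = F p" for p by (simp add: F_def[abs_def])
  have est: "\<exists>Cp>0. \<exists>Mp>0. \<forall>n\<ge>1. \<forall>\<epsilon>\<in>E p. \<forall>(t, z)\<in>D.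
      cmod (u p t z \<epsilon> - (\<Sum>m<n. h m (t, z) * \<epsilon> ^ m)) \<le> Cp * Mp ^ n * Gamma (1 + real n / \<kappa>) * cmod \<epsilon> ^ n"
    if p: "p < n\<^sub>E" for p
  proof (rule exI[of _ C'], rule conjI[OF C], rule exI[of _ A], rule conjI[OF A], intro allI impI ballI)
    fix n :: nat and \<epsilon> x assume "\<epsilon> \<in> E p" and x: "x \<in> D"
    then have e: "\<epsilon> \<in> sector (d\<^sub>E p) (\<theta>\<^sub>E p) \<epsilon>\<^sub>0" by (simp add: E)
    obtain t z where xe: "x = (t, z)" by (cases x)
    show "case x of (t, z) \<Rightarrow> cmod (u p t z \<epsilon> - (\<Sum>m<n. h m (t, z) * \<epsilon> ^ m)) \<le> C' * A ^ n * Gamma (1 + real n / \<kappa>) * cmod \<epsilon> ^ n"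
      using gev[OF p e x, of n] x unfolding xe by (simp add: F_eq)
  qed
  show ?thesis
  proof (intro exI[of _ h] conjI allI impI)
    show "h m \<in> bounded_holomorphic D" for m by (rule memh)
    fix p assume p: "p < n\<^sub>E"
    show "vholomorphic_on (bounded_holomorphic D) (sup_norm D) (\<lambda>\<epsilon>. zero_off D (\<lambda>(t, z). u p t z \<epsilon>)) (E p)"
      unfolding F E by (rule vhol[OF p])
    show "\<exists>B. \<forall>\<epsilon>\<in>E p. sup_norm D (zero_off D (\<lambda>(t, z). u p t z \<epsilon>)) \<le> B"
      using sn[OF p] unfolding F_def E .
    show "\<exists>Cp>0. \<exists>Mp>0. \<forall>n\<ge>1. \<forall>\<epsilon>\<in>E p. \<forall>(t, z)\<in>D.
        cmod (u p t z \<epsilon> - (\<Sum>m<n. h m (t, z) * \<epsilon> ^ m)) \<le> Cp * Mp ^ n * Gamma (1 + real n / \<kappa>) * cmod \<epsilon> ^ n"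
      by (rule est[OF p])
    assume "pi / \<kappa> < \<theta>\<^sub>E p"
    then show "is_kappa_sum_on_sector (bounded_holomorphic D) (sup_norm D) \<kappa> h (d\<^sub>E p) (\<theta>\<^sub>E p) \<epsilon>\<^sub>0
        (\<lambda>\<epsilon>. zero_off D (\<lambda>(t, z). u p t z \<epsilon>))"
      unfolding F by (rule ks[OF p])
  qed
qed

end
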